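(* Let $k$ be a perfect field of characteristic $p>0$, $R$ a smooth $k$-algebra and let $f$ be an element of $R$ not contained in $k\cdot 1$. Then the roots of the $b$-function $b_f$ of $f$ are the opposites of the $F$-jumping exponents of $f$ which are in $(0,1]\cap\mathbb{Z}_{(p)}$; that is, the set of roots of $b_f$ is $$\{-\lambda\;:\;\lambda \text{ an } F\text{-jumping exponent of } f,\ \lambda\in(0,1]\cap\mathbb{Z}_{(p)}\}.$$
   Context: $D_R$ is the ring of Grothendieck ($k$-linear) differential operators of $R$, and similarly $D_{R[t]}$ for the polynomial ring $R[t]$. For $e\ge 0$, $\frac{d}{dt}^{[p^e]}\in D_{R[t]}$ is the $R$-linear divided power operator with $\frac{d}{dt}^{[p^e]}(t^n)=\binom{n}{p^e}t^{n-p^e}$ (with $\binom{n}{m}=0$ for $n<m$), and $\nu_e:=\frac{d}{dt}^{[p^e]}\,t^{p^e}$ is the $e$-th higher Euler operator. $D_R[\nu_e;e\in\mathbb{N}]\subset D_{R[t]}$ is the subring generated by $D_R$ and all $\nu_e$. $B_f:=R[t][\frac{1}{f-t}]/R[t]$ (a left $D_{R[t]}$-module), $\delta_f\in B_f$ is the class of $\frac{1}{f-t}$, $M_f:=D_R[\nu_e;e\in\mathbb{N}]\,\delta_f\subset B_f$. The subset $tM_f$ is a $D_R[\nu_e;e\in\mathbb{N}]$-submodule of $M_f$, and $N_f:=M_f/tM_f$. Let $A_k$ be the $k$-algebra of functions $\mathbb{N}\to k$ generated by the binomial coefficient functions $\binom{s}{n}: l\mapsto\binom{l}{n} \bmod p$;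 it is generated by the $\binom{s}{p^e}$, $e\ge0$. $N_f^\gamma$ is $N_f$ viewed as an $A_k$-module with $\binom{s}{p^e}$ acting as $-\nu_e$ (this is well defined). The $b$-function $b_f$ is the annihilator of $N_f^\gamma$ in $A_k$, an ideal of $A_k$. Roots: the maximal ideals of $A_k$ are in bijection with $\mathbb{Z}_p$, the $p$-adic integer $z=\sum_{e\ge0}z_ep^e$ ($0\le z_e\le p-1$) corresponding to the ideal $\mathfrak{m}_z$ generated by $\{\binom{s}{p^e}-z_e;\ e\ge0\}$. The roots of an ideal $I\subset A_k$ are the $z\in\mathbb{Z}_p$ with $I\subset\mathfrak{m}_z$. Elements of $\mathbb{Z}_{(p)}\subset\mathbb{Q}$ are regarded as elements of $\mathbb{Z}_p$. Test ideals: for an ideal $J\subset R$ and $e\ge0$, $J^{[p^e]}$ is the ideal generated by the $p^e$-th powers of elements of $J$, and $J^{[1/p^e]}$ is the intersection of all ideals $I$ of $R$ with $I^{[p^e]}\supset J$. For real $\lambda\ge0$, $\tau(f^\lambda):=\bigcup_{e\ge0}(f^{\lceil\lambda p^e\rceil}R)^{[1/p^e]}$ (an increasing union). An $F$-jumping exponent of $f$ is a real $\lambda>0$ such that $\tau(f^{\lambda-\epsilon})\ne\tau(f^\lambda)$ for all $\epsilon>0$ with $\lambda-\epsilon>0$.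
   Formalization: Added hypothesis: f is a nonzerodivisor in R (automatic for connected R). If f vanishes on a component, e.g. R = k × k[x], f = (0,x), then 0 is a root of b_f but is not −λ for any λ in (0,1], so the claim fails. *)

theory Defs
  imports
    Complex_Main
    "HOL-Computational_Algebra.Primes"
    "HOL-Algebra.UnivPoly"
    "HOL-Algebra.Generated_Rings"
begin

section \<open>Algebras over a perfect field\<close>

text \<open>A commutative \<open>k\<close>-algebra is a commutative ring \<open>R\<close> with a ring homomorphism
  \<open>\<iota>\<close> from \<open>k\<close> to \<open>R\<close>; most notions below only depend on the set
  \<open>K = \<iota> ` carrier k\<close> of scalars.\<close>

definition perfect_field_of_char :: "('k, 'x) ring_scheme \<Rightarrow> nat \<Rightarrow> bool" where
  "perfect_field_of_char k p \<longleftrightarrow>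
     field k \<and> Factorial_Ring.prime p \<and> [p] \<cdot>\<^bsub>k\<^esub> \<one>\<^bsub>k\<^esub> = \<zero>\<^bsub>k\<^esub> \<and>
     (\<forall>x \<in> carrier k. \<exists>y \<in> carrier k. y [^]\<^bsub>k\<^esub> p = x)"

text \<open>Smooth means of finite type (which, over a field, is the same as of finite presentation)
  and formally smooth: \<open>k\<close>-algebra maps to \<open>C/J\<close> with \<open>J\<^sup>2 = 0\<close> lift to \<open>C\<close>.
  HOL cannot quantify over test algebras \<open>C\<close> of all types, so their elements are taken from
  \<^typ>\<open>'a list\<close>, where \<^typ>\<open>'a\<close> is the type of the elements of \<open>R\<close>. This loses nothing: if
  \<open>R = P/I\<close> with \<open>P\<close> a polynomial ring in finitely many variables over \<open>k\<close>, then all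
  lifting problems are solved once the identity of \<open>R = (P/I\<^sup>2)/(I/I\<^sup>2)\<close> lifts to \<open>P/I\<^sup>2\<close>, and
  if \<open>R\<close> is nonzero then \<open>k\<close> embeds in \<open>R\<close>, so that a copy of \<open>P/I\<^sup>2\<close> lives on a subset of the
  infinite type \<^typ>\<open>'a list\<close>.\<close>

definition finite_type_algebra ::
    "('k, 'x) ring_scheme \<Rightarrow> ('a, 'y) ring_scheme \<Rightarrow> ('k \<Rightarrow> 'a) \<Rightarrow> bool" where
  "finite_type_algebra k R \<iota> \<longleftrightarrow>
     (\<exists>X. finite X \<and> X \<subseteq> carrier R \<and> generate_ring R (\<iota> ` carrier k \<union> X) = carrier R)"

definition formally_smooth_algebra ::
    "('k, 'x) ring_scheme \<Rightarrow> ('a, 'y) ring_scheme \<Rightarrow> ('k \<Rightarrow> 'a) \<Rightarrow> bool" where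
  "formally_smooth_algebra k R \<iota> \<longleftrightarrow>
     (\<forall>(C :: 'a list ring) \<gamma> J \<phi>.
        cring C \<longrightarrow> \<gamma> \<in> ring_hom k C \<longrightarrow>
        ideal J C \<longrightarrow> (\<forall>x \<in> J. \<forall>y \<in> J. x \<otimes>\<^bsub>C\<^esub> y = \<zero>\<^bsub>C\<^esub>) \<longrightarrow>
        \<phi> \<in> ring_hom R (C Quot J) \<longrightarrow> (\<forall>c \<in> carrier k. \<phi> (\<iota> c) = J +>\<^bsub>C\<^esub> \<gamma> c) \<longrightarrow>
        (\<exists>\<psi> \<in> ring_hom R C.
           (\<forall>c \<in> carrier k. \<psi> (\<iota> c) = \<gamma> c) \<and> (\<forall>x \<in> carrier R. \<phi> x = J +>\<^bsub>C\<^esub> \<psi> x)))"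

definition smooth_algebra ::
    "('k, 'x) ring_scheme \<Rightarrow> ('a, 'y) ring_scheme \<Rightarrow> ('k \<Rightarrow> 'a) \<Rightarrow> bool" where
  "smooth_algebra k R \<iota> \<longleftrightarrow>
     cring R \<and> \<iota> \<in> ring_hom k R \<and> finite_type_algebra k R \<iota> \<and> formally_smooth_algebra k R \<iota>"

text \<open>If \<open>R\<close> is smooth and connected, hence a domain, every \<open>f\<close> outside \<open>k\<cdot>1\<close> is a
  nonzerodivisor. If \<open>R\<close> is disconnected, this says that \<open>f\<close> vanishes on no component: for
  \<open>R = k \<times> k[x]\<close> and \<open>f = (0, x)\<close>, which is outside \<open>k\<cdot>1\<close>, the component \<open>k\<close> contributes the
  root 0 to the b-function, which is not the opposite of a positive number.\<close>

definition nonzerodivisor :: "('a, 'y) ring_scheme \<Rightarrow> 'a \<Rightarrow> bool" where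
  "nonzerodivisor R f \<longleftrightarrow> (\<forall>x \<in> carrier R. f \<otimes>\<^bsub>R\<^esub> x = \<zero>\<^bsub>R\<^esub> \<longrightarrow> x = \<zero>\<^bsub>R\<^esub>)"


section \<open>Grothendieck differential operators\<close>

text \<open>Operators on a ring \<open>S\<close> are functions that are \<^const>\<open>undefined\<close> outside the carrier, so
  that equality of operators is equality of functions.\<close>

definition linear_operators :: "('s, 'y) ring_scheme \<Rightarrow> 's set \<Rightarrow> ('s \<Rightarrow> 's) set" where
  "linear_operators S K =
     {P \<in> carrier S \<rightarrow>\<^sub>E carrier S.
        (\<forall>x \<in> carrier S. \<forall>y \<in> carrier S. P (x \<oplus>\<^bsub>S\<^esub> y) = P x \<oplus>\<^bsub>S\<^esub> P y) \<and>
        (\<forall>c \<in> K. \<forall>x \<in> carrier S. P (c \<otimes>\<^bsub>S\<^esub> x) = c \<otimes>\<^bsub>S\<^esub> P x)}"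

definition mult_operator :: "('s, 'y) ring_scheme \<Rightarrow> 's \<Rightarrow> 's \<Rightarrow> 's" where
  "mult_operator S a = (\<lambda>x \<in> carrier S. a \<otimes>\<^bsub>S\<^esub> x)"

definition commutator_with :: "('s, 'y) ring_scheme \<Rightarrow> ('s \<Rightarrow> 's) \<Rightarrow> 's \<Rightarrow> 's \<Rightarrow> 's" where
  "commutator_with S P a = (\<lambda>x \<in> carrier S. P (a \<otimes>\<^bsub>S\<^esub> x) \<ominus>\<^bsub>S\<^esub> a \<otimes>\<^bsub>S\<^esub> P x)"

primrec diff_ops_upto :: "('s, 'y) ring_scheme \<Rightarrow> 's set \<Rightarrow> nat \<Rightarrow> ('s \<Rightarrow> 's) set" where
  "diff_ops_upto S K 0 =
     {P \<in> linear_operators S K.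
        \<forall>a \<in> carrier S. \<forall>x \<in> carrier S. P (a \<otimes>\<^bsub>S\<^esub> x) = a \<otimes>\<^bsub>S\<^esub> P x}"
| "diff_ops_upto S K (Suc n) =
     {P \<in> linear_operators S K. \<forall>a \<in> carrier S. commutator_with S P a \<in> diff_ops_upto S K n}"

definition diff_ops :: "('s, 'y) ring_scheme \<Rightarrow> 's set \<Rightarrow> ('s \<Rightarrow> 's) ring" where
  "diff_ops S K =
     \<lparr>carrier = (\<Union>n. diff_ops_upto S K n),
      mult = compose (carrier S),
      one = (\<lambda>x \<in> carrier S. x),
      zero = (\<lambda>x \<in> carrier S. \<zero>\<^bsub>S\<^esub>),
      add = (\<lambda>P Q. \<lambda>x \<in> carrier S. P x \<oplus>\<^bsub>S\<^esub> Q x)\<rparr>"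


section \<open>Differential operators on \<open>R[t]\<close>\<close>

definition poly_scalars :: "('a, 'y) ring_scheme \<Rightarrow> 'a set \<Rightarrow> (nat \<Rightarrow> 'a) set" where
  "poly_scalars R K = (\<lambda>c. monom (UP R) c 0) ` K"

definition poly_diff_ops ::
    "('a, 'y) ring_scheme \<Rightarrow> 'a set \<Rightarrow> ((nat \<Rightarrow> 'a) \<Rightarrow> nat \<Rightarrow> 'a) ring" where
  "poly_diff_ops R K = diff_ops (UP R) (poly_scalars R K)"

definition poly_var :: "('a, 'y) ring_scheme \<Rightarrow> nat \<Rightarrow> 'a" where
  "poly_var R = monom (UP R) \<one>\<^bsub>R\<^esub> 1"

text \<open>The inclusion of \<open>D\<^sub>R\<close> in \<open>D\<^bsub>R[t]\<^esub>\<close>: operators act coefficientwise.\<close>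

definition extend_to_poly ::
    "('a, 'y) ring_scheme \<Rightarrow> ('a \<Rightarrow> 'a) \<Rightarrow> (nat \<Rightarrow> 'a) \<Rightarrow> nat \<Rightarrow> 'a" where
  "extend_to_poly R P = (\<lambda>q \<in> carrier (UP R). \<lambda>n. P (coeff (UP R) q n))"

text \<open>The \<open>R\<close>-linear operator sending \<open>t\<^sup>n\<close> to \<open>(n choose m) t\<^bsup>n-m\<^esup>\<close>.\<close>

definition divided_ddt ::
    "('a, 'y) ring_scheme \<Rightarrow> nat \<Rightarrow> (nat \<Rightarrow> 'a) \<Rightarrow> nat \<Rightarrow> 'a" where
  "divided_ddt R m =
     (\<lambda>q \<in> carrier (UP R). \<lambda>j. [((j + m) choose m)] \<cdot>\<^bsub>R\<^esub> coeff (UP R) q (j + m))"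

definition euler_op ::
    "('a, 'y) ring_scheme \<Rightarrow> nat \<Rightarrow> nat \<Rightarrow> (nat \<Rightarrow> 'a) \<Rightarrow> nat \<Rightarrow> 'a" where
  "euler_op R p e =
     compose (carrier (UP R)) (divided_ddt R (p ^ e))
       (mult_operator (UP R) (poly_var R [^]\<^bsub>UP R\<^esub> (p ^ e)))"

definition euler_ring ::
    "('a, 'y) ring_scheme \<Rightarrow> 'a set \<Rightarrow> nat \<Rightarrow> ((nat \<Rightarrow> 'a) \<Rightarrow> nat \<Rightarrow> 'a) set" where
  "euler_ring R K p =
     generate_ring (poly_diff_ops R K)
       (extend_to_poly R ` carrier (diff_ops R K) \<union> range (euler_op R p))"


section \<open>Localization at one element\<close>

text \<open>\<open>loc_frac S g a n\<close> is the fraction \<open>a/g\<^sup>n\<close>, as an equivalence class of pairs.\<close>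

definition loc_frac :: "('s, 'y) ring_scheme \<Rightarrow> 's \<Rightarrow> 's \<Rightarrow> nat \<Rightarrow> ('s \<times> nat) set" where
  "loc_frac S g a n =
     {(b, m). b \<in> carrier S \<and>
        (\<exists>l::nat. g [^]\<^bsub>S\<^esub> l \<otimes>\<^bsub>S\<^esub> (g [^]\<^bsub>S\<^esub> m \<otimes>\<^bsub>S\<^esub> a) =
                  g [^]\<^bsub>S\<^esub> l \<otimes>\<^bsub>S\<^esub> (g [^]\<^bsub>S\<^esub> n \<otimes>\<^bsub>S\<^esub> b))}"

definition localization :: "('s, 'y) ring_scheme \<Rightarrow> 's \<Rightarrow> ('s \<times> nat) set ring" where
  "localization S g =
     \<lparr>carrier = {loc_frac S g a n | a n. a \<in> carrier S},
      mult = (\<lambda>X Y. \<Union>(a, n) \<in> X. \<Union>(b, m) \<in> Y. loc_frac S g (a \<otimes>\<^bsub>S\<^esub> b) (n + m)),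
      one = loc_frac S g \<one>\<^bsub>S\<^esub> 0,
      zero = loc_frac S g \<zero>\<^bsub>S\<^esub> 0,
      add = (\<lambda>X Y. \<Union>(a, n) \<in> X. \<Union>(b, m) \<in> Y.
               loc_frac S g (g [^]\<^bsub>S\<^esub> m \<otimes>\<^bsub>S\<^esub> a \<oplus>\<^bsub>S\<^esub> g [^]\<^bsub>S\<^esub> n \<otimes>\<^bsub>S\<^esub> b) (n + m))\<rparr>"

definition loc_image :: "('s, 'y) ring_scheme \<Rightarrow> 's \<Rightarrow> 's set \<Rightarrow> ('s \<times> nat) set set" where
  "loc_image S g X = (\<lambda>a. loc_frac S g a 0) ` X"

text \<open>A differential operator on \<open>S\<close> extends uniquely to one on the
  localization; this makes the localization a left module over the differential operators.\<close>

definition loc_extend ::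
    "('s, 'y) ring_scheme \<Rightarrow> 's set \<Rightarrow> 's \<Rightarrow> ('s \<Rightarrow> 's) \<Rightarrow> ('s \<times> nat) set \<Rightarrow> ('s \<times> nat) set" where
  "loc_extend S K g P =
     (THE Q. Q \<in> carrier (diff_ops (localization S g) (loc_image S g K)) \<and>
             (\<forall>a \<in> carrier S. Q (loc_frac S g a 0) = loc_frac S g (P a) 0))"


section \<open>The modules \<open>B\<^sub>f\<close>, \<open>M\<^sub>f\<close> and \<open>N\<^sub>f\<close>\<close>

text \<open>Quotients of abelian groups are written with \<open>Quot\<close>; only the additive part of the
  resulting records is meaningful. An additive map \<open>P\<close> of \<open>G\<close> preserving a subgroup \<open>H\<close> acts on
  \<open>G Quot H\<close> by sending \<open>H + x\<close> to \<open>H + P x\<close>.\<close>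

definition quot_action ::
    "('b, 'y) ring_scheme \<Rightarrow> 'b set \<Rightarrow> ('b \<Rightarrow> 'b) \<Rightarrow> 'b set \<Rightarrow> 'b set" where
  "quot_action G H P c = H <+>\<^bsub>G\<^esub> (P ` c)"

definition f_minus_t :: "('a, 'y) ring_scheme \<Rightarrow> 'a \<Rightarrow> nat \<Rightarrow> 'a" where
  "f_minus_t R f = monom (UP R) f 0 \<ominus>\<^bsub>UP R\<^esub> poly_var R"

definition B_loc :: "('a, 'y) ring_scheme \<Rightarrow> 'a \<Rightarrow> ((nat \<Rightarrow> 'a) \<times> nat) set ring" where
  "B_loc R f = localization (UP R) (f_minus_t R f)"

definition B_poly :: "('a, 'y) ring_scheme \<Rightarrow> 'a \<Rightarrow> ((nat \<Rightarrow> 'a) \<times> nat) set set" where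
  "B_poly R f = loc_image (UP R) (f_minus_t R f) (carrier (UP R))"

definition B_mod :: "('a, 'y) ring_scheme \<Rightarrow> 'a \<Rightarrow> ((nat \<Rightarrow> 'a) \<times> nat) set set ring" where
  "B_mod R f = B_loc R f Quot B_poly R f"

definition B_action ::
    "('a, 'y) ring_scheme \<Rightarrow> 'a set \<Rightarrow> 'a \<Rightarrow> ((nat \<Rightarrow> 'a) \<Rightarrow> nat \<Rightarrow> 'a) \<Rightarrow>
       ((nat \<Rightarrow> 'a) \<times> nat) set set \<Rightarrow> ((nat \<Rightarrow> 'a) \<times> nat) set set" where
  "B_action R K f P =
     quot_action (B_loc R f) (B_poly R f)
       (loc_extend (UP R) (poly_scalars R K) (f_minus_t R f) P)"

definition delta_f :: "('a, 'y) ring_scheme \<Rightarrow> 'a \<Rightarrow> ((nat \<Rightarrow> 'a) \<times> nat) set set" where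
  "delta_f R f =
     B_poly R f +>\<^bsub>B_loc R f\<^esub> loc_frac (UP R) (f_minus_t R f) \<one>\<^bsub>UP R\<^esub> 1"

definition M_mod ::
    "('a, 'y) ring_scheme \<Rightarrow> 'a set \<Rightarrow> nat \<Rightarrow> 'a \<Rightarrow> ((nat \<Rightarrow> 'a) \<times> nat) set set set" where
  "M_mod R K p f = (\<lambda>P. B_action R K f P (delta_f R f)) ` euler_ring R K p"

definition tM_mod ::
    "('a, 'y) ring_scheme \<Rightarrow> 'a set \<Rightarrow> nat \<Rightarrow> 'a \<Rightarrow> ((nat \<Rightarrow> 'a) \<times> nat) set set set" where
  "tM_mod R K p f = B_action R K f (mult_operator (UP R) (poly_var R)) ` M_mod R K p f"

definition N_mod ::
    "('a, 'y) ring_scheme \<Rightarrow> 'a set \<Rightarrow> nat \<Rightarrow> 'a \<Rightarrow> ((nat \<Rightarrow> 'a) \<times> nat) set set set ring" where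
  "N_mod R K p f = (B_mod R f)\<lparr>carrier := M_mod R K p f\<rparr> Quot tM_mod R K p f"

definition N_action ::
    "('a, 'y) ring_scheme \<Rightarrow> 'a set \<Rightarrow> nat \<Rightarrow> 'a \<Rightarrow> ((nat \<Rightarrow> 'a) \<Rightarrow> nat \<Rightarrow> 'a) \<Rightarrow>
       ((nat \<Rightarrow> 'a) \<times> nat) set set set \<Rightarrow> ((nat \<Rightarrow> 'a) \<times> nat) set set set" where
  "N_action R K p f P = quot_action (B_mod R f) (tM_mod R K p f) (B_action R K f P)"


section \<open>The algebra \<open>A\<^sub>k\<close> and the b-function\<close>

definition nat_fun_ring :: "('k, 'x) ring_scheme \<Rightarrow> (nat \<Rightarrow> 'k) ring" where
  "nat_fun_ring k =
     \<lparr>carrier = UNIV \<rightarrow> carrier k,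
      mult = (\<lambda>a b l. a l \<otimes>\<^bsub>k\<^esub> b l),
      one = (\<lambda>l. \<one>\<^bsub>k\<^esub>),
      zero = (\<lambda>l. \<zero>\<^bsub>k\<^esub>),
      add = (\<lambda>a b l. a l \<oplus>\<^bsub>k\<^esub> b l)\<rparr>"

definition const_fun :: "'k \<Rightarrow> nat \<Rightarrow> 'k" where
  "const_fun c = (\<lambda>l. c)"

definition binom_fun :: "('k, 'x) ring_scheme \<Rightarrow> nat \<Rightarrow> nat \<Rightarrow> 'k" where
  "binom_fun k n = (\<lambda>l. [(l choose n)] \<cdot>\<^bsub>k\<^esub> \<one>\<^bsub>k\<^esub>)"

definition A_alg :: "('k, 'x) ring_scheme \<Rightarrow> (nat \<Rightarrow> 'k) ring" where
  "A_alg k =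
     (nat_fun_ring k)\<lparr>carrier :=
        generate_ring (nat_fun_ring k) (const_fun ` carrier k \<union> range (binom_fun k))\<rparr>"

text \<open>The action of \<open>A\<^sub>k\<close> on \<open>N\<^sub>f\<close>: the module structure in which \<open>k\<close> acts by the scalars
  and \<open>(s choose p\<^sup>e)\<close> acts as \<open>-\<nu>\<^sub>e\<close>. It is unique because the functions
  \<open>(s choose p\<^sup>e)\<close> generate \<open>A\<^sub>k\<close> as a \<open>k\<close>-algebra.\<close>

definition with_smult :: "'n ring \<Rightarrow> ('b \<Rightarrow> 'n \<Rightarrow> 'n) \<Rightarrow> ('b, 'n) module" where
  "with_smult N sm =
     \<lparr>carrier = carrier N, mult = mult N, one = one N, zero = zero N, add = add N, smult = sm\<rparr>"

definition N_gamma ::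
    "('k, 'x) ring_scheme \<Rightarrow> ('a, 'y) ring_scheme \<Rightarrow> ('k \<Rightarrow> 'a) \<Rightarrow> nat \<Rightarrow> 'a \<Rightarrow>
       (nat \<Rightarrow> 'k, ((nat \<Rightarrow> 'a) \<times> nat) set set set) module" where
  "N_gamma k R \<iota> p f =
     (let K = \<iota> ` carrier k; N = N_mod R K p f in
      with_smult N
        (THE sm. sm \<in> carrier (A_alg k) \<rightarrow>\<^sub>E (carrier N \<rightarrow>\<^sub>E carrier N) \<and>
           module (A_alg k) (with_smult N sm) \<and>
           (\<forall>c \<in> carrier k. \<forall>x \<in> carrier N.
              sm (const_fun c) x =
                N_action R K p f (mult_operator (UP R) (monom (UP R) (\<iota> c) 0)) x) \<and>
           (\<forall>e. \<forall>x \<in> carrier N.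
              sm (binom_fun k (p ^ e)) x = \<ominus>\<^bsub>N\<^esub> N_action R K p f (euler_op R p e) x)))"

definition annihilator :: "('b, 'y) ring_scheme \<Rightarrow> ('b, 'n, 'z) module_scheme \<Rightarrow> 'b set" where
  "annihilator A M = {a \<in> carrier A. \<forall>x \<in> carrier M. a \<odot>\<^bsub>M\<^esub> x = \<zero>\<^bsub>M\<^esub>}"

definition b_function ::
    "('k, 'x) ring_scheme \<Rightarrow> ('a, 'y) ring_scheme \<Rightarrow> ('k \<Rightarrow> 'a) \<Rightarrow> nat \<Rightarrow> 'a \<Rightarrow> (nat \<Rightarrow> 'k) set" where
  "b_function k R \<iota> p f = annihilator (A_alg k) (N_gamma k R \<iota> p f)"


section \<open>\<open>p\<close>-adic integers and roots\<close>

text \<open>\<open>\<int>\<^sub>p\<close> as the inverse limit of the \<open>\<int>/p\<^sup>n\<close>, with residues represented in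
  \<open>{0..<p\<^sup>n}\<close>: the term \<open>z n\<close> is \<open>z mod p\<^sup>n\<close>.\<close>

definition padic_ints :: "nat \<Rightarrow> (nat \<Rightarrow> int) set" where
  "padic_ints p =
     {z. \<forall>n. 0 \<le> z n \<and> z n < int p ^ n \<and> z (Suc n) mod int p ^ n = z n}"

definition padic_digit :: "nat \<Rightarrow> (nat \<Rightarrow> int) \<Rightarrow> nat \<Rightarrow> int" where
  "padic_digit p z e = z (Suc e) div int p ^ e"

definition rat_local :: "nat \<Rightarrow> rat set" where
  "rat_local p = {q. \<not> int p dvd snd (quotient_of q)}"

definition padic_of_rat :: "nat \<Rightarrow> rat \<Rightarrow> nat \<Rightarrow> int" where
  "padic_of_rat p q =
     (\<lambda>n. THE r. 0 \<le> r \<and> r < int p ^ n \<and>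
            int p ^ n dvd fst (quotient_of q) - r * snd (quotient_of q))"

definition root_ideal :: "('k, 'x) ring_scheme \<Rightarrow> nat \<Rightarrow> (nat \<Rightarrow> int) \<Rightarrow> (nat \<Rightarrow> 'k) set" where
  "root_ideal k p z =
     Idl\<^bsub>A_alg k\<^esub> {binom_fun k (p ^ e) \<ominus>\<^bsub>A_alg k\<^esub> [padic_digit p z e] \<cdot>\<^bsub>A_alg k\<^esub> \<one>\<^bsub>A_alg k\<^esub>
                   | e. True}"

definition roots_of :: "('k, 'x) ring_scheme \<Rightarrow> nat \<Rightarrow> (nat \<Rightarrow> 'k) set \<Rightarrow> (nat \<Rightarrow> int) set" where
  "roots_of k p I = {z \<in> padic_ints p. I \<subseteq> root_ideal k p z}"


section \<open>Test ideals and \<open>F\<close>-jumping exponents\<close>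

definition frob_power :: "('a, 'y) ring_scheme \<Rightarrow> nat \<Rightarrow> nat \<Rightarrow> 'a set \<Rightarrow> 'a set" where
  "frob_power R p e J = Idl\<^bsub>R\<^esub> ((\<lambda>x. x [^]\<^bsub>R\<^esub> (p ^ e)) ` J)"

definition frob_root :: "('a, 'y) ring_scheme \<Rightarrow> nat \<Rightarrow> nat \<Rightarrow> 'a set \<Rightarrow> 'a set" where
  "frob_root R p e J = \<Inter>{I. ideal I R \<and> J \<subseteq> frob_power R p e I}"

definition test_ideal :: "('a, 'y) ring_scheme \<Rightarrow> nat \<Rightarrow> 'a \<Rightarrow> real \<Rightarrow> 'a set" where
  "test_ideal R p f r =
     (\<Union>e. frob_root R p e (PIdl\<^bsub>R\<^esub> (f [^]\<^bsub>R\<^esub> nat \<lceil>r * real p ^ e\<rceil>)))"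

definition F_jumping_exponent :: "('a, 'y) ring_scheme \<Rightarrow> nat \<Rightarrow> 'a \<Rightarrow> real \<Rightarrow> bool" where
  "F_jumping_exponent R p f r \<longleftrightarrow>
     r > 0 \<and>
     (\<forall>\<epsilon> > 0. r - \<epsilon> > 0 \<longrightarrow> test_ideal R p f (r - \<epsilon>) \<noteq> test_ideal R p f r)"

end

theory Submission
  imports Defs
begin

text \<open>Write \<open>q = p\<^sup>e\<close>, and let \<open>D\<^sub>e\<close> be the ring of additive maps \<open>R \<rightarrow> R\<close> that commute with multiplication by \<open>q\<close>-th
powers.
As \<open>R\<close> is generated by finitely many elements over scalars that are \<open>q\<close>-th powers, \<open>D\<^sub>R\<close> is the union of the \<open>D\<^sub>e\<close>
(\<open>diff_ops_carrier\<close>), and the same holds for \<open>R[t]\<close> and for the localization in which \<open>B\<^sub>f\<close> is formed.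

This makes the modules explicit. The ring \<open>D\<^sub>R[\<nu>\<^sub>e; e \<in> \<nat>]\<close> consists of the operators \<open>\<Sum> u\<^sub>n t\<^sup>n \<mapsto> \<Sum> \<Phi>\<^sub>n(u\<^sub>n) t\<^sup>n\<close>,
where for some \<open>e\<close> all \<open>\<Phi>\<^sub>n\<close> are in \<open>D\<^sub>e\<close> and \<open>\<Phi>\<close> has period \<open>q\<close> (\<open>euler_ring_eq\<close>). They act on the numerators of
fractions over \<open>(f - t)\<^sup>q\<close>, and \<open>\<delta>\<^sub>f\<close> has numerator \<open>(f - t)\<^bsup>q-1\<^esup> = \<Sum>\<^bsub>j<q\<^esub> f\<^bsup>q-1-j\<^esup> t\<^sup>j\<close>. Hence \<open>M\<^sub>f\<close> is at level \<open>e\<close> the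
direct sum of the \<open>D\<^sub>e f\<^sup>m\<close> for \<open>m = q-1-j\<close>, and \<open>tM\<^sub>f\<close> is the sum of the \<open>D\<^sub>e f\<^bsup>m+1\<^esup>\<close>. On the summand with index
\<open>m\<close>, \<open>-\<nu>\<^sub>i\<close> acts as the \<open>i\<close>-th digit of \<open>m\<close>, so that a function \<open>a \<in> A\<^sub>k\<close> acts as \<open>a(m)\<close>. Therefore \<open>z\<close> is a root of
\<open>b\<^sub>f\<close> if and only if \<open>z mod p\<^sup>e \<in> S\<^sub>e\<close> for all \<open>e\<close>, where \<open>S\<^sub>e = {m < q. f\<^sup>m \<notin> D\<^sub>e f\<^bsup>m+1\<^esup>}\<close> (\<open>roots_of_b_function\<close>).

Smoothness gives \<open>s = \<Sum> \<sigma>\<^sub>i(s)\<^sup>p x\<^sub>i\<close> with additive maps \<open>\<sigma>\<^sub>i\<close> that take \<open>r\<^sup>p s\<close> to \<open>r \<sigma>\<^sub>i(s)\<close>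
(\<open>smooth_frobenius_dual_basis\<close>). The values at \<open>s\<close> of the \<open>e\<close>-fold compositions of the \<open>\<sigma>\<^sub>i\<close> generate the ideal
\<open>C e s = (s)\<^bsup>[1/q]\<^esup>\<close>, and \<open>t \<in> D\<^sub>e s\<close> if and only if \<open>C e t \<subseteq> C e s\<close> (\<open>linear_op_iff\<close>). So \<open>m \<in> S\<^sub>e\<close> means
\<open>\<tau>(f\<^bsup>m/q\<^esup>) \<noteq> \<tau>(f\<^bsup>(m+1)/q\<^esup>)\<close>, that is, there is an \<open>F\<close>-jumping exponent in \<open>(m/q, (m+1)/q]\<close>. Degree bounds show that
there are finitely many test ideals \<open>\<tau>(f\<^sup>\<lambda>)\<close> with \<open>\<lambda> \<le> 1\<close>, and Nakayama's lemma that they are right continuous in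
\<open>\<lambda>\<close>; here it matters that \<open>f\<close> is a nonzerodivisor.

What remains is combinatorics (locale \<open>jump_chain\<close>). If \<open>z mod p\<^sup>e \<in> S\<^sub>e\<close> for all \<open>e\<close>, there are jumping exponents \<open>\<lambda>\<^sub>e\<close>
in \<open>(0,1]\<close> such that \<open>\<mu>\<^sub>e = p\<^sup>e \<lambda>\<^sub>e - (z mod p\<^sup>e)\<close> is again a jumping exponent in \<open>(0,1]\<close>. One pair \<open>(\<lambda>, \<mu>)\<close> occurs
for infinitely many \<open>e\<close>, and \<open>z = p\<^sup>e \<lambda> - \<mu>\<close> modulo \<open>p\<^sup>e\<close> forces \<open>z = -\<mu>\<close>. Conversely, the residues of \<open>-\<lambda>\<close> are
\<open>(p\<^sup>e - 1) \<lambda>\<close> for infinitely many \<open>e\<close>, and their intervals contain \<open>\<lambda>\<close>.\<close>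

section \<open>Binomial expansions in characteristic \<open>p\<close>\<close>

text \<open>Pascal's rule, abstracted from the binomial theorem: a two-parameter recursion of this shape is
  solved by binomial coefficients.\<close>

lemma (in abelian_monoid) pascal_sum:
  assumes cl: "\<And>m n j. T m n j \<in> carrier G"
    and rel: "\<And>m n j. T (Suc m) n j = T m (Suc n) j \<oplus> T m n (Suc j)"
  shows "T m n j = (\<Oplus>i\<in>{..m}. [(m choose i)] \<cdot> T 0 (n + (m - i)) (j + i))"
proof (induction m arbitrary: n j)
  case 0
  show ?case by (simp add: cl)
next
  case (Suc m)
  define c where "c = (\<lambda>i. T 0 (n + (Suc m - i)) (j + i))"
  have ccl [simp]: "c i \<in> carrier G" for i by (simp add: c_def cl)
  have "T (Suc m) n j = T m (Suc n) j \<oplus> T m n (Suc j)" by (rule rel)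
  also have "T m (Suc n) j = (\<Oplus>i\<in>{..m}. [(m choose i)] \<cdot> c i)"
    unfolding Suc.IH[of "Suc n" j] c_def by (intro finsum_cong) (auto simp: cl Suc_diff_le)
  also have "\<dots> = (\<Oplus>i\<in>{..Suc m}. [(m choose i)] \<cdot> c i)"
    by (simp add: binomial_eq_0)
  also have "\<dots> = (\<Oplus>i\<in>{..m}. [(m choose Suc i)] \<cdot> c (Suc i)) \<oplus> c 0"
    by (subst finsum_Suc2) auto
  also have "T m n (Suc j) = (\<Oplus>i\<in>{..m}. [(m choose i)] \<cdot> c (Suc i))"
    unfolding Suc.IH[of n "Suc j"] c_def by (intro finsum_cong) (auto simp: cl)
  finally have "T (Suc m) n j = (\<Oplus>i\<in>{..m}. [(m choose Suc i)] \<cdot> c (Suc i)) \<oplus> c 0 \<oplus>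
      (\<Oplus>i\<in>{..m}. [(m choose i)] \<cdot> c (Suc i))" .
  also have "\<dots> = ((\<Oplus>i\<in>{..m}. [(m choose Suc i)] \<cdot> c (Suc i)) \<oplus>
      (\<Oplus>i\<in>{..m}. [(m choose i)] \<cdot> c (Suc i))) \<oplus> c 0"
    by (simp add: a_ac)
  also have "\<dots> = (\<Oplus>i\<in>{..m}. [(Suc m choose Suc i)] \<cdot> c (Suc i)) \<oplus> c 0"
    by (subst finsum_addf[symmetric]) (auto simp: add.nat_pow_mult a_ac)
  also have "\<dots> = (\<Oplus>i\<in>{..Suc m}. [(Suc m choose i)] \<cdot> c i)"
    by (subst finsum_Suc2) auto
  finally show ?case by (simp add: c_def)
qed

locale cring_char = cring R for R (structure) + fixes p :: nat
  assumes p_prime: "Factorial_Ring.prime p" and char_p: "[p] \<cdot> \<one> = \<zero>"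
begin

lemma p_gt_0 [simp]: "p > 0" using p_prime by (rule prime_gt_0_nat)
lemma p_gt_1: "p > 1" using p_prime by (rule prime_gt_1_nat)
lemma p_ne_0: "p \<noteq> 0" using p_gt_0 by blast

lemma add_pow_char: "x \<in> carrier R ==> p dvd n ==> [(n::nat)] \<cdot> x = \<zero>"
proof -
  assume x: "x \<in> carrier R" and "p dvd n"
  then obtain m where n: "n = p * m" by auto
  have "[p] \<cdot> x = ([p] \<cdot> \<one>) \<otimes> x" using x by (subst add_pow_ldistr) auto
  then have "[p] \<cdot> x = \<zero>" using x by (simp add: char_p)
  moreover have "[n] \<cdot> x = [m] \<cdot> ([p] \<cdot> x)"
    using x add.nat_pow_pow[of x m p] by (simp add: n)
  ultimately show ?thesis by simp
qed

text \<open>In characteristic \<open>p\<close> only the two outer terms of \<open>pascal_sum\<close> survive. With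
  \<open>T m n j = (a + b)\<^sup>m a\<^sup>n b\<^sup>j\<close> this is the additivity of Frobenius; with the iterated commutators
  \<open>T m n j = a\<^sup>n (ad\<^sub>a\<^sup>j P) (a\<^sup>m x)\<close> it is \<open>ad\<^sub>a\<^sup>q = ad\<^bsub>a\<^sup>q\<^esub>\<close>, and for binomial coefficients it
  gives their periodicity.\<close>

lemma frobenius_recursion:
  assumes "\<And>m n j. T m n j \<in> carrier R"
    and "\<And>m n j. T (Suc m) n j = T m (Suc n) j \<oplus> T m n (Suc j)"
  shows "T (p ^ e) n j = T 0 (n + p ^ e) j \<oplus> T 0 n (j + p ^ e)"
  using assms
proof (induction e arbitrary: T n j)
  case 0
  show ?case using 0(2)[of 0 n j] by simp
next
  case (Suc e)
  define q where "q = p ^ e"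
  define U where "U = (\<lambda>m n' j'. T (q * m) (q * n' + n) (q * j' + j))"
  have Ucl: "U m n' j' \<in> carrier R" for m n' j' by (simp add: U_def Suc.prems)
  have Urel: "U (Suc m) n' j' = U m (Suc n') j' \<oplus> U m n' (Suc j')" for m n' j'
  proof -
    have "T (q * m + q) (q * n' + n) (q * j' + j) =
        T (q * m + 0) (q * n' + n + q) (q * j' + j) \<oplus> T (q * m + 0) (q * n' + n) (q * j' + j + q)"
      unfolding q_def by (rule Suc.IH) (simp_all add: Suc.prems(1), simp only: add_Suc_right Suc.prems(2))
    then show ?thesis by (simp add: U_def ac_simps)
  qed
  have "U p 0 0 = (\<Oplus>i\<in>{..p}. [(p choose i)] \<cdot> U 0 (p - i) i)"
    by (subst pascal_sum[of U, OF Ucl Urel]) simp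
  also have "\<dots> = (\<Oplus>i\<in>{0, p}. [(p choose i)] \<cdot> U 0 (p - i) i)"
  proof (intro add.finprod_mono_neutral_cong_right)
    show "[(p choose i)] \<cdot> U 0 (p - i) i = \<zero>" if "i \<in> {..p} - {0, p}" for i
      using that Ucl by (intro add_pow_char dvd_choose_prime) (auto simp: p_prime intro: add.nat_pow_closed)
  qed (auto simp: Ucl)
  also have "\<dots> = U 0 p 0 \<oplus> U 0 0 p"
    using p_ne_0 by (simp add: Ucl)
  finally show ?case by (simp add: U_def q_def ac_simps)
qed

lemma frob_add:
  assumes "a \<in> carrier R" "b \<in> carrier R"
  shows "(a \<oplus> b) [^] (p ^ e) = a [^] (p ^ e) \<oplus> b [^] (p ^ e)"
proof -
  define T where "T = (\<lambda>(m::nat) (n::nat) (j::nat). (a \<oplus> b) [^] m \<otimes> (a [^] n \<otimes> b [^] j))"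
  have "T (p ^ e) 0 0 = T 0 (0 + p ^ e) 0 \<oplus> T 0 0 (0 + p ^ e)"
  proof (rule frobenius_recursion)
    fix m n j :: nat
    define u v w where "u = (a \<oplus> b) [^] m" and "v = a [^] n" and "w = b [^] j"
    have "u \<in> carrier R" "v \<in> carrier R" "w \<in> carrier R"
      using assms by (simp_all add: u_def v_def w_def)
    then show "T (Suc m) n j = T m (Suc n) j \<oplus> T m n (Suc j)"
      unfolding T_def nat_pow_Suc u_def[symmetric] v_def[symmetric] w_def[symmetric]
      using assms by algebra
  qed (use assms in \<open>simp add: T_def\<close>)
  then show ?thesis using assms by (simp add: T_def)
qed

lemma frob_zero: "\<zero> [^] (p ^ e) = \<zero>"
  by (rule nat_pow_zero) (simp add: p_ne_0)

lemma frob_hom: "(\<lambda>x. x [^] (p ^ e)) \<in> ring_hom R R"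
  by (rule ring_hom_memI) (auto simp: nat_pow_distrib frob_add)

lemma frob_minus:
  assumes "a \<in> carrier R"
  shows "(\<ominus> a) [^] (p ^ e) = \<ominus> (a [^] (p ^ e))"
  using frob_add[of "\<ominus> a" a e] assms
  by (simp add: l_neg frob_zero sum_zero_eq_neg)

lemma frob_diff:
  assumes "a \<in> carrier R" "b \<in> carrier R"
  shows "(a \<ominus> b) [^] (p ^ e) = a [^] (p ^ e) \<ominus> b [^] (p ^ e)"
  using assms by (simp add: minus_eq frob_add frob_minus)

end

section \<open>Quotients and Hilbert's basis theorem\<close>

text \<open>Any map whose fibres are the cosets of \<open>I\<close> transports \<open>S/I\<close> to its image. Formal smoothness is
  about rings on one fixed type, so quotients have to be realised there, not on sets of cosets.\<close>

lemma quotient_ring_on: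
  fixes S (structure) and \<theta> :: "'s => 'c"
  assumes S: "cring S" and I: "ideal I S"
    and \<theta>: "\<And>u v. u \<in> carrier S ==> v \<in> carrier S ==> \<theta> u = \<theta> v \<longleftrightarrow> u \<ominus> v \<in> I"
  obtains C :: "'c ring" where "cring C" "\<theta> \<in> ring_hom S C" "carrier C = \<theta> ` carrier S"
proof -
  interpret S: cring S by (rule S)
  interpret I: ideal I S by (rule I)
  define r where "r = inv_into (carrier S) \<theta>"
  define C where "C = \<lparr>carrier = \<theta> ` carrier S, mult = (\<lambda>X Y. \<theta> (r X \<otimes> r Y)), one = \<theta> \<one>,
      zero = \<theta> \<zero>, add = (\<lambda>X Y. \<theta> (r X \<oplus> r Y))\<rparr>"
  have r: "r (\<theta> u) \<in> carrier S" "r (\<theta> u) \<ominus> u \<in> I" if "u \<in> carrier S" for u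
    using that f_inv_into_f[of "\<theta> u" \<theta> "carrier S"] \<theta>[of "r (\<theta> u)" u]
    by (auto simp: r_def intro: inv_into_into)
  have mult: "\<theta> u \<otimes>\<^bsub>C\<^esub> \<theta> v = \<theta> (u \<otimes> v)" if uv: "u \<in> carrier S" "v \<in> carrier S" for u v
  proof -
    have "r (\<theta> u) \<otimes> r (\<theta> v) \<ominus> u \<otimes> v = r (\<theta> u) \<otimes> (r (\<theta> v) \<ominus> v) \<oplus> v \<otimes> (r (\<theta> u) \<ominus> u)"
      using uv r(1)[OF uv(1)] r(1)[OF uv(2)] by algebra
    also have "\<dots> \<in> I" using uv r by (intro I.a_closed I.I_l_closed) auto
    finally show ?thesis using uv r by (simp add: C_def \<theta>)
  qed
  have add: "\<theta> u \<oplus>\<^bsub>C\<^esub> \<theta> v = \<theta> (u \<oplus> v)" if uv: "u \<in> carrier S" "v \<in> carrier S" for u v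
  proof -
    have "(r (\<theta> u) \<oplus> r (\<theta> v)) \<ominus> (u \<oplus> v) = (r (\<theta> v) \<ominus> v) \<oplus> (r (\<theta> u) \<ominus> u)"
      using uv r(1)[OF uv(1)] r(1)[OF uv(2)] by algebra
    also have "\<dots> \<in> I" using uv r by (intro I.a_closed) auto
    finally show ?thesis using uv r by (simp add: C_def \<theta>)
  qed
  have one: "\<one>\<^bsub>C\<^esub> = \<theta> \<one>" and zero: "\<zero>\<^bsub>C\<^esub> = \<theta> \<zero>" and car: "carrier C = \<theta> ` carrier S"
    by (simp_all add: C_def)
  have "cring C"
  proof (intro cringI abelian_groupI comm_monoidI)
    fix x assume "x \<in> carrier C"
    then obtain u where u: "u \<in> carrier S" "x = \<theta> u" by (auto simp: car)
    show "\<exists>y\<in>carrier C. y \<oplus>\<^bsub>C\<^esub> x = \<zero>\<^bsub>C\<^esub>"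
      by (rule bexI[of _ "\<theta> (\<ominus> u)"]) (use u in \<open>auto simp: car add zero S.l_neg\<close>)
  qed (auto simp: car mult add one zero S.m_ac S.a_ac S.l_distr S.r_distr)
  moreover have "\<theta> \<in> ring_hom S C"
    by (rule ring_hom_memI) (auto simp: car mult add one)
  ultimately show ?thesis using that car by blast
qed

definition scalar_submodule :: "('a, 'y) ring_scheme => 'a set => 'a set => bool" where
  "scalar_submodule R A I \<longleftrightarrow> I \<subseteq> carrier R \<and> \<zero>\<^bsub>R\<^esub> \<in> I \<and> (\<forall>x\<in>I. \<forall>y\<in>I. x \<oplus>\<^bsub>R\<^esub> y \<in> I) \<and>
     (\<forall>a\<in>A. \<forall>x\<in>I. a \<otimes>\<^bsub>R\<^esub> x \<in> I)"

text \<open>Finite generation is phrased through the submodules containing the generators, so that no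
  linear combinations have to be written down.\<close>

definition noetherian_subring :: "('a, 'y) ring_scheme => 'a set => bool" where
  "noetherian_subring R A \<longleftrightarrow> subring A R \<and>
     (\<forall>I \<subseteq> A. scalar_submodule R A I -->
       (\<exists>F \<subseteq> I. finite F \<and> (\<forall>J. scalar_submodule R A J --> F \<subseteq> J --> I \<subseteq> J)))"

lemma scalar_submoduleD:
  assumes "scalar_submodule R A I"
  shows "x \<in> I ==> x \<in> carrier R" "\<zero>\<^bsub>R\<^esub> \<in> I" "x \<in> I ==> y \<in> I ==> x \<oplus>\<^bsub>R\<^esub> y \<in> I"
    "a \<in> A ==> x \<in> I ==> a \<otimes>\<^bsub>R\<^esub> x \<in> I"
  using assms by (auto simp: scalar_submodule_def)

lemma (in ring) scalar_submodule_neg: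
  assumes "scalar_submodule R A I" "subring A R" "x \<in> I"
  shows "\<ominus> x \<in> I"
proof -
  have "\<ominus> \<one> \<in> A" using assms(2) by (simp add: subringE(3,5))
  then have "\<ominus> \<one> \<otimes> x \<in> I" using scalar_submoduleD(4)[OF assms(1) _ assms(3)] by blast
  then show ?thesis using scalar_submoduleD(1)[OF assms(1,3)] by (simp add: l_minus)
qed

text \<open>The elements that are polynomials in \<open>y\<close> of degree less than \<open>d\<close> over \<open>A\<close>.\<close>

primrec bounded_deg :: "('a, 'y) ring_scheme => 'a set => 'a => nat => 'a set" where
  "bounded_deg R A y 0 = {\<zero>\<^bsub>R\<^esub>}"
| "bounded_deg R A y (Suc d) = {w \<oplus>\<^bsub>R\<^esub> a \<otimes>\<^bsub>R\<^esub> y [^]\<^bsub>R\<^esub> d | w a. w \<in> bounded_deg R A y d \<and> a \<in> A}"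

context cring begin

context
  fixes A y
  assumes A: "subring A R" and y: "y \<in> carrier R"
begin

private lemma A_carrier: "a \<in> A ==> a \<in> carrier R"
  using subringE(1)[OF A] by blast

private abbreviation "L \<equiv> bounded_deg R A y"

lemma L_carrier: "w \<in> L d ==> w \<in> carrier R"
  by (induction d arbitrary: w) (auto simp: A_carrier y)

lemma L_mono: "w \<in> L d ==> w \<in> L (Suc d)"
  using L_carrier[of w d] subringE(2)[OF A] y
  unfolding bounded_deg.simps mem_Collect_eq by (rule_tac exI[of _ w], rule_tac exI[of _ \<zero>]) simp

lemma L_mono': "d \<le> d' ==> w \<in> L d ==> w \<in> L d'"
  by (induction d' rule: dec_induct) (blast intro: L_mono)+

lemma L_zero: "\<zero> \<in> L d"
  by (rule L_mono'[of 0]) auto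

lemma L_add: "v \<in> L d ==> w \<in> L d ==> v \<oplus> w \<in> L d"
proof (induction d arbitrary: v w)
  case (Suc d)
  then obtain v' a w' b where "v = v' \<oplus> a \<otimes> y [^] d" "w = w' \<oplus> b \<otimes> y [^] d"
    and *: "v' \<in> L d" "w' \<in> L d" "a \<in> A" "b \<in> A" by auto
  moreover have "v' \<oplus> a \<otimes> y [^] d \<oplus> (w' \<oplus> b \<otimes> y [^] d) = (v' \<oplus> w') \<oplus> (a \<oplus> b) \<otimes> y [^] d"
  proof -
    have "v' \<in> carrier R" "w' \<in> carrier R" "a \<in> carrier R" "b \<in> carrier R" "y [^] d \<in> carrier R"
      using * y L_carrier A_carrier by auto
    then show ?thesis by algebra
  qed
  ultimately show ?case using Suc.IH[OF *(1,2)] subringE(7)[OF A *(3,4)] by auto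
qed auto

lemma L_scalar: "c \<in> A ==> w \<in> L d ==> c \<otimes> w \<in> L d"
proof (induction d arbitrary: w)
  case 0
  then show ?case by (auto simp: A_carrier)
next
  case (Suc d)
  then obtain w' b where "w = w' \<oplus> b \<otimes> y [^] d" and *: "w' \<in> L d" "b \<in> A" by auto
  moreover have "c \<otimes> (w' \<oplus> b \<otimes> y [^] d) = c \<otimes> w' \<oplus> (c \<otimes> b) \<otimes> y [^] d"
  proof -
    have "w' \<in> carrier R" "c \<in> carrier R" "b \<in> carrier R" "y [^] d \<in> carrier R"
      using * Suc.prems y L_carrier A_carrier by auto
    then show ?thesis by algebra
  qed
  ultimately show ?case using Suc.IH[OF Suc.prems(1) *(1)] subringE(6)[OF A Suc.prems(1) *(2)] by auto
qed

lemma L_neg: "w \<in> L d ==> \<ominus> w \<in> L d"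
  using L_scalar[of "\<ominus> \<one>" w d] L_carrier[of w d] A by (simp add: subringE(3,5) l_minus)

lemma L_shift: "w \<in> L d ==> y \<otimes> w \<in> L (Suc d)"
proof (induction d arbitrary: w)
  case 0
  then show ?case using L_zero[of "Suc 0"] y by simp
next
  case (Suc d)
  then obtain w' b where "w = w' \<oplus> b \<otimes> y [^] d" and *: "w' \<in> L d" "b \<in> A" by auto
  moreover have "y \<otimes> (w' \<oplus> b \<otimes> y [^] d) = y \<otimes> w' \<oplus> b \<otimes> y [^] Suc d"
  proof -
    have "w' \<in> carrier R" "b \<in> carrier R" "y [^] d \<in> carrier R"
      using * y L_carrier A_carrier by auto
    then show ?thesis unfolding nat_pow_Suc using y by algebra
  qed
  ultimately show ?case using Suc.IH[OF *(1)] *(2) by (auto simp del: nat_pow_Suc)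
qed

lemma L_shift_pow: "w \<in> L d ==> y [^] (n::nat) \<otimes> w \<in> L (n + d)"
proof (induction n)
  case 0
  then show ?case using L_carrier[of w d] by simp
next
  case (Suc n)
  have "y [^] Suc n \<otimes> w = y \<otimes> (y [^] n \<otimes> w)"
    using y L_carrier[OF Suc.prems] by (simp add: m_ac)
  then show ?case using L_shift[OF Suc.IH[OF Suc.prems]] by simp
qed

lemma L_mult: "v \<in> L d ==> w \<in> L d' ==> v \<otimes> w \<in> L (d + d')"
proof (induction d arbitrary: v)
  case 0
  then show ?case using L_carrier[of w d'] L_zero by simp
next
  case (Suc d)
  then obtain v' b where "v = v' \<oplus> b \<otimes> y [^] d" and *: "v' \<in> L d" "b \<in> A" by auto
  moreover have "(v' \<oplus> b \<otimes> y [^] d) \<otimes> w = v' \<otimes> w \<oplus> b \<otimes> (y [^] d \<otimes> w)"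
  proof -
    have "v' \<in> carrier R" "b \<in> carrier R" "y [^] d \<in> carrier R" "w \<in> carrier R"
      using * Suc.prems y L_carrier A_carrier by auto
    then show ?thesis by algebra
  qed
  moreover have "v' \<otimes> w \<oplus> b \<otimes> (y [^] d \<otimes> w) \<in> L (Suc d + d')"
    using Suc.IH[OF *(1) Suc.prems(2)] L_scalar[OF *(2) L_shift_pow[OF Suc.prems(2), of d]]
    by (intro L_add) (auto intro: L_mono simp del: bounded_deg.simps)
  ultimately show ?case by simp
qed

lemma generate_insert_bounded:
  "generate_ring R (insert y A) = (\<Union>d. L d)"
proof
  have "subring (\<Union>d. L d) R"
  proof (rule subringI)
    show "\<one> \<in> (\<Union>d. L d)"
      using subringE(3)[OF A] by (auto intro!: exI[of _ "Suc 0"] exI[of _ \<one>])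
  next
    fix v w assume "v \<in> (\<Union>d. L d)" "w \<in> (\<Union>d. L d)"
    then obtain d d' where *: "v \<in> L d" "w \<in> L d'" by auto
    then show "v \<otimes> w \<in> (\<Union>d. L d)" using L_mult by blast
    show "v \<oplus> w \<in> (\<Union>d. L d)"
      using L_add[of v "max d d'" w] L_mono'[of d "max d d'" v] L_mono'[of d' "max d d'" w] * by auto
  qed (use L_carrier L_neg in blast)+
  moreover have "insert y A \<subseteq> (\<Union>d. L d)"
  proof -
    have "a \<in> L (Suc 0)" if "a \<in> A" for a using that A_carrier by (auto intro!: exI[of _ a])
    moreover have "y \<in> L (Suc (Suc 0))"
      unfolding bounded_deg.simps(2)[of _ _ _ "Suc 0"] mem_Collect_eq
      by (rule exI[of _ \<zero>], rule exI[of _ \<one>]) (use y subringE(3)[OF A] L_zero in \<open>simp del: bounded_deg.simps\<close>)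
    ultimately show ?thesis by blast
  qed
  ultimately show "generate_ring R (insert y A) \<subseteq> (\<Union>d. L d)"
    using y A_carrier by (intro generate_ring_min_subring1) auto
next
  let ?G = "generate_ring R (insert y A)"
  have G: "subring ?G R" using y A_carrier by (intro generate_ring_is_subring) auto
  have "y [^] d \<in> ?G" for d :: nat
    by (induction d) (auto intro: generate_ring.intros)
  then have "w \<in> ?G" if "w \<in> L d" for w d
    using that
  proof (induction d arbitrary: w)
    case 0
    then show ?case using subringE(2)[OF G] by simp
  qed (auto intro!: generate_ring.eng_add generate_ring.eng_mult intro: generate_ring.incl)
  then show "(\<Union>d. L d) \<subseteq> ?G" by blast
qed

end

text \<open>Hilbert's basis theorem for \<open>A[y]\<close>. The leading coefficients of the elements of \<open>I\<close> of degree
  \<open>d\<close> form an increasing sequence \<open>H I d\<close> of \<open>A\<close>-modules, stationary from some \<open>N\<close> on. Elements of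
  \<open>I\<close> lifting generators of the \<open>H I d\<close> with \<open>d \<le> N\<close> generate \<open>I\<close>: for \<open>K \<subseteq> I\<close> containing them,
  \<open>H K = H I\<close>, and \<open>K = I\<close> follows by induction on the degree.\<close>

lemma noetherian_insert:
  assumes noeth: "noetherian_subring R A" and y: "y \<in> carrier R"
  shows "noetherian_subring R (generate_ring R (insert y A))"
proof -
  have A: "subring A R"
    and fg: "\<And>I. I \<subseteq> A ==> scalar_submodule R A I ==>
       \<exists>F \<subseteq> I. finite F \<and> (\<forall>J. scalar_submodule R A J --> F \<subseteq> J --> I \<subseteq> J)"
    using noeth by (auto simp: noetherian_subring_def)
  note Ac = subringE(1)[OF A]
  define G where "G = generate_ring R (insert y A)"
  define L where "L = bounded_deg R A y"
  note GL = generate_insert_bounded[OF A y, folded G_def L_def]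
  note Lf = L_carrier[OF A y, folded L_def] L_mono'[OF A y, folded L_def] L_zero[OF A y, folded L_def]
    L_add[OF A y, folded L_def] L_scalar[OF A y, folded L_def] L_neg[OF A y, folded L_def]
    L_shift_pow[OF A y, folded L_def]
  have G: "subring G R" unfolding G_def using y Ac by (intro generate_ring_is_subring) auto
  have AG: "a \<in> G" if "a \<in> A" for a using that by (auto simp: G_def intro: generate_ring.incl)
  have yG: "y [^] (n::nat) \<in> G" for n
    by (induction n) (auto simp: G_def intro: generate_ring.intros)
  have "\<exists>F \<subseteq> I. finite F \<and> (\<forall>J. scalar_submodule R G J --> F \<subseteq> J --> I \<subseteq> J)"
    if IG: "I \<subseteq> G" and I: "scalar_submodule R G I" for I
  proof -
    \<comment> \<open>the leading coefficients of elements of degree at most \<open>d\<close>\<close>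
    define H where "H = (\<lambda>K d. {a \<in> A. \<exists>w \<in> L d. w \<oplus> a \<otimes> y [^] (d::nat) \<in> K})"
    have Hsub: "scalar_submodule R A (H K d)" if K: "scalar_submodule R G K" for K d
      unfolding scalar_submodule_def
    proof (intro conjI ballI)
      show "H K d \<subseteq> carrier R" using Ac by (auto simp: H_def)
      show "\<zero> \<in> H K d"
        using subringE(2)[OF A] scalar_submoduleD(2)[OF K] Lf(3)[of d] y
        by (auto simp: H_def intro!: bexI[of _ \<zero>])
    next
      fix a b assume "a \<in> H K d" "b \<in> H K d"
      then obtain v w where *: "a \<in> A" "b \<in> A" "v \<in> L d" "w \<in> L d"
        "v \<oplus> a \<otimes> y [^] d \<in> K" "w \<oplus> b \<otimes> y [^] d \<in> K" by (auto simp: H_def)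
      have "(v \<oplus> a \<otimes> y [^] d) \<oplus> (w \<oplus> b \<otimes> y [^] d) = (v \<oplus> w) \<oplus> (a \<oplus> b) \<otimes> y [^] d"
      proof -
        have "v \<in> carrier R" "w \<in> carrier R" "a \<in> carrier R" "b \<in> carrier R" "y [^] d \<in> carrier R"
          using * y Lf(1) Ac by auto
        then show ?thesis by algebra
      qed
      then show "a \<oplus> b \<in> H K d"
        using * scalar_submoduleD(3)[OF K *(5,6)] Lf(4)[OF *(3,4)] subringE(7)[OF A *(1,2)]
        by (auto simp: H_def)
    next
      fix c b assume c: "c \<in> A" and "b \<in> H K d"
      then obtain w where *: "b \<in> A" "w \<in> L d" "w \<oplus> b \<otimes> y [^] d \<in> K" by (auto simp: H_def)
      have "c \<otimes> (w \<oplus> b \<otimes> y [^] d) = (c \<otimes> w) \<oplus> (c \<otimes> b) \<otimes> y [^] d"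
      proof -
        have "w \<in> carrier R" "c \<in> carrier R" "b \<in> carrier R" "y [^] d \<in> carrier R"
          using * c y Lf(1) Ac by auto
        then show ?thesis by algebra
      qed
      then show "c \<otimes> b \<in> H K d"
        using * scalar_submoduleD(4)[OF K AG[OF c] *(3)] Lf(5)[OF c *(2)] subringE(6)[OF A c *(1)]
        by (auto simp: H_def)
    qed
    have Hshift: "H K d \<subseteq> H K (n + d)" if K: "scalar_submodule R G K" for K d n
    proof
      fix b assume "b \<in> H K d"
      then obtain w where *: "b \<in> A" "w \<in> L d" "w \<oplus> b \<otimes> y [^] d \<in> K" by (auto simp: H_def)
      have "y [^] n \<otimes> (w \<oplus> b \<otimes> y [^] d) = (y [^] n \<otimes> w) \<oplus> b \<otimes> y [^] (n + d)"
      proof -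
        have "w \<in> carrier R" "b \<in> carrier R" "y [^] d \<in> carrier R" "y [^] n \<in> carrier R"
          using * y Lf(1) Ac by auto
        moreover have "y [^] (n + d) = y [^] n \<otimes> y [^] d" using y by (simp add: nat_pow_mult)
        ultimately show ?thesis by algebra
      qed
      then show "b \<in> H K (n + d)"
        using *(1) scalar_submoduleD(4)[OF K yG *(3), of n] Lf(7)[OF *(2), of n]
        unfolding H_def mem_Collect_eq by metis
    qed
    have Hmono: "H K d \<subseteq> H K d'" if "scalar_submodule R G K" "d \<le> d'" for K d d'
      using Hshift[OF that(1), of d "d' - d"] that(2) by simp
    have HA: "H K d \<subseteq> A" for K d by (auto simp: H_def)
    have "scalar_submodule R A (\<Union>d. H I d)"
      unfolding scalar_submodule_def
    proof (intro conjI ballI)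
      show "(\<Union>d. H I d) \<subseteq> carrier R" using HA Ac by blast
      show "\<zero> \<in> (\<Union>d. H I d)" using scalar_submoduleD(2)[OF Hsub[OF I]] by blast
      show "a \<otimes> x \<in> (\<Union>d. H I d)" if "a \<in> A" "x \<in> (\<Union>d. H I d)" for a x
        using that scalar_submoduleD(4)[OF Hsub[OF I]] by blast
      show "x \<oplus> z \<in> (\<Union>d. H I d)" if xz: "x \<in> (\<Union>d. H I d)" "z \<in> (\<Union>d. H I d)" for x z
      proof -
        obtain d d' where "x \<in> H I d" "z \<in> H I d'" using xz by auto
        then have "x \<in> H I (max d d')" "z \<in> H I (max d d')"
          using Hmono[OF I, of d "max d d'"] Hmono[OF I, of d' "max d d'"] by auto
        then show ?thesis using scalar_submoduleD(3)[OF Hsub[OF I]] by blast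
      qed
    qed
    then obtain F where F: "F \<subseteq> (\<Union>d. H I d)" "finite F"
      "\<And>J. scalar_submodule R A J ==> F \<subseteq> J ==> (\<Union>d. H I d) \<subseteq> J"
      using fg[of "\<Union>d. H I d"] HA by blast
    obtain N where N: "F \<subseteq> H I N"
      using F(1,2)
    proof (induction F arbitrary: thesis rule: infinite_finite_induct)
      case (insert x F)
      obtain M where M: "F \<subseteq> H I M" using insert.IH insert.prems by auto
      obtain d where d: "x \<in> H I d" using insert.prems by auto
      show ?case
        by (rule insert.prems(1)[of "max M d"])
          (use M d Hmono[OF I, of M "max M d"] Hmono[OF I, of d "max M d"] in auto)
    qed auto
    have "\<exists>F \<subseteq> H I d. finite F \<and> (\<forall>J. scalar_submodule R A J --> F \<subseteq> J --> H I d \<subseteq> J)" for d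
      using fg[OF HA Hsub[OF I]] .
    then obtain E where E: "\<And>d. E d \<subseteq> H I d" "\<And>d. finite (E d)"
      "\<And>d J. scalar_submodule R A J ==> E d \<subseteq> J ==> H I d \<subseteq> J"
      by metis
    \<comment> \<open>at the last level also generators of the union of all \<open>H I d\<close>\<close>
    define E' where "E' = (\<lambda>d. if d = N then F \<union> E N else E d)"
    have E': "E' d \<subseteq> H I d" "finite (E' d)" for d using E N F(2) by (auto simp: E'_def)
    have "\<forall>d. \<forall>a \<in> E' d. \<exists>w \<in> L d. w \<oplus> a \<otimes> y [^] d \<in> I"
      using E'(1) by (fastforce simp: H_def)
    then obtain w where w: "\<And>d a. a \<in> E' d ==> w d a \<in> L d"
      "\<And>d a. a \<in> E' d ==> w d a \<oplus> a \<otimes> y [^] d \<in> I" by metis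
    define U where "U = (\<Union>d\<le>N. (\<lambda>a. w d a \<oplus> a \<otimes> y [^] d) ` E' d)"
    have "U \<subseteq> I" "finite U" using w(2) E'(2) by (auto simp: U_def)
    moreover have "I \<subseteq> J" if J: "scalar_submodule R G J" and UJ: "U \<subseteq> J" for J
    proof -
      define K where "K = I \<inter> J"
      have K: "scalar_submodule R G K" using I J by (auto simp: K_def scalar_submodule_def)
      have EH: "E' d \<subseteq> H K d" if "d \<le> N" for d
        using that UJ w E'(1)[of d] by (fastforce simp: K_def U_def H_def)
      have HH: "H I d \<subseteq> H K d" for d
      proof (cases "d \<le> N")
        case True
        have "E d \<subseteq> H K d" using EH[OF True] by (auto simp: E'_def split: if_splits)
        then show ?thesis by (rule E(3)[OF Hsub[OF K]])
      next
        case False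
        have "F \<subseteq> H K N" using EH[of N] by (auto simp: E'_def)
        then have "(\<Union>d. H I d) \<subseteq> H K N" by (rule F(3)[OF Hsub[OF K]])
        then show ?thesis using Hmono[OF K, of N d] False by auto
      qed
      have "u \<in> J" if "u \<in> I" "u \<in> L d" for u d
        using that
      proof (induction d arbitrary: u)
        case 0
        then show ?case using scalar_submoduleD(2)[OF J] by (simp add: L_def)
      next
        case (Suc d)
        then obtain v a where va: "u = v \<oplus> a \<otimes> y [^] d" "v \<in> L d" "a \<in> A" by (auto simp: L_def)
        then have "a \<in> H I d" using Suc.prems by (auto simp: H_def)
        then obtain v' where v': "v' \<in> L d" "v' \<oplus> a \<otimes> y [^] d \<in> K" using HH by (auto simp: H_def)
        have c: "v \<in> carrier R" "v' \<in> carrier R" "a \<in> carrier R" "y [^] d \<in> carrier R"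
          using va v' y Lf(1) Ac by auto
        have "u \<oplus> \<ominus> (v' \<oplus> a \<otimes> y [^] d) = v \<oplus> \<ominus> v'"
          unfolding va(1) using c by algebra
        moreover have "u \<oplus> \<ominus> (v' \<oplus> a \<otimes> y [^] d) \<in> I"
          using Suc.prems v'(2) scalar_submodule_neg[OF I G] scalar_submoduleD(3)[OF I]
          by (auto simp: K_def)
        ultimately have "v \<oplus> \<ominus> v' \<in> J" using Suc.IH[of "v \<oplus> \<ominus> v'"] va(2) v'(1) Lf(4,6) by simp
        then have "(v \<oplus> \<ominus> v') \<oplus> (v' \<oplus> a \<otimes> y [^] d) \<in> J"
          using v'(2) scalar_submoduleD(3)[OF J] by (auto simp: K_def)
        moreover have "(v \<oplus> \<ominus> v') \<oplus> (v' \<oplus> a \<otimes> y [^] d) = u" unfolding va(1) using c by algebra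
        ultimately show ?case by simp
      qed
      then show ?thesis using IG GL by blast
    qed
    ultimately show ?thesis by blast
  qed
  then show ?thesis using G by (simp add: noetherian_subring_def G_def)
qed

lemma noetherian_field:
  assumes K: "subring K R" and inv: "\<And>c. c \<in> K ==> c \<noteq> \<zero> ==> \<exists>d\<in>K. d \<otimes> c = \<one>"
  shows "noetherian_subring R K"
  unfolding noetherian_subring_def
proof (intro conjI allI impI)
  fix I assume IK: "I \<subseteq> K" and I: "scalar_submodule R K I"
  show "\<exists>F\<subseteq>I. finite F \<and> (\<forall>J. scalar_submodule R K J --> F \<subseteq> J --> I \<subseteq> J)"
  proof (cases "I \<subseteq> {\<zero>}")
    case True
    then show ?thesis by (auto simp: scalar_submodule_def intro!: exI[of _ "{}"])
  next
    case False
    then obtain c where c: "c \<in> I" "c \<noteq> \<zero>" by auto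
    then obtain d where d: "d \<in> K" "d \<otimes> c = \<one>" using inv IK by blast
    have "x \<in> J" if J: "scalar_submodule R K J" "c \<in> J" and x: "x \<in> I" for J x
    proof -
      have "x \<otimes> (d \<otimes> c) \<in> J" using J d(1) x IK by (auto simp: scalar_submodule_def)
      then show ?thesis using d(2) x IK subringE(1)[OF K] by auto
    qed
    then show ?thesis using c(1) by (intro exI[of _ "{c}"]) auto
  qed
qed (rule K)

lemma noetherian_finite_type:
  assumes K: "subring K R" and inv: "\<And>c. c \<in> K ==> c \<noteq> \<zero> ==> \<exists>d\<in>K. d \<otimes> c = \<one>"
    and X: "finite X" "X \<subseteq> carrier R"
  shows "noetherian_subring R (generate_ring R (K \<union> X))"
  using X
proof (induction X)
  case empty
  have "generate_ring R K = K"
    using subringE(1)[OF K] K by (intro equalityI generate_ring_min_subring1) (auto intro: generate_ring.incl)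
  then show ?case using noetherian_field[OF K inv] by simp
next
  case (insert y X)
  note Kc = subringE(1)[OF K]
  have "generate_ring R (insert y (generate_ring R (K \<union> X))) = generate_ring R (K \<union> insert y X)"
  proof
    have "generate_ring R (K \<union> X) \<subseteq> generate_ring R (K \<union> insert y X)"
      using insert.prems Kc by (intro mono_generate_ring) auto
    then show "generate_ring R (insert y (generate_ring R (K \<union> X))) \<subseteq> generate_ring R (K \<union> insert y X)"
      using insert.prems Kc generate_ring_in_carrier[of "K \<union> X"]
      by (intro generate_ring_min_subring1 generate_ring_is_subring) (auto intro: generate_ring.incl)
  next
    show "generate_ring R (K \<union> insert y X) \<subseteq> generate_ring R (insert y (generate_ring R (K \<union> X)))"
      using insert.prems Kc generate_ring_in_carrier[of "K \<union> X"]
      by (intro mono_generate_ring) (auto intro: generate_ring.incl)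
  qed
  then show ?case using noetherian_insert[of "generate_ring R (K \<union> X)" y] insert by simp
qed

end

section \<open>Adjoining \<open>p\<close>-th roots\<close>

lemma (in ring_hom_cring) hom_add_pow:
  assumes "x \<in> carrier R"
  shows "h ([(n::nat)] \<cdot> x) = [n] \<cdot>\<^bsub>S\<^esub> h x"
  using assms by (induction n) simp_all

lemma (in cring_char) cring_char_hom:
  assumes "cring S" "h \<in> ring_hom R S"
  shows "cring_char S p"
proof -
  interpret h: ring_hom_cring R S h by (intro ring_hom_cringI is_cring assms)
  show ?thesis
    using h.hom_add_pow[of \<one> p] by unfold_locales (simp_all add: p_prime char_p)
qed

lemma (in cring) ring_hom_generate_ring:
  assumes S: "cring S" and h: "h \<in> ring_hom R S" and X: "X \<subseteq> carrier R" "h ` X \<subseteq> Y"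
    and a: "a \<in> generate_ring R X"
  shows "h a \<in> generate_ring S Y"
proof -
  interpret h: ring_hom_cring R S h by (intro ring_hom_cringI is_cring S h)
  note c = generate_ring_in_carrier[OF X(1)]
  show ?thesis
    using a
  proof induction
    case (incl x)
    then show ?case using X(2) by (blast intro: generate_ring.incl)
  qed (simp_all add: c generate_ring.intros)
qed

declare (in UP_ring) monom_mult [simp del]

text \<open>The coefficient of \<open>T\<^sup>l\<close> in the remainder of \<open>u\<close> modulo \<open>T\<^sup>n - y\<close>: the monomial \<open>T\<^sup>k\<close> becomes
  \<open>y\<^bsup>k div n\<^esup> T\<^bsup>k mod n\<^esup>\<close>. These coefficients represent the classes of \<open>R[T]/(T\<^sup>n - y)\<close>.\<close>

definition root_reduce :: "('a, 'y) ring_scheme => 'a => nat => (nat => 'a) => nat => 'a" where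
  "root_reduce R y n u l =
     (\<Oplus>\<^bsub>R\<^esub>k\<in>{..deg R u}. if k mod n = l then coeff (UP R) u k \<otimes>\<^bsub>R\<^esub> y [^]\<^bsub>R\<^esub> (k div n) else \<zero>\<^bsub>R\<^esub>)"

lemma (in ring) add_diff_add:
  "[|u \<in> carrier R; v \<in> carrier R; s \<in> carrier R; t \<in> carrier R|] ==>
     u \<oplus> v \<ominus> (s \<oplus> t) = (u \<ominus> s) \<oplus> (v \<ominus> t)"
  by algebra

lemma (in ring) r_distr_diff:
  "[|a \<in> carrier R; b \<in> carrier R; c \<in> carrier R|] ==> a \<otimes> (b \<ominus> c) = a \<otimes> b \<ominus> a \<otimes> c"
  by algebra

lemma (in ring) diff_trans:
  "[|a \<in> carrier R; b \<in> carrier R; c \<in> carrier R|] ==> (a \<ominus> b) \<oplus> (b \<ominus> c) = a \<ominus> c"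
  by algebra

lemma (in ring) diff_diff_diff:
  "[|a \<in> carrier R; b \<in> carrier R; c \<in> carrier R|] ==> (a \<ominus> c) \<ominus> (b \<ominus> c) = a \<ominus> b"
  by algebra

lemma (in ring) add_diff_cancel:
  "[|a \<in> carrier R; b \<in> carrier R|] ==> b \<oplus> (a \<ominus> b) = a"
  by algebra

lemma (in cring) ideal_of_closed:
  assumes T: "T \<subseteq> carrier R" "T \<noteq> {}" and add: "\<And>a b. a \<in> T ==> b \<in> T ==> a \<oplus> b \<in> T"
    and mult: "\<And>x a. x \<in> carrier R ==> a \<in> T ==> x \<otimes> a \<in> T"
  shows "ideal T R"
proof (rule idealI)
  show "subgroup T (add_monoid R)"
  proof (rule add.subgroupI[OF T _ add])
    show "\<ominus> a \<in> T" if "a \<in> T" for a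
      using mult[of "\<ominus> \<one>" a] that T(1) by (auto simp: l_minus)
  qed
  show "a \<otimes> x \<in> T" if "a \<in> T" "x \<in> carrier R" for a x
    using mult[OF that(2,1)] that T(1) m_comm[of a x] by auto
qed (use mult ring_axioms in auto)

lemma (in ideal) diff_closed: "a \<in> I ==> b \<in> I ==> a \<ominus> b \<in> I"
  by (simp add: minus_eq)

context UP_cring
begin

lemma UP_add_induct [consumes 1, case_names add monom]:
  assumes u: "u \<in> carrier P"
    and add: "\<And>u v. u \<in> carrier P ==> v \<in> carrier P ==> Pr u ==> Pr v ==> Pr (u \<oplus>\<^bsub>P\<^esub> v)"
    and monom: "\<And>c k. c \<in> carrier R ==> Pr (monom P c k)"
  shows "Pr u"
proof -
  have "Pr (\<Oplus>\<^bsub>P\<^esub>i\<in>{..n}. monom P (coeff P u i) i)" for n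
    using u by (induction n) (auto intro!: add monom P.finsum_closed simp: Pi_def)
  then show ?thesis using up_repr[OF u] by metis
qed

context
  fixes y :: 'a and n :: nat
  assumes y: "y \<in> carrier R" and n: "n > 0"
begin

lemma root_reduce_eq:
  assumes u: "u \<in> carrier P" and N: "deg R u \<le> N"
  shows "root_reduce R y n u l = (\<Oplus>k\<in>{..N}. if k mod n = l then coeff P u k \<otimes> y [^] (k div n) else \<zero>)"
  unfolding root_reduce_def P_def[symmetric]
  by (rule R.add.finprod_mono_neutral_cong_left)
    (use u N y in \<open>auto simp: deg_aboveD\<close>)

lemma root_reduce_closed:
  assumes u: "u \<in> carrier P"
  shows "root_reduce R y n u l \<in> carrier R"
  unfolding root_reduce_def P_def[symmetric] using u y by (intro R.finsum_closed) auto

lemma root_reduce_add: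
  assumes u: "u \<in> carrier P" and v: "v \<in> carrier P"
  shows "root_reduce R y n (u \<oplus>\<^bsub>P\<^esub> v) l = root_reduce R y n u l \<oplus> root_reduce R y n v l"
proof -
  define N where "N = max (deg R (u \<oplus>\<^bsub>P\<^esub> v)) (max (deg R u) (deg R v))"
  have N: "deg R (u \<oplus>\<^bsub>P\<^esub> v) \<le> N" "deg R u \<le> N" "deg R v \<le> N" by (auto simp: N_def)
  show ?thesis
    unfolding root_reduce_eq[OF P.a_closed[OF u v] N(1)] root_reduce_eq[OF u N(2)] root_reduce_eq[OF v N(3)]
    using u v y
    by (subst R.finsum_addf[symmetric], force, force, intro R.finsum_cong') (auto simp: R.l_distr)
qed

lemma root_reduce_monom:
  assumes c: "c \<in> carrier R"
  shows "root_reduce R y n (monom P c k) l = (if k mod n = l then c \<otimes> y [^] (k div n) else \<zero>)"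
proof -
  have "root_reduce R y n (monom P c k) l =
      (\<Oplus>i\<in>{..k}. if i mod n = l then coeff P (monom P c k) i \<otimes> y [^] (i div n) else \<zero>)"
    using c by (intro root_reduce_eq) (auto intro: deg_monom_le)
  also have "\<dots> = (\<Oplus>i\<in>{..k}. if k = i then (if k mod n = l then c \<otimes> y [^] (k div n) else \<zero>) else \<zero>)"
    using c y by (intro R.finsum_cong') auto
  also have "\<dots> = (if k mod n = l then c \<otimes> y [^] (k div n) else \<zero>)"
    using c y by (subst R.finsum_singleton) auto
  finally show ?thesis .
qed

lemma root_reduce_const_mult:
  assumes c: "c \<in> carrier R" and u: "u \<in> carrier P"
  shows "root_reduce R y n (monom P c 0 \<otimes>\<^bsub>P\<^esub> u) l = c \<otimes> root_reduce R y n u l"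
  using u
proof (induction u rule: UP_add_induct)
  case (add u v)
  then show ?case using c by (simp add: P.r_distr root_reduce_add root_reduce_closed R.r_distr)
next
  case (monom d k)
  have "monom P c 0 \<otimes>\<^bsub>P\<^esub> monom P d k = monom P (c \<otimes> d) k"
    using monom c monom_mult[of c d 0 k] by simp
  then show ?case using c monom y by (simp add: root_reduce_monom R.m_assoc)
qed

lemma root_reduce_ideal:
  assumes u: "u \<in> carrier P" and l: "l < n"
  shows "root_reduce R y n ((monom P \<one> n \<ominus>\<^bsub>P\<^esub> monom P y 0) \<otimes>\<^bsub>P\<^esub> u) l = \<zero>"
  using u
proof (induction u rule: UP_add_induct)
  case (add u v)
  then show ?case using y by (simp add: P.r_distr root_reduce_add)
next
  case (monom c k)
  have "(monom P \<one> n \<ominus>\<^bsub>P\<^esub> monom P y 0) \<otimes>\<^bsub>P\<^esub> monom P c k = monom P c (k + n) \<oplus>\<^bsub>P\<^esub> monom P (\<ominus> (y \<otimes> c)) k"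
  proof -
    have "(monom P \<one> n \<ominus>\<^bsub>P\<^esub> monom P y 0) \<otimes>\<^bsub>P\<^esub> monom P c k =
      monom P \<one> n \<otimes>\<^bsub>P\<^esub> monom P c k \<oplus>\<^bsub>P\<^esub> \<ominus>\<^bsub>P\<^esub> (monom P y 0 \<otimes>\<^bsub>P\<^esub> monom P c k)"
      using monom y by (simp add: P.minus_eq P.l_distr P.l_minus)
    also have "monom P \<one> n \<otimes>\<^bsub>P\<^esub> monom P c k = monom P c (k + n)"
      using monom monom_mult[of \<one> c n k] by (simp add: add.commute)
    also have "monom P y 0 \<otimes>\<^bsub>P\<^esub> monom P c k = monom P (y \<otimes> c) k"
      using monom y monom_mult[of y c 0 k] by simp
    finally show ?thesis using monom y by simp
  qed
  moreover have "c \<otimes> y [^] Suc (k div n) \<oplus> \<ominus> (y \<otimes> c) \<otimes> y [^] (k div n) = \<zero>"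
  proof -
    have "y [^] (k div n) \<in> carrier R" using y by simp
    then show ?thesis unfolding R.nat_pow_Suc using monom y by algebra
  qed
  ultimately show ?case using monom y l n by (simp add: root_reduce_add root_reduce_monom del: R.nat_pow_Suc monom_a_inv)
qed

lemma root_reduce_repr:
  assumes u: "u \<in> carrier P" and I: "ideal I P" "monom P \<one> n \<ominus>\<^bsub>P\<^esub> monom P y 0 \<in> I"
  shows "u \<ominus>\<^bsub>P\<^esub> (\<Oplus>\<^bsub>P\<^esub>l\<in>{..<n}. monom P (root_reduce R y n u l) l) \<in> I"
  using u
proof (induction u rule: UP_add_induct)
  interpret I: ideal I P by (rule I)
  case (add u v)
  let ?s = "\<lambda>u. \<Oplus>\<^bsub>P\<^esub>l\<in>{..<n}. monom P (root_reduce R y n u l) l"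
  have "?s (u \<oplus>\<^bsub>P\<^esub> v) = ?s u \<oplus>\<^bsub>P\<^esub> ?s v"
    using add(1,2)
    by (subst P.finsum_addf[symmetric], force simp: root_reduce_closed, force simp: root_reduce_closed,
      intro P.finsum_cong') (auto simp: root_reduce_add root_reduce_closed)
  moreover have c: "?s u \<in> carrier P" "?s v \<in> carrier P"
    using add(1,2) by (auto simp: root_reduce_closed)
  moreover have "u \<oplus>\<^bsub>P\<^esub> v \<ominus>\<^bsub>P\<^esub> (?s u \<oplus>\<^bsub>P\<^esub> ?s v) = (u \<ominus>\<^bsub>P\<^esub> ?s u) \<oplus>\<^bsub>P\<^esub> (v \<ominus>\<^bsub>P\<^esub> ?s v)"
    using add(1,2) c by (intro P.add_diff_add)
  ultimately show ?case using add(3,4) by simp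
next
  interpret I: ideal I P by (rule I)
  case (monom c k)
  have "(\<Oplus>\<^bsub>P\<^esub>l\<in>{..<n}. monom P (root_reduce R y n (monom P c k) l) l) =
     (\<Oplus>\<^bsub>P\<^esub>l\<in>{..<n}. if k mod n = l then monom P (c \<otimes> y [^] (k div n)) l else \<zero>\<^bsub>P\<^esub>)"
    using monom y by (intro P.finsum_cong') (auto simp: root_reduce_monom)
  also have "\<dots> = monom P (c \<otimes> y [^] (k div n)) (k mod n)"
    using monom y n by (subst P.finsum_singleton) auto
  finally have sum: "(\<Oplus>\<^bsub>P\<^esub>l\<in>{..<n}. monom P (root_reduce R y n (monom P c k) l) l) =
     monom P (c \<otimes> y [^] (k div n)) (k mod n)" .
  have "monom P c k \<ominus>\<^bsub>P\<^esub> monom P (c \<otimes> y [^] (k div n)) (k mod n) \<in> I"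
  proof -
    have "monom P c (n * m + j) \<ominus>\<^bsub>P\<^esub> monom P (c \<otimes> y [^] m) j \<in> I" if "c \<in> carrier R" for c m j
      using that
    proof (induction m arbitrary: c)
      case 0
      then show ?case by (simp add: P.minus_eq P.r_neg)
    next
      case (Suc m)
      have "monom P c (n * Suc m + j) \<ominus>\<^bsub>P\<^esub> monom P (c \<otimes> y [^] Suc m) j =
        (monom P c (n * m + j) \<otimes>\<^bsub>P\<^esub> (monom P \<one> n \<ominus>\<^bsub>P\<^esub> monom P y 0)) \<oplus>\<^bsub>P\<^esub>
        (monom P (c \<otimes> y) (n * m + j) \<ominus>\<^bsub>P\<^esub> monom P ((c \<otimes> y) \<otimes> y [^] m) j)"
      proof -
        have "monom P c (n * m + j) \<otimes>\<^bsub>P\<^esub> (monom P \<one> n \<ominus>\<^bsub>P\<^esub> monom P y 0) =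
          monom P c (n * m + j) \<otimes>\<^bsub>P\<^esub> monom P \<one> n \<ominus>\<^bsub>P\<^esub> monom P c (n * m + j) \<otimes>\<^bsub>P\<^esub> monom P y 0"
          using Suc.prems y by (intro P.r_distr_diff) auto
        also have "monom P c (n * m + j) \<otimes>\<^bsub>P\<^esub> monom P \<one> n = monom P c (n * Suc m + j)"
          using Suc.prems monom_mult[of c \<one> "n * m + j" n] by (simp add: ac_simps)
        also have "monom P c (n * m + j) \<otimes>\<^bsub>P\<^esub> monom P y 0 = monom P (c \<otimes> y) (n * m + j)"
          using Suc.prems y monom_mult[of c y "n * m + j" 0] by simp
        finally have *: "monom P c (n * m + j) \<otimes>\<^bsub>P\<^esub> (monom P \<one> n \<ominus>\<^bsub>P\<^esub> monom P y 0) =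
          monom P c (n * Suc m + j) \<ominus>\<^bsub>P\<^esub> monom P (c \<otimes> y) (n * m + j)" .
        have **: "(c \<otimes> y) \<otimes> y [^] m = c \<otimes> y [^] Suc m"
          using Suc.prems y by (simp add: R.m_ac)
        have cc: "monom P c (n * Suc m + j) \<in> carrier P" "monom P (c \<otimes> y) (n * m + j) \<in> carrier P"
          "monom P (c \<otimes> y [^] Suc m) j \<in> carrier P"
          using Suc.prems y by (auto simp del: R.nat_pow_Suc)
        show ?thesis unfolding * ** using cc by (intro P.diff_trans[symmetric])
      qed
      also have "\<dots> \<in> I"
        using Suc y I(2) by (intro I.a_closed I.I_l_closed) auto
      finally show ?case .
    qed
    from this[OF monom, of "k div n" "k mod n"] show ?thesis by simp
  qed
  then show ?case by (simp only: sum)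
qed

end

end

lemma (in abelian_monoid) finsum_div_mod:
  fixes n p :: nat
  assumes "\<And>i l. h i l \<in> carrier G"
  shows "(\<Oplus>m\<in>{..<n * p}. h (m div p) (m mod p)) = (\<Oplus>l\<in>{..<p}. \<Oplus>i\<in>{..<n}. h i l)"
proof (cases "p = 0")
  case False
  show ?thesis
  proof (induction n)
    case (Suc n)
    have eq: "{..<Suc n * p} = {..<n * p} \<union> (\<lambda>l. n * p + l) ` {..<p}"
    proof (intro equalityI subsetI)
      fix m assume m: "m \<in> {..<Suc n * p}"
      show "m \<in> {..<n * p} \<union> (\<lambda>l. n * p + l) ` {..<p}"
      proof (cases "m < n * p")
        case False
        then have "m = n * p + (m - n * p)" "m - n * p < p" using m by auto
        then show ?thesis by blast
      qed simp
    qed auto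
    have "(\<Oplus>m\<in>{..<Suc n * p}. h (m div p) (m mod p)) =
       (\<Oplus>m\<in>{..<n * p}. h (m div p) (m mod p)) \<oplus> (\<Oplus>m\<in>(\<lambda>l. n * p + l) ` {..<p}. h (m div p) (m mod p))"
      unfolding eq using assms by (intro finsum_Un_disjoint) auto
    also have "(\<Oplus>m\<in>(\<lambda>l. n * p + l) ` {..<p}. h (m div p) (m mod p)) = (\<Oplus>l\<in>{..<p}. h n l)"
      using assms False by (subst finsum_reindex) (auto intro!: finsum_cong' simp: inj_on_def)
    also have "(\<Oplus>m\<in>{..<n * p}. h (m div p) (m mod p)) \<oplus> (\<Oplus>l\<in>{..<p}. h n l) =
       (\<Oplus>l\<in>{..<p}. (\<Oplus>i\<in>{..<n}. h i l) \<oplus> h n l)"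
      unfolding Suc.IH using assms by (intro finsum_addf[symmetric]) auto
    also have "\<dots> = (\<Oplus>l\<in>{..<p}. \<Oplus>i\<in>{..<Suc n}. h i l)"
      using assms by (intro finsum_cong') (auto simp: lessThan_Suc a_comm)
    finally show ?case .
  qed simp
qed simp

text \<open>An injective coding of tuples of words by words (each letter is announced by \<open>o'\<close>, each word ended
  by \<open>z\<close>): it places the tuples of remainders modulo \<open>T\<^sup>p - y\<close> again in the type of lists.\<close>

primrec encode_word :: "'a => 'a => 'a list => 'a list" where
  "encode_word z o' [] = [z]"
| "encode_word z o' (a # as) = o' # a # encode_word z o' as"

primrec encode_words :: "'a => 'a => 'a list list => 'a list" where
  "encode_words z o' [] = []"
| "encode_words z o' (w # ws) = encode_word z o' w @ encode_words z o' ws"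

lemma encode_word_inj:
  "z \<noteq> o' ==> encode_word z o' v @ r = encode_word z o' w @ s ==> v = w \<and> r = s"
proof (induction v arbitrary: w)
  case Nil
  then show ?case by (cases w) auto
next
  case (Cons a v)
  then show ?case by (cases w) auto
qed

lemma encode_words_inj:
  "z \<noteq> o' ==> encode_words z o' vs = encode_words z o' ws ==> vs = ws"
proof (induction vs arbitrary: ws)
  case Nil
  then show ?case
  proof (cases ws)
    case (Cons w ws')
    then show ?thesis using Nil by (cases w) auto
  qed simp
next
  case (Cons v vs)
  then show ?case
  proof (cases ws)
    case Nil
    then show ?thesis using Cons by (cases v) auto
  next
    case (Cons w ws')
    then show ?thesis using Cons.prems Cons.IH encode_word_inj[OF Cons.prems(1), of v _ w] by fastforce
  qed
qed

text \<open>\<open>j\<close> and \<open>\<pi>\<close> factor the Frobenius maps of both \<open>R\<close> and \<open>Q\<close>. The example is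
  \<open>Q = R[x\<^sub>1\<^bsup>1/p\<^esup>, \<dots>, x\<^sub>r\<^bsup>1/p\<^esup>]\<close> with roots adjoined freely, \<open>\<pi>\<close> sending \<open>r\<close> to \<open>r\<^sup>p\<close> and the root of \<open>x\<^sub>i\<close>
  to \<open>x\<^sub>i\<close>.\<close>

definition frobenius_cover ::
  "('a, 'y) ring_scheme => nat => ('b, 'z) ring_scheme => ('a => 'b) => ('b => 'a) => bool" where
  "frobenius_cover R p Q j \<pi> \<longleftrightarrow> cring Q \<and> j \<in> ring_hom R Q \<and> \<pi> \<in> ring_hom Q R \<and>
     (\<forall>r\<in>carrier R. \<pi> (j r) = r [^]\<^bsub>R\<^esub> p) \<and> (\<forall>u\<in>carrier Q. j (\<pi> u) = u [^]\<^bsub>Q\<^esub> p)"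

text \<open>The \<open>\<kappa> i\<close> are \<open>R\<close>-linear coordinates for the generators \<open>b i\<close> of the \<open>R\<close>-module \<open>Q\<close> (where \<open>R\<close> acts through \<open>j\<close>).\<close>

definition dual_basis ::
  "('a, 'y) ring_scheme => ('b, 'z) ring_scheme => ('a => 'b) => nat => (nat => 'b) => (nat => 'b => 'a) => bool" where
  "dual_basis R Q j n b \<kappa> \<longleftrightarrow>
     (\<forall>i<n. b i \<in> carrier Q) \<and> (\<forall>i<n. \<kappa> i \<in> carrier Q \<rightarrow> carrier R) \<and>
     (\<forall>i<n. \<forall>u\<in>carrier Q. \<forall>v\<in>carrier Q. \<kappa> i (u \<oplus>\<^bsub>Q\<^esub> v) = \<kappa> i u \<oplus>\<^bsub>R\<^esub> \<kappa> i v) \<and>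
     (\<forall>i<n. \<forall>r\<in>carrier R. \<forall>u\<in>carrier Q. \<kappa> i (j r \<otimes>\<^bsub>Q\<^esub> u) = r \<otimes>\<^bsub>R\<^esub> \<kappa> i u) \<and>
     (\<forall>u\<in>carrier Q. u = (\<Oplus>\<^bsub>Q\<^esub>i\<in>{..<n}. j (\<kappa> i u) \<otimes>\<^bsub>Q\<^esub> b i))"

lemma frobenius_coverD:
  assumes "frobenius_cover R p Q j \<pi>"
  shows "cring Q" "j \<in> ring_hom R Q" "\<pi> \<in> ring_hom Q R"
    "r \<in> carrier R ==> \<pi> (j r) = r [^]\<^bsub>R\<^esub> p" "u \<in> carrier Q ==> j (\<pi> u) = u [^]\<^bsub>Q\<^esub> p"
  using assms by (auto simp: frobenius_cover_def)

lemma dual_basisD: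
  assumes "dual_basis R Q j n b \<kappa>" 
  shows "i < n ==> b i \<in> carrier Q" "i < n ==> u \<in> carrier Q ==> \<kappa> i u \<in> carrier R"
    "i < n ==> u \<in> carrier Q ==> v \<in> carrier Q ==> \<kappa> i (u \<oplus>\<^bsub>Q\<^esub> v) = \<kappa> i u \<oplus>\<^bsub>R\<^esub> \<kappa> i v"
    "i < n ==> r \<in> carrier R ==> u \<in> carrier Q ==> \<kappa> i (j r \<otimes>\<^bsub>Q\<^esub> u) = r \<otimes>\<^bsub>R\<^esub> \<kappa> i u"
    "u \<in> carrier Q ==> (\<Oplus>\<^bsub>Q\<^esub>i\<in>{..<n}. j (\<kappa> i u) \<otimes>\<^bsub>Q\<^esub> b i) = u"
  using assms by (auto simp: dual_basis_def Pi_def)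

text \<open>\<open>Q' = Q[T]/(T\<^sup>p - j x)\<close> is free over \<open>Q\<close> on the powers of \<open>T\<close>, and \<open>T \<mapsto> x\<close> extends \<open>\<pi>\<close> because
  \<open>\<pi> (j x) = x\<^sup>p\<close>. That \<open>j'\<close> after \<open>\<pi>'\<close> is Frobenius has to be checked on constants and on \<open>T\<close> only.\<close>

lemma (in cring_char) adjoin_root:
  fixes Q :: "'a list ring"
  assumes cover: "frobenius_cover R p Q j \<pi>" and dual: "dual_basis R Q j n b \<kappa>"
    and x: "x \<in> carrier R" and nontriv: "\<zero> \<noteq> \<one>"
  obtains Q' :: "'a list ring" and j' \<pi>' b' \<kappa>' where "frobenius_cover R p Q' j' \<pi>'"
    "dual_basis R Q' j' (n * p) b' \<kappa>'" "\<pi> ` carrier Q \<subseteq> \<pi>' ` carrier Q'" "x \<in> \<pi>' ` carrier Q'"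
proof -
  note C = frobenius_coverD[OF cover] and D = dual_basisD[OF dual]
  interpret Q: cring Q by (rule C)
  interpret j: ring_hom_cring R Q j by (intro ring_hom_cringI is_cring C)
  interpret pi: ring_hom_cring Q R \<pi> by (intro ring_hom_cringI is_cring C)
  interpret U: UP_cring Q "UP Q" by (simp_all add: UP_cring_def Q.is_cring)
  interpret E: UP_univ_prop Q R \<pi> "UP Q" x "eval Q R \<pi> x"
    by unfold_locales (simp_all add: x)
  define y where "y = j x"
  have y: "y \<in> carrier Q" by (simp add: y_def x)
  define \<rho> where "\<rho> = root_reduce Q y p"
  note \<rho> = U.root_reduce_closed[OF y p_gt_0, folded \<rho>_def] U.root_reduce_add[OF y p_gt_0, folded \<rho>_def]
    U.root_reduce_const_mult[OF y p_gt_0, folded \<rho>_def] U.root_reduce_ideal[OF y p_gt_0, folded \<rho>_def]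
    U.root_reduce_repr[OF y p_gt_0, folded \<rho>_def] U.root_reduce_monom[OF y p_gt_0, folded \<rho>_def]
  define I where "I = PIdl\<^bsub>UP Q\<^esub> (monom (UP Q) \<one>\<^bsub>Q\<^esub> p \<ominus>\<^bsub>UP Q\<^esub> monom (UP Q) y 0)"
  have gen: "monom (UP Q) \<one>\<^bsub>Q\<^esub> p \<ominus>\<^bsub>UP Q\<^esub> monom (UP Q) y 0 \<in> carrier (UP Q)"
    using y by auto
  have I: "ideal I (UP Q)" unfolding I_def by (rule U.P.cgenideal_ideal[OF gen])
  have genI: "monom (UP Q) \<one>\<^bsub>Q\<^esub> p \<ominus>\<^bsub>UP Q\<^esub> monom (UP Q) y 0 \<in> I"
    unfolding I_def by (rule U.P.cgenideal_self[OF gen])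
  have \<rho>I: "\<rho> u l = \<zero>\<^bsub>Q\<^esub>" if "u \<in> I" "l < p" for u l
  proof -
    obtain v where v: "v \<in> carrier (UP Q)"
      "u = v \<otimes>\<^bsub>UP Q\<^esub> (monom (UP Q) \<one>\<^bsub>Q\<^esub> p \<ominus>\<^bsub>UP Q\<^esub> monom (UP Q) y 0)"
      using \<open>u \<in> I\<close> by (auto simp: I_def cgenideal_def)
    show ?thesis using \<rho>(4)[OF v(1) \<open>l < p\<close>] unfolding v(2) U.P.m_comm[OF v(1) gen] .
  qed
  have \<rho>minus: "\<rho> u l = \<rho> v l \<oplus>\<^bsub>Q\<^esub> \<rho> (u \<ominus>\<^bsub>UP Q\<^esub> v) l" if "u \<in> carrier (UP Q)" "v \<in> carrier (UP Q)" for u v l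
  proof -
    have "u = v \<oplus>\<^bsub>UP Q\<^esub> (u \<ominus>\<^bsub>UP Q\<^esub> v)" using that by (simp add: U.P.add_diff_cancel)
    then show ?thesis using \<rho>(2)[of v "u \<ominus>\<^bsub>UP Q\<^esub> v" l] that by auto
  qed
  define \<theta> where "\<theta> = (\<lambda>u. encode_words \<zero> \<one> (map (\<rho> u) [0..<p]))"
  have \<theta>eq: "\<theta> u = \<theta> v \<longleftrightarrow> u \<ominus>\<^bsub>UP Q\<^esub> v \<in> I" if uv: "u \<in> carrier (UP Q)" "v \<in> carrier (UP Q)" for u v
  proof -
    have "\<theta> u = \<theta> v \<longleftrightarrow> map (\<rho> u) [0..<p] = map (\<rho> v) [0..<p]"
      using encode_words_inj[OF nontriv] by (auto simp: \<theta>_def simp del: map_eq_conv)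
    also have "\<dots> \<longleftrightarrow> (\<forall>l<p. \<rho> u l = \<rho> v l)" by auto
    also have "\<dots> \<longleftrightarrow> u \<ominus>\<^bsub>UP Q\<^esub> v \<in> I"
    proof
      assume "u \<ominus>\<^bsub>UP Q\<^esub> v \<in> I"
      then show "\<forall>l<p. \<rho> u l = \<rho> v l" using \<rho>minus[OF uv] \<rho>I uv \<rho>(1) by simp
    next
      assume eq: "\<forall>l<p. \<rho> u l = \<rho> v l"
      let ?s = "\<Oplus>\<^bsub>UP Q\<^esub>l\<in>{..<p}. monom (UP Q) (\<rho> u l) l"
      have s: "?s \<in> carrier (UP Q)" using uv \<rho>(1) by auto
      have "?s = (\<Oplus>\<^bsub>UP Q\<^esub>l\<in>{..<p}. monom (UP Q) (\<rho> v l) l)"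
        using uv eq \<rho>(1) by (intro U.P.finsum_cong') auto
      then have "u \<ominus>\<^bsub>UP Q\<^esub> ?s \<in> I" "v \<ominus>\<^bsub>UP Q\<^esub> ?s \<in> I"
        using \<rho>(5)[OF uv(1) I genI] \<rho>(5)[OF uv(2) I genI] by auto
      moreover have "u \<ominus>\<^bsub>UP Q\<^esub> v = (u \<ominus>\<^bsub>UP Q\<^esub> ?s) \<ominus>\<^bsub>UP Q\<^esub> (v \<ominus>\<^bsub>UP Q\<^esub> ?s)"
        using uv s by (simp add: U.P.diff_diff_diff)
      ultimately show "u \<ominus>\<^bsub>UP Q\<^esub> v \<in> I" using ideal.diff_closed[OF I] by simp
    qed
    finally show ?thesis .
  qed
  obtain Q' :: "'a list ring" where Q': "cring Q'" "\<theta> \<in> ring_hom (UP Q) Q'"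
    "carrier Q' = \<theta> ` carrier (UP Q)"
    using quotient_ring_on[OF U.UP_cring I \<theta>eq] by blast
  interpret Q': cring Q' by (rule Q')
  interpret th: ring_hom_cring "UP Q" Q' \<theta> by (intro ring_hom_cringI U.UP_cring Q')
  define j' where "j' = (\<lambda>r. \<theta> (monom (UP Q) (j r) 0))"
  define r where "r = inv_into (carrier (UP Q)) \<theta>"
  define \<pi>' where "\<pi>' = (\<lambda>X. eval Q R \<pi> x (r X))"
  define b' where "b' = (\<lambda>m. \<theta> (monom (UP Q) (b (m div p)) (m mod p)))"
  define \<kappa>' where "\<kappa>' = (\<lambda>m X. \<kappa> (m div p) (\<rho> (r X) (m mod p)))"
  have r: "r (\<theta> u) \<in> carrier (UP Q)" "r (\<theta> u) \<ominus>\<^bsub>UP Q\<^esub> u \<in> I" if "u \<in> carrier (UP Q)" for u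
    using that f_inv_into_f[of "\<theta> u" \<theta> "carrier (UP Q)"] \<theta>eq[of "r (\<theta> u)" u]
    by (auto simp: r_def intro: inv_into_into)
  have evI: "eval Q R \<pi> x u = \<zero>" if "u \<in> I" for u
  proof -
    obtain v where v: "v \<in> carrier (UP Q)"
      "u = v \<otimes>\<^bsub>UP Q\<^esub> (monom (UP Q) \<one>\<^bsub>Q\<^esub> p \<ominus>\<^bsub>UP Q\<^esub> monom (UP Q) y 0)"
      using \<open>u \<in> I\<close> by (auto simp: I_def cgenideal_def)
    have "eval Q R \<pi> x (monom (UP Q) \<one>\<^bsub>Q\<^esub> p \<ominus>\<^bsub>UP Q\<^esub> monom (UP Q) y 0) = \<zero>"
      using y x C(4)[OF x] by (simp add: U.P.minus_eq E.Eval_monom y_def r_neg)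
    then show ?thesis using v gen by simp
  qed
  have \<pi>': "\<pi>' (\<theta> u) = eval Q R \<pi> x u" if u: "u \<in> carrier (UP Q)" for u
  proof -
    have "eval Q R \<pi> x (r (\<theta> u)) \<ominus> eval Q R \<pi> x u = \<zero>"
      using evI[OF r(2)[OF u]] u r(1)[OF u] by (simp add: U.P.minus_eq minus_eq)
    then show ?thesis using u r(1)[OF u] by (simp add: \<pi>'_def)
  qed
  have \<kappa>': "\<kappa>' m (\<theta> u) = \<kappa> (m div p) (\<rho> u (m mod p))" if u: "u \<in> carrier (UP Q)" for u m
    using \<rho>minus[OF r(1)[OF u] u, of "m mod p"] \<rho>I[OF r(2)[OF u], of "m mod p"] u \<rho>(1)
    by (simp add: \<kappa>'_def)
  have j'hom: "j' \<in> ring_hom R Q'"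
    using ring_hom_trans[OF ring_hom_trans[OF C(2) U.const_ring_hom] Q'(2)]
    by (simp add: j'_def comp_def)
  interpret j': ring_hom_cring R Q' j' by (intro ring_hom_cringI is_cring Q' j'hom)
  have \<pi>'hom: "\<pi>' \<in> ring_hom Q' R"
  proof (rule ring_hom_memI)
    show "\<pi>' \<one>\<^bsub>Q'\<^esub> = \<one>" using \<pi>'[of "\<one>\<^bsub>UP Q\<^esub>"] by simp
    fix X Y assume "X \<in> carrier Q'" "Y \<in> carrier Q'"
    then obtain u v where uv: "u \<in> carrier (UP Q)" "v \<in> carrier (UP Q)" "X = \<theta> u" "Y = \<theta> v"
      by (auto simp: Q'(3))
    show "\<pi>' (X \<otimes>\<^bsub>Q'\<^esub> Y) = \<pi>' X \<otimes> \<pi>' Y"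
      using uv \<pi>'[of "u \<otimes>\<^bsub>UP Q\<^esub> v"] by (simp add: \<pi>')
    show "\<pi>' (X \<oplus>\<^bsub>Q'\<^esub> Y) = \<pi>' X \<oplus> \<pi>' Y"
      using uv \<pi>'[of "u \<oplus>\<^bsub>UP Q\<^esub> v"] by (simp add: \<pi>')
  qed (auto simp: Q'(3) \<pi>')
  interpret pi': ring_hom_cring Q' R \<pi>' by (intro ring_hom_cringI is_cring Q' \<pi>'hom)
  have pchar: "cring_char Q' p" by (rule cring_char_hom[OF Q'(1) j'hom])
  interpret Q'c: cring_char Q' p by (rule pchar)
  have frobhom: "(\<lambda>u. u [^]\<^bsub>Q'\<^esub> p) \<in> ring_hom Q' Q'" using Q'c.frob_hom[of 1] by simp
  have frob': "\<theta> u [^]\<^bsub>Q'\<^esub> p = j' (eval Q R \<pi> x u)" if u: "u \<in> carrier (UP Q)" for u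
  proof -
    have "UP_pre_univ_prop Q Q' (\<lambda>c. \<theta> (monom (UP Q) c 0) [^]\<^bsub>Q'\<^esub> p)"
      using ring_hom_trans[OF ring_hom_trans[OF U.const_ring_hom Q'(2)] frobhom]
      by (intro UP_pre_univ_propI Q.is_cring Q'(1)) (simp add: comp_def)
    then interpret V: UP_pre_univ_prop Q Q' "\<lambda>c. \<theta> (monom (UP Q) c 0) [^]\<^bsub>Q'\<^esub> p" "UP Q"
      by simp_all
    show ?thesis
    proof (rule V.UP_hom_unique[where Phi = "\<lambda>u. \<theta> u [^]\<^bsub>Q'\<^esub> p" and Psi = "\<lambda>u. j' (eval Q R \<pi> x u)" and s = "j' x"])
      show "ring_hom_cring (UP Q) Q' (\<lambda>u. \<theta> u [^]\<^bsub>Q'\<^esub> p)"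
        using ring_hom_trans[OF Q'(2) frobhom]
        by (intro ring_hom_cringI U.UP_cring Q'(1)) (simp add: comp_def)
      show "ring_hom_cring (UP Q) Q' (\<lambda>u. j' (eval Q R \<pi> x u))"
        using ring_hom_trans[OF E.homh j'hom]
        by (intro ring_hom_cringI U.UP_cring Q'(1)) (simp add: comp_def)
      have "\<theta> (monom (UP Q) \<one>\<^bsub>Q\<^esub> (Suc 0)) [^]\<^bsub>Q'\<^esub> p = \<theta> (monom (UP Q) \<one>\<^bsub>Q\<^esub> (Suc 0) [^]\<^bsub>UP Q\<^esub> p)"
        by simp
      also have "\<dots> = \<theta> (monom (UP Q) \<one>\<^bsub>Q\<^esub> p)" by (subst U.monom_pow) simp_all
      also have "\<dots> = \<theta> (monom (UP Q) y 0)" using y genI by (subst \<theta>eq) auto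
      finally show "\<theta> (monom (UP Q) \<one>\<^bsub>Q\<^esub> (Suc 0)) [^]\<^bsub>Q'\<^esub> p = j' x" by (simp add: j'_def y_def)
      show "j' (eval Q R \<pi> x (monom (UP Q) \<one>\<^bsub>Q\<^esub> (Suc 0))) = j' x"
        using E.Eval_monom[of "\<one>\<^bsub>Q\<^esub>" "Suc 0"] x by simp
      fix c assume c: "c \<in> carrier Q"
      have "\<theta> (monom (UP Q) c 0) [^]\<^bsub>Q'\<^esub> p = \<theta> (monom (UP Q) c 0 [^]\<^bsub>UP Q\<^esub> p)" using c by simp
      also have "\<dots> = j' (\<pi> c)" using c C(5)[OF c] by (subst U.monom_pow) (simp_all add: j'_def)
      finally show "j' (eval Q R \<pi> x (monom (UP Q) c 0)) = \<theta> (monom (UP Q) c 0) [^]\<^bsub>Q'\<^esub> p"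
        using E.Eval_monom[OF c, of 0] c by simp
    qed (use u x in auto)
  qed
  have "frobenius_cover R p Q' j' \<pi>'"
    unfolding frobenius_cover_def
  proof (intro conjI ballI Q'(1) j'hom \<pi>'hom)
    fix a assume a: "a \<in> carrier R"
    then show "\<pi>' (j' a) = a [^] p"
      using C(4)[OF a] by (simp add: j'_def \<pi>' E.Eval_monom)
  next
    fix X assume "X \<in> carrier Q'"
    then show "j' (\<pi>' X) = X [^]\<^bsub>Q'\<^esub> p" by (auto simp: Q'(3) \<pi>' frob')
  qed
  moreover have "dual_basis R Q' j' (n * p) b' \<kappa>'"
    unfolding dual_basis_def
  proof (intro conjI allI impI ballI)
    fix m assume "m < n * p"
    then have i: "m div p < n" by (simp add: less_mult_imp_div_less)
    show "b' m \<in> carrier Q'" using D(1)[OF i] by (simp add: b'_def)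
    show "\<kappa>' m \<in> carrier Q' \<rightarrow> carrier R" using D(2)[OF i] \<rho>(1) by (auto simp: Q'(3) \<kappa>')
    fix Y assume "Y \<in> carrier Q'"
    then obtain v where v: "v \<in> carrier (UP Q)" "Y = \<theta> v" by (auto simp: Q'(3))
    show "\<kappa>' m (j' a \<otimes>\<^bsub>Q'\<^esub> Y) = a \<otimes> \<kappa>' m Y" if a: "a \<in> carrier R" for a
      using v a \<kappa>'[of "monom (UP Q) (j a) 0 \<otimes>\<^bsub>UP Q\<^esub> v" m] D(4)[OF i] \<rho>(1,3)
      by (simp add: j'_def \<kappa>')
    show "\<kappa>' m (X \<oplus>\<^bsub>Q'\<^esub> Y) = \<kappa>' m X \<oplus> \<kappa>' m Y" if "X \<in> carrier Q'" for X
    proof -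
      obtain u where u: "u \<in> carrier (UP Q)" "X = \<theta> u" using \<open>X \<in> _\<close> by (auto simp: Q'(3))
      show ?thesis
        using u v \<kappa>'[of "u \<oplus>\<^bsub>UP Q\<^esub> v" m] D(3)[OF i] \<rho>(1,2) by (simp add: \<kappa>')
    qed
  next
    fix X assume "X \<in> carrier Q'"
    then obtain u where u: "u \<in> carrier (UP Q)" "X = \<theta> u" by (auto simp: Q'(3))
    define h where "h = (\<lambda>i l. if i < n then monom (UP Q) (j (\<kappa> i (\<rho> u l)) \<otimes>\<^bsub>Q\<^esub> b i) l else \<zero>\<^bsub>UP Q\<^esub>)"
    have hcl: "h i l \<in> carrier (UP Q)" for i l using D(1,2) \<rho>(1)[OF u(1)] by (auto simp: h_def)
    have "(\<Oplus>\<^bsub>Q'\<^esub>m\<in>{..<n * p}. j' (\<kappa>' m X) \<otimes>\<^bsub>Q'\<^esub> b' m) = (\<Oplus>\<^bsub>Q'\<^esub>m\<in>{..<n * p}. \<theta> (h (m div p) (m mod p)))"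
    proof (rule Q'.finsum_cong'[OF refl])
      fix m assume "m \<in> {..<n * p}"
      then have i: "m div p < n" by (simp add: less_mult_imp_div_less)
      let ?c = "j (\<kappa> (m div p) (\<rho> u (m mod p)))"
      have c: "?c \<in> carrier Q" using D(2)[OF i] \<rho>(1)[OF u(1)] by simp
      have "j' (\<kappa>' m X) \<otimes>\<^bsub>Q'\<^esub> b' m = \<theta> (monom (UP Q) ?c 0 \<otimes>\<^bsub>UP Q\<^esub> monom (UP Q) (b (m div p)) (m mod p))"
        using c D(1)[OF i] by (simp add: u \<kappa>' j'_def b'_def)
      also have "monom (UP Q) ?c 0 \<otimes>\<^bsub>UP Q\<^esub> monom (UP Q) (b (m div p)) (m mod p) = h (m div p) (m mod p)"
        using c D(1)[OF i] i U.monom_mult[of ?c "b (m div p)" 0 "m mod p"] by (simp add: h_def)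
      finally show "j' (\<kappa>' m X) \<otimes>\<^bsub>Q'\<^esub> b' m = \<theta> (h (m div p) (m mod p))" .
    qed (use hcl in auto)
    also have "\<dots> = \<theta> (\<Oplus>\<^bsub>UP Q\<^esub>m\<in>{..<n * p}. h (m div p) (m mod p))"
      using hcl by (subst th.hom_finsum) (auto simp: comp_def)
    also have "(\<Oplus>\<^bsub>UP Q\<^esub>m\<in>{..<n * p}. h (m div p) (m mod p)) = (\<Oplus>\<^bsub>UP Q\<^esub>l\<in>{..<p}. \<Oplus>\<^bsub>UP Q\<^esub>i\<in>{..<n}. h i l)"
      by (rule U.P.finsum_div_mod[OF hcl])
    also have "\<dots> = (\<Oplus>\<^bsub>UP Q\<^esub>l\<in>{..<p}. monom (UP Q) (\<rho> u l) l)"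
    proof (rule U.P.finsum_cong'[OF refl])
      fix l
      show "(\<Oplus>\<^bsub>UP Q\<^esub>i\<in>{..<n}. h i l) = monom (UP Q) (\<rho> u l) l"
      proof (rule U.up_eqI)
        fix k
        have "coeff (UP Q) (\<Oplus>\<^bsub>UP Q\<^esub>i\<in>{..<n}. h i l) k = (\<Oplus>\<^bsub>Q\<^esub>i\<in>{..<n}. coeff (UP Q) (h i l) k)"
          using hcl by (intro U.coeff_finsum) auto
        also have "\<dots> = (\<Oplus>\<^bsub>Q\<^esub>i\<in>{..<n}. if l = k then j (\<kappa> i (\<rho> u l)) \<otimes>\<^bsub>Q\<^esub> b i else \<zero>\<^bsub>Q\<^esub>)"
          using D(1,2) \<rho>(1)[OF u(1)] by (intro Q.finsum_cong') (auto simp: h_def)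
        also have "\<dots> = (if l = k then \<rho> u l else \<zero>\<^bsub>Q\<^esub>)" using D(5)[OF \<rho>(1)[OF u(1)]] by simp
        finally show "coeff (UP Q) (\<Oplus>\<^bsub>UP Q\<^esub>i\<in>{..<n}. h i l) k = coeff (UP Q) (monom (UP Q) (\<rho> u l) l) k"
          using \<rho>(1)[OF u(1)] by simp
      qed (use hcl \<rho>(1)[OF u(1)] in auto)
    qed (use \<rho>(1)[OF u(1)] in auto)
    also have "\<theta> \<dots> = \<theta> u"
      using \<theta>eq[of u "\<Oplus>\<^bsub>UP Q\<^esub>l\<in>{..<p}. monom (UP Q) (\<rho> u l) l"] \<rho>(5)[OF u(1) I genI] \<rho>(1)[OF u(1)] u(1)
      by simp
    finally show "X = (\<Oplus>\<^bsub>Q'\<^esub>m\<in>{..<n * p}. j' (\<kappa>' m X) \<otimes>\<^bsub>Q'\<^esub> b' m)" by (simp add: u)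
  qed
  moreover have "\<pi> ` carrier Q \<subseteq> \<pi>' ` carrier Q'"
  proof
    fix a assume "a \<in> \<pi> ` carrier Q"
    then obtain c where c: "c \<in> carrier Q" "a = \<pi> c" by auto
    then have "a = \<pi>' (\<theta> (monom (UP Q) c 0))" using E.Eval_monom[OF c(1), of 0] by (simp add: \<pi>')
    then show "a \<in> \<pi>' ` carrier Q'" using c by auto
  qed
  moreover have "x \<in> \<pi>' ` carrier Q'"
  proof
    show "x = \<pi>' (\<theta> (monom (UP Q) \<one>\<^bsub>Q\<^esub> 1))" using E.Eval_monom[of "\<one>\<^bsub>Q\<^esub>" 1] x by (simp add: \<pi>')
  qed auto
  ultimately show ?thesis using that by blast
qed

section \<open>Smooth algebras have Frobenius dual bases\<close>

lemma perfect_field_cring_char: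
  assumes "perfect_field_of_char k p"
  shows "cring_char k p" "field k"
proof -
  show "field k" using assms by (simp add: perfect_field_of_char_def)
  then interpret field k .
  show "cring_char k p"
    using assms by unfold_locales (auto simp: perfect_field_of_char_def)
qed

lemma (in cring_char) exists_frobenius_cover:
  assumes X: "finite X" "X \<subseteq> carrier R" and nontriv: "\<zero> \<noteq> \<one>"
  shows "\<exists>(Q :: 'a list ring) j \<pi> n b \<kappa>. frobenius_cover R p Q j \<pi> \<and> dual_basis R Q j n b \<kappa> \<and>
    X \<subseteq> \<pi> ` carrier Q"
  using X
proof (induction X)
  case empty
  have zid: "ideal {\<zero>} R" by (rule zeroideal)
  have single: "[u] = [v] \<longleftrightarrow> u \<ominus> v \<in> {\<zero>}" if "u \<in> carrier R" "v \<in> carrier R" for u v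
    using that by simp
  obtain Q :: "'a list ring" where Q: "cring Q" "(\<lambda>r. [r]) \<in> ring_hom R Q"
    "carrier Q = (\<lambda>r. [r]) ` carrier R"
    using quotient_ring_on[where \<theta> = "\<lambda>r. [r]", OF is_cring zid single] by metis
  interpret Q: cring Q by (rule Q)
  interpret j: ring_hom_cring R Q "\<lambda>r. [r]" by (intro ring_hom_cringI is_cring Q)
  define \<pi> where "\<pi> = (\<lambda>X. hd X [^] p)"
  have one: "\<one>\<^bsub>Q\<^esub> = [\<one>]" by simp
  have \<pi>: "\<pi> \<in> ring_hom Q R"
    by (rule ring_hom_memI)
      (auto simp: \<pi>_def Q(3) j.hom_mult[symmetric] j.hom_add[symmetric] one nat_pow_distrib frob_add[of _ _ 1, simplified]
        simp del: j.hom_mult j.hom_add j.hom_one)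
  have "frobenius_cover R p Q (\<lambda>r. [r]) \<pi>"
    unfolding frobenius_cover_def
    by (intro conjI Q \<pi> ballI) (auto simp: \<pi>_def Q(3))
  moreover have "dual_basis R Q (\<lambda>r. [r]) 1 (\<lambda>_. \<one>\<^bsub>Q\<^esub>) (\<lambda>_. hd)"
    unfolding dual_basis_def
  proof (intro conjI allI impI ballI)
    show "\<one>\<^bsub>Q\<^esub> \<in> carrier Q" by simp
    fix u assume "u \<in> carrier Q"
    then obtain a where a: "u = [a]" "a \<in> carrier R" by (auto simp: Q(3))
    then show "u = (\<Oplus>\<^bsub>Q\<^esub>i\<in>{..<1::nat}. [hd u] \<otimes>\<^bsub>Q\<^esub> \<one>\<^bsub>Q\<^esub>)"
      using \<open>u \<in> carrier Q\<close> by (simp add: lessThan_Suc del: j.hom_one)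
  qed (auto simp: Q(3) j.hom_mult[symmetric] j.hom_add[symmetric] simp del: j.hom_mult j.hom_add j.hom_one)
  ultimately show ?case by blast
next
  case (insert x X)
  then obtain Q :: "'a list ring" and j \<pi> n b \<kappa> where Q: "frobenius_cover R p Q j \<pi>"
    "dual_basis R Q j n b \<kappa>" "X \<subseteq> \<pi> ` carrier Q" by auto
  obtain Q' :: "'a list ring" and j' \<pi>' b' \<kappa>' where Q': "frobenius_cover R p Q' j' \<pi>'"
    "dual_basis R Q' j' (n * p) b' \<kappa>'" "\<pi> ` carrier Q \<subseteq> \<pi>' ` carrier Q'" "x \<in> \<pi>' ` carrier Q'"
    using adjoin_root[OF Q(1,2) _ nontriv] insert.prems by blast
  then have "insert x X \<subseteq> \<pi>' ` carrier Q'" using Q(3) by blast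
  with Q' show ?case by blast
qed

lemma cring_noetherian_ideal:
  fixes Q (structure)
  assumes "cring Q" and noeth: "noetherian_subring Q (carrier Q)" and I: "ideal I Q"
  obtains U where "finite U" "U \<subseteq> I" "I = Idl U"
proof -
  interpret cring Q by fact
  interpret I: ideal I Q by (rule I)
  have sub: "scalar_submodule Q (carrier Q) J" if "ideal J Q" for J
  proof -
    interpret J: ideal J Q by (rule that)
    show ?thesis by (auto simp: scalar_submodule_def J.Icarr J.I_l_closed)
  qed
  have "I \<subseteq> carrier Q" using I.Icarr by blast
  then obtain U where U: "U \<subseteq> I" "finite U" "\<And>J. scalar_submodule Q (carrier Q) J ==> U \<subseteq> J ==> I \<subseteq> J"
    using noeth sub[OF I] by (auto simp: noetherian_subring_def)
  have Uc: "U \<subseteq> carrier Q" using U(1) I.Icarr by blast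
  have "I = Idl U"
    using U(3)[OF sub[OF genideal_ideal[OF Uc]] genideal_self[OF Uc]] genideal_minimal[OF I U(1)] by blast
  then show ?thesis using that U by blast
qed

text \<open>\<open>Q\<close> is of finite type over the image of \<open>k\<close>, generated by the images of generators of \<open>R\<close>
  and by the basis.\<close>

lemma frobenius_cover_noetherian:
  assumes k: "field k" and i: "\<iota> \<in> ring_hom k R" and R: "cring R"
    and X: "finite X" "X \<subseteq> carrier R" "generate_ring R (\<iota> ` carrier k \<union> X) = carrier R"
    and cover: "frobenius_cover R p Q j \<pi>" and dual: "dual_basis R Q j n b \<kappa>"
  shows "noetherian_subring Q (carrier Q)"
proof -
  note C = frobenius_coverD[OF cover] and D = dual_basisD[OF dual]
  interpret k: field k by (rule k)
  interpret R: cring R by (rule R)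
  interpret Q: cring Q by (rule C)
  interpret i: ring_hom_cring k R \<iota> by (intro ring_hom_cringI k.is_cring R i)
  interpret j: ring_hom_cring R Q j by (intro ring_hom_cringI R C)
  define K where "K = (\<lambda>c. j (\<iota> c)) ` carrier k"
  define Y where "Y = j ` X \<union> b ` {..<n}"
  have Y: "finite Y" "Y \<subseteq> carrier Q" using X D(1) by (auto simp: Y_def)
  have "(\<lambda>c. j (\<iota> c)) \<in> ring_hom k Q" using ring_hom_trans[OF i C(2)] by (simp add: comp_def)
  then have Ksub: "subring K Q"
    unfolding K_def
    by (rule ring_hom_ring.img_is_subring[OF ring_hom_ringI2[OF k.ring_axioms Q.ring_axioms] k.carrier_is_subring])
  have Kinv: "\<exists>d\<in>K. d \<otimes>\<^bsub>Q\<^esub> c = \<one>\<^bsub>Q\<^esub>" if c: "c \<in> K" "c \<noteq> \<zero>\<^bsub>Q\<^esub>" for c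
  proof -
    obtain a where a: "a \<in> carrier k" "c = j (\<iota> a)" using c by (auto simp: K_def)
    then have "a \<noteq> \<zero>\<^bsub>k\<^esub>" using c(2) by auto
    then have "a \<in> Units k" using a k.field_Units by auto
    then obtain d where d: "d \<in> carrier k" "d \<otimes>\<^bsub>k\<^esub> a = \<one>\<^bsub>k\<^esub>" by (auto simp: Units_def)
    have "j (\<iota> d) \<otimes>\<^bsub>Q\<^esub> c = j (\<iota> (d \<otimes>\<^bsub>k\<^esub> a))" using a(1) d(1) by (simp add: a(2))
    then show ?thesis using d by (auto simp: K_def)
  qed
  have KY: "K \<union> Y \<subseteq> carrier Q" using Y by (auto simp: K_def)
  have "carrier Q \<subseteq> generate_ring Q (K \<union> Y)"
  proof
    note G = Q.generate_ring_is_subring[OF KY]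
    have jr: "j r \<in> generate_ring Q (K \<union> Y)" if "r \<in> generate_ring R (\<iota> ` carrier k \<union> X)" for r
      using that
    proof induction
      case one
      then show ?case by (simp add: generate_ring.one)
    next
      case (incl h)
      then show ?case by (intro generate_ring.incl) (auto simp: K_def Y_def)
    qed (use X R.generate_ring_in_carrier[of "\<iota> ` carrier k \<union> X"] in
        \<open>auto simp: X(3) intro: generate_ring.intros\<close>)
    fix u assume u: "u \<in> carrier Q"
    have "(\<Oplus>\<^bsub>Q\<^esub>i\<in>A. j (\<kappa> i u) \<otimes>\<^bsub>Q\<^esub> b i) \<in> generate_ring Q (K \<union> Y)" if "A \<subseteq> {..<n}" for A
      using finite_subset[OF that finite_lessThan] that
    proof (induction A)
      case empty
      then show ?case by (simp add: Q.zero_in_generate)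
    next
      case (insert i A)
      have "j (\<kappa> i u) \<otimes>\<^bsub>Q\<^esub> b i \<in> generate_ring Q (K \<union> Y)"
        using insert.prems jr[of "\<kappa> i u"] X(3) D(2)[of i u] u
        by (intro generate_ring.eng_mult) (auto simp: Y_def intro: generate_ring.incl)
      then show ?case
        using insert D(1,2) u by (subst Q.finsum_insert) (auto intro: generate_ring.eng_add)
    qed
    from this[of "{..<n}"] show "u \<in> generate_ring Q (K \<union> Y)" using D(5)[OF u] by simp
  qed
  then have "generate_ring Q (K \<union> Y) = carrier Q" using Q.generate_ring_incl[OF KY] by blast
  then show ?thesis using Q.noetherian_finite_type[OF Ksub Kinv Y] by simp
qed

text \<open>A section of \<open>\<pi>\<close> that is a \<open>k\<close>-algebra homomorphism up to errors in \<open>N\<close>.\<close>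

definition hom_modulo ::
  "('a, 'y) ring_scheme => ('b, 'z) ring_scheme => ('k, 'x) ring_scheme => ('k => 'a) => ('k => 'b) =>
     ('b => 'a) => 'b set => ('a => 'b) => bool" where
  "hom_modulo R Q k \<iota> \<gamma> \<pi> N \<psi> \<longleftrightarrow> \<psi> \<in> carrier R \<rightarrow> carrier Q \<and>
     (\<forall>x\<in>carrier R. \<forall>y\<in>carrier R.
        \<psi> (x \<oplus>\<^bsub>R\<^esub> y) \<ominus>\<^bsub>Q\<^esub> (\<psi> x \<oplus>\<^bsub>Q\<^esub> \<psi> y) \<in> N \<and> \<psi> (x \<otimes>\<^bsub>R\<^esub> y) \<ominus>\<^bsub>Q\<^esub> \<psi> x \<otimes>\<^bsub>Q\<^esub> \<psi> y \<in> N) \<and>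
     \<psi> \<one>\<^bsub>R\<^esub> \<ominus>\<^bsub>Q\<^esub> \<one>\<^bsub>Q\<^esub> \<in> N \<and> (\<forall>c\<in>carrier k. \<psi> (\<iota> c) \<ominus>\<^bsub>Q\<^esub> \<gamma> c \<in> N) \<and> (\<forall>x\<in>carrier R. \<pi> (\<psi> x) = x)"

text \<open>Formal smoothness, applied to the square-zero ideal \<open>N/N'\<close> of \<open>Q/N'\<close>. The quotient is placed on
  the type of \<open>Q\<close> by choosing representatives.\<close>

lemma lift_hom_modulo:
  fixes Q :: "'a list ring" and R :: "'a ring"
  assumes smooth: "formally_smooth_algebra k R \<iota>" and i: "\<iota> \<in> ring_hom k R"
    and R: "cring R" and Q: "cring Q" and \<gamma>: "\<gamma> \<in> ring_hom k Q" and \<pi>: "\<pi> \<in> ring_hom Q R"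
    and N: "ideal N Q" and N': "ideal N' Q" "N' \<subseteq> N"
    and ker: "\<And>u. u \<in> N ==> \<pi> u = \<zero>\<^bsub>R\<^esub>" and sq: "\<And>u v. u \<in> N ==> v \<in> N ==> u \<otimes>\<^bsub>Q\<^esub> v \<in> N'"
    and \<psi>: "hom_modulo R Q k \<iota> \<gamma> \<pi> N \<psi>"
  shows "\<exists>\<psi>'. hom_modulo R Q k \<iota> \<gamma> \<pi> N' \<psi>'"
proof -
  interpret Q: cring Q by (rule Q)
  interpret R: cring R by (rule R)
  interpret pi: ring_hom_cring Q R \<pi> by (intro ring_hom_cringI Q R \<pi>)
  note Ncl = additive_subgroup.a_closed[OF ideal.axioms(1)[OF N]] ideal.diff_closed[OF N] ideal.Icarr[OF N]
    additive_subgroup.zero_closed[OF ideal.axioms(1)[OF N]]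
  note N'cl = additive_subgroup.a_closed[OF ideal.axioms(1)[OF N'(1)]] ideal.diff_closed[OF N'(1)] ideal.Icarr[OF N'(1)]
    additive_subgroup.zero_closed[OF ideal.axioms(1)[OF N'(1)]]
  define \<theta> where "\<theta> = (\<lambda>u. SOME v. v \<in> carrier Q \<and> u \<ominus>\<^bsub>Q\<^esub> v \<in> N')"
  have \<theta>: "\<theta> u \<in> carrier Q" "u \<ominus>\<^bsub>Q\<^esub> \<theta> u \<in> N'" if "u \<in> carrier Q" for u
  proof -
    have "\<exists>v. v \<in> carrier Q \<and> u \<ominus>\<^bsub>Q\<^esub> v \<in> N'"
      using that N'cl(4) by (auto intro!: exI[of _ u] simp: Q.minus_eq Q.r_neg)
    from someI_ex[OF this] show "\<theta> u \<in> carrier Q" "u \<ominus>\<^bsub>Q\<^esub> \<theta> u \<in> N'" by (auto simp: \<theta>_def)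
  qed
  have \<theta>eq: "\<theta> u = \<theta> v \<longleftrightarrow> u \<ominus>\<^bsub>Q\<^esub> v \<in> N'" if uv: "u \<in> carrier Q" "v \<in> carrier Q" for u v
  proof
    assume "\<theta> u = \<theta> v"
    then show "u \<ominus>\<^bsub>Q\<^esub> v \<in> N'"
      using N'cl(2)[OF \<theta>(2)[OF uv(1)] \<theta>(2)[OF uv(2)]] uv \<theta>(1) by (simp add: Q.diff_diff_diff)
  next
    assume d: "u \<ominus>\<^bsub>Q\<^esub> v \<in> N'"
    have "(u \<ominus>\<^bsub>Q\<^esub> w \<in> N') = (v \<ominus>\<^bsub>Q\<^esub> w \<in> N')" if w: "w \<in> carrier Q" for w
    proof
      assume "v \<ominus>\<^bsub>Q\<^esub> w \<in> N'"
      then show "u \<ominus>\<^bsub>Q\<^esub> w \<in> N'" using N'cl(1)[OF d \<open>v \<ominus>\<^bsub>Q\<^esub> w \<in> N'\<close>] uv w by (simp add: Q.diff_trans)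
    next
      assume "u \<ominus>\<^bsub>Q\<^esub> w \<in> N'"
      moreover have "(u \<ominus>\<^bsub>Q\<^esub> w) \<ominus>\<^bsub>Q\<^esub> (u \<ominus>\<^bsub>Q\<^esub> v) = v \<ominus>\<^bsub>Q\<^esub> w" using uv w by algebra
      ultimately show "v \<ominus>\<^bsub>Q\<^esub> w \<in> N'" using N'cl(2)[OF _ d] by metis
    qed
    then show "\<theta> u = \<theta> v" by (auto simp: \<theta>_def cong: conj_cong)
  qed
  obtain C :: "'a list ring" where C: "cring C" "\<theta> \<in> ring_hom Q C" "carrier C = \<theta> ` carrier Q"
    using quotient_ring_on[OF Q N'(1) \<theta>eq] by blast
  interpret C: cring C by (rule C)
  interpret th: ring_hom_cring Q C \<theta> by (intro ring_hom_cringI Q C)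
  define J where "J = \<theta> ` N"
  have J: "ideal J C"
  proof (rule C.ideal_of_closed)
    show "J \<subseteq> carrier C" "J \<noteq> {}" using Ncl(3,4) by (auto simp: J_def C(3))
    show "a \<oplus>\<^bsub>C\<^esub> b \<in> J" if "a \<in> J" "b \<in> J" for a b
    proof -
      obtain u v where u: "u \<in> N" "a = \<theta> u" "v \<in> N" "b = \<theta> v" using \<open>a \<in> J\<close> \<open>b \<in> J\<close> by (auto simp: J_def)
      then have "\<theta> (u \<oplus>\<^bsub>Q\<^esub> v) = a \<oplus>\<^bsub>C\<^esub> b" using Ncl(3) by simp
      then show ?thesis using Ncl(1)[OF u(1,3)] unfolding J_def by (metis imageI)
    qed
    show "x \<otimes>\<^bsub>C\<^esub> a \<in> J" if "x \<in> carrier C" "a \<in> J" for a x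
    proof -
      obtain u v where u: "u \<in> N" "a = \<theta> u" "v \<in> carrier Q" "x = \<theta> v"
        using \<open>a \<in> J\<close> \<open>x \<in> carrier C\<close> by (auto simp: J_def C(3))
      then have "\<theta> (v \<otimes>\<^bsub>Q\<^esub> u) = x \<otimes>\<^bsub>C\<^esub> a" using Ncl(3) by simp
      then show ?thesis using ideal.I_l_closed[OF N u(1,3)] unfolding J_def by (metis imageI)
    qed
  qed
  have Jsq: "\<forall>x \<in> J. \<forall>y \<in> J. x \<otimes>\<^bsub>C\<^esub> y = \<zero>\<^bsub>C\<^esub>"
  proof (intro ballI)
    fix x y assume "x \<in> J" "y \<in> J"
    then obtain u v where u: "u \<in> N" "x = \<theta> u" "v \<in> N" "y = \<theta> v" by (auto simp: J_def)
    have "\<theta> (u \<otimes>\<^bsub>Q\<^esub> v) = \<theta> \<zero>\<^bsub>Q\<^esub>" using sq[OF u(1,3)] Ncl(3) u by (subst \<theta>eq) (auto simp: Q.minus_eq)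
    then show "x \<otimes>\<^bsub>C\<^esub> y = \<zero>\<^bsub>C\<^esub>" using u Ncl(3) by simp
  qed
  have coset: "J +>\<^bsub>C\<^esub> \<theta> u = J +>\<^bsub>C\<^esub> \<theta> v \<longleftrightarrow> u \<ominus>\<^bsub>Q\<^esub> v \<in> N" if uv: "u \<in> carrier Q" "v \<in> carrier Q" for u v
  proof -
    have "J +>\<^bsub>C\<^esub> \<theta> u = J +>\<^bsub>C\<^esub> \<theta> v \<longleftrightarrow> \<theta> u \<ominus>\<^bsub>C\<^esub> \<theta> v \<in> J"
      using uv by (intro C.quotient_eq_iff_same_a_r_cos[OF J, symmetric]) auto
    also have "\<theta> u \<ominus>\<^bsub>C\<^esub> \<theta> v = \<theta> (u \<ominus>\<^bsub>Q\<^esub> v)" using uv by (simp add: Q.minus_eq C.minus_eq)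
    also have "\<theta> (u \<ominus>\<^bsub>Q\<^esub> v) \<in> J \<longleftrightarrow> u \<ominus>\<^bsub>Q\<^esub> v \<in> N"
    proof
      assume "\<theta> (u \<ominus>\<^bsub>Q\<^esub> v) \<in> J"
      then obtain w where w: "w \<in> N" "\<theta> (u \<ominus>\<^bsub>Q\<^esub> v) = \<theta> w" by (auto simp: J_def)
      then have "(u \<ominus>\<^bsub>Q\<^esub> v) \<ominus>\<^bsub>Q\<^esub> w \<in> N" using \<theta>eq[of "u \<ominus>\<^bsub>Q\<^esub> v" w] uv Ncl(3) N'(2) by auto
      from Ncl(1)[OF w(1) this] show "u \<ominus>\<^bsub>Q\<^esub> v \<in> N" using uv Ncl(3)[OF w(1)] by (simp add: Q.add_diff_cancel)
    qed (simp add: J_def)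
    finally show ?thesis .
  qed
  define \<phi> where "\<phi> = (\<lambda>x. J +>\<^bsub>C\<^esub> \<theta> (\<psi> x))"
  have \<psi>c: "\<psi> x \<in> carrier Q" if "x \<in> carrier R" for x using \<psi> that by (auto simp: hom_modulo_def)
  interpret J: ideal J C by (rule J)
  have \<phi>: "\<phi> \<in> ring_hom R (C Quot J)"
  proof (rule ring_hom_memI)
    fix x y assume xy: "x \<in> carrier R" "y \<in> carrier R"
    have c: "\<theta> (\<psi> x) \<in> carrier C" "\<theta> (\<psi> y) \<in> carrier C" using \<psi>c xy by auto
    show "\<phi> (x \<otimes>\<^bsub>R\<^esub> y) = \<phi> x \<otimes>\<^bsub>C Quot J\<^esub> \<phi> y"
      using coset[of "\<psi> (x \<otimes>\<^bsub>R\<^esub> y)" "\<psi> x \<otimes>\<^bsub>Q\<^esub> \<psi> y"] \<psi> xy \<psi>c ring_hom_mult[OF J.rcos_ring_hom c]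
      by (simp add: \<phi>_def hom_modulo_def)
    show "\<phi> (x \<oplus>\<^bsub>R\<^esub> y) = \<phi> x \<oplus>\<^bsub>C Quot J\<^esub> \<phi> y"
      using coset[of "\<psi> (x \<oplus>\<^bsub>R\<^esub> y)" "\<psi> x \<oplus>\<^bsub>Q\<^esub> \<psi> y"] \<psi> xy \<psi>c ring_hom_add[OF J.rcos_ring_hom c]
      by (simp add: \<phi>_def hom_modulo_def)
  next
    show "\<phi> x \<in> carrier (C Quot J)" if "x \<in> carrier R" for x
      using ring_hom_closed[OF J.rcos_ring_hom, of "\<theta> (\<psi> x)"] \<psi>c[OF that] by (simp add: \<phi>_def)
    show "\<phi> \<one>\<^bsub>R\<^esub> = \<one>\<^bsub>C Quot J\<^esub>"
      using coset[of "\<psi> \<one>\<^bsub>R\<^esub>" "\<one>\<^bsub>Q\<^esub>"] \<psi> \<psi>c ring_hom_one[OF J.rcos_ring_hom]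
      by (simp add: \<phi>_def hom_modulo_def)
  qed
  have \<phi>\<gamma>: "\<forall>c\<in>carrier k. \<phi> (\<iota> c) = J +>\<^bsub>C\<^esub> \<theta> (\<gamma> c)"
    using coset \<psi> \<psi>c ring_hom_closed[OF i] ring_hom_closed[OF \<gamma>] by (simp add: \<phi>_def hom_modulo_def)
  have "\<theta> \<circ> \<gamma> \<in> ring_hom k C" by (rule ring_hom_trans[OF \<gamma> C(2)])
  then obtain \<chi> where \<chi>: "\<chi> \<in> ring_hom R C" "\<And>c. c \<in> carrier k ==> \<chi> (\<iota> c) = \<theta> (\<gamma> c)"
    "\<And>x. x \<in> carrier R ==> \<phi> x = J +>\<^bsub>C\<^esub> \<chi> x"
    using smooth[unfolded formally_smooth_algebra_def, rule_format, of C "\<theta> \<circ> \<gamma>" J \<phi>] C(1) J Jsq \<phi> \<phi>\<gamma>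
    by (auto simp: comp_def)
  define \<psi>' where "\<psi>' = (\<lambda>x. inv_into (carrier Q) \<theta> (\<chi> x))"
  have \<psi>': "\<psi>' x \<in> carrier Q" "\<theta> (\<psi>' x) = \<chi> x" if "x \<in> carrier R" for x
    using ring_hom_closed[OF \<chi>(1) that] by (auto simp: \<psi>'_def C(3) f_inv_into_f intro: inv_into_into)
  have "hom_modulo R Q k \<iota> \<gamma> \<pi> N' \<psi>'"
    unfolding hom_modulo_def
  proof (intro conjI ballI)
    show "\<psi>' \<in> carrier R \<rightarrow> carrier Q" using \<psi>' by auto
    show "\<psi>' (x \<oplus>\<^bsub>R\<^esub> y) \<ominus>\<^bsub>Q\<^esub> (\<psi>' x \<oplus>\<^bsub>Q\<^esub> \<psi>' y) \<in> N'" if "x \<in> carrier R" "y \<in> carrier R" for x y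
      using that \<psi>' \<chi>(1) by (subst \<theta>eq[symmetric]) (auto simp: ring_hom_add)
    show "\<psi>' (x \<otimes>\<^bsub>R\<^esub> y) \<ominus>\<^bsub>Q\<^esub> \<psi>' x \<otimes>\<^bsub>Q\<^esub> \<psi>' y \<in> N'" if "x \<in> carrier R" "y \<in> carrier R" for x y
      using that \<psi>' \<chi>(1) by (subst \<theta>eq[symmetric]) (auto simp: ring_hom_mult)
    show "\<psi>' \<one>\<^bsub>R\<^esub> \<ominus>\<^bsub>Q\<^esub> \<one>\<^bsub>Q\<^esub> \<in> N'" using \<psi>' \<chi>(1) by (subst \<theta>eq[symmetric]) (auto simp: ring_hom_one)
    show "\<psi>' (\<iota> c) \<ominus>\<^bsub>Q\<^esub> \<gamma> c \<in> N'" if "c \<in> carrier k" for c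
      using that \<psi>' \<chi>(2) ring_hom_closed[OF i] ring_hom_closed[OF \<gamma>] by (subst \<theta>eq[symmetric]) auto
    fix x assume x: "x \<in> carrier R"
    have "\<psi> x \<ominus>\<^bsub>Q\<^esub> \<psi>' x \<in> N"
      using \<chi>(3)[OF x] coset[of "\<psi> x" "\<psi>' x"] \<psi>' \<psi>c x by (simp add: \<phi>_def)
    then have "\<pi> (\<psi> x) \<ominus>\<^bsub>R\<^esub> \<pi> (\<psi>' x) = \<zero>\<^bsub>R\<^esub>"
      using ker[of "\<psi> x \<ominus>\<^bsub>Q\<^esub> \<psi>' x"] \<psi>' \<psi>c x by (simp add: Q.minus_eq R.minus_eq)
    moreover have "\<pi> (\<psi> x) = x" using \<psi> x by (simp add: hom_modulo_def)
    ultimately show "\<pi> (\<psi>' x) = x" using x \<psi>' by (simp add: R.r_right_minus_eq)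
  qed
  then show ?thesis by blast
qed

lemma (in cring) colon_ideal:
  assumes "ideal N R" "y \<in> carrier R"
  shows "ideal {x \<in> carrier R. x \<otimes> y \<in> N} R"
proof (rule idealI)
  interpret N: ideal N R by (rule assms)
  show "subgroup {x \<in> carrier R. x \<otimes> y \<in> N} (add_monoid R)"
    by (rule add.subgroupI) (auto simp: assms l_minus l_distr intro!: exI[of _ \<zero>])
  show "x \<otimes> a \<in> {x \<in> carrier R. x \<otimes> y \<in> N}" if "a \<in> {x \<in> carrier R. x \<otimes> y \<in> N}" "x \<in> carrier R" for a x
    using that assms(2) N.I_l_closed[of "a \<otimes> y" x] by (auto simp: m_assoc)
  show "a \<otimes> x \<in> {x \<in> carrier R. x \<otimes> y \<in> N}" if "a \<in> {x \<in> carrier R. x \<otimes> y \<in> N}" "x \<in> carrier R" for a x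
    using that assms(2) N.I_l_closed[of "a \<otimes> y" x] by (auto simp: m_ac)
qed (rule ring_axioms)

lemma (in cring) genideal_mult:
  assumes N: "ideal N R" and AB: "A \<subseteq> carrier R" "B \<subseteq> carrier R"
    and ab: "\<And>a b. a \<in> A ==> b \<in> B ==> a \<otimes> b \<in> N"
    and xy: "x \<in> Idl A" "y \<in> Idl B"
  shows "x \<otimes> y \<in> N"
proof -
  note Bc = ideal.Icarr[OF genideal_ideal[OF AB(2)]]
  have "a \<otimes> y \<in> N" if a: "a \<in> A" for a
  proof -
    have ac: "a \<in> carrier R" using a AB by blast
    have "Idl B \<subseteq> {x \<in> carrier R. x \<otimes> a \<in> N}"
    proof (intro genideal_minimal colon_ideal N ac subsetI CollectI conjI)
      fix b assume b: "b \<in> B"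
      then show bc: "b \<in> carrier R" using AB by blast
      show "b \<otimes> a \<in> N" using ab[OF a b] m_comm[OF ac bc] by simp
    qed
    then have "y \<otimes> a \<in> N" using xy(2) by blast
    then show ?thesis using m_comm[OF ac Bc[OF xy(2)]] by simp
  qed
  then have "Idl A \<subseteq> {x \<in> carrier R. x \<otimes> y \<in> N}"
    using AB Bc[OF xy(2)] by (intro genideal_minimal colon_ideal N) auto
  then show ?thesis using xy(1) by auto
qed

text \<open>With \<open>u\<^sup>p = 0\<close>, the ideals generated by \<open>U\<close> and \<open>u\<^sup>m\<close> decrease to the one generated by \<open>U\<close>, and
  the square of each lies in the next one; so the lifting step applies \<open>p\<close> times.\<close>

lemma hom_modulo_remove_generator:
  fixes Q :: "'a list ring" and R :: "'a ring"
  assumes smooth: "formally_smooth_algebra k R \<iota>" and i: "\<iota> \<in> ring_hom k R"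
    and R: "cring R" and Q: "cring Q" and \<gamma>: "\<gamma> \<in> ring_hom k Q" and \<pi>: "\<pi> \<in> ring_hom Q R"
    and U: "insert u U \<subseteq> carrier Q" "\<And>v. v \<in> insert u U ==> \<pi> v = \<zero>\<^bsub>R\<^esub>"
    and nil: "u [^]\<^bsub>Q\<^esub> (p::nat) = \<zero>\<^bsub>Q\<^esub>"
    and \<psi>: "hom_modulo R Q k \<iota> \<gamma> \<pi> (Idl\<^bsub>Q\<^esub> (insert u U)) \<psi>"
  shows "\<exists>\<psi>'. hom_modulo R Q k \<iota> \<gamma> \<pi> (Idl\<^bsub>Q\<^esub> U) \<psi>'"
proof -
  interpret Q: cring Q by (rule Q)
  interpret R: cring R by (rule R)
  interpret pi: ring_hom_cring Q R \<pi> by (intro ring_hom_cringI Q R \<pi>)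
  define N where "N = (\<lambda>m. Idl\<^bsub>Q\<^esub> (insert (u [^]\<^bsub>Q\<^esub> Suc m) U))"
  have u: "u \<in> carrier Q" using U by auto
  have gen: "insert (u [^]\<^bsub>Q\<^esub> Suc m) U \<subseteq> carrier Q" for m using U by auto
  have N: "ideal (N m) Q" for m unfolding N_def by (rule Q.genideal_ideal[OF gen])
  have self: "insert (u [^]\<^bsub>Q\<^esub> Suc m) U \<subseteq> N m" for m unfolding N_def by (rule Q.genideal_self[OF gen])
  have ker: "\<pi> v = \<zero>\<^bsub>R\<^esub>" if "v \<in> N m" for v m
  proof -
    have "ideal (a_kernel Q R \<pi>) Q" by (rule ring_hom_ring.kernel_is_ideal) (intro ring_hom_ringI2 Q.ring_axioms R.ring_axioms \<pi>)
    moreover have "insert (u [^]\<^bsub>Q\<^esub> Suc m) U \<subseteq> a_kernel Q R \<pi>"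
    proof
      fix v assume "v \<in> insert (u [^]\<^bsub>Q\<^esub> Suc m) U"
      then consider "v = u [^]\<^bsub>Q\<^esub> Suc m" | "v \<in> U" by blast
      then show "v \<in> a_kernel Q R \<pi>"
      proof cases
        case 1
        have "\<pi> u = \<zero>\<^bsub>R\<^esub>" by (rule U(2)) simp
        then have "\<pi> v = \<zero>\<^bsub>R\<^esub>" unfolding 1 using u by simp
        moreover have "v \<in> carrier Q" unfolding 1 using u by simp
        ultimately show ?thesis unfolding a_kernel_def' by blast
      next
        case 2
        then have "\<pi> v = \<zero>\<^bsub>R\<^esub>" "v \<in> carrier Q" using U(1) U(2)[of v] by blast+
        then show ?thesis unfolding a_kernel_def' by blast
      qed
    qed
    ultimately have "N m \<subseteq> a_kernel Q R \<pi>" unfolding N_def by (rule Q.genideal_minimal)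
    then have "v \<in> a_kernel Q R \<pi>" using \<open>v \<in> N m\<close> by blast
    then show ?thesis unfolding a_kernel_def' by blast
  qed
  have "\<exists>\<psi>'. hom_modulo R Q k \<iota> \<gamma> \<pi> (N m) \<psi>'" for m
  proof (induction m)
    case 0
    have "u [^]\<^bsub>Q\<^esub> Suc 0 = u" using u by simp
    then show ?case using \<psi> unfolding N_def by metis
  next
    case (Suc m)
    then obtain \<chi> where \<chi>: "hom_modulo R Q k \<iota> \<gamma> \<pi> (N m) \<chi>" by blast
    show ?case
    proof (rule lift_hom_modulo[OF smooth i R Q \<gamma> \<pi> N N _ ker _ \<chi>])
      have "u [^]\<^bsub>Q\<^esub> Suc (Suc m) = u \<otimes>\<^bsub>Q\<^esub> u [^]\<^bsub>Q\<^esub> Suc m" using u by (simp add: Q.m_ac)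
      also have "\<dots> \<in> N m" using self[of m] u by (intro ideal.I_l_closed[OF N]) auto
      finally show "N (Suc m) \<subseteq> N m"
        using self[of m] Q.genideal_minimal[OF N, of "insert (u [^]\<^bsub>Q\<^esub> Suc (Suc m)) U" m] unfolding N_def by blast
      fix v w assume vw: "v \<in> N m" "w \<in> N m"
      show "v \<otimes>\<^bsub>Q\<^esub> w \<in> N (Suc m)"
      proof (rule Q.genideal_mult[OF N gen gen _ vw[unfolded N_def]])
        fix a b assume ab: "a \<in> insert (u [^]\<^bsub>Q\<^esub> Suc m) U" "b \<in> insert (u [^]\<^bsub>Q\<^esub> Suc m) U"
        have abc: "a \<in> carrier Q" "b \<in> carrier Q" using ab gen by blast+
        consider "a \<in> U" | "b \<in> U" | "a = u [^]\<^bsub>Q\<^esub> Suc m" "b = u [^]\<^bsub>Q\<^esub> Suc m" using ab by auto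
        then show "a \<otimes>\<^bsub>Q\<^esub> b \<in> N (Suc m)"
        proof cases
          case 1
          then show ?thesis using self[of "Suc m"] abc by (intro ideal.I_r_closed[OF N]) auto
        next
          case 2
          then show ?thesis using self[of "Suc m"] abc by (intro ideal.I_l_closed[OF N]) auto
        next
          case 3
          have "a \<otimes>\<^bsub>Q\<^esub> b = u [^]\<^bsub>Q\<^esub> m \<otimes>\<^bsub>Q\<^esub> u [^]\<^bsub>Q\<^esub> Suc (Suc m)" using u by (simp add: 3 Q.m_ac)
          also have "\<dots> \<in> N (Suc m)"
            using self[of "Suc m"] u by (intro ideal.I_l_closed[OF N]) auto
          finally show ?thesis .
        qed
      qed
    qed
  qed
  then obtain \<chi> where \<chi>: "hom_modulo R Q k \<iota> \<gamma> \<pi> (N p) \<chi>" by blast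
  have UQ: "U \<subseteq> carrier Q" using U by auto
  note IU = Q.genideal_ideal[OF UQ]
  have "N p \<subseteq> Idl\<^bsub>Q\<^esub> U"
    unfolding N_def using nil u Q.genideal_self[OF UQ] additive_subgroup.zero_closed[OF ideal.axioms(1)[OF IU]]
    by (intro Q.genideal_minimal IU) auto
  then show ?thesis using \<chi> unfolding hom_modulo_def by blast
qed

text \<open>\<open>R\<close> is a direct summand of a free module over its subring of \<open>p\<close>-th powers: the \<open>\<sigma> i\<close> are
  \<open>p\<close>-th roots of coordinates (Cartier operators).\<close>

definition frobenius_dual_basis ::
  "('a, 'y) ring_scheme => nat => nat => (nat => 'a) => (nat => 'a => 'a) => bool" where
  "frobenius_dual_basis R p n x \<sigma> \<longleftrightarrow>
     (\<forall>i<n. x i \<in> carrier R) \<and> (\<forall>i<n. \<forall>s\<in>carrier R. \<sigma> i s \<in> carrier R) \<and>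
     (\<forall>i<n. \<forall>s\<in>carrier R. \<forall>t\<in>carrier R. \<sigma> i (s \<oplus>\<^bsub>R\<^esub> t) = \<sigma> i s \<oplus>\<^bsub>R\<^esub> \<sigma> i t) \<and>
     (\<forall>i<n. \<forall>r\<in>carrier R. \<forall>s\<in>carrier R. \<sigma> i (r [^]\<^bsub>R\<^esub> p \<otimes>\<^bsub>R\<^esub> s) = r \<otimes>\<^bsub>R\<^esub> \<sigma> i s) \<and>
     (\<forall>s\<in>carrier R. s = (\<Oplus>\<^bsub>R\<^esub>i\<in>{..<n}. \<sigma> i s [^]\<^bsub>R\<^esub> p \<otimes>\<^bsub>R\<^esub> x i))"

lemma perfect_field_root_hom:
  assumes k: "perfect_field_of_char k p" and h: "h \<in> ring_hom k Q"
  obtains r where "\<And>c. c \<in> carrier k ==> r c \<in> carrier k \<and> r c [^]\<^bsub>k\<^esub> p = c" "(\<lambda>c. h (r c)) \<in> ring_hom k Q"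
proof -
  interpret k: cring_char k p by (rule perfect_field_cring_char[OF k])
  interpret k: field k by (rule perfect_field_cring_char[OF k])
  have inj: "c = d" if "c \<in> carrier k" "d \<in> carrier k" "c [^]\<^bsub>k\<^esub> p = d [^]\<^bsub>k\<^esub> p" for c d
  proof -
    have "(c \<ominus>\<^bsub>k\<^esub> d) [^]\<^bsub>k\<^esub> p = \<zero>\<^bsub>k\<^esub>"
      using k.frob_diff[of c d 1] that by (simp add: k.minus_eq k.r_neg)
    then have "c \<ominus>\<^bsub>k\<^esub> d = \<zero>\<^bsub>k\<^esub>"
    proof -
      have "c \<ominus>\<^bsub>k\<^esub> d \<in> carrier k" using that by simp
      then have "z = \<zero>\<^bsub>k\<^esub>" if "z = c \<ominus>\<^bsub>k\<^esub> d" "z [^]\<^bsub>k\<^esub> m = \<zero>\<^bsub>k\<^esub>" for z and m :: nat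
        using that by (induction m) (auto simp: k.integral_iff)
      then show ?thesis using \<open>(c \<ominus>\<^bsub>k\<^esub> d) [^]\<^bsub>k\<^esub> p = \<zero>\<^bsub>k\<^esub>\<close> by blast
    qed
    then show ?thesis using that by simp
  qed
  have "\<forall>c\<in>carrier k. \<exists>y\<in>carrier k. y [^]\<^bsub>k\<^esub> p = c" using k by (simp add: perfect_field_of_char_def)
  then obtain r where r: "\<And>c. c \<in> carrier k ==> r c \<in> carrier k \<and> r c [^]\<^bsub>k\<^esub> p = c" by metis
  have "r \<in> ring_hom k k"
  proof (rule ring_hom_memI)
    fix c d assume cd: "c \<in> carrier k" "d \<in> carrier k"
    note rs = r[OF cd(1)] r[OF cd(2)] r[OF k.m_closed[OF cd]] r[OF k.a_closed[OF cd]]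
    show "r (c \<otimes>\<^bsub>k\<^esub> d) = r c \<otimes>\<^bsub>k\<^esub> r d"
      by (rule inj) (use rs in \<open>simp_all add: k.nat_pow_distrib\<close>)
    show "r (c \<oplus>\<^bsub>k\<^esub> d) = r c \<oplus>\<^bsub>k\<^esub> r d"
      by (rule inj) (use rs k.frob_add[of "r c" "r d" 1] in simp_all)
  next
    show "r \<one>\<^bsub>k\<^esub> = \<one>\<^bsub>k\<^esub>" by (rule inj) (use r[of "\<one>\<^bsub>k\<^esub>"] in simp_all)
  qed (use r in blast)
  from ring_hom_trans[OF this h] r that show ?thesis by (auto simp: comp_def)
qed

text \<open>Cover \<open>R\<close> by \<open>Q\<close> such that \<open>\<pi>\<close> hits all generators, hence is surjective (\<open>k\<close> is perfect). The
  kernel of \<open>\<pi>\<close> is finitely generated, and its elements satisfy \<open>u\<^sup>p = j (\<pi> u) = 0\<close>, so by smoothness \<open>\<pi>\<close>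
  has a section \<open>\<psi>\<close> that is a ring homomorphism. Then \<open>\<psi> (t\<^sup>p s) = j t \<cdot> \<psi> s\<close>, and the dual basis of \<open>Q\<close>
  pulls back along \<open>\<psi>\<close>.\<close>

lemma smooth_frobenius_dual_basis:
  fixes R :: "'a ring" and k :: "'k ring"
  assumes k: "perfect_field_of_char k p" and smooth: "smooth_algebra k R \<iota>" and nontriv: "\<zero>\<^bsub>R\<^esub> \<noteq> \<one>\<^bsub>R\<^esub>"
  obtains n x \<sigma> where "frobenius_dual_basis R p n x \<sigma>"
proof -
  have R: "cring R" and i: "\<iota> \<in> ring_hom k R" and fs: "formally_smooth_algebra k R \<iota>"
    using smooth by (auto simp: smooth_algebra_def)
  interpret k: cring_char k p by (rule perfect_field_cring_char[OF k])
  interpret R: cring_char R p by (rule k.cring_char_hom[OF R i])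
  interpret i: ring_hom_cring k R \<iota> by (intro ring_hom_cringI k.is_cring R i)
  obtain X where X: "finite X" "X \<subseteq> carrier R" "generate_ring R (\<iota> ` carrier k \<union> X) = carrier R"
    using smooth by (auto simp: smooth_algebra_def finite_type_algebra_def)
  obtain Q :: "'a list ring" and j \<pi> n b \<kappa> where cover: "frobenius_cover R p Q j \<pi>"
    and dual: "dual_basis R Q j n b \<kappa>" and X\<pi>: "X \<subseteq> \<pi> ` carrier Q"
    using R.exists_frobenius_cover[OF X(1,2) nontriv] by blast
  note C = frobenius_coverD[OF cover] and D = dual_basisD[OF dual]
  interpret Q: cring_char Q p by (rule R.cring_char_hom[OF C(1,2)])
  interpret j: ring_hom_cring R Q j by (intro ring_hom_cringI R Q.is_cring C)
  interpret pi: ring_hom_cring Q R \<pi> by (intro ring_hom_cringI R Q.is_cring C)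
  have jk: "j \<circ> \<iota> \<in> ring_hom k Q" by (rule ring_hom_trans[OF i C(2)])
  obtain r where r: "\<And>c. c \<in> carrier k ==> r c \<in> carrier k \<and> r c [^]\<^bsub>k\<^esub> p = c"
    and \<gamma>: "(\<lambda>c. (j \<circ> \<iota>) (r c)) \<in> ring_hom k Q"
    using perfect_field_root_hom[OF k jk] by metis
  define \<gamma> where "\<gamma> = (\<lambda>c. j (\<iota> (r c)))"
  have \<gamma>: "\<gamma> \<in> ring_hom k Q" using \<gamma> by (simp add: \<gamma>_def)
  have \<pi>\<gamma>: "\<pi> (\<gamma> c) = \<iota> c" if "c \<in> carrier k" for c
    using r[OF that] C(4)[of "\<iota> (r c)"] i.hom_pow[of "r c" p] by (simp add: \<gamma>_def)
  have surj: "\<exists>u\<in>carrier Q. \<pi> u = y" if "y \<in> carrier R" for y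
  proof -
    have "subring (\<pi> ` carrier Q) R"
      by (rule ring_hom_ring.img_is_subring[OF ring_hom_ringI2[OF Q.ring_axioms R.ring_axioms C(3)] Q.carrier_is_subring])
    moreover have "\<iota> ` carrier k \<union> X \<subseteq> \<pi> ` carrier Q"
    proof -
      have "\<iota> c \<in> \<pi> ` carrier Q" if "c \<in> carrier k" for c
        using \<pi>\<gamma>[OF that] ring_hom_closed[OF \<gamma> that] by (metis imageI)
      then show ?thesis using X\<pi> by blast
    qed
    ultimately have "carrier R \<subseteq> \<pi> ` carrier Q"
      using R.generate_ring_min_subring1[of "\<iota> ` carrier k \<union> X" "\<pi> ` carrier Q"] X by auto
    then show ?thesis using that by blast
  qed
  have hr: "ring_hom_ring Q R \<pi>" by (intro ring_hom_ringI2 Q.ring_axioms R.ring_axioms C)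
  have ker: "ideal (a_kernel Q R \<pi>) Q" by (rule ring_hom_ring.kernel_is_ideal[OF hr])
  obtain U where U: "finite U" "U \<subseteq> a_kernel Q R \<pi>" "a_kernel Q R \<pi> = Idl\<^bsub>Q\<^esub> U"
    using cring_noetherian_ideal[OF C(1) frobenius_cover_noetherian[OF perfect_field_cring_char(2)[OF k] i R X cover dual] ker]
    by blast
  have kerD: "u \<in> carrier Q" "\<pi> u = \<zero>\<^bsub>R\<^esub>" "u [^]\<^bsub>Q\<^esub> p = \<zero>\<^bsub>Q\<^esub>" if "u \<in> a_kernel Q R \<pi>" for u
  proof -
    show *: "u \<in> carrier Q" "\<pi> u = \<zero>\<^bsub>R\<^esub>" using that unfolding a_kernel_def' by blast+
    have "u [^]\<^bsub>Q\<^esub> p = j (\<pi> u)" by (rule C(5)[OF *(1), symmetric])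
    then show "u [^]\<^bsub>Q\<^esub> p = \<zero>\<^bsub>Q\<^esub>" unfolding *(2) by simp
  qed
  have kerI: "u \<in> a_kernel Q R \<pi>" if "u \<in> carrier Q" "\<pi> u = \<zero>\<^bsub>R\<^esub>" for u
    using that unfolding a_kernel_def' by blast
  obtain \<psi>0 where \<psi>0: "\<And>y. y \<in> carrier R ==> \<psi>0 y \<in> carrier Q \<and> \<pi> (\<psi>0 y) = y"
    using surj by metis
  have start: "hom_modulo R Q k \<iota> \<gamma> \<pi> (Idl\<^bsub>Q\<^esub> U) \<psi>0"
    unfolding hom_modulo_def U(3)[symmetric]
    using \<psi>0 ring_hom_closed[OF \<gamma>] \<pi>\<gamma>
    by (intro conjI ballI kerI) (auto simp: Q.minus_eq R.r_neg)
  have "\<exists>\<psi>. hom_modulo R Q k \<iota> \<gamma> \<pi> (Idl\<^bsub>Q\<^esub> {}) \<psi>"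
    using U(1,2) start
  proof (induction U arbitrary: \<psi>0)
    case (insert u U)
    have sub: "insert u U \<subseteq> carrier Q" "\<And>v. v \<in> insert u U ==> \<pi> v = \<zero>\<^bsub>R\<^esub>" "u [^]\<^bsub>Q\<^esub> p = \<zero>\<^bsub>Q\<^esub>"
      using insert.prems(1) kerD by blast+
    obtain \<psi>1 where "hom_modulo R Q k \<iota> \<gamma> \<pi> (Idl\<^bsub>Q\<^esub> U) \<psi>1"
      using hom_modulo_remove_generator[OF fs i R C(1) \<gamma> C(3) sub insert.prems(2)] by blast
    then show ?case using insert by blast
  qed blast
  moreover have "Idl\<^bsub>Q\<^esub> {} \<subseteq> {\<zero>\<^bsub>Q\<^esub>}" by (intro Q.genideal_minimal Q.zeroideal) auto
  ultimately obtain \<psi> where "hom_modulo R Q k \<iota> \<gamma> \<pi> {\<zero>\<^bsub>Q\<^esub>} \<psi>"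
    unfolding hom_modulo_def by blast
  then have \<psi>: "\<And>x. x \<in> carrier R ==> \<psi> x \<in> carrier Q" "\<And>x. x \<in> carrier R ==> \<pi> (\<psi> x) = x"
    "\<And>x y. x \<in> carrier R ==> y \<in> carrier R ==> \<psi> (x \<oplus>\<^bsub>R\<^esub> y) = \<psi> x \<oplus>\<^bsub>Q\<^esub> \<psi> y"
    "\<And>x y. x \<in> carrier R ==> y \<in> carrier R ==> \<psi> (x \<otimes>\<^bsub>R\<^esub> y) = \<psi> x \<otimes>\<^bsub>Q\<^esub> \<psi> y"
    "\<psi> \<one>\<^bsub>R\<^esub> = \<one>\<^bsub>Q\<^esub>"
    unfolding hom_modulo_def by (auto simp: Pi_def)
  have \<psi>hom: "\<psi> \<in> ring_hom R Q" using \<psi> by (intro ring_hom_memI) auto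
  interpret psi: ring_hom_cring R Q \<psi> by (intro ring_hom_cringI R Q.is_cring \<psi>hom)
  have "frobenius_dual_basis R p n (\<lambda>i. \<pi> (b i)) (\<lambda>i s. \<kappa> i (\<psi> s))"
    unfolding frobenius_dual_basis_def
  proof (intro conjI allI impI ballI)
    fix i assume i: "i < n"
    show "\<pi> (b i) \<in> carrier R" using D(1)[OF i] by simp
    fix s assume s: "s \<in> carrier R"
    show "\<kappa> i (\<psi> s) \<in> carrier R" using D(2)[OF i] s by simp
    show "\<kappa> i (\<psi> (s \<oplus>\<^bsub>R\<^esub> t)) = \<kappa> i (\<psi> s) \<oplus>\<^bsub>R\<^esub> \<kappa> i (\<psi> t)" if "t \<in> carrier R" for t
      using D(3)[OF i] s that by simp
    fix t assume t: "t \<in> carrier R"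
    have "\<psi> (t [^]\<^bsub>R\<^esub> p \<otimes>\<^bsub>R\<^esub> s) = j t \<otimes>\<^bsub>Q\<^esub> \<psi> s"
      using s t C(5)[of "\<psi> t"] \<psi>(2)[OF t] by simp
    then show "\<kappa> i (\<psi> (t [^]\<^bsub>R\<^esub> p \<otimes>\<^bsub>R\<^esub> s)) = t \<otimes>\<^bsub>R\<^esub> \<kappa> i (\<psi> s)" using D(4)[OF i t] s by simp
  next
    fix s assume s: "s \<in> carrier R"
    have "s = \<pi> (\<Oplus>\<^bsub>Q\<^esub>i\<in>{..<n}. j (\<kappa> i (\<psi> s)) \<otimes>\<^bsub>Q\<^esub> b i)" using D(5)[of "\<psi> s"] \<psi>(2)[OF s] s by simp
    also have "\<dots> = (\<Oplus>\<^bsub>R\<^esub>i\<in>{..<n}. \<pi> (j (\<kappa> i (\<psi> s)) \<otimes>\<^bsub>Q\<^esub> b i))"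
      using D(1,2) s by (subst pi.hom_finsum) (auto simp: comp_def)
    also have "\<dots> = (\<Oplus>\<^bsub>R\<^esub>i\<in>{..<n}. \<kappa> i (\<psi> s) [^]\<^bsub>R\<^esub> p \<otimes>\<^bsub>R\<^esub> \<pi> (b i))"
      using D(1,2) s C(4) by (intro R.finsum_cong') auto
    finally show "s = (\<Oplus>\<^bsub>R\<^esub>i\<in>{..<n}. \<kappa> i (\<psi> s) [^]\<^bsub>R\<^esub> p \<otimes>\<^bsub>R\<^esub> \<pi> (b i))" .
  qed
  then show ?thesis using that by blast
qed

section \<open>Cartier operators and Frobenius roots of ideals\<close>

text \<open>The endomorphisms of \<open>S\<close> over its subring of \<open>p\<^sup>e\<close>-th powers; in the applications these are the
  differential operators of level \<open>e\<close>, written \<open>D\<^sub>e\<close> below.\<close>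

definition frob_linear_ops :: "('a, 'y) ring_scheme => nat => nat => ('a => 'a) set" where
  "frob_linear_ops S p e =
     {P \<in> carrier S \<rightarrow>\<^sub>E carrier S.
        (\<forall>x \<in> carrier S. \<forall>y \<in> carrier S. P (x \<oplus>\<^bsub>S\<^esub> y) = P x \<oplus>\<^bsub>S\<^esub> P y) \<and>
        (\<forall>a \<in> carrier S. \<forall>x \<in> carrier S. P (a [^]\<^bsub>S\<^esub> (p ^ e) \<otimes>\<^bsub>S\<^esub> x) = a [^]\<^bsub>S\<^esub> (p ^ e) \<otimes>\<^bsub>S\<^esub> P x)}"

lemma frob_linear_opsD:
  assumes "P \<in> frob_linear_ops S p e"
  shows "x \<in> carrier S ==> P x \<in> carrier S"
    "x \<in> carrier S ==> y \<in> carrier S ==> P (x \<oplus>\<^bsub>S\<^esub> y) = P x \<oplus>\<^bsub>S\<^esub> P y"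
    "a \<in> carrier S ==> x \<in> carrier S ==> P (a [^]\<^bsub>S\<^esub> (p ^ e) \<otimes>\<^bsub>S\<^esub> x) = a [^]\<^bsub>S\<^esub> (p ^ e) \<otimes>\<^bsub>S\<^esub> P x"
    "P \<in> carrier S \<rightarrow>\<^sub>E carrier S"
  using assms by (auto simp: frob_linear_ops_def)

lemma (in ideal) finsum_mem:
  assumes "\<And>i. i \<in> A ==> h i \<in> I"
  shows "(\<Oplus>i\<in>A. h i) \<in> I"
  using assms
proof (induction A rule: infinite_finite_induct)
  case (insert i A)
  then show ?case by (subst finsum_insert) (auto simp: Icarr)
qed auto

lemma (in cring) genideal_insert_decomp:
  assumes V: "insert v V \<subseteq> carrier R" and z: "z \<in> Idl (insert v V)"
  shows "\<exists>r\<in>carrier R. \<exists>w\<in>Idl V. z = r \<otimes> v \<oplus> w"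
proof -
  have v: "v \<in> carrier R" and Vc: "V \<subseteq> carrier R" using V by auto
  have "insert v V \<subseteq> PIdl v \<union> Idl V" using cgenideal_self[OF v] genideal_self[OF Vc] by blast
  also have "\<dots> \<subseteq> Idl (PIdl v \<union> Idl V)"
    using ideal.Icarr[OF cgenideal_ideal[OF v]] ideal.Icarr[OF genideal_ideal[OF Vc]] by (intro genideal_self) blast
  also have "\<dots> = PIdl v <+> Idl V" by (rule union_genideal[OF cgenideal_ideal[OF v] genideal_ideal[OF Vc]])
  finally have "Idl (insert v V) \<subseteq> PIdl v <+> Idl V"
    by (intro genideal_minimal add_ideals cgenideal_ideal genideal_ideal v Vc)
  from subsetD[OF this z] show ?thesis by (auto simp: set_add_def' cgenideal_def)
qed

text \<open>Nakayama's lemma for \<open>I = I\<^sup>2\<close>, removing generators one at a time: if \<open>(1 - e) I \<subseteq> (v, V)\<close>, then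
  \<open>(1 - e) v = a v + w\<close> with \<open>a \<in> I\<close> and \<open>w \<in> (V)\<close>, so that \<open>(1 - e - a) v \<in> (V)\<close>; replace \<open>1 - e\<close> by
  \<open>(1 - e - a) (1 - e)\<close>.\<close>

lemma (in cring) idempotent_ideal_unit:
  assumes I: "ideal I R" and U: "finite U" "U \<subseteq> I" "I = Idl U"
    and idem: "I \<subseteq> Idl {a \<otimes> b | a b. a \<in> I \<and> b \<in> I}"
  shows "\<exists>c\<in>I. \<forall>y\<in>I. c \<otimes> y = y"
proof -
  interpret I: ideal I R by (rule I)
  have step: "\<exists>c\<in>I. \<forall>y\<in>I. (\<one> \<ominus> c) \<otimes> y = \<zero>" if "finite V" "V \<subseteq> I" "\<exists>e\<in>I. \<forall>y\<in>I. (\<one> \<ominus> e) \<otimes> y \<in> Idl V" for V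
    using that
  proof (induction V)
    case empty
    have "Idl {} \<subseteq> {\<zero>}" by (intro genideal_minimal zeroideal) auto
    then show ?case using empty.prems by blast
  next
    case (insert v V)
    then obtain e where e: "e \<in> I" "\<And>y. y \<in> I ==> (\<one> \<ominus> e) \<otimes> y \<in> Idl (insert v V)" by blast
    have ec: "e \<in> carrier R" using e I.Icarr by blast
    have vI: "v \<in> I" and VI: "V \<subseteq> I" using insert.prems by auto
    have vc: "v \<in> carrier R" and Vc: "V \<subseteq> carrier R" using vI VI I.Icarr by auto
    interpret J: ideal "Idl V" R by (rule genideal_ideal[OF Vc])
    have dec: "\<exists>r\<in>carrier R. \<exists>w\<in>Idl V. (\<one> \<ominus> e) \<otimes> y = r \<otimes> v \<oplus> w" if "y \<in> I" for y
      using genideal_insert_decomp[OF _ e(2)[OF that]] vc Vc by blast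
    define T where "T = {y \<in> carrier R. \<exists>a\<in>I. \<exists>w\<in>Idl V. (\<one> \<ominus> e) \<otimes> y = a \<otimes> v \<oplus> w}"
    have "ideal T R"
    proof (rule ideal_of_closed)
      show "x \<otimes> a \<in> T" if "x \<in> carrier R" "a \<in> T" for a x
      proof -
        obtain r w where a: "a \<in> carrier R" "(\<one> \<ominus> e) \<otimes> a = r \<otimes> v \<oplus> w" "r \<in> I" "w \<in> Idl V"
          using \<open>a \<in> T\<close> by (auto simp: T_def)
        have "(\<one> \<ominus> e) \<otimes> (x \<otimes> a) = x \<otimes> ((\<one> \<ominus> e) \<otimes> a)" using a(1) \<open>x \<in> carrier R\<close> ec by algebra
        also have "\<dots> = (x \<otimes> r) \<otimes> v \<oplus> x \<otimes> w"
          unfolding a(2) using I.Icarr[OF a(3)] J.Icarr[OF a(4)] vc \<open>x \<in> carrier R\<close> by algebra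
        finally show ?thesis
          unfolding T_def using a(1) I.I_l_closed[OF a(3)] J.I_l_closed[OF a(4)] \<open>x \<in> carrier R\<close> by blast
      qed
      show "T \<subseteq> carrier R" by (auto simp: T_def)
      have "(\<one> \<ominus> e) \<otimes> \<zero> = \<zero> \<otimes> v \<oplus> \<zero>" using ec vc by simp
      then have "\<zero> \<in> T" unfolding T_def using I.zero_closed J.zero_closed by blast
      then show "T \<noteq> {}" by blast
      fix a b assume "a \<in> T" "b \<in> T"
      then obtain r w s u where a: "a \<in> carrier R" "(\<one> \<ominus> e) \<otimes> a = r \<otimes> v \<oplus> w" "r \<in> I" "w \<in> Idl V"
        and b: "b \<in> carrier R" "(\<one> \<ominus> e) \<otimes> b = s \<otimes> v \<oplus> u" "s \<in> I" "u \<in> Idl V"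
        by (auto simp: T_def)
      have "(\<one> \<ominus> e) \<otimes> (a \<oplus> b) = (\<one> \<ominus> e) \<otimes> a \<oplus> (\<one> \<ominus> e) \<otimes> b" using a(1) b(1) ec by algebra
      also have "\<dots> = (r \<oplus> s) \<otimes> v \<oplus> (w \<oplus> u)"
        unfolding a(2) b(2) using I.Icarr[OF a(3)] J.Icarr[OF a(4)] I.Icarr[OF b(3)] J.Icarr[OF b(4)] vc by algebra
      finally show "a \<oplus> b \<in> T"
        unfolding T_def using a(1) b(1) I.a_closed[OF a(3) b(3)] J.a_closed[OF a(4) b(4)] by blast
    qed
    moreover have "{a \<otimes> b | a b. a \<in> I \<and> b \<in> I} \<subseteq> T"
    proof clarify
      fix a b assume ab: "a \<in> I" "b \<in> I"
      obtain r w where d: "r \<in> carrier R" "w \<in> Idl V" "(\<one> \<ominus> e) \<otimes> b = r \<otimes> v \<oplus> w" using dec[OF ab(2)] by blast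
      have c: "a \<in> carrier R" "b \<in> carrier R" using ab I.Icarr by auto
      have "(\<one> \<ominus> e) \<otimes> (a \<otimes> b) = a \<otimes> ((\<one> \<ominus> e) \<otimes> b)" using c ec by algebra
      also have "\<dots> = (a \<otimes> r) \<otimes> v \<oplus> a \<otimes> w" unfolding d(3) using c d(1) J.Icarr[OF d(2)] vc by algebra
      finally show "a \<otimes> b \<in> T"
        unfolding T_def using c I.I_r_closed[OF ab(1) d(1)] J.I_l_closed[OF d(2) c(1)] by blast
    qed
    ultimately have "Idl {a \<otimes> b | a b. a \<in> I \<and> b \<in> I} \<subseteq> T" by (rule genideal_minimal)
    then have "v \<in> T" using idem vI by blast
    then obtain a w where a: "a \<in> I" "w \<in> Idl V" "(\<one> \<ominus> e) \<otimes> v = a \<otimes> v \<oplus> w" by (auto simp: T_def)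
    have ac: "a \<in> carrier R" and wc: "w \<in> carrier R" using a I.Icarr J.Icarr by auto
    have av: "(\<one> \<ominus> e \<ominus> a) \<otimes> v = w"
    proof -
      have "(\<one> \<ominus> e \<ominus> a) \<otimes> v = (\<one> \<ominus> e) \<otimes> v \<ominus> a \<otimes> v" using ec ac vc by algebra
      also have "\<dots> = w" unfolding a(3) using ac vc wc by algebra
      finally show ?thesis .
    qed
    define e' where "e' = \<one> \<ominus> (\<one> \<ominus> e \<ominus> a) \<otimes> (\<one> \<ominus> e)"
    have "e' = e \<oplus> (e \<oplus> a) \<otimes> (\<one> \<ominus> e)" unfolding e'_def using ec ac by algebra
    also have "\<dots> \<in> I" using e(1) a(1) ec by (intro I.a_closed I.I_r_closed) auto
    finally have e'I: "e' \<in> I" .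
    have "(\<one> \<ominus> e') \<otimes> y \<in> Idl V" if y: "y \<in> I" for y
    proof -
      obtain r u where d: "r \<in> carrier R" "u \<in> Idl V" "(\<one> \<ominus> e) \<otimes> y = r \<otimes> v \<oplus> u" using dec[OF y] by blast
      have "(\<one> \<ominus> e') \<otimes> y = (\<one> \<ominus> e \<ominus> a) \<otimes> ((\<one> \<ominus> e) \<otimes> y)"
        unfolding e'_def using ec ac I.Icarr[OF y] by algebra
      also have "\<dots> = r \<otimes> ((\<one> \<ominus> e \<ominus> a) \<otimes> v) \<oplus> (\<one> \<ominus> e \<ominus> a) \<otimes> u"
        unfolding d(3) using ec ac d(1) J.Icarr[OF d(2)] vc by algebra
      also have "\<dots> \<in> Idl V" unfolding av using a(2) d ec ac by (intro J.a_closed J.I_l_closed) auto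
      finally show ?thesis .
    qed
    then show ?case using insert.IH VI e'I by blast
  qed
  have "\<exists>e\<in>I. \<forall>y\<in>I. (\<one> \<ominus> e) \<otimes> y \<in> Idl U"
    using I.zero_closed I.Icarr by (intro bexI[of _ \<zero>]) (auto simp: U(3)[symmetric] minus_eq)
  then obtain c where c: "c \<in> I" "\<And>y. y \<in> I ==> (\<one> \<ominus> c) \<otimes> y = \<zero>"
    using step[OF U(1,2)] by metis
  have "c \<otimes> y = y" if y: "y \<in> I" for y
  proof -
    have yc: "y \<in> carrier R" "c \<in> carrier R" using y c(1) I.Icarr by auto
    have "(\<one> \<ominus> c) \<otimes> y = y \<ominus> c \<otimes> y" using yc by algebra
    then have "y \<ominus> c \<otimes> y = \<zero>" using c(2)[OF y] by simp
    then show ?thesis using yc r_right_minus_eq[of y "c \<otimes> y"] by simp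
  qed
  then show ?thesis using c(1) by blast
qed

primrec cartier_word :: "(nat => 'a => 'a) => nat list => 'a => 'a" where
  "cartier_word \<sigma> [] s = s"
| "cartier_word \<sigma> (a # A) s = cartier_word \<sigma> A (\<sigma> a s)"

definition index_words :: "nat => nat => nat list set" where
  "index_words n e = {A. length A = e \<and> set A \<subseteq> {..<n}}"

text \<open>The ideal \<open>(s)\<^bsup>[1/p^e]\<^esup>\<close> in terms of iterated Cartier operators (see \<open>frob_root_PIdl\<close>).\<close>

definition cartier_ideal :: "('a, 'y) ring_scheme => nat => (nat => 'a => 'a) => nat => 'a => 'a set" where
  "cartier_ideal R n \<sigma> e s = Idl\<^bsub>R\<^esub> ((\<lambda>A. cartier_word \<sigma> A s) ` index_words n e)"

locale frobenius_basis = cring_char +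
  fixes n :: nat and b :: "nat => 'a" and \<sigma> :: "nat => 'a => 'a"
  assumes basis: "frobenius_dual_basis R p n b \<sigma>"
begin

lemma b_closed: "i < n ==> b i \<in> carrier R"
  and sigma_closed: "i < n ==> s \<in> carrier R ==> \<sigma> i s \<in> carrier R"
  and sigma_add: "i < n ==> s \<in> carrier R ==> t \<in> carrier R ==> \<sigma> i (s \<oplus> t) = \<sigma> i s \<oplus> \<sigma> i t"
  and sigma_frob: "i < n ==> r \<in> carrier R ==> s \<in> carrier R ==> \<sigma> i (r [^] p \<otimes> s) = r \<otimes> \<sigma> i s"
  using basis unfolding frobenius_dual_basis_def by blast+

lemma sigma_expand: "s \<in> carrier R ==> s = (\<Oplus>i\<in>{..<n}. \<sigma> i s [^] p \<otimes> b i)"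
  using basis unfolding frobenius_dual_basis_def by (elim conjE) (rule bspec)

abbreviation "W \<equiv> index_words n"
abbreviation "sw \<equiv> cartier_word \<sigma>"
abbreviation "C \<equiv> cartier_ideal R n \<sigma>"
abbreviation "FP \<equiv> frob_power R p"

lemma W_0: "W 0 = {[]}" by (auto simp: index_words_def)

lemma W_Suc: "a # A \<in> W (Suc e) \<longleftrightarrow> a < n \<and> A \<in> W e"
  by (auto simp: index_words_def)

lemma W_SucE: "A \<in> W (Suc e) ==> \<exists>a A'. A = a # A' \<and> a < n \<and> A' \<in> W e"
  by (cases A) (auto simp: index_words_def)

lemma W_finite: "finite (W e)"
proof -
  have "W e = {A. set A \<subseteq> {..<n} \<and> length A = e}" by (auto simp: index_words_def)
  then show ?thesis using finite_lists_length_eq[of "{..<n}" e] by simp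
qed

lemma sw_closed: "A \<in> W e ==> s \<in> carrier R ==> sw A s \<in> carrier R"
proof (induction e arbitrary: A s)
  case (Suc e)
  then obtain a A' where A: "A = a # A'" "a < n" "A' \<in> W e" using W_SucE by blast
  show ?case unfolding A(1) using Suc.IH[OF A(3)] Suc.prems(2) A(2) by (simp add: sigma_closed)
qed (simp add: W_0)

lemma sw_add: "A \<in> W e ==> s \<in> carrier R ==> t \<in> carrier R ==> sw A (s \<oplus> t) = sw A s \<oplus> sw A t"
proof (induction e arbitrary: A s t)
  case (Suc e)
  then obtain a A' where A: "A = a # A'" "a < n" "A' \<in> W e" using W_SucE by blast
  show ?case unfolding A(1) using Suc.IH[OF A(3)] Suc.prems(2,3) A(2) by (simp add: sigma_closed sigma_add)
qed (simp add: W_0)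

lemma frob_Suc: "r \<in> carrier R ==> r [^] (p ^ Suc e) = (r [^] (p ^ e)) [^] p"
  by (simp add: nat_pow_pow mult.commute)

lemma sw_frob: "A \<in> W e ==> r \<in> carrier R ==> s \<in> carrier R ==> sw A (r [^] (p ^ e) \<otimes> s) = r \<otimes> sw A s"
proof (induction e arbitrary: A s)
  case (Suc e)
  then obtain a A' where A: "A = a # A'" "a < n" "A' \<in> W e" using W_SucE by blast
  show ?case unfolding A(1) using Suc.IH[OF A(3) Suc.prems(2), of "\<sigma> a s"] Suc.prems(2,3) A(2)
    by (simp add: sigma_frob sigma_closed nat_pow_closed frob_Suc del: power_Suc)
qed (auto simp: W_0)

lemma FP_ideal: "ideal I R ==> ideal (FP e I) R"
  unfolding frob_power_def by (intro genideal_ideal) (auto dest: ideal.Icarr)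

lemma FP_self: "ideal I R ==> i \<in> I ==> i [^] (p ^ e) \<in> FP e I"
  unfolding frob_power_def
  by (rule subsetD[OF genideal_self]) (auto dest: ideal.Icarr)

lemma FP_minimal: "ideal J R ==> (\<And>i. i \<in> I ==> i [^] (p ^ e) \<in> J) ==> FP e I \<subseteq> J"
  unfolding frob_power_def by (intro genideal_minimal) auto

lemma FP_carrier: "ideal I R ==> s \<in> FP e I ==> s \<in> carrier R"
  by (rule ideal.Icarr[OF FP_ideal])

lemma frob_preimage_ideal:
  assumes "ideal J R"
  shows "ideal {y \<in> carrier R. y [^] (p ^ e) \<in> J} R"
proof -
  interpret J: ideal J R by (rule assms)
  show ?thesis
  proof (rule idealI)
    show "subgroup {y \<in> carrier R. y [^] (p ^ e) \<in> J} (add_monoid R)"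
      by (rule add.subgroupI) (auto simp: frob_add frob_minus intro!: exI[of _ \<zero>] simp: frob_zero)
  next
    fix a x assume a: "a \<in> {y \<in> carrier R. y [^] (p ^ e) \<in> J}" and x: "x \<in> carrier R"
    show "x \<otimes> a \<in> {y \<in> carrier R. y [^] (p ^ e) \<in> J}" using a x J.I_l_closed by (simp add: nat_pow_distrib)
    show "a \<otimes> x \<in> {y \<in> carrier R. y [^] (p ^ e) \<in> J}" using a x J.I_r_closed by (simp add: nat_pow_distrib)
  qed (rule ring_axioms)
qed

lemma FP_frob_Suc:
  assumes I: "ideal I R" and y: "y \<in> FP e I"
  shows "y [^] p \<in> FP (Suc e) I"
proof -
  have "FP e I \<subseteq> {y \<in> carrier R. y [^] (p ^ 1) \<in> FP (Suc e) I}"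
  proof (rule FP_minimal[OF frob_preimage_ideal[OF FP_ideal[OF I]]])
    fix i assume i: "i \<in> I"
    then have ic: "i \<in> carrier R" using ideal.Icarr[OF I] by blast
    show "i [^] (p ^ e) \<in> {y \<in> carrier R. y [^] (p ^ 1) \<in> FP (Suc e) I}"
      using FP_self[OF I i, of "Suc e"] ic frob_Suc[OF ic, of e] by (simp del: power_Suc)
  qed
  then show ?thesis using y by auto
qed

text \<open>The multiples of the \<open>i\<^bsup>p^e\<^esup>\<close> generate \<open>I\<^bsup>[p^e]\<^esup>\<close> additively.\<close>

lemma FP_linear:
  assumes I: "ideal I R" and J: "ideal J R" and s: "s \<in> FP e I"
    and cl: "\<And>x. x \<in> carrier R ==> P x \<in> carrier R"
    and add: "\<And>x y. x \<in> carrier R ==> y \<in> carrier R ==> P (x \<oplus> y) = P x \<oplus> P y"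
    and gen: "\<And>i r. i \<in> I ==> r \<in> carrier R ==> P (i [^] (p ^ e) \<otimes> r) \<in> J"
  shows "P s \<in> J"
proof -
  interpret J: ideal J R by (rule J)
  have P0: "P \<zero> = \<zero>" using add[of \<zero> \<zero>] cl[of \<zero>] by (simp add: add.l_cancel_one)
  have Pneg: "P (\<ominus> x) = \<ominus> P x" if "x \<in> carrier R" for x
    using add[of "\<ominus> x" x] that cl by (simp add: l_neg P0 sum_zero_eq_neg)
  define T where "T = {s \<in> carrier R. \<forall>r\<in>carrier R. P (s \<otimes> r) \<in> J}"
  have "ideal T R"
  proof (rule idealI)
    show "subgroup T (add_monoid R)"
    proof (rule add.subgroupI)
      show "T \<subseteq> carrier R" by (auto simp: T_def)
      show "T \<noteq> {}" using P0 by (auto simp: T_def intro!: exI[of _ \<zero>])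
      show "\<ominus> a \<in> T" if "a \<in> T" for a using that Pneg by (auto simp: T_def l_minus)
      show "a \<oplus> b \<in> T" if "a \<in> T" "b \<in> T" for a b using that add by (auto simp: T_def l_distr)
    qed
    show "x \<otimes> a \<in> T" "a \<otimes> x \<in> T" if "a \<in> T" "x \<in> carrier R" for a x
      using that by (auto simp: T_def m_assoc m_comm[of x a])
  qed (rule ring_axioms)
  then have "FP e I \<subseteq> T"
    using gen ideal.Icarr[OF I] by (intro FP_minimal) (auto simp: T_def)
  then have "P (s \<otimes> \<one>) \<in> J" using s unfolding T_def by blast
  then show ?thesis using FP_carrier[OF I s] by simp
qed

text \<open>Membership in a Frobenius power is tested by coordinates with respect to the \<open>p\<^sup>e\<close>-th powers.\<close>

lemma FP_iff:
  assumes I: "ideal I R" and s: "s \<in> carrier R"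
  shows "s \<in> FP e I \<longleftrightarrow> (\<forall>A\<in>W e. sw A s \<in> I)"
proof
  assume sI: "s \<in> FP e I"
  show "\<forall>A\<in>W e. sw A s \<in> I"
  proof
    fix A assume A: "A \<in> W e"
    show "sw A s \<in> I"
      by (rule FP_linear[OF I I sI])
        (use A in \<open>auto simp: sw_closed sw_add sw_frob ideal.Icarr[OF I] intro: ideal.I_r_closed[OF I]\<close>)
  qed
next
  show "s \<in> FP e I" if "\<forall>A\<in>W e. sw A s \<in> I"
    using that s
  proof (induction e arbitrary: s)
    case 0
    then show ?case using FP_self[OF I, of s 0] by (simp add: W_0)
  next
    case (Suc e)
    interpret F: ideal "FP (Suc e) I" R by (rule FP_ideal[OF I])
    have "\<sigma> a s [^] p \<otimes> b a \<in> FP (Suc e) I" if a: "a < n" for a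
    proof -
      have "\<sigma> a s \<in> FP e I" using Suc a by (intro Suc.IH) (auto simp: W_Suc sigma_closed dest: bspec[of _ _ "a # _"])
      then show ?thesis using FP_frob_Suc[OF I] a b_closed F.I_r_closed by blast
    qed
    then have "(\<Oplus>i\<in>{..<n}. \<sigma> i s [^] p \<otimes> b i) \<in> FP (Suc e) I" by (intro F.finsum_mem) auto
    then show ?case using sigma_expand[OF Suc.prems(2)] by simp
  qed
qed

lemma C_gens: "s \<in> carrier R ==> (\<lambda>A. sw A s) ` W e \<subseteq> carrier R"
  using sw_closed by blast

lemma C_ideal: "s \<in> carrier R ==> ideal (C e s) R"
  unfolding cartier_ideal_def by (rule genideal_ideal[OF C_gens])

lemma C_subset_iff:
  assumes I: "ideal I R" and s: "s \<in> carrier R"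
  shows "C e s \<subseteq> I \<longleftrightarrow> s \<in> FP e I"
  unfolding FP_iff[OF I s] cartier_ideal_def using Idl_subset_ideal[OF I C_gens[OF s, of e]] by auto

lemma in_FP_C: "s \<in> carrier R ==> s \<in> FP e (C e s)"
  using C_subset_iff[OF C_ideal] by blast

lemma frob_root_PIdl:
  assumes s: "s \<in> carrier R"
  shows "frob_root R p e (PIdl s) = C e s"
proof -
  have "PIdl s \<subseteq> FP e I \<longleftrightarrow> C e s \<subseteq> I" if I: "ideal I R" for I
    using C_subset_iff[OF I s] cgenideal_minimal[OF FP_ideal[OF I]] cgenideal_self[OF s] by blast
  then have "frob_root R p e (PIdl s) = \<Inter>{I. ideal I R \<and> C e s \<subseteq> I}"
    unfolding frob_root_def by blast
  then show ?thesis using C_ideal[OF s] by blast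
qed

lemma C_mult_subset:
  assumes "s \<in> carrier R" "r \<in> carrier R"
  shows "C e (s \<otimes> r) \<subseteq> C e s"
  using assms C_subset_iff[OF C_ideal] ideal.I_r_closed[OF FP_ideal[OF C_ideal]] in_FP_C by simp

text \<open>Flatness of Frobenius: \<open>\<sigma> a\<close> takes \<open>s\<^sup>p\<close> to \<open>s \<sigma>\<^sub>a(1)\<close>, and \<open>1\<close> is a combination of the \<open>\<sigma>\<^sub>a(1)\<close>.\<close>

lemma FP_frob_cancel:
  assumes I: "ideal I R" and s: "s \<in> carrier R" and sp: "s [^] p \<in> FP (Suc e) I"
  shows "s \<in> FP e I"
proof -
  interpret F: ideal "FP e I" R by (rule FP_ideal[OF I])
  have *: "s \<otimes> \<sigma> a \<one> \<in> FP e I" if a: "a < n" for a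
  proof -
    have "sw A (s \<otimes> \<sigma> a \<one>) \<in> I" if A: "A \<in> W e" for A
    proof -
      have "sw (a # A) (s [^] p \<otimes> \<one>) \<in> I"
        using sp s a A by (subst (asm) FP_iff[OF I]) (auto simp: W_Suc dest: bspec[of _ _ "a # A"])
      then show ?thesis using s sigma_frob[OF a s, of \<one>] by simp
    qed
    then show ?thesis using s a by (subst FP_iff[OF I]) (auto simp: sigma_closed)
  qed
  have "s \<otimes> (\<sigma> i \<one> [^] p \<otimes> b i) \<in> FP e I" if i: "i < n" for i
  proof -
    obtain m where m: "p = Suc m" using p_ne_0 not0_implies_Suc by blast
    have "s \<otimes> (\<sigma> i \<one> [^] p \<otimes> b i) = (s \<otimes> \<sigma> i \<one>) \<otimes> (\<sigma> i \<one> [^] m \<otimes> b i)"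
      using s i b_closed sigma_closed by (simp add: m m_ac)
    then show ?thesis using F.I_r_closed[OF *[OF i]] i b_closed sigma_closed by simp
  qed
  then have "(\<Oplus>i\<in>{..<n}. s \<otimes> (\<sigma> i \<one> [^] p \<otimes> b i)) \<in> FP e I" by (intro F.finsum_mem) auto
  also have "(\<Oplus>i\<in>{..<n}. s \<otimes> (\<sigma> i \<one> [^] p \<otimes> b i)) = s \<otimes> (\<Oplus>i\<in>{..<n}. \<sigma> i \<one> [^] p \<otimes> b i)"
    using s b_closed sigma_closed by (intro finsum_rdistr[symmetric]) auto
  also have "\<dots> = s" using s sigma_expand[of \<one>] by simp
  finally show ?thesis .
qed

lemma FP_pow_iff:
  assumes I: "ideal I R" and s: "s \<in> carrier R"
  shows "s [^] (p ^ a) \<in> FP (e + a) I \<longleftrightarrow> s \<in> FP e I"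
proof (induction a)
  case (Suc a)
  have "s [^] (p ^ Suc a) \<in> FP (e + Suc a) I \<longleftrightarrow> s [^] (p ^ a) \<in> FP (e + a) I"
    unfolding frob_Suc[OF s] using FP_frob_Suc[OF I, of "s [^] (p ^ a)" "e + a"]
      FP_frob_cancel[OF I, of "s [^] (p ^ a)" "e + a"] s by auto
  with Suc show ?case by simp
qed (use s in simp)

lemma C_pow:
  assumes s: "s \<in> carrier R"
  shows "C (e + a) (s [^] (p ^ a)) = C e s"
proof -
  have sa: "s [^] (p ^ a) \<in> carrier R" using s by simp
  have "C (e + a) (s [^] (p ^ a)) \<subseteq> I \<longleftrightarrow> C e s \<subseteq> I" if I: "ideal I R" for I
    using C_subset_iff[OF I sa] C_subset_iff[OF I s] FP_pow_iff[OF I s] by simp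
  then show ?thesis using C_ideal[OF s] C_ideal[OF sa] by blast
qed

lemma FP_add:
  assumes I: "ideal I R" and s: "s \<in> carrier R"
  shows "s \<in> FP (a + e) I \<longleftrightarrow> s \<in> FP a (FP e I)"
proof -
  have "A @ B \<in> W (a + e)" if "A \<in> W a" "B \<in> W e" for A B
    using that by (auto simp: index_words_def)
  moreover have "\<exists>B D. A = B @ D \<and> B \<in> W a \<and> D \<in> W e" if "A \<in> W (a + e)" for A
    using that set_take_subset[of a A] set_drop_subset[of a A]
    by (intro exI[of _ "take a A"] exI[of _ "drop a A"]) (auto simp: index_words_def)
  moreover have "sw (A @ B) s = sw B (sw A s)" for A B s by (induction A arbitrary: s) auto
  ultimately show ?thesis
    unfolding FP_iff[OF I s] FP_iff[OF FP_ideal[OF I] s] using FP_iff[OF I sw_closed[OF _ s]] by metis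
qed

text \<open>\<open>D\<^sub>e s\<close> is an ideal that contains the \<open>p\<^sup>e\<close>-th power of each generator of \<open>C e s\<close>, because the word
  operators become elements of \<open>D\<^sub>e\<close> after raising to the \<open>p\<^sup>e\<close>-th power; hence
  \<open>D\<^sub>e s = (C e s)\<^bsup>[p^e]\<^esup>\<close>.\<close>

lemma linear_op_iff:
  assumes s: "s \<in> carrier R" and t: "t \<in> carrier R"
  shows "(\<exists>P\<in>frob_linear_ops R p e. P s = t) \<longleftrightarrow> C e t \<subseteq> C e s"
proof
  assume "\<exists>P\<in>frob_linear_ops R p e. P s = t"
  then obtain P where P: "P \<in> frob_linear_ops R p e" "P s = t" by blast
  note PD = frob_linear_opsD[OF P(1)]
  have "P s \<in> FP e (C e s)"
  proof (rule FP_linear[OF C_ideal[OF s] FP_ideal[OF C_ideal[OF s]] in_FP_C[OF s] PD(1,2)])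
    fix i r assume i: "i \<in> C e s" and r: "r \<in> carrier R"
    then have "i \<in> carrier R" using ideal.Icarr[OF C_ideal[OF s]] by blast
    then show "P (i [^] p ^ e \<otimes> r) \<in> FP e (C e s)"
      using PD(1,3) r FP_self[OF C_ideal[OF s] i] ideal.I_r_closed[OF FP_ideal[OF C_ideal[OF s]]] by simp
  qed
  then show "C e t \<subseteq> C e s" using C_subset_iff[OF C_ideal[OF s] t] P(2) by simp
next
  assume "C e t \<subseteq> C e s"
  then have tF: "t \<in> FP e (C e s)" using C_subset_iff[OF C_ideal[OF s] t] by simp
  define T where "T = (\<lambda>P. P s) ` frob_linear_ops R p e"
  have T: "ideal T R"
  proof (rule ideal_of_closed)
    show "T \<subseteq> carrier R" using s frob_linear_opsD(1) by (auto simp: T_def)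
    have "(\<lambda>y\<in>carrier R. y) \<in> frob_linear_ops R p e" by (auto simp: frob_linear_ops_def)
    then show "T \<noteq> {}" by (auto simp: T_def)
    show "x \<otimes> a \<in> T" if x: "x \<in> carrier R" and a: "a \<in> T" for a x
    proof -
      obtain P where P: "P \<in> frob_linear_ops R p e" "a = P s" using a by (auto simp: T_def)
      note PD = frob_linear_opsD[OF P(1)]
      have "(\<lambda>y\<in>carrier R. x \<otimes> P y) \<in> frob_linear_ops R p e"
        unfolding frob_linear_ops_def using x PD(1-3) by (auto simp: r_distr m_lcomm)
      then show ?thesis unfolding T_def using s P(2) by (auto intro!: image_eqI[of _ _ "\<lambda>y\<in>carrier R. x \<otimes> P y"])
    qed
    fix a c assume "a \<in> T" "c \<in> T"
    then obtain P Q where P: "P \<in> frob_linear_ops R p e" "a = P s" and Q: "Q \<in> frob_linear_ops R p e" "c = Q s"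
      by (auto simp: T_def)
    have "(\<lambda>y\<in>carrier R. P y \<oplus> Q y) \<in> frob_linear_ops R p e"
      unfolding frob_linear_ops_def using frob_linear_opsD(1-3)[OF P(1)] frob_linear_opsD(1-3)[OF Q(1)]
      by (auto simp: r_distr a_ac)
    then show "a \<oplus> c \<in> T" unfolding T_def using s P(2) Q(2)
      by (auto intro!: image_eqI[of _ _ "\<lambda>y\<in>carrier R. P y \<oplus> Q y"])
  qed
  have "C e s \<subseteq> {y \<in> carrier R. y [^] (p ^ e) \<in> T}"
    unfolding cartier_ideal_def
  proof (rule genideal_minimal[OF frob_preimage_ideal[OF T]], clarify, intro conjI)
    fix A assume A: "A \<in> W e"
    show "sw A s \<in> carrier R" using A s by (rule sw_closed)
    have "(\<lambda>y\<in>carrier R. sw A y [^] (p ^ e)) \<in> frob_linear_ops R p e"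
      unfolding frob_linear_ops_def using A
      by (auto simp: sw_closed sw_add sw_frob frob_add nat_pow_distrib)
    then show "sw A s [^] p ^ e \<in> T"
      unfolding T_def using s by (auto intro!: image_eqI[of _ _ "\<lambda>y\<in>carrier R. sw A y [^] (p ^ e)"])
  qed
  then have "FP e (C e s) \<subseteq> T" by (intro FP_minimal[OF T]) auto
  then show "\<exists>P\<in>frob_linear_ops R p e. P s = t" using tF by (auto simp: T_def)
qed

end

section \<open>Finiteness and right continuity\<close>

primrec lin_span :: "('a, 'y) ring_scheme => 'a set => 'a list => 'a set" where
  "lin_span R K [] = {\<zero>\<^bsub>R\<^esub>}"
| "lin_span R K (v # vs) = {c \<otimes>\<^bsub>R\<^esub> v \<oplus>\<^bsub>R\<^esub> w | c w. c \<in> K \<and> w \<in> lin_span R K vs}"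

context cring begin

context
  fixes K assumes K: "subring K R"
begin

lemma Kc: "c \<in> K ==> c \<in> carrier R" using subringE(1)[OF K] by blast

lemma lin_span_carrier: "set vs \<subseteq> carrier R ==> w \<in> lin_span R K vs ==> w \<in> carrier R"
  by (induction vs arbitrary: w) (auto simp: Kc)

lemma lin_span_zero: "set vs \<subseteq> carrier R ==> \<zero> \<in> lin_span R K vs"
proof (induction vs)
  case (Cons v vs)
  have "\<zero> = \<zero> \<otimes> v \<oplus> \<zero>" using Cons.prems by simp
  moreover have "\<zero> \<in> lin_span R K vs" using Cons by simp
  ultimately show ?case unfolding lin_span.simps using subringE(2)[OF K] by blast
qed simp

lemma lin_span_Cons: "set (v # vs) \<subseteq> carrier R ==> w \<in> lin_span R K vs ==> w \<in> lin_span R K (v # vs)"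
proof -
  assume a: "set (v # vs) \<subseteq> carrier R" "w \<in> lin_span R K vs"
  have "w = \<zero> \<otimes> v \<oplus> w" using a lin_span_carrier[of vs w] by simp
  then show ?thesis using a(2) subringE(2)[OF K] unfolding lin_span.simps by blast
qed

lemma lin_span_add:
  "set vs \<subseteq> carrier R ==> w \<in> lin_span R K vs ==> u \<in> lin_span R K vs ==> w \<oplus> u \<in> lin_span R K vs"
proof (induction vs arbitrary: w u)
  case (Cons v vs)
  obtain c w' where w: "w = c \<otimes> v \<oplus> w'" "c \<in> K" "w' \<in> lin_span R K vs" using Cons.prems(2) by auto
  obtain d u' where u: "u = d \<otimes> v \<oplus> u'" "d \<in> K" "u' \<in> lin_span R K vs" using Cons.prems(3) by auto
  have cc: "c \<in> carrier R" "d \<in> carrier R" "v \<in> carrier R" "w' \<in> carrier R" "u' \<in> carrier R"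
    using w u Cons.prems(1) Kc lin_span_carrier[of vs] by auto
  have "w \<oplus> u = (c \<oplus> d) \<otimes> v \<oplus> (w' \<oplus> u')" unfolding w(1) u(1) using cc by algebra
  moreover have "w' \<oplus> u' \<in> lin_span R K vs" using Cons w u by auto
  ultimately show ?case unfolding lin_span.simps using subringE(7)[OF K w(2) u(2)] by blast
qed simp

lemma lin_span_scalar:
  "set vs \<subseteq> carrier R ==> c \<in> K ==> w \<in> lin_span R K vs ==> c \<otimes> w \<in> lin_span R K vs"
proof (induction vs arbitrary: w)
  case (Cons v vs)
  obtain d w' where w: "w = d \<otimes> v \<oplus> w'" "d \<in> K" "w' \<in> lin_span R K vs" using Cons.prems(3) by auto
  have cc: "c \<in> carrier R" "d \<in> carrier R" "v \<in> carrier R" "w' \<in> carrier R"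
    using w Cons.prems Kc lin_span_carrier[of vs] by auto
  have "c \<otimes> w = (c \<otimes> d) \<otimes> v \<oplus> c \<otimes> w'" unfolding w(1) using cc by algebra
  moreover have "c \<otimes> w' \<in> lin_span R K vs" using Cons w by auto
  ultimately show ?case unfolding lin_span.simps using subringE(6)[OF K Cons.prems(2) w(2)] by blast
qed (simp add: Kc)

lemma lin_span_mem:
  "set vs \<subseteq> carrier R ==> v \<in> set vs ==> v \<in> lin_span R K vs"
proof (induction vs)
  case (Cons u vs)
  show ?case
  proof (cases "v = u")
    case True
    have "u = \<one> \<otimes> u \<oplus> \<zero>" using Cons.prems(1) by simp
    moreover have "\<zero> \<in> lin_span R K vs" using lin_span_zero[of vs] Cons.prems(1) by simp
    ultimately show ?thesis unfolding True lin_span.simps using subringE(3)[OF K] by blast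
  next
    case False
    then show ?thesis using Cons lin_span_Cons by auto
  qed
qed simp

lemma lin_span_le:
  assumes "\<zero> \<in> T" "\<And>u w. u \<in> T ==> w \<in> T ==> u \<oplus> w \<in> T" "\<And>c v. c \<in> K ==> v \<in> set vs ==> c \<otimes> v \<in> T"
  shows "lin_span R K vs \<subseteq> T"
  using assms(3) by (induction vs) (auto intro!: assms(1,2))

end

text \<open>Records at which vectors of \<open>vs\<close> the intersection of \<open>I\<close> with the flag spanned by the tails of
  \<open>vs\<close> grows. A list of booleans takes finitely many values; this replaces dimensions.\<close>

primrec jump_list :: "'a set => 'a set => 'a list => bool list" where
  "jump_list K I [] = []"
| "jump_list K I (v # vs) = (I \<inter> (lin_span R K (v # vs) - lin_span R K vs) \<noteq> {}) # jump_list K I vs"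

lemma jump_list_length: "length (jump_list K I vs) = length vs"
  by (induction vs) auto

lemma jump_list_inj:
  assumes K: "subring K R" and inv: "\<And>c. c \<in> K ==> c \<noteq> \<zero> ==> \<exists>d\<in>K. d \<otimes> c = \<one>"
    and I: "ideal I R" and J: "ideal J R" "I \<subseteq> J" and vs: "set vs \<subseteq> carrier R"
    and eq: "jump_list K I vs = jump_list K J vs"
  shows "J \<inter> lin_span R K vs \<subseteq> I"
  using vs eq
proof (induction vs)
  case Nil
  then show ?case using additive_subgroup.zero_closed[OF ideal.axioms(1)[OF I]] by auto
next
  case (Cons v vs)
  interpret I: ideal I R by (rule I)
  interpret J: ideal J R by (rule J)
  have IH: "J \<inter> lin_span R K vs \<subseteq> I" using Cons by auto
  have vsc: "set vs \<subseteq> carrier R" and vc: "v \<in> carrier R" using Cons.prems by auto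
  show ?case
  proof
    fix x assume x: "x \<in> J \<inter> lin_span R K (v # vs)"
    show "x \<in> I"
    proof (cases "x \<in> lin_span R K vs")
      case False
      then obtain y where y: "y \<in> I" "y \<in> lin_span R K (v # vs)" "y \<notin> lin_span R K vs"
        using x Cons.prems(2) by (auto simp del: lin_span.simps)
      obtain c w where xw: "x = c \<otimes> v \<oplus> w" "c \<in> K" "w \<in> lin_span R K vs" using x by auto
      obtain d u where yu: "y = d \<otimes> v \<oplus> u" "d \<in> K" "u \<in> lin_span R K vs" using y by auto
      note Kcs = Kc[OF K] and Lc = lin_span_carrier[OF K vsc]
      have "d \<noteq> \<zero>" using y(3) yu vc Lc by auto
      then obtain d' where d': "d' \<in> K" "d' \<otimes> d = \<one>" using inv yu(2) by blast
      have cc: "c \<in> carrier R" "d \<in> carrier R" "d' \<in> carrier R" "w \<in> carrier R" "u \<in> carrier R"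
        using xw yu d' Kcs Lc by auto
      have cdI: "(c \<otimes> d') \<otimes> y \<in> I" using I.I_l_closed[OF y(1)] cc by simp
      have "(c \<otimes> d') \<otimes> y = c \<otimes> (d' \<otimes> d) \<otimes> v \<oplus> (c \<otimes> d') \<otimes> u" unfolding yu(1) using cc vc by algebra
      then have "x \<ominus> (c \<otimes> d') \<otimes> y = w \<ominus> (c \<otimes> d') \<otimes> u" unfolding xw(1) d'(2) using cc vc by algebra
      also have "\<dots> = w \<oplus> (\<ominus> (c \<otimes> d')) \<otimes> u" using cc by algebra
      also have "\<dots> \<in> lin_span R K vs"
        using xw(2,3) yu(3) d'(1) by (intro lin_span_add lin_span_scalar K vsc subringE(5,6)[OF K])
      finally have "x \<ominus> (c \<otimes> d') \<otimes> y \<in> I"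
        using IH x J.diff_closed[of x "(c \<otimes> d') \<otimes> y"] cdI J(2) by blast
      from I.a_closed[OF cdI this] show ?thesis
        using x J.Icarr I.Icarr[OF cdI] by (simp add: add_diff_cancel)
    qed (use IH x in blast)
  qed
qed

text \<open>Nested subspaces of a finite-dimensional space with the same jumps coincide
  (\<open>jump_list_inj\<close>), and each ideal of the chain is generated by its part in that space.\<close>

lemma finite_chain_of_ideals:
  assumes K: "subring K R" and inv: "\<And>c. c \<in> K ==> c \<noteq> \<zero> ==> \<exists>d\<in>K. d \<otimes> c = \<one>"
    and vs: "set vs \<subseteq> carrier R"
    and F: "\<And>I. I \<in> F ==> ideal I R" "\<And>I. I \<in> F ==> I \<subseteq> Idl (I \<inter> lin_span R K vs)"
    and chain: "\<And>I J. I \<in> F ==> J \<in> F ==> I \<subseteq> J \<or> J \<subseteq> I"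
  shows "finite F"
proof (rule inj_on_finite)
  have *: "J \<subseteq> I" if "I \<in> F" "J \<in> F" "I \<subseteq> J" "jump_list K I vs = jump_list K J vs" for I J
  proof -
    have "J \<inter> lin_span R K vs \<subseteq> I" using jump_list_inj[OF K inv F(1) F(1)] that vs by blast
    then have "Idl (J \<inter> lin_span R K vs) \<subseteq> I" using F(1)[OF that(1)] by (rule genideal_minimal[rotated])
    then show ?thesis using F(2)[OF that(2)] by blast
  qed
  show "inj_on (\<lambda>I. jump_list K I vs) F"
  proof (rule inj_onI)
    fix I J assume IJ: "I \<in> F" "J \<in> F" "jump_list K I vs = jump_list K J vs"
    show "I = J" using chain[OF IJ(1,2)] *[OF IJ(1,2) _ IJ(3)] *[OF IJ(2,1) _ IJ(3)[symmetric]] by blast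
  qed
  show "(\<lambda>I. jump_list K I vs) ` F \<subseteq> {bs. set bs \<subseteq> UNIV \<and> length bs = length vs}"
    by (auto simp: jump_list_length)
  show "finite {bs :: bool list. set bs \<subseteq> UNIV \<and> length bs = length vs}"
    by (rule finite_lists_length_eq) simp
qed

end

locale frobenius_basis_algebra = frobenius_basis +
  fixes K X
  assumes K: "subring K R" and K_inv: "\<And>c. c \<in> K ==> c \<noteq> \<zero> ==> \<exists>d\<in>K. d \<otimes> c = \<one>"
    and K_root: "\<And>c. c \<in> K ==> \<exists>d\<in>K. d [^] p = c"
    and X: "finite X" "X \<subseteq> carrier R" and gen: "generate_ring R (K \<union> X) = carrier R"
begin

definition mon :: "('a => nat) => 'a" where
  "mon m = (\<Otimes>x\<in>X. x [^] m x)"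

definition exps :: "nat => ('a => nat) set" where
  "exps d = {m. (\<forall>x. x \<notin> X --> m x = 0) \<and> sum m X \<le> d}"

lemma exps_finite: "finite (exps d)"
proof (rule finite_subset)
  show "exps d \<subseteq> {m. \<forall>x. (x \<in> X --> m x \<in> {..d}) \<and> (x \<notin> X --> m x = 0)}"
  proof (intro subsetI CollectI allI conjI impI)
    fix m x assume m: "m \<in> exps d"
    show "m x \<in> {..d}" if "x \<in> X"
      using member_le_sum[OF that, of m] X(1) m by (simp add: exps_def)
    show "m x = 0" if "x \<notin> X" using that m by (simp add: exps_def)
  qed
  show "finite {m. \<forall>x. (x \<in> X --> m x \<in> {..d}) \<and> (x \<notin> X --> m x = 0)}"
    by (rule finite_set_of_finite_funs[OF X(1)]) simp
qed

definition monomials :: "nat => 'a list" where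
  "monomials d = (SOME vs. set vs = mon ` exps d)"

lemma set_monomials: "set (monomials d) = mon ` exps d"
proof -
  obtain vs where "set vs = mon ` exps d" using finite_list[OF finite_imageI[OF exps_finite]] by (rule exE)
  then show ?thesis unfolding monomials_def by (rule someI)
qed

text \<open>The \<open>K\<close>-span of the monomials of degree at most \<open>d\<close> in the generators: a degree filtration on an
  algebra that has no grading.\<close>

definition gauge :: "nat => 'a set" where
  "gauge d = lin_span R K (monomials d)"

lemma mono_closed: "mon m \<in> carrier R"
  unfolding mon_def using X(2) by (intro finprod_closed) blast

lemma monomials_carrier: "set (monomials d) \<subseteq> carrier R"
  using mono_closed by (auto simp: set_monomials)

lemma mono_add: "mon (\<lambda>x. m x + m' x) = mon m \<otimes> mon m'"
proof -
  have Xc: "x \<in> carrier R" if "x \<in> X" for x using that X by blast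
  have "mon (\<lambda>x. m x + m' x) = (\<Otimes>x\<in>X. x [^] m x \<otimes> x [^] m' x)"
    unfolding mon_def by (rule finprod_cong') (auto simp: Xc nat_pow_mult)
  also have "\<dots> = mon m \<otimes> mon m'"
    unfolding mon_def by (rule finprod_multf) (auto simp: Xc)
  finally show ?thesis .
qed

lemma mono_mult: "mon (\<lambda>x. a * m x) = mon m [^] a"
proof (induction a)
  case 0
  show ?case by (simp add: mon_def)
next
  case (Suc a)
  have "mon (\<lambda>x. Suc a * m x) = mon (\<lambda>x. a * m x + m x)"
    by (rule arg_cong[where f = mon]) (simp add: fun_eq_iff)
  also have "\<dots> = mon (\<lambda>x. a * m x) \<otimes> mon m" by (rule mono_add)
  finally show ?case by (simp add: Suc)
qed

lemmas gauge_carrier = lin_span_carrier[OF K monomials_carrier, folded gauge_def]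
  and gauge_zero = lin_span_zero[OF K monomials_carrier, folded gauge_def]
  and gauge_add = lin_span_add[OF K monomials_carrier, folded gauge_def]
  and gauge_scalar = lin_span_scalar[OF K monomials_carrier, folded gauge_def]

lemma gauge_mono: "m \<in> exps d ==> mon m \<in> gauge d"
  unfolding gauge_def by (rule lin_span_mem[OF K monomials_carrier]) (simp add: set_monomials)

lemma gauge_le:
  assumes "\<zero> \<in> T" "\<And>u w. u \<in> T ==> w \<in> T ==> u \<oplus> w \<in> T" "\<And>c m. c \<in> K ==> m \<in> exps d ==> c \<otimes> mon m \<in> T"
  shows "gauge d \<subseteq> T"
  unfolding gauge_def
proof (rule lin_span_le[OF K assms(1,2)])
  fix c v assume "c \<in> K" "v \<in> set (monomials d)"
  then show "c \<otimes> v \<in> T" using assms(3) by (auto simp: set_monomials)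
qed

lemma gauge_subset: "d \<le> d' ==> gauge d \<subseteq> gauge d'"
proof (rule gauge_le[OF gauge_zero gauge_add])
  fix c m assume "d \<le> d'" "c \<in> K" "m \<in> exps d"
  moreover from this have "m \<in> exps d'" by (simp add: exps_def)
  ultimately show "c \<otimes> mon m \<in> gauge d'" by (intro gauge_scalar gauge_mono)
qed

lemma exps_add: "m \<in> exps d ==> m' \<in> exps d' ==> (\<lambda>x. m x + m' x) \<in> exps (d + d')"
  by (auto simp: exps_def sum.distrib)

lemma gauge_mono_mult:
  assumes m: "m \<in> exps d" and s: "s \<in> gauge d'"
  shows "mon m \<otimes> s \<in> gauge (d + d')"
proof -
  have "gauge d' \<subseteq> {s \<in> carrier R. mon m \<otimes> s \<in> gauge (d + d')}"
  proof (rule gauge_le)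
    fix c m' assume c: "c \<in> K" and m': "m' \<in> exps d'"
    have cc: "c \<in> carrier R" using c Kc[OF K] by blast
    have "mon m \<otimes> (c \<otimes> mon m') = c \<otimes> mon (\<lambda>x. m x + m' x)"
      unfolding mono_add[of m m'] using cc mono_closed by (intro m_lcomm) auto
    then show "c \<otimes> mon m' \<in> {s \<in> carrier R. mon m \<otimes> s \<in> gauge (d + d')}"
      using cc mono_closed gauge_scalar[OF c gauge_mono[OF exps_add[OF m m']]] by simp
  qed (auto simp: mono_closed gauge_zero r_distr gauge_add)
  then show ?thesis using s by blast
qed

lemma gauge_mult:
  assumes r: "r \<in> gauge d" and s: "s \<in> gauge d'"
  shows "r \<otimes> s \<in> gauge (d + d')"
proof -
  have sc: "s \<in> carrier R" using s gauge_carrier by blast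
  have "gauge d \<subseteq> {r \<in> carrier R. r \<otimes> s \<in> gauge (d + d')}"
  proof (rule gauge_le)
    fix c m assume c: "c \<in> K" and m: "m \<in> exps d"
    have cc: "c \<in> carrier R" using c Kc[OF K] by blast
    have "(c \<otimes> mon m) \<otimes> s = c \<otimes> (mon m \<otimes> s)" using cc mono_closed sc by (simp add: m_assoc)
    then show "c \<otimes> mon m \<in> {r \<in> carrier R. r \<otimes> s \<in> gauge (d + d')}"
      using cc mono_closed gauge_scalar[OF c gauge_mono_mult[OF m s]] by simp
  qed (auto simp: gauge_zero l_distr gauge_add sc)
  then show ?thesis using r by blast
qed

lemma gauge_K: "c \<in> K ==> c \<in> gauge d"
proof -
  assume c: "c \<in> K"
  have "(\<lambda>x. 0) \<in> exps d" by (simp add: exps_def)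
  then have "c \<otimes> mon (\<lambda>x. 0) \<in> gauge d" by (intro gauge_scalar gauge_mono c)
  then show ?thesis using Kc[OF K c] by (simp add: mon_def)
qed

lemma gauge_pow: "s \<in> gauge d ==> s [^] (a::nat) \<in> gauge (a * d)"
proof (induction a)
  case 0
  show ?case using gauge_K[OF subringE(3)[OF K]] by simp
next
  case (Suc a)
  then show ?case using gauge_mult[of "s [^] a" "a * d" s d] by (simp add: add.commute)
qed

lemma gauge_exhaust:
  assumes "s \<in> carrier R"
  shows "\<exists>d. s \<in> gauge d"
proof -
  have "generate_ring R (K \<union> X) \<subseteq> (\<Union>d. gauge d)"
  proof (rule generate_ring_min_subring1)
    show "K \<union> X \<subseteq> carrier R" using K X subringE(1) by blast
    show "subring (\<Union>d. gauge d) R"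
    proof (rule subringI)
      show "(\<Union>d. gauge d) \<subseteq> carrier R" using gauge_carrier by blast
      show "\<one> \<in> (\<Union>d. gauge d)" using gauge_K[OF subringE(3)[OF K]] by blast
      show "\<ominus> h \<in> (\<Union>d. gauge d)" if h: "h \<in> (\<Union>d. gauge d)" for h
      proof -
        obtain d where d: "h \<in> gauge d" using h by blast
        have "\<ominus> \<one> \<otimes> h \<in> gauge d" using gauge_scalar[OF _ d] subringE(3,5)[OF K] by blast
        then show ?thesis using gauge_carrier[OF d] by (auto simp: l_minus)
      qed
      fix u v assume "u \<in> (\<Union>d. gauge d)" "v \<in> (\<Union>d. gauge d)"
      then obtain d d' where d: "u \<in> gauge d" "v \<in> gauge d'" by blast
      show "u \<otimes> v \<in> (\<Union>d. gauge d)" using gauge_mult[OF d] by blast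
      have "u \<in> gauge (max d d')" "v \<in> gauge (max d d')"
        using d gauge_subset[of d "max d d'"] gauge_subset[of d' "max d d'"] by auto
      then show "u \<oplus> v \<in> (\<Union>d. gauge d)" using gauge_add by blast
    qed
    have "x \<in> gauge 1" if x: "x \<in> X" for x
    proof -
      define m where "m = (\<lambda>y. if y = x then 1 else 0 :: nat)"
      have "m \<in> exps 1" using x X(1) by (auto simp: exps_def m_def)
      moreover have "mon m = (\<Otimes>y\<in>X. if x = y then y else \<one>)"
        unfolding mon_def m_def using X by (intro finprod_cong') auto
      then have "mon m = x" using x X by (subst (asm) finprod_singleton) auto
      ultimately show ?thesis using gauge_mono by metis
    qed
    then show "K \<union> X \<subseteq> (\<Union>d. gauge d)" using gauge_K by blast
  qed
  then show ?thesis using assms gen by auto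
qed

text \<open>Split off \<open>p\<close>-th powers, \<open>c x\<^sup>m = (c\<^bsup>1/p\<^esup> x\<^bsup>m div p\<^esup>)\<^sup>p x\<^bsup>m mod p\<^esup>\<close>: Cartier operators divide the degree by
  \<open>p\<close>, up to a constant \<open>G\<close> that bounds their values on the finitely many remaining monomials.\<close>

lemma gauge_sigma:
  "\<exists>G. \<forall>i d s. i < n --> s \<in> gauge d --> \<sigma> i s \<in> gauge (d div p + G)"
proof -
  \<comment> \<open>the monomials with all exponents below \<open>p\<close> have degree at most \<open>card X * p\<close>\<close>
  define Z where "Z = (\<lambda>(i, m). \<sigma> i (mon m)) ` ({..<n} \<times> exps (card X * p))"
  have "finite Z" "Z \<subseteq> carrier R" using exps_finite by (auto simp: Z_def sigma_closed mono_closed)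
  then have "\<exists>G. Z \<subseteq> gauge G"
  proof (induction Z)
    case (insert z Z)
    then obtain G where G: "Z \<subseteq> gauge G" by auto
    obtain d where d: "z \<in> gauge d" using gauge_exhaust insert.prems by blast
    have "insert z Z \<subseteq> gauge (max G d)"
      using G d gauge_subset[of G "max G d"] gauge_subset[of d "max G d"] by auto
    then show ?case by blast
  qed auto
  then obtain G where G: "Z \<subseteq> gauge G" by blast
  have "\<sigma> i s \<in> gauge (d div p + G)" if i: "i < n" and s: "s \<in> gauge d" for i d s
  proof -
    have "gauge d \<subseteq> {s \<in> carrier R. \<sigma> i s \<in> gauge (d div p + G)}"
    proof (rule gauge_le)
      have "\<sigma> i \<zero> = \<zero>" using sigma_add[OF i, of \<zero> \<zero>] sigma_closed[OF i, of \<zero>] by (simp add: add.l_cancel_one)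
      then show "\<zero> \<in> {s \<in> carrier R. \<sigma> i s \<in> gauge (d div p + G)}" using gauge_zero by simp
      show "u \<oplus> w \<in> {s \<in> carrier R. \<sigma> i s \<in> gauge (d div p + G)}"
        if "u \<in> {s \<in> carrier R. \<sigma> i s \<in> gauge (d div p + G)}" "w \<in> {s \<in> carrier R. \<sigma> i s \<in> gauge (d div p + G)}" for u w
        using that gauge_add by (simp add: sigma_add[OF i])
      fix c m assume c: "c \<in> K" and m: "m \<in> exps d"
      obtain c' where c': "c' \<in> K" "c' [^] p = c" using K_root[OF c] by blast
      have cc: "c \<in> carrier R" "c' \<in> carrier R" using c c' Kc[OF K] by blast+
      define q r where "q = (\<lambda>x. m x div p)" and "r = (\<lambda>x. m x mod p)"
      have "(\<lambda>x. p * q x + r x) = m" by (auto simp: q_def r_def)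
      then have "mon m = mon (\<lambda>x. p * q x) \<otimes> mon r" using mono_add[of "\<lambda>x. p * q x" r] by simp
      then have "mon m = mon q [^] p \<otimes> mon r" by (simp add: mono_mult)
      then have "c \<otimes> mon m = (c' \<otimes> mon q) [^] p \<otimes> mon r"
        using cc mono_closed by (simp add: c'(2)[symmetric] nat_pow_distrib m_assoc)
      then have "\<sigma> i (c \<otimes> mon m) = (c' \<otimes> mon q) \<otimes> \<sigma> i (mon r)"
        using cc mono_closed sigma_frob[OF i] by simp
      also have "\<dots> = c' \<otimes> (mon q \<otimes> \<sigma> i (mon r))"
        using cc mono_closed sigma_closed[OF i] by (simp add: m_assoc)
      also have "\<dots> \<in> gauge (d div p + G)"
      proof (intro gauge_scalar[OF c'(1)] gauge_mono_mult)
        have "p * sum q X \<le> sum m X" unfolding q_def sum_distrib_left by (intro sum_mono) simp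
        also have "\<dots> \<le> d" using m by (simp add: exps_def)
        finally have "sum q X \<le> d div p" by (simp add: less_eq_div_iff_mult_less_eq mult.commute)
        then show "q \<in> exps (d div p)" using m by (auto simp: exps_def q_def)
        have "sum r X \<le> (\<Sum>x\<in>X. p)" unfolding r_def by (intro sum_mono) (simp add: less_imp_le)
        then have "r \<in> exps (card X * p)" using m by (auto simp: exps_def r_def)
        then show "\<sigma> i (mon r) \<in> gauge G" using G i by (auto simp: Z_def)
      qed
      finally show "c \<otimes> mon m \<in> {s \<in> carrier R. \<sigma> i s \<in> gauge (d div p + G)}" using cc mono_closed by simp
    qed
    then show ?thesis using s by blast
  qed
  then show ?thesis by blast
qed

text \<open>The degree of \<open>f\<^sup>m\<close> is at most \<open>\<delta> p\<^sup>e\<close>, and dividing \<open>e\<close> times by \<open>p\<close> leaves \<open>\<delta>\<close> plus a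
  geometric series; \<open>2 G\<close> is a fixed bound since \<open>2 G div p + G \<le> 2 G\<close>.\<close>

lemma cartier_ideals_bounded:
  assumes f: "f \<in> carrier R"
  shows "\<exists>D. \<forall>e (m::nat) A. m \<le> p ^ e --> A \<in> W e --> sw A (f [^] m) \<in> gauge D"
proof -
  obtain \<delta> where \<delta>: "f \<in> gauge \<delta>" using gauge_exhaust[OF f] by blast
  obtain G where G: "\<And>i d s. i < n ==> s \<in> gauge d ==> \<sigma> i s \<in> gauge (d div p + G)" 
    using gauge_sigma by metis
  have word: "sw A s \<in> gauge (\<delta> + 2 * G)" if "A \<in> W e" "s \<in> gauge (\<delta> * p ^ e + 2 * G)" for e A s
    using that
  proof (induction e arbitrary: A s)
    case 0
    then show ?case by (simp add: W_0)
  next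
    case (Suc e)
    obtain a A' where A: "A = a # A'" "a < n" "A' \<in> W e" using W_SucE Suc.prems(1) by blast
    have "(\<delta> * p ^ Suc e + 2 * G) div p + G = \<delta> * p ^ e + (2 * G) div p + G"
    proof -
      have "\<delta> * p ^ Suc e + 2 * G = 2 * G + p * (\<delta> * p ^ e)" by (simp add: ac_simps)
      then show ?thesis by (simp only: div_mult_self2[OF p_ne_0])
    qed
    also have "\<dots> \<le> \<delta> * p ^ e + 2 * G" using div_le_mono2[of 2 p "2 * G"] p_gt_1 by simp
    finally have "\<sigma> a s \<in> gauge (\<delta> * p ^ e + 2 * G)"
      using G[OF A(2) Suc.prems(2)] gauge_subset by blast
    then show ?case using Suc.IH[OF A(3)] by (simp add: A(1))
  qed
  have "sw A (f [^] m) \<in> gauge (\<delta> + 2 * G)" if m: "m \<le> p ^ e" and A: "A \<in> W e" for e A and m :: nat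
  proof (rule word[OF A])
    have "m * \<delta> \<le> \<delta> * p ^ e + 2 * G" using m by (simp add: mult.commute trans_le_add1)
    then show "f [^] m \<in> gauge (\<delta> * p ^ e + 2 * G)" using gauge_pow[OF \<delta>, of m] gauge_subset by blast
  qed
  then show ?thesis by blast
qed

text \<open>All ideals \<open>C e (f\<^sup>m)\<close> can be compared at a common level, so they form a chain.\<close>

lemma C_chain:
  fixes m m' :: nat
  assumes f: "f \<in> carrier R"
  shows "C e (f [^] m) \<subseteq> C e' (f [^] m') \<longleftrightarrow> C (e + e') (f [^] (m * p ^ e')) \<subseteq> C (e + e') (f [^] (m' * p ^ e))"
  using C_pow[of "f [^] m" e e'] C_pow[of "f [^] m'" e' e] f by (simp add: nat_pow_pow add.commute)

lemma C_antimono: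
  fixes m m' :: nat
  assumes f: "f \<in> carrier R" and m: "m \<le> m'"
  shows "C e (f [^] m') \<subseteq> C e (f [^] m)"
  using C_mult_subset[of "f [^] m" "f [^] (m' - m)" e] f m by (simp add: nat_pow_mult)

lemma finite_cartier_ideals:
  assumes f: "f \<in> carrier R"
  shows "finite {C e (f [^] (m::nat)) | e m. m \<le> p ^ e}"
proof -
  obtain D where D: "\<And>e (m::nat) A. m \<le> p ^ e ==> A \<in> W e ==> sw A (f [^] m) \<in> gauge D"
    using cartier_ideals_bounded[OF f] by metis
  show ?thesis
  proof (rule finite_chain_of_ideals[OF K K_inv monomials_carrier[of D], folded gauge_def])
    fix I assume "I \<in> {C e (f [^] (m::nat)) | e m. m \<le> p ^ e}"
    then obtain e and m :: nat where I: "I = C e (f [^] m)" "m \<le> p ^ e" by blast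
    show "ideal I R" unfolding I by (rule C_ideal) (use f in simp)
    have "(\<lambda>A. sw A (f [^] m)) ` W e \<subseteq> I \<inter> gauge D"
      using D[OF I(2)] genideal_self[OF C_gens[of "f [^] m" e]] f unfolding I(1) cartier_ideal_def by auto
    then show "I \<subseteq> Idl (I \<inter> gauge D)"
      unfolding I(1) cartier_ideal_def using gauge_carrier
      by (intro genideal_minimal genideal_ideal order_trans[OF _ genideal_self]) auto
  next
    fix I J assume "I \<in> {C e (f [^] (m::nat)) | e m. m \<le> p ^ e}" "J \<in> {C e (f [^] (m::nat)) | e m. m \<le> p ^ e}"
    then obtain e e' and m m' :: nat where I: "I = C e (f [^] m)" and J: "J = C e' (f [^] m')" by blast
    show "I \<subseteq> J \<or> J \<subseteq> I"
      unfolding I J C_chain[OF f, of e m] C_chain[OF f, of e' m'] add.commute[of e' e]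
      using C_antimono[OF f, of "m * p ^ e'" "m' * p ^ e" "e + e'"] C_antimono[OF f, of "m' * p ^ e" "m * p ^ e'" "e + e'"]
      by linarith
  qed
qed

text \<open>The increasing sequence \<open>C a f\<close> is stationary; its limit \<open>c\<close> contains \<open>f\<close> and satisfies
  \<open>c \<subseteq> c\<^bsup>[p]\<^esup> \<subseteq> c\<^sup>2\<close>. Nakayama gives \<open>e \<in> c\<close> with \<open>e f = f\<close>, and \<open>e = 1\<close> as \<open>f\<close> is a nonzerodivisor. This is
  \<open>\<tau>(f\<^sup>\<epsilon>) = R\<close> for small \<open>\<epsilon>\<close>.\<close>

lemma cartier_ideal_unit:
  assumes f: "f \<in> carrier R" and nzd: "nonzerodivisor R f"
  shows "\<exists>a. \<one> \<in> C a f"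
proof -
  have mon: "C a f \<subseteq> C (a + d) f" for a d
  proof -
    have "C a f = C (a + d) (f [^] (p ^ d))" by (rule C_pow[OF f, symmetric])
    also have "\<dots> \<subseteq> C (a + d) (f [^] (1::nat))" by (intro C_antimono f) (simp add: Suc_leI)
    finally show ?thesis using f by simp
  qed
  have "range (\<lambda>a. C a f) \<subseteq> {C e (f [^] (m::nat)) | e m. m \<le> p ^ e}"
  proof clarify
    fix a show "\<exists>e m. C a f = C e (f [^] (m::nat)) \<and> m \<le> p ^ e"
      using f by (intro exI[of _ a] exI[of _ "1::nat"]) (simp add: Suc_leI)
  qed
  then have "finite (range (\<lambda>a. C a f))" using finite_cartier_ideals[OF f] finite_subset by blast
  then obtain a where a: "C (Suc a) f = C a f"
  proof -
    assume *: "\<And>a. C (Suc a) f = C a f ==> thesis"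
    obtain M where M: "M \<in> range (\<lambda>a. C a f)" "\<And>N. N \<in> range (\<lambda>a. C a f) ==> M \<subseteq> N ==> M = N"
      using finite_has_maximal[OF \<open>finite (range (\<lambda>a. C a f))\<close>] by blast
    then obtain a where "M = C a f" by blast
    then have "C (Suc a) f = C a f" using M(2)[of "C (Suc a) f"] mon[of a 1] by auto
    then show thesis by (rule *)
  qed
  define c where "c = C a f"
  have c: "ideal c R" unfolding c_def by (rule C_ideal[OF f])
  interpret c: ideal c R by (rule c)
  have "f \<in> FP (a + 1) c" using in_FP_C[OF f, of "Suc a"] a by (simp add: c_def)
  then have "f \<in> FP a (FP 1 c)" using FP_add[OF c f] by blast
  then have cFP: "c \<subseteq> FP 1 c" unfolding c_def using C_subset_iff[OF FP_ideal[OF C_ideal[OF f]] f] by blast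
  have fc: "f \<in> c"
  proof -
    have "FP a c \<subseteq> c"
    proof (rule FP_minimal[OF c])
      fix i assume i: "i \<in> c"
      obtain m where m: "p ^ a = Suc m" using p_ne_0 not0_implies_Suc[of "p ^ a"] by auto
      show "i [^] (p ^ a) \<in> c" unfolding m using i c.I_l_closed c.Icarr by simp
    qed
    then show ?thesis using in_FP_C[OF f, of a] by (auto simp: c_def)
  qed
  have "\<exists>e\<in>c. \<forall>y\<in>c. e \<otimes> y = y"
  proof (rule idempotent_ideal_unit[OF c])
    show "finite ((\<lambda>A. sw A f) ` W a)" using W_finite by simp
    show "(\<lambda>A. sw A f) ` W a \<subseteq> c" unfolding c_def cartier_ideal_def by (rule genideal_self[OF C_gens[OF f]])
    show "c = Idl ((\<lambda>A. sw A f) ` W a)" by (simp add: c_def cartier_ideal_def)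
    have sub: "{u \<otimes> v | u v. u \<in> c \<and> v \<in> c} \<subseteq> carrier R" using c.Icarr by auto
    have "FP 1 c \<subseteq> Idl {u \<otimes> v | u v. u \<in> c \<and> v \<in> c}"
    proof (rule FP_minimal[OF genideal_ideal[OF sub]])
      fix i assume i: "i \<in> c"
      have "\<exists>m. p = Suc (Suc m)" using p_gt_1 by presburger
      then obtain m where m: "p = Suc (Suc m)" by (rule exE)
      have eq: "i [^] (p ^ 1) = (i [^] m \<otimes> i) \<otimes> i" unfolding power_one_right m by simp
      have "i [^] m \<otimes> i \<in> c" by (rule c.I_l_closed[OF i nat_pow_closed[OF c.Icarr[OF i]]])
      then have "(i [^] m \<otimes> i) \<otimes> i \<in> {u \<otimes> v | u v. u \<in> c \<and> v \<in> c}" using i by blast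
      then show "i [^] (p ^ 1) \<in> Idl {u \<otimes> v | u v. u \<in> c \<and> v \<in> c}"
        unfolding eq by (rule subsetD[OF genideal_self[OF sub]])
    qed
    then show "c \<subseteq> Idl {u \<otimes> v | u v. u \<in> c \<and> v \<in> c}" using cFP by blast
  qed
  then obtain e where e: "e \<in> c" "e \<otimes> f = f" using fc by blast
  have ec: "e \<in> carrier R" using e c.Icarr by blast
  have "f \<otimes> (\<one> \<ominus> e) = f \<ominus> e \<otimes> f" using f ec by algebra
  also have "\<dots> = \<zero>" unfolding e(2) using f by (simp add: minus_eq r_neg)
  finally have "\<one> \<ominus> e = \<zero>" using nzd ec unfolding nonzerodivisor_def by blast
  then have "e = \<one>" using ec r_right_minus_eq[of \<one> e] by simp
  then show ?thesis using e(1) by (auto simp: c_def)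
qed

text \<open>From \<open>f\<^bsup>m p^a + 1\<^esup> \<in> L\<^bsup>[p^(e+a)]\<^esup>\<close> one gets \<open>f\<^sup>m \<cdot> C a f \<subseteq> L\<^bsup>[p^e]\<^esup>\<close>, where \<open>C a f = R\<close> for large \<open>a\<close>.\<close>

lemma C_right_continuous:
  fixes m :: nat
  assumes f: "f \<in> carrier R" and nzd: "nonzerodivisor R f"
  shows "\<exists>a. C e (f [^] m) \<subseteq> C (e + a) (f [^] (m * p ^ a + 1))"
proof -
  obtain a where a: "\<one> \<in> C a f" using cartier_ideal_unit[OF f nzd] by blast
  define L where "L = C (e + a) (f [^] (m * p ^ a + 1))"
  have fm: "f [^] (m * p ^ a + 1) \<in> carrier R" "f [^] m \<in> carrier R" using f by auto
  have L: "ideal L R" unfolding L_def by (rule C_ideal[OF fm(1)])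
  interpret F: ideal "FP e L" R by (rule FP_ideal[OF L])
  have "f [^] (m * p ^ a + 1) \<in> FP (a + e) L"
    using in_FP_C[OF fm(1), of "e + a"] by (simp add: L_def add.commute)
  then have "f [^] (m * p ^ a + 1) \<in> FP a (FP e L)" using FP_add[OF L fm(1)] by blast
  then have *: "sw A (f [^] (m * p ^ a + 1)) \<in> FP e L" if "A \<in> W a" for A
    using FP_iff[OF F.ideal_axioms fm(1)] that by blast
  have **: "f [^] m \<otimes> sw A f \<in> FP e L" if A: "A \<in> W a" for A
  proof -
    have "f [^] (m * p ^ a + 1) = (f [^] m) [^] (p ^ a) \<otimes> f" using f by (simp add: nat_pow_pow)
    then show ?thesis using *[OF A] sw_frob[OF A fm(2) f] by simp
  qed
  have "C a f \<subseteq> {x \<in> carrier R. x \<otimes> f [^] m \<in> FP e L}"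
    unfolding cartier_ideal_def
  proof (rule genideal_minimal[OF colon_ideal[OF F.ideal_axioms fm(2)]], clarify, intro conjI)
    fix A assume A: "A \<in> W a"
    show "sw A f \<in> carrier R" using sw_closed[OF A f] .
    then show "sw A f \<otimes> f [^] m \<in> FP e L" using **[OF A] fm(2) by (simp add: m_comm)
  qed
  then have "\<one> \<otimes> f [^] m \<in> FP e L" using a by blast
  then show ?thesis using C_subset_iff[OF L fm(2)] fm(2) unfolding L_def by auto
qed

end

section \<open>Jumps and \<open>p\<close>-adic expansions\<close>

text \<open>The combinatorics of \<open>I e m = \<tau>(f\<^bsup>m/p^e\<^esup>)\<close>. The last axiom comes from differential operators:
  an operator taking \<open>f\<^bsup>m+1\<^esup>\<close> to \<open>f\<^sup>m\<close> commutes with the \<open>p\<^sup>e\<close>-th power \<open>f\<^bsup>p^e l\<^esup>\<close>.\<close>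

locale jump_chain =
  fixes p :: nat and I :: "nat => nat => 'b set"
  assumes prime_p: "Factorial_Ring.prime p"
    and antimono: "m \<le> m' ==> I e m' \<subseteq> I e m"
    and refine: "I (e + a) (m * p ^ a) = I e m"
    and finite_values: "finite {I e m | e m. m \<le> p ^ e}"
    and right_cont: "\<exists>a. I e m \<subseteq> I (e + a) (m * p ^ a + 1)"
    and suffix: "I e m \<subseteq> I e (m + 1) ==> I (e + a) (m + p ^ e * l) \<subseteq> I (e + a) (m + p ^ e * l + 1)"
begin

lemma p2: "p \<ge> 2" using prime_p by (rule prime_ge_2_nat)
lemma p_pos [simp]: "p > 0" "p \<noteq> 0" using p2 by auto
lemma p0: "real p > 0" using p2 by simp
lemma pe0: "real p ^ e > 0" using p0 by simp

definition T :: "real => 'b set" where "T r = (\<Union>e. I e (nat \<lceil>r * real p ^ e\<rceil>))"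

definition S :: "nat => nat set" where "S e = {m. m < p ^ e \<and> I e m \<noteq> I e (m + 1)}"

definition jump :: "real => bool" where
  "jump r \<longleftrightarrow> r > 0 \<and> (\<forall>\<epsilon>>0. r - \<epsilon> > 0 --> T (r - \<epsilon>) \<noteq> T r)"

definition J :: "real set" where "J = {r. jump r \<and> r \<le> 1}"

lemma I_increasing:
  assumes "r \<ge> 0"
  shows "I e (nat \<lceil>r * real p ^ e\<rceil>) \<subseteq> I (e + a) (nat \<lceil>r * real p ^ (e + a)\<rceil>)"
proof -
  have "r * real p ^ (e + a) = (r * real p ^ e) * real (p ^ a)" by (simp add: power_add)
  also have "\<dots> \<le> real (nat \<lceil>r * real p ^ e\<rceil>) * real (p ^ a)"
    by (intro mult_right_mono real_nat_ceiling_ge) simp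
  finally have "nat \<lceil>r * real p ^ (e + a)\<rceil> \<le> nat \<lceil>r * real p ^ e\<rceil> * p ^ a"
    unfolding nat_ceiling_le_eq of_nat_mult .
  then have "I (e + a) (nat \<lceil>r * real p ^ e\<rceil> * p ^ a) \<subseteq> I (e + a) (nat \<lceil>r * real p ^ (e + a)\<rceil>)"
    by (rule antimono)
  then show ?thesis unfolding refine .
qed

lemma T_dyadic: "T (real m / real p ^ e) = I e m"
proof
  have eq: "nat \<lceil>real m / real p ^ e * real p ^ (e + a)\<rceil> = m * p ^ a" for a
  proof -
    have "real m / real p ^ e * real p ^ (e + a) = real (m * p ^ a)"
      using p0 by (simp add: power_add)
    then show ?thesis by (simp only: ceiling_of_nat nat_int)
  qed
  show "T (real m / real p ^ e) \<subseteq> I e m"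
    unfolding T_def
  proof (rule UN_least)
    fix e'
    have "I e' (nat \<lceil>real m / real p ^ e * real p ^ e'\<rceil>) \<subseteq> I (e' + e) (nat \<lceil>real m / real p ^ e * real p ^ (e' + e)\<rceil>)"
      by (rule I_increasing) simp
    also have "\<dots> = I e m" unfolding add.commute[of e' e] eq by (rule refine)
    finally show "I e' (nat \<lceil>real m / real p ^ e * real p ^ e'\<rceil>) \<subseteq> I e m" .
  qed
  have "I e m = I e (nat \<lceil>real m / real p ^ e * real p ^ e\<rceil>)" using eq[of 0] by simp
  then show "I e m \<subseteq> T (real m / real p ^ e)" unfolding T_def by blast
qed

lemma T_antimono: "r \<le> s ==> T s \<subseteq> T r"
proof -
  assume "r \<le> s"
  then have "nat \<lceil>r * real p ^ e\<rceil> \<le> nat \<lceil>s * real p ^ e\<rceil>" for e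
    using pe0[of e] by (intro nat_mono ceiling_mono) simp
  then show ?thesis unfolding T_def using antimono by blast
qed

lemma T_right_cont:
  assumes "r \<ge> 0" "x \<in> T r"
  shows "\<exists>s>r. x \<in> T s"
proof -
  obtain e where e: "x \<in> I e (nat \<lceil>r * real p ^ e\<rceil>)" using assms by (auto simp: T_def)
  define m where "m = nat \<lceil>r * real p ^ e\<rceil>"
  obtain a where a: "I e m \<subseteq> I (e + a) (m * p ^ a + 1)" using right_cont by blast
  have "r * real p ^ e \<le> real m" unfolding m_def by (rule real_nat_ceiling_ge)
  then have "r * real p ^ (e + a) \<le> real m * real p ^ a"
    using pe0[of a] by (simp add: power_add mult.assoc[symmetric])
  then have "r * real p ^ (e + a) < real (m * p ^ a + 1)" by simp
  then have "r < real (m * p ^ a + 1) / real p ^ (e + a)" using pe0[of "e + a"] by (simp add: pos_less_divide_eq)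
  moreover have "x \<in> T (real (m * p ^ a + 1) / real p ^ (e + a))"
    unfolding T_dyadic using e a by (auto simp: m_def)
  ultimately show ?thesis by blast
qed

text \<open>Among the parameters in \<open>[m/p\<^sup>e, (m+1)/p\<^sup>e]\<close> with the same ideal as the right end there is a
  smallest one, by right continuity; this is the jump.\<close>

lemma S_jump:
  assumes m: "m \<in> S e"
  shows "\<exists>r\<in>J. real m < r * real p ^ e \<and> r * real p ^ e \<le> real m + 1"
proof -
  define u v where "u = real m / real p ^ e" and "v = real (m + 1) / real p ^ e"
  have uv: "u < v" "0 \<le> u" unfolding u_def v_def using pe0[of e] by (auto simp: divide_strict_right_mono)
  have v1: "v \<le> 1"
  proof -
    have "real (m + 1) \<le> real (p ^ e)" using m unfolding of_nat_le_iff S_def by simp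
    then show ?thesis unfolding v_def using pe0[of e] by (simp add: divide_le_eq)
  qed
  have Tuv: "T u \<noteq> T v" using m unfolding u_def v_def T_dyadic by (simp add: S_def)
  define A where "A = {x. u \<le> x \<and> x \<le> v \<and> T x = T v}"
  have A: "v \<in> A" "bdd_below A" using uv by (auto simp: A_def intro!: bdd_belowI[of _ u])
  define r where "r = Inf A"
  have ru: "u \<le> r" unfolding r_def by (rule cInf_greatest) (use A in \<open>auto simp: A_def\<close>)
  have rv: "r \<le> v" unfolding r_def by (rule cInf_lower) (use A in auto)
  have Tr: "T r = T v"
  proof
    show "T v \<subseteq> T r" using T_antimono[OF rv] .
    show "T r \<subseteq> T v"
    proof
      fix x assume "x \<in> T r"
      then obtain s where s: "s > r" "x \<in> T s" using T_right_cont[of r x] ru uv(2) by auto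
      obtain y where y: "y \<in> A" "y < s" using s(1) cInf_less_iff[of A s] A unfolding r_def by blast
      then show "x \<in> T v" using s(2) T_antimono[of y s] by (auto simp: A_def)
    qed
  qed
  have "r \<noteq> u" using Tr Tuv by auto
  then have ru': "u < r" using ru by simp
  have "T (r - \<epsilon>) \<noteq> T r" if \<epsilon>: "\<epsilon> > 0" "r - \<epsilon> > 0" for \<epsilon>
  proof
    assume eq: "T (r - \<epsilon>) = T r"
    show False
    proof (cases "u \<le> r - \<epsilon>")
      case True
      then have "r - \<epsilon> \<in> A" using eq Tr rv \<epsilon> by (auto simp: A_def)
      then have "r \<le> r - \<epsilon>" unfolding r_def by (rule cInf_lower) (rule A)
      then show False using \<epsilon> by simp
    next
      case False
      have "T u \<subseteq> T (r - \<epsilon>)" by (rule T_antimono) (use False in simp)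
      moreover have "T r \<subseteq> T u" by (rule T_antimono[OF ru])
      ultimately show False using eq Tr Tuv by auto
    qed
  qed
  then have "r \<in> J" using ru' uv rv v1 by (auto simp: J_def jump_def)
  moreover have "real m < r * real p ^ e" using ru' pe0[of e] by (simp add: u_def pos_divide_less_eq)
  moreover have "r * real p ^ e \<le> real m + 1" using rv pe0[of e] by (simp add: v_def pos_le_divide_eq)
  ultimately show ?thesis by blast
qed

lemma jump_S:
  assumes r: "jump r" and m: "real m < r * real p ^ e" "r * real p ^ e \<le> real m + 1" "m < p ^ e"
  shows "m \<in> S e"
proof -
  define u v where "u = real m / real p ^ e" and "v = real (m + 1) / real p ^ e"
  have uv: "u < r" "r \<le> v" using m pe0[of e] by (auto simp: u_def v_def pos_divide_less_eq pos_le_divide_eq)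
  have "r > 0" using r by (simp add: jump_def)
  \<comment> \<open>any step back to a point at least \<open>u\<close> that stays positive\<close>
  define \<epsilon> where "\<epsilon> = r - max u (r / 2)"
  have "\<epsilon> > 0" "r - \<epsilon> > 0" using uv \<open>r > 0\<close> by (auto simp: \<epsilon>_def)
  then have "T (r - \<epsilon>) \<noteq> T r" using r by (simp add: jump_def)
  moreover have "T r \<subseteq> T (r - \<epsilon>)" by (rule T_antimono) (use \<open>\<epsilon> > 0\<close> in simp)
  moreover have "T (r - \<epsilon>) \<subseteq> T u" by (rule T_antimono) (simp add: \<epsilon>_def)
  moreover have "T v \<subseteq> T r" by (rule T_antimono[OF uv(2)])
  ultimately have "T u \<noteq> T v" by blast
  then show ?thesis using m(3) unfolding u_def v_def T_dyadic by (simp add: S_def)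
qed

text \<open>Distinct jumps have distinct ideals, all of which are among the finitely many values.\<close>

lemma J_finite: "finite J"
proof (rule inj_on_finite[where f = T])
  show "inj_on T J"
  proof (rule linorder_inj_onI')
    fix r s assume rs: "r \<in> J" "s \<in> J" "r < s"
    have "\<forall>\<epsilon>>0. s - \<epsilon> > 0 --> T (s - \<epsilon>) \<noteq> T s" using rs(2) by (simp add: J_def jump_def)
    from spec[OF this, of "s - r"] show "T r \<noteq> T s" using rs by (simp add: J_def jump_def)
  qed
  show "T ` J \<subseteq> {I e m | e m. m \<le> p ^ e}"
  proof
    fix X assume "X \<in> T ` J"
    then obtain r where r: "X = T r" "0 < r" "r \<le> 1" by (auto simp: J_def jump_def)
    define A where "A = range (\<lambda>e. I e (nat \<lceil>r * real p ^ e\<rceil>))"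
    have "nat \<lceil>r * real p ^ e\<rceil> \<le> p ^ e" for e
    proof -
      have "r * real p ^ e \<le> real (p ^ e)" using r mult_right_mono[of r 1 "real p ^ e"] by simp
      then show ?thesis by (simp add: nat_le_iff ceiling_le_iff)
    qed
    then have sub: "A \<subseteq> {I e m | e m. m \<le> p ^ e}" unfolding A_def by blast
    have "finite A" by (rule finite_subset[OF sub finite_values])
    moreover have "A \<noteq> {}" by (simp add: A_def)
    ultimately
    obtain M where M: "M \<in> A" "\<And>N. N \<in> A ==> M \<subseteq> N ==> M = N"
      using finite_has_maximal[of A] by metis
    then obtain e where e: "M = I e (nat \<lceil>r * real p ^ e\<rceil>)" by (auto simp: A_def)
    have "N \<subseteq> M" if "N \<in> A" for N
    proof -
      obtain e' where e': "N = I e' (nat \<lceil>r * real p ^ e'\<rceil>)" using \<open>N \<in> A\<close> by (auto simp: A_def)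
      define L where "L = I (e + e') (nat \<lceil>r * real p ^ (e + e')\<rceil>)"
      have "M \<subseteq> L" "N \<subseteq> L" "L \<in> A"
        unfolding L_def A_def e e' using I_increasing[of r e e'] I_increasing[of r e' e] r(2)
        by (simp_all add: add.commute)
      then show ?thesis using M(2) by blast
    qed
    then have "\<Union>A = M" using M(1) by blast
    then have "T r = M" by (simp add: T_def A_def)
    then show "X \<in> {I e m | e m. m \<le> p ^ e}" using M(1) sub r(1) by blast
  qed
qed (rule finite_values)

lemma S_suffix:
  assumes "m \<in> S (e + a)"
  shows "m mod p ^ e \<in> S e"
proof (rule ccontr)
  assume *: "m mod p ^ e \<notin> S e"
  have "m mod p ^ e < p ^ e" using p2 by simp
  with * have "I e (m mod p ^ e) = I e (m mod p ^ e + 1)" by (simp add: S_def)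
  then have "I (e + a) (m mod p ^ e + p ^ e * (m div p ^ e)) \<subseteq> I (e + a) (m mod p ^ e + p ^ e * (m div p ^ e) + 1)"
    by (intro suffix) simp
  then have "I (e + a) m \<subseteq> I (e + a) (m + 1)" by simp
  then show False using antimono[of m "m + 1" "e + a"] assms by (auto simp: S_def)
qed

text \<open>Fractional parts of \<open>p\<^sup>e r\<close>, taken in \<open>(0,1]\<close>, are again jumps. For each \<open>a\<close>, the largest
  integer less than \<open>p\<^bsup>e+a\<^esup> r\<close> is in \<open>S (e + a)\<close>, hence its residue modulo \<open>p\<^sup>a\<close> is in \<open>S a\<close> (\<open>S_suffix\<close>); so \<open>J\<close> has an
  element at distance less than \<open>p\<^bsup>-a\<^esup>\<close> from the fractional part, and \<open>J\<close> is finite.\<close>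

lemma J_shift:
  assumes r: "r \<in> J" and c: "of_int c < r * real p ^ e" "r * real p ^ e \<le> of_int c + 1"
  shows "r * real p ^ e - of_int c \<in> J"
proof (rule ccontr)
  define s where "s = r * real p ^ e - of_int c"
  assume "r * real p ^ e - of_int c \<notin> J"
  then have sJ: "s \<notin> J" by (simp add: s_def)
  have rr: "jump r" "0 < r" "r \<le> 1" using r by (auto simp: J_def jump_def)
  obtain \<delta> where \<delta>: "\<delta> > 0" "\<And>t. t \<in> J ==> \<delta> \<le> \<bar>t - s\<bar>"
  proof -
    have sep: "\<exists>\<delta>>0. \<forall>t\<in>J'. \<delta> \<le> \<bar>t - s\<bar>" if "finite J'" "s \<notin> J'" for J' :: "real set"
      using that
    proof (induction J')
      case (insert t J')
      then obtain \<delta> where d: "\<delta> > 0" "\<forall>t\<in>J'. \<delta> \<le> \<bar>t - s\<bar>" by auto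
      then show ?case using insert.prems by (intro exI[of _ "min \<delta> \<bar>t - s\<bar>"]) auto
    qed (auto intro: exI[of _ 1])
    from sep[OF J_finite sJ] that show ?thesis by metis
  qed
  obtain a where a: "1 / \<delta> < real p ^ a" using real_arch_pow[of "real p" "1 / \<delta>"] p2 by auto
  define y where "y = r * real p ^ (e + a)"
  define M where "M = nat (\<lceil>y\<rceil> - 1)"
  have y0: "y > 0" using rr pe0 by (simp add: y_def)
  then have Mint: "int M = \<lceil>y\<rceil> - 1" by (simp add: M_def)
  have My: "real M < y" "y \<le> real M + 1"
  proof -
    have "real M = of_int (\<lceil>y\<rceil> - 1)" using Mint by (metis of_int_of_nat_eq)
    then show "real M < y" "y \<le> real M + 1" by linarith+
  qed
  have "y \<le> real (p ^ (e + a))" using rr mult_right_mono[of r 1 "real p ^ (e + a)"] by (simp add: y_def)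
  then have "real M < real (p ^ (e + a))" using My by linarith
  then have "M \<in> S (e + a)" using rr My by (intro jump_S[of r]) (auto simp: y_def)
  then have "M mod p ^ a \<in> S a" using S_suffix[of M a e] by (simp add: add.commute)
  then obtain t where t: "t \<in> J" "real (M mod p ^ a) < t * real p ^ a" "t * real p ^ a \<le> real (M mod p ^ a) + 1"
    using S_jump by blast
  have ys: "y = (s + of_int c) * real p ^ a" by (simp add: y_def s_def power_add)
  have s01: "0 < s" "s \<le> 1" using c by (auto simp: s_def)
  have Mc: "int (M mod p ^ a) = int M - c * int (p ^ a)"
  proof -
    have "of_int (c * int (p ^ a)) < y" using s01 pe0[of a] by (simp add: ys distrib_right)
    then have 1: "c * int (p ^ a) \<le> int M" using Mint by linarith
    have "s * real p ^ a \<le> 1 * real p ^ a" using s01 pe0[of a] by (intro mult_right_mono) auto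
    then have "y \<le> of_int ((c + 1) * int (p ^ a))" by (simp add: ys distrib_right)
    then have 2: "int M < (c + 1) * int (p ^ a)" using Mint by linarith
    have "int M mod int (p ^ a) = (int M - c * int (p ^ a)) mod int (p ^ a)" by (simp add: mod_diff_eq[symmetric])
    also have "\<dots> = int M - c * int (p ^ a)" using 1 2 by (intro mod_pos_pos_trivial) (auto simp: distrib_right)
    finally show ?thesis by (simp add: zmod_int)
  qed
  have "real (M mod p ^ a) = real M - of_int c * real p ^ a"
    using arg_cong[OF Mc, of real_of_int] by simp
  then have "real (M mod p ^ a) < s * real p ^ a" "s * real p ^ a \<le> real (M mod p ^ a) + 1"
    using My by (simp_all add: ys distrib_right)
  then have "\<bar>(t - s) * real p ^ a\<bar> < 1" using t by (simp add: left_diff_distrib)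
  then have "\<bar>t - s\<bar> * real p ^ a < 1" using pe0[of a] by (simp add: abs_mult)
  moreover have "1 < \<delta> * real p ^ a" using a \<delta>(1) by (simp add: pos_divide_less_eq mult.commute)
  moreover have "\<delta> * real p ^ a \<le> \<bar>t - s\<bar> * real p ^ a" using \<delta>(2)[OF t(1)] pe0[of a] by simp
  ultimately show False by linarith
qed

end

lemma padic_ints_mod:
  assumes z: "z \<in> padic_ints p" and le: "n \<le> m"
  shows "z m mod int p ^ n = z n"
  using le
proof (induction m rule: dec_induct)
  case base
  then show ?case using z by (simp add: padic_ints_def)
next
  case (step m)
  have "z (Suc m) mod int p ^ n = (z (Suc m) mod int p ^ m) mod int p ^ n"
    using step.hyps by (simp add: mod_mod_cancel le_imp_power_dvd)
  also have "z (Suc m) mod int p ^ m = z m" using z by (simp add: padic_ints_def)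
  finally show ?case using step.IH by simp
qed

lemma padic_nat_mod:
  assumes z: "z \<in> padic_ints p" and le: "n \<le> m"
  shows "nat (z m) mod p ^ n = nat (z n)"
proof -
  have "z m \<ge> 0" using z by (simp add: padic_ints_def)
  then show ?thesis unfolding padic_ints_mod[OF z le, symmetric] by (simp add: nat_mod_distrib nat_power_eq)
qed

lemma padic_of_neg_rat_eq:
  assumes p: "Factorial_Ring.prime p" and q: "quotient_of r = (a, b)" "\<not> int p dvd b"
    and x: "0 \<le> x" "x < int p ^ n" "int p ^ n dvd a + x * b"
  shows "padic_of_rat p (- r) n = x"
proof -
  have cop: "coprime (int p ^ n) b"
    using p q(2) prime_imp_coprime[of "int p" b] by simp
  have "quotient_of (- r) = (- a, b)" using q(1) by (simp add: rat_uminus_code)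
  then have "padic_of_rat p (- r) n = (THE r. 0 \<le> r \<and> r < int p ^ n \<and> int p ^ n dvd - a - r * b)"
    by (simp add: padic_of_rat_def)
  also have "\<dots> = x"
  proof (rule the_equality)
    have "- a - x * b = - (a + x * b)" by simp
    then show "0 \<le> x \<and> x < int p ^ n \<and> int p ^ n dvd - a - x * b" using x by (metis dvd_minus_iff)
    fix y assume y: "0 \<le> y \<and> y < int p ^ n \<and> int p ^ n dvd - a - y * b"
    have "int p ^ n dvd (- a - y * b) + (a + x * b)" using x(3) y by (blast intro: dvd_add)
    then have "int p ^ n dvd (x - y) * b" by (simp add: algebra_simps)
    then have "int p ^ n dvd x - y" using cop coprime_dvd_mult_left_iff by blast
    then have "x mod int p ^ n = y mod int p ^ n" by (simp add: mod_eq_dvd_iff)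
    then show "y = x" using x(1,2) y by simp
  qed
  finally show ?thesis .
qed

lemma padic_of_neg_rat:
  assumes p: "Factorial_Ring.prime p" and q: "quotient_of r = (a, b)" "\<not> int p dvd b"
  shows "padic_of_rat p (- r) \<in> padic_ints p"
    and "0 \<le> padic_of_rat p (- r) n \<and> padic_of_rat p (- r) n < int p ^ n \<and> int p ^ n dvd a + padic_of_rat p (- r) n * b"
proof -
  have pn: "int p ^ n > 0" for n using p prime_gt_0_nat by simp
  have *: "0 \<le> padic_of_rat p (- r) n \<and> padic_of_rat p (- r) n < int p ^ n \<and> int p ^ n dvd a + padic_of_rat p (- r) n * b" for n
  proof -
    have "coprime (int p ^ n) b" using p q(2) prime_imp_coprime[of "int p" b] by simp
    then obtain u v where uv: "u * int p ^ n + v * b = 1" using bezout_int[of "int p ^ n" b] by auto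
    define x where "x = (- a * v) mod int p ^ n"
    have "a + (- a * v) * b = a * (u * int p ^ n)"
    proof -
      have "a + (- a * v) * b = a * (1 - v * b)" by (simp add: algebra_simps)
      also have "1 - v * b = u * int p ^ n" using uv by simp
      finally show ?thesis .
    qed
    then have "int p ^ n dvd a + (- a * v) * b" by simp
    moreover have "(a + (- a * v) * b) mod int p ^ n = (a + x * b) mod int p ^ n"
      unfolding x_def by (metis mod_add_right_eq mod_mult_left_eq)
    ultimately have "int p ^ n dvd a + x * b" by (simp add: dvd_eq_mod_eq_0)
    moreover have "0 \<le> x" "x < int p ^ n" using pn[of n] by (auto simp: x_def)
    ultimately show ?thesis using padic_of_neg_rat_eq[OF p q, of x n] by simp
  qed
  show "0 \<le> padic_of_rat p (- r) n \<and> padic_of_rat p (- r) n < int p ^ n \<and> int p ^ n dvd a + padic_of_rat p (- r) n * b"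
    by (rule *)
  have "padic_of_rat p (- r) (Suc n) mod int p ^ n = padic_of_rat p (- r) n" for n
  proof -
    let ?y = "padic_of_rat p (- r) (Suc n)"
    have "int p ^ n dvd a + ?y * b" using *[of "Suc n"] dvd_trans[OF le_imp_power_dvd[of n "Suc n" "int p"]] by auto
    moreover have "(a + (?y mod int p ^ n) * b) mod int p ^ n = (a + ?y * b) mod int p ^ n"
      by (metis mod_add_right_eq mod_mult_left_eq)
    ultimately have "int p ^ n dvd a + (?y mod int p ^ n) * b" by (simp add: dvd_eq_mod_eq_0)
    then show ?thesis using padic_of_neg_rat_eq[OF p q, of "?y mod int p ^ n" n] pn[of n] by simp
  qed
  then show "padic_of_rat p (- r) \<in> padic_ints p" unfolding padic_ints_def using * by auto
qed

lemma period_of_coprime: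
  assumes p: "coprime (int p) b" "b > 0"
  shows "\<exists>N>0. b dvd int p ^ N - 1"
proof -
  have "range (\<lambda>i. int p ^ i mod b) \<subseteq> {0..<b}" using p(2) by auto
  then have "finite (range (\<lambda>i. int p ^ i mod b))" using finite_subset by blast
  then have "\<not> inj (\<lambda>i. int p ^ i mod b)" using finite_imageD infinite_UNIV_nat by blast
  then obtain i j where "int p ^ i mod b = int p ^ j mod b" "i < j"
    by (metis (mono_tags, lifting) injI linorder_neqE_nat)
  then have "b dvd int p ^ j - int p ^ i" by (metis mod_eq_dvd_iff)
  also have "int p ^ j - int p ^ i = (int p ^ (j - i) - 1) * int p ^ i"
    using \<open>i < j\<close> by (simp add: left_diff_distrib power_add[symmetric])
  finally have "b dvd int p ^ (j - i) - 1" using p(1) by (simp add: coprime_dvd_mult_left_iff coprime_commute)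
  then show ?thesis using \<open>i < j\<close> by (intro exI[of _ "j - i"]) auto
qed

context jump_chain
begin

text \<open>For each \<open>e\<close> there are jumps \<open>l\<^sub>e\<close> and \<open>u\<^sub>e = p\<^sup>e l\<^sub>e - z\<^sub>e\<close>, where \<open>z\<^sub>e = z mod p\<^sup>e\<close>. As \<open>J\<close> is finite, some pair
  \<open>(l, u)\<close> occurs infinitely often. Two occurrences show that \<open>l\<close> and \<open>u\<close> are rational with denominator
  dividing \<open>B = p\<^sup>N - 1\<close>, and \<open>z\<^sub>e + u = p\<^sup>e l\<close> for infinitely many \<open>e\<close> shows \<open>z = -u\<close>.\<close>

lemma padic_root_imp_jump:
  assumes z: "z \<in> padic_ints p" and zS: "\<And>e. nat (z e) \<in> S e"
  shows "\<exists>r. jump (real_of_rat r) \<and> 0 < r \<and> r \<le> 1 \<and> r \<in> rat_local p \<and> z = padic_of_rat p (- r)"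
proof -
  have z0: "z e \<ge> 0" "z e < int p ^ e" for e using z by (auto simp: padic_ints_def)
  have "\<forall>e. \<exists>l\<in>J. of_int (z e) < l * real p ^ e \<and> l * real p ^ e \<le> of_int (z e) + 1"
    using S_jump[OF zS] z0 by auto
  then obtain l where l: "\<And>e. l e \<in> J" "\<And>e. of_int (z e) < l e * real p ^ e"
    "\<And>e. l e * real p ^ e \<le> of_int (z e) + 1" by metis
  define u where "u = (\<lambda>e. l e * real p ^ e - of_int (z e))"
  have u: "u e \<in> J" for e unfolding u_def using l by (intro J_shift)
  have "(\<lambda>e. (l e, u e)) ` UNIV \<subseteq> J \<times> J" using l u by auto
  then have "finite ((\<lambda>e. (l e, u e)) ` UNIV)" using J_finite finite_subset by blast
  then obtain e0 where inf: "infinite {e. (l e, u e) = (l e0, u e0)}"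
    using pigeonhole_infinite[of UNIV "\<lambda>e. (l e, u e)"] by auto
  define E where "E = {e. (l e, u e) = (l e0, u e0)}"
  have E: "l e0 * real p ^ e = of_int (z e) + u e0" if "e \<in> E" for e
    using that by (auto simp: E_def u_def)
  have Einf: "\<exists>e\<in>E. e > n" for n using inf unfolding E_def[symmetric] infinite_nat_iff_unbounded by blast
  obtain e1 where e1: "e1 \<in> E" "e1 > e0" using Einf by blast
  have e0: "e0 \<in> E" by (simp add: E_def)
  define N where "N = e1 - e0"
  define B where "B = int p ^ N - 1"
  have N: "N > 0" using e1 by (simp add: N_def)
  have pB: "\<not> int p dvd B"
  proof
    assume "int p dvd B"
    moreover have "int p dvd int p ^ N" using N by simp
    ultimately have "int p dvd int p ^ N - B" using dvd_diff by blast
    then show False using p2 by (simp add: B_def)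
  qed
  have B0: "B > 0" using N p2 one_less_power[of "int p" N] by (simp add: B_def)
  have "int p ^ e0 dvd z e1 - z e0"
    using padic_ints_mod[OF z, of e0 e1] e1(2) by (metis less_imp_le mod_eq_dvd_iff mod_mod_trivial)
  then obtain k where k: "z e1 - z e0 = int p ^ e0 * k" by blast
  have "l e0 * real_of_int B * real p ^ e0 = l e0 * real p ^ e1 - l e0 * real p ^ e0"
    using e1(2) by (simp add: B_def N_def right_diff_distrib left_diff_distrib mult.assoc power_add[symmetric])
  also have "\<dots> = of_int (z e1 - z e0)" using E[OF e1(1)] E[OF e0] by simp
  also have "\<dots> = of_int k * real p ^ e0" by (simp add: k)
  finally have lB: "l e0 * real_of_int B = of_int k" using pe0[of e0] by simp
  \<comment> \<open>the numerator of \<open>u\<close> over the denominator \<open>B\<close>\<close>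
  define c where "c = int p ^ e0 * k - z e0 * B"
  have uB: "u e0 * real_of_int B = of_int c"
  proof -
    have "u e0 * real_of_int B = (l e0 * real_of_int B) * real p ^ e0 - of_int (z e0) * of_int B"
      using E[OF e0] by (simp add: algebra_simps)
    then show ?thesis by (simp add: lB c_def)
  qed
  define r where "r = Fract c B"
  have rB: "r * of_int B = of_int c" using B0 by (simp add: r_def Fract_of_int_quotient)
  have ru: "real_of_rat r = u e0"
  proof -
    have "real_of_rat r * of_int B = u e0 * of_int B"
      using arg_cong[OF rB, of real_of_rat] by (simp add: of_rat_mult uB)
    then show ?thesis using B0 by simp
  qed
  obtain a b where ab: "quotient_of r = (a, b)" by fastforce
  have b0: "b > 0" and cop: "coprime a b" and rab: "r = of_int a / of_int b"
    using ab quotient_of_denom_pos quotient_of_coprime quotient_of_div by blast+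
  have "of_int (a * B) = (of_int (c * b) :: rat)" using rB b0 by (simp add: rab field_simps)
  then have aB: "a * B = c * b" by (simp only: of_int_eq_iff)
  then have "b dvd a * B" by simp
  then have "b dvd B" using cop by (simp add: coprime_dvd_mult_right_iff coprime_commute)
  then obtain t where t: "B = b * t" by blast
  then have ct: "c = a * t" using aB b0 by simp
  have pt: "\<not> int p dvd t" and pb: "\<not> int p dvd b" using pB by (auto simp: t)
  have "padic_of_rat p (- r) n = z n" for n
  proof (rule padic_of_neg_rat_eq[OF prime_p ab pb])
    show "0 \<le> z n" "z n < int p ^ n" using z0 by auto
    obtain e where e: "e \<in> E" "e > n" using Einf by blast
    have "real_of_int (z e * B + c) = (of_int (z e) + u e0) * of_int B" by (simp add: distrib_right uB)
    also have "\<dots> = of_int (int p ^ e * k)" unfolding E[OF e(1), symmetric] using lB by (simp add: mult.assoc mult.commute[of "real p ^ e"])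
    finally have "z e * B + c = int p ^ e * k" by (simp only: of_int_eq_iff)
    then have "int p ^ e dvd (a + z e * b) * t" by (simp add: t ct algebra_simps)
    moreover have "coprime (int p ^ e) t" using prime_p pt prime_imp_coprime[of "int p" t] by simp
    ultimately have "int p ^ e dvd a + z e * b" by (simp add: coprime_dvd_mult_left_iff)
    then have "int p ^ n dvd a + z e * b" using e(2) by (meson dvd_trans le_imp_power_dvd less_imp_le)
    moreover have "(a + z e * b) mod int p ^ n = (a + z n * b) mod int p ^ n"
      using padic_ints_mod[OF z, of n e] e(2) by (metis less_imp_le mod_add_right_eq mod_mult_left_eq)
    ultimately show "int p ^ n dvd a + z n * b" by (simp add: dvd_eq_mod_eq_0)
  qed
  then have "z = padic_of_rat p (- r)" by auto
  moreover have "jump (real_of_rat r)" "real_of_rat r > 0" "real_of_rat r \<le> 1"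
    using u[of e0] by (auto simp: ru J_def jump_def)
  moreover have "r \<in> rat_local p" using ab pb by (simp add: rat_local_def)
  ultimately show ?thesis by (intro exI[of _ r]) (simp add: zero_less_of_rat_iff of_rat_le_1_iff)
qed

text \<open>If the denominator of \<open>r\<close> divides \<open>p\<^sup>e - 1\<close>, then \<open>-r mod p\<^sup>e\<close> is \<open>m = (p\<^sup>e - 1) r\<close>, and \<open>r\<close> lies in
  \<open>(m/p\<^sup>e, (m+1)/p\<^sup>e]\<close>. Such \<open>e\<close> are unbounded, and the other residues are suffixes.\<close>

lemma jump_imp_padic_root:
  assumes r: "jump (real_of_rat r)" "r \<le> 1" "r \<in> rat_local p"
  shows "padic_of_rat p (- r) \<in> padic_ints p" "nat (padic_of_rat p (- r) n) \<in> S n"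
proof -
  obtain a b where ab: "quotient_of r = (a, b)" by fastforce
  have pb: "\<not> int p dvd b" using r(3) ab by (simp add: rat_local_def)
  have b0: "b > 0" and rab: "r = of_int a / of_int b"
    using ab quotient_of_denom_pos quotient_of_div by blast+
  have r0: "0 < real_of_rat r" "real_of_rat r \<le> 1" using r(1,2) by (auto simp: jump_def of_rat_le_1_iff)
  show zp: "padic_of_rat p (- r) \<in> padic_ints p" by (rule padic_of_neg_rat[OF prime_p ab pb])
  have "coprime (int p) b" using prime_p pb prime_imp_coprime[of "int p" b] by simp
  then obtain N where N: "N > 0" "b dvd int p ^ N - 1" using period_of_coprime b0 by blast
  \<comment> \<open>a multiple of the period \<open>N\<close> that is at least \<open>n\<close>\<close>
  define e where "e = N * n"
  have "int p ^ N - 1 dvd (int p ^ N) ^ n - 1 ^ n" using power_diff_sumr2 dvd_triv_left by metis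
  then have "b dvd int p ^ e - 1" using N(2) by (simp add: e_def power_mult) (meson dvd_trans)
  then obtain t where t: "int p ^ e - 1 = b * t" by blast
  define m where "m = a * t"
  have mr: "real_of_int m = (real p ^ e - 1) * real_of_rat r"
  proof -
    have "real p ^ e - 1 = of_int b * of_int t" using arg_cong[OF t, of real_of_int] by simp
    moreover have "real_of_rat r = of_int a / of_int b" by (simp add: rab of_rat_divide)
    ultimately show ?thesis using b0 by (simp add: m_def)
  qed
  have pe1: "real p ^ e \<ge> 1" using p2 by (intro one_le_power) simp
  have m0: "m \<ge> 0" using mr pe1 r0 by (metis diff_ge_0_iff_ge less_imp_le of_int_0_le_iff mult_nonneg_nonneg)
  have me: "real_of_int m \<le> real p ^ e - 1" unfolding mr using pe1 r0 mult_left_mono[of "real_of_rat r" 1 "real p ^ e - 1"] by simp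
  then have "real_of_int m < real_of_int (int p ^ e)" by simp
  then have mlt: "m < int p ^ e" by (simp only: of_int_less_iff)
  have "a + m * b = a * (1 + b * t)" by (simp add: m_def algebra_simps)
  also have "1 + b * t = int p ^ e" using t by simp
  finally have "padic_of_rat p (- r) e = m"
    using padic_of_neg_rat_eq[OF prime_p ab pb m0 mlt] by simp
  moreover have "nat m \<in> S e"
  proof (rule jump_S[OF r(1)])
    have *: "real (nat m) = real_of_rat r * real p ^ e - real_of_rat r" using m0 mr by (simp add: algebra_simps)
    show "real (nat m) < real_of_rat r * real p ^ e" "real_of_rat r * real p ^ e \<le> real (nat m) + 1"
      unfolding * using r0 by linarith+
    show "nat m < p ^ e" using mlt m0 by (simp add: nat_less_iff)
  qed
  ultimately have "nat (padic_of_rat p (- r) e) \<in> S (n + (e - n))" using N(1) by (simp add: e_def)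
  then have "nat (padic_of_rat p (- r) e) mod p ^ n \<in> S n" by (rule S_suffix)
  moreover have "nat (padic_of_rat p (- r) e) mod p ^ n = nat (padic_of_rat p (- r) n)"
    using N(1) by (intro padic_nat_mod[OF zp]) (simp add: e_def)
  ultimately show "nat (padic_of_rat p (- r) n) \<in> S n" by simp
qed

end

section \<open>Differential operators in characteristic \<open>p\<close>\<close>

primrec ad_iter :: "('s, 'y) ring_scheme => ('s => 's) => 's => nat => 's => 's" where
  "ad_iter S P a 0 = P"
| "ad_iter S P a (Suc j) = commutator_with S (ad_iter S P a j) a"

text \<open>Operators of order less than \<open>n\<close>; starting with the zero operator makes all steps of the
  recursion alike.\<close>

primrec diff_ops_below :: "('s, 'y) ring_scheme => 's set => nat => ('s => 's) set" where
  "diff_ops_below S K 0 = {\<lambda>x\<in>carrier S. \<zero>\<^bsub>S\<^esub>}"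
| "diff_ops_below S K (Suc n) = diff_ops_upto S K n"

context cring begin

lemma diff_ops_below_Suc:
  "diff_ops_below R K (Suc n) =
     {P \<in> linear_operators R K. \<forall>a\<in>carrier R. commutator_with R P a \<in> diff_ops_below R K n}"
proof (cases n)
  case 0
  have "commutator_with R P a = (\<lambda>x\<in>carrier R. \<zero>) \<longleftrightarrow> (\<forall>x\<in>carrier R. P (a \<otimes> x) = a \<otimes> P x)"
    if "P \<in> linear_operators R K" "a \<in> carrier R" for P a
  proof -
    have "P x \<in> carrier R" if "x \<in> carrier R" for x
      using \<open>P \<in> linear_operators R K\<close> that by (auto simp: linear_operators_def)
    then show ?thesis using that(2) by (auto simp: commutator_with_def fun_eq_iff restrict_def)
  qed
  then show ?thesis by (auto simp: 0)
qed simp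

lemma below_SucI:
  "[|P \<in> linear_operators R K; \<And>a. a \<in> carrier R ==> commutator_with R P a \<in> diff_ops_below R K n|] ==>
     P \<in> diff_ops_below R K (Suc n)"
  unfolding diff_ops_below_Suc by blast

lemma below_SucD:
  "P \<in> diff_ops_below R K (Suc n) ==> a \<in> carrier R ==> commutator_with R P a \<in> diff_ops_below R K n"
  unfolding diff_ops_below_Suc by blast

context
  fixes K assumes KR: "K \<subseteq> carrier R"
begin

lemma linD:
  assumes "P \<in> linear_operators R K"
  shows "x \<in> carrier R ==> P x \<in> carrier R"
    "x \<in> carrier R ==> y \<in> carrier R ==> P (x \<oplus> y) = P x \<oplus> P y"
    "c \<in> K ==> x \<in> carrier R ==> P (c \<otimes> x) = c \<otimes> P x"
    "P \<in> extensional (carrier R)"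
  using assms by (auto simp: linear_operators_def PiE_def)

lemma lin_zero: "(\<lambda>x\<in>carrier R. \<zero>) \<in> linear_operators R K"
  using KR by (auto simp: linear_operators_def)

lemma lin_add:
  assumes "P \<in> linear_operators R K" "Q \<in> linear_operators R K"
  shows "(\<lambda>x\<in>carrier R. P x \<oplus> Q x) \<in> linear_operators R K"
  unfolding linear_operators_def
  using linD(1-3)[OF assms(1)] linD(1-3)[OF assms(2)] KR by (auto simp: r_distr a_ac subset_iff)

lemma lin_lmult:
  assumes "P \<in> linear_operators R K" "b \<in> carrier R"
  shows "(\<lambda>x\<in>carrier R. b \<otimes> P x) \<in> linear_operators R K"
  unfolding linear_operators_def
  using linD(1-3)[OF assms(1)] assms(2) KR by (auto simp: r_distr m_lcomm subset_iff)

lemma lin_rmult: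
  assumes "P \<in> linear_operators R K" "b \<in> carrier R"
  shows "(\<lambda>x\<in>carrier R. P (b \<otimes> x)) \<in> linear_operators R K"
proof -
  have "P (b \<otimes> (c \<otimes> x)) = c \<otimes> P (b \<otimes> x)" if "c \<in> K" "x \<in> carrier R" for c x
    using linD(3)[OF assms(1) that(1), of "b \<otimes> x"] that KR assms(2) by (auto simp: m_lcomm subset_iff)
  then show ?thesis
    unfolding linear_operators_def
    using linD(1,2)[OF assms(1)] assms(2) KR by (auto simp: r_distr subset_iff)
qed

lemma below_zero: "(\<lambda>x\<in>carrier R. \<zero>) \<in> diff_ops_below R K n"
proof (induction n)
  case (Suc n)
  have "commutator_with R (\<lambda>x\<in>carrier R. \<zero>) a = (\<lambda>x\<in>carrier R. \<zero>)" if "a \<in> carrier R" for a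
    using that by (auto simp: commutator_with_def fun_eq_iff minus_eq restrict_def)
  then show ?case using Suc lin_zero by (intro below_SucI) metis+
qed (simp add: restrict_def)

lemma below_lin: "P \<in> diff_ops_below R K n ==> P \<in> linear_operators R K"
  by (cases n) (auto simp: lin_zero diff_ops_below_Suc simp del: diff_ops_below.simps(2))

lemma below_add:
  "P \<in> diff_ops_below R K n ==> Q \<in> diff_ops_below R K n ==> (\<lambda>x\<in>carrier R. P x \<oplus> Q x) \<in> diff_ops_below R K n"
proof (induction n arbitrary: P Q)
  case (Suc n)
  have P: "P \<in> linear_operators R K" "Q \<in> linear_operators R K" using Suc.prems below_lin by blast+
  have "commutator_with R (\<lambda>x\<in>carrier R. P x \<oplus> Q x) a =
     (\<lambda>x\<in>carrier R. commutator_with R P a x \<oplus> commutator_with R Q a x)" (is "?l = ?r") if a: "a \<in> carrier R" for a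
  proof (rule extensionalityI[of _ "carrier R"])
    fix x assume True: "x \<in> carrier R"
    have "P x \<in> carrier R" "Q x \<in> carrier R" "P (a \<otimes> x) \<in> carrier R" "Q (a \<otimes> x) \<in> carrier R"
      using linD(1)[OF P(1)] linD(1)[OF P(2)] True a by auto
    then have "P (a \<otimes> x) \<oplus> Q (a \<otimes> x) \<ominus> a \<otimes> (P x \<oplus> Q x) = (P (a \<otimes> x) \<ominus> a \<otimes> P x) \<oplus> (Q (a \<otimes> x) \<ominus> a \<otimes> Q x)"
      using a by algebra
    then show "?l x = ?r x" using True a by (simp add: commutator_with_def)
  qed (simp_all add: commutator_with_def)
  then show ?case
    using Suc.IH[OF below_SucD[OF Suc.prems(1)] below_SucD[OF Suc.prems(2)]] lin_add[OF P]
    by (intro below_SucI) metis+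
qed (auto simp: fun_eq_iff restrict_def)

lemma below_lmult:
  "P \<in> diff_ops_below R K n ==> b \<in> carrier R ==> (\<lambda>x\<in>carrier R. b \<otimes> P x) \<in> diff_ops_below R K n"
proof (induction n arbitrary: P)
  case 0
  then show ?case by (auto simp: fun_eq_iff)
next
  case (Suc n)
  have P: "P \<in> linear_operators R K" using Suc.prems below_lin by blast
  have "commutator_with R (\<lambda>x\<in>carrier R. b \<otimes> P x) a = (\<lambda>x\<in>carrier R. b \<otimes> commutator_with R P a x)" (is "?l = ?r")
    if a: "a \<in> carrier R" for a
  proof (rule extensionalityI[of _ "carrier R"])
    fix x assume True: "x \<in> carrier R"
    have "P x \<in> carrier R" "P (a \<otimes> x) \<in> carrier R" using linD(1)[OF P] True a by auto
    then have "b \<otimes> P (a \<otimes> x) \<ominus> a \<otimes> (b \<otimes> P x) = b \<otimes> (P (a \<otimes> x) \<ominus> a \<otimes> P x)"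
      using a Suc.prems(2) by algebra
    then show "?l x = ?r x" using True a by (simp add: commutator_with_def)
  qed (simp_all add: commutator_with_def)
  then show ?case
    using Suc.IH[OF below_SucD[OF Suc.prems(1)] Suc.prems(2)] lin_lmult[OF P Suc.prems(2)]
    by (intro below_SucI) metis+
qed

lemma below_rmult:
  "P \<in> diff_ops_below R K n ==> b \<in> carrier R ==> (\<lambda>x\<in>carrier R. P (b \<otimes> x)) \<in> diff_ops_below R K n"
proof (induction n arbitrary: P)
  case 0
  then show ?case by (auto simp: fun_eq_iff)
next
  case (Suc n)
  have P: "P \<in> linear_operators R K" using Suc.prems below_lin by blast
  have "commutator_with R (\<lambda>x\<in>carrier R. P (b \<otimes> x)) a = (\<lambda>x\<in>carrier R. commutator_with R P a (b \<otimes> x))"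
    if a: "a \<in> carrier R" for a
    using a Suc.prems(2) by (auto simp: commutator_with_def fun_eq_iff m_lcomm)
  then show ?case
    using Suc.IH[OF below_SucD[OF Suc.prems(1)] Suc.prems(2)] lin_rmult[OF P Suc.prems(2)]
    by (intro below_SucI) metis+
qed

lemma below_neg:
  assumes "P \<in> diff_ops_below R K n"
  shows "(\<lambda>x\<in>carrier R. \<ominus> P x) \<in> diff_ops_below R K n"
proof -
  have "(\<lambda>x\<in>carrier R. \<ominus> \<one> \<otimes> P x) = (\<lambda>x\<in>carrier R. \<ominus> P x)"
    using linD(1)[OF below_lin[OF assms]] by (auto simp: fun_eq_iff l_minus)
  then show ?thesis using below_lmult[OF assms, of "\<ominus> \<one>"] by simp
qed

end

lemma ad_iter_closed:
  "P \<in> carrier R \<rightarrow> carrier R ==> a \<in> carrier R ==> x \<in> carrier R ==> ad_iter R P a j x \<in> carrier R"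
  by (induction j arbitrary: x) (auto simp: commutator_with_def)

lemma ad_iter_zero:
  assumes "\<And>x. x \<in> carrier R ==> ad_iter R P a j x = \<zero>" "a \<in> carrier R" "x \<in> carrier R"
  shows "ad_iter R P a (j + i) x = \<zero>"
  using assms(3) by (induction i arbitrary: x) (auto simp: assms commutator_with_def minus_eq)

lemma ad_iter_shift: "ad_iter R (commutator_with R P a) a j = ad_iter R P a (Suc j)"
  by (induction j) auto

lemma commutator_zero:
  "(\<And>x. x \<in> carrier R ==> P x = \<zero>) ==> a \<in> carrier R ==> x \<in> carrier R ==> commutator_with R P a x = \<zero>"
  by (auto simp: commutator_with_def minus_eq)

lemma commutator_commute:
  assumes P: "P \<in> carrier R \<rightarrow> carrier R" and ab: "a \<in> carrier R" "b \<in> carrier R"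
  shows "commutator_with R (commutator_with R P a) b = commutator_with R (commutator_with R P b) a" (is "?l = ?r")
proof (rule extensionalityI[of _ "carrier R"])
  fix x assume True: "x \<in> carrier R"
  have c: "P (a \<otimes> (b \<otimes> x)) \<in> carrier R" "P (a \<otimes> x) \<in> carrier R" "P (b \<otimes> x) \<in> carrier R" "P x \<in> carrier R"
    using funcset_mem[OF P] ab True by auto
  have e: "b \<otimes> (a \<otimes> x) = a \<otimes> (b \<otimes> x)" using ab True by (simp add: m_lcomm)
  have "P (a \<otimes> (b \<otimes> x)) \<ominus> a \<otimes> P (b \<otimes> x) \<ominus> b \<otimes> (P (a \<otimes> x) \<ominus> a \<otimes> P x) =
    P (a \<otimes> (b \<otimes> x)) \<ominus> b \<otimes> P (a \<otimes> x) \<ominus> a \<otimes> (P (b \<otimes> x) \<ominus> b \<otimes> P x)"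
    using c ab by algebra
  then show "?l x = ?r x" using True ab by (simp add: commutator_with_def e)
qed (simp_all add: commutator_with_def)

lemma ad_iter_commutator:
  assumes P: "P \<in> carrier R \<rightarrow> carrier R" and ab: "a \<in> carrier R" "b \<in> carrier R"
  shows "ad_iter R (commutator_with R P a) b j = commutator_with R (ad_iter R P b j) a"
proof (induction j)
  case (Suc j)
  then show ?case using commutator_commute[of "ad_iter R P b j" a b] ad_iter_closed[OF P ab(2)] ab by simp
qed simp

end

context cring_char begin

lemma frob_commutator:
  assumes P: "P \<in> carrier R \<rightarrow> carrier R" and a: "a \<in> carrier R" and x: "x \<in> carrier R"
  shows "P (a [^] (p ^ e) \<otimes> x) = a [^] (p ^ e) \<otimes> P x \<oplus> ad_iter R P a (p ^ e) x"
proof -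
  define T where "T = (\<lambda>(m::nat) (n::nat) (j::nat). a [^] n \<otimes> ad_iter R P a j (a [^] m \<otimes> x))"
  note cl = ad_iter_closed[OF P a]
  have "T (p ^ e) 0 0 = T 0 (0 + p ^ e) 0 \<oplus> T 0 0 (0 + p ^ e)"
  proof (rule frobenius_recursion)
    fix m n j :: nat
    show "T m n j \<in> carrier R" using cl a x by (simp add: T_def)
    define y u where "y = a [^] m \<otimes> x" and "u = a [^] n"
    have yu: "y \<in> carrier R" "u \<in> carrier R" using a x by (simp_all add: y_def u_def)
    have "ad_iter R P a j (a [^] Suc m \<otimes> x) = ad_iter R P a j (a \<otimes> y)"
      using a x by (simp add: y_def m_ac)
    also have "\<dots> = a \<otimes> ad_iter R P a j y \<oplus> ad_iter R P a (Suc j) y"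
    proof -
      have "ad_iter R P a j (a \<otimes> y) \<in> carrier R" "ad_iter R P a j y \<in> carrier R" using cl yu a by auto
      then show ?thesis using yu a by (simp add: commutator_with_def add_diff_cancel)
    qed
    finally have e: "ad_iter R P a j (a [^] Suc m \<otimes> x) = a \<otimes> ad_iter R P a j y \<oplus> ad_iter R P a (Suc j) y" .
    have "u \<otimes> (a \<otimes> ad_iter R P a j y \<oplus> ad_iter R P a (Suc j) y) =
      (u \<otimes> a) \<otimes> ad_iter R P a j y \<oplus> u \<otimes> ad_iter R P a (Suc j) y"
      using yu a cl[OF yu(1), where j = j] cl[OF yu(1), where j = "Suc j"] by algebra
    then show "T (Suc m) n j = T m (Suc n) j \<oplus> T m n (Suc j)"
      unfolding T_def e y_def[symmetric] u_def[symmetric] by (simp add: u_def)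
  qed
  then show ?thesis using funcset_mem[OF P] a x cl by (simp add: T_def)
qed

text \<open>\<open>[P, a\<^sup>q] = ad\<^sub>a\<^sup>q P\<close> vanishes once \<open>q\<close> exceeds the order.\<close>

lemma diff_ops_upto_frob_linear:
  assumes K: "K \<subseteq> carrier R" and P: "P \<in> diff_ops_upto R K n" and n: "n < p ^ e"
  shows "P \<in> frob_linear_ops R p e"
proof -
  have Pb: "P \<in> diff_ops_below R K (Suc n)" using P by simp
  note L = linD[OF K below_lin[OF K Pb]]
  have Pc: "P \<in> carrier R \<rightarrow> carrier R" using L(1) by auto
  have "ad_iter R P a (p ^ e) x = \<zero>" if a: "a \<in> carrier R" and x: "x \<in> carrier R" for a x
  proof -
    have "ad_iter R P a i \<in> diff_ops_below R K (Suc n - i)" if "i \<le> Suc n" for i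
      using that
    proof (induction i)
      case (Suc i)
      then have "ad_iter R P a i \<in> diff_ops_below R K (Suc (n - i))" by (simp add: Suc_diff_le del: diff_ops_below.simps)
      then show ?case using a unfolding diff_ops_below_Suc by simp
    qed (use Pb in simp)
    from this[of "Suc n"] have "ad_iter R P a (Suc n) y = \<zero>" if "y \<in> carrier R" for y using that by simp
    from ad_iter_zero[OF this a x, of "p ^ e - Suc n"] n show ?thesis by simp
  qed
  then have "P (a [^] (p ^ e) \<otimes> x) = a [^] (p ^ e) \<otimes> P x" if "a \<in> carrier R" "x \<in> carrier R" for a x
    using frob_commutator[OF Pc that, of e] that L(1) by simp
  then show ?thesis using L by (auto simp: frob_linear_ops_def PiE_def)
qed

lemma frob_linear_commutator:
  assumes P: "P \<in> frob_linear_ops R p e" and a: "a \<in> carrier R"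
  shows "commutator_with R P a \<in> frob_linear_ops R p e"
proof -
  note D = frob_linear_opsD[OF P]
  have "commutator_with R P a (x \<oplus> y) = commutator_with R P a x \<oplus> commutator_with R P a y"
    if xy: "x \<in> carrier R" "y \<in> carrier R" for x y
  proof -
    have c: "P (a \<otimes> x) \<in> carrier R" "P (a \<otimes> y) \<in> carrier R" "P x \<in> carrier R" "P y \<in> carrier R"
      using D(1) xy a by auto
    have "P (a \<otimes> x) \<oplus> P (a \<otimes> y) \<ominus> a \<otimes> (P x \<oplus> P y) = (P (a \<otimes> x) \<ominus> a \<otimes> P x) \<oplus> (P (a \<otimes> y) \<ominus> a \<otimes> P y)"
      using c a by algebra
    then show ?thesis using xy a D(2) by (simp add: commutator_with_def r_distr)
  qed
  moreover have "commutator_with R P a (b [^] (p ^ e) \<otimes> x) = b [^] (p ^ e) \<otimes> commutator_with R P a x"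
    if b: "b \<in> carrier R" and x: "x \<in> carrier R" for b x
  proof -
    define c where "c = b [^] (p ^ e)"
    have cc: "c \<in> carrier R" using b by (simp add: c_def)
    have k: "P (a \<otimes> x) \<in> carrier R" "P x \<in> carrier R" using D(1) x a by auto
    have "P (a \<otimes> (c \<otimes> x)) = c \<otimes> P (a \<otimes> x)"
      using D(3)[OF b, of "a \<otimes> x"] a x cc by (simp add: c_def[symmetric] m_lcomm)
    moreover have "P (c \<otimes> x) = c \<otimes> P x" using D(3)[OF b x] by (simp add: c_def)
    moreover have "c \<otimes> P (a \<otimes> x) \<ominus> a \<otimes> (c \<otimes> P x) = c \<otimes> (P (a \<otimes> x) \<ominus> a \<otimes> P x)"
      using k cc a by algebra
    ultimately show ?thesis using x cc a by (simp add: commutator_with_def c_def[symmetric])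
  qed
  ultimately show ?thesis using D(1) a by (auto simp: frob_linear_ops_def commutator_with_def)
qed

text \<open>If \<open>ad\<^sub>x\<^sup>v P = 0\<close> with \<open>v = v(x)\<close> for each generator \<open>x\<close>, then \<open>P\<close> has order at most the sum of the \<open>v(x)\<close>:
  taking the commutator with \<open>x\<close> lowers \<open>v(x)\<close>, and commutators with arbitrary elements are controlled by those with
  generators through the Leibniz rule. For \<open>P \<in> D\<^sub>e\<close>, \<open>v(x) = p\<^sup>e\<close> works, since \<open>ad\<^sub>x\<^sup>q = ad\<^bsub>x\<^sup>q\<^esub>\<close>.\<close>

lemma frob_linear_diff_ops:
  assumes K: "K \<subseteq> carrier R" and X: "finite X" "X \<subseteq> carrier R" and gen: "generate_ring R (K \<union> X) = carrier R"
    and root: "\<And>c. c \<in> K ==> \<exists>d\<in>carrier R. d [^] (p ^ e) = c"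
    and P: "P \<in> frob_linear_ops R p e"
  shows "\<exists>n. P \<in> diff_ops_upto R K n"
proof -
  have klin: "P (c \<otimes> x) = c \<otimes> P x" if "P \<in> frob_linear_ops R p e" "c \<in> K" "x \<in> carrier R" for P c x
    using root[OF that(2)] frob_linear_opsD(3)[OF that(1) _ that(3)] by auto
  have lin: "P \<in> linear_operators R K" if "P \<in> frob_linear_ops R p e" for P
    using klin[OF that] frob_linear_opsD[OF that] by (auto simp: linear_operators_def)
  have zero: "P = (\<lambda>x\<in>carrier R. \<zero>)"
    if "P \<in> frob_linear_ops R p e" "\<And>x. x \<in> carrier R ==> P x = \<zero>" for P
    using frob_linear_opsD(4)[OF that(1)] that(2) by (auto simp: fun_eq_iff PiE_def extensional_def)
  have main: "P \<in> diff_ops_below R K (Suc N)"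
    if "P \<in> frob_linear_ops R p e" "\<And>x y. x \<in> X ==> y \<in> carrier R ==> ad_iter R P x (v x) y = \<zero>" "sum v X \<le> N"
    for P v N
    using that
  proof (induction N arbitrary: P v)
    have one_step: "P \<in> diff_ops_below R K (Suc N)"
      if P: "P \<in> frob_linear_ops R p e" and gens: "\<And>x. x \<in> X ==> commutator_with R P x \<in> diff_ops_below R K N" for P N
    proof -
      note D = frob_linear_opsD[OF P]
      have "commutator_with R P a \<in> diff_ops_below R K N" if "a \<in> generate_ring R (K \<union> X)" for a
        using that
      proof induction
        case one
        have "commutator_with R P \<one> = (\<lambda>x\<in>carrier R. \<zero>)"
          using D(1) by (auto simp: commutator_with_def fun_eq_iff minus_eq r_neg)
        then show ?case using below_zero[OF K] by metis
      next
        case (incl h)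
        show ?case
        proof (cases "h \<in> X")
          case False
          then have hK: "h \<in> K" using incl by blast
          then have "commutator_with R P h = (\<lambda>x\<in>carrier R. \<zero>)"
            using klin[OF P hK] D(1) K by (auto simp: commutator_with_def fun_eq_iff minus_eq r_neg subset_iff)
          then show ?thesis using below_zero[OF K] by metis
        qed (rule gens)
      next
        case (a_inv h)
        have hc: "h \<in> carrier R" using a_inv gen by simp
        have P0: "P (\<ominus> x) = \<ominus> P x" if "x \<in> carrier R" for x
        proof -
          have z: "P \<zero> = \<zero>" using D(2)[of \<zero> \<zero>] D(1)[of \<zero>] by (simp add: add.l_cancel_one)
          show ?thesis using D(2)[of "\<ominus> x" x] that D(1) by (simp add: l_neg z sum_zero_eq_neg)
        qed
        have "commutator_with R P (\<ominus> h) = (\<lambda>x\<in>carrier R. \<ominus> commutator_with R P h x)" (is "?l = ?r")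
        proof (rule extensionalityI[of _ "carrier R"])
          fix x assume True: "x \<in> carrier R"
          have "P (h \<otimes> x) \<in> carrier R" "P x \<in> carrier R" using D(1) True hc by auto
          then have "\<ominus> P (h \<otimes> x) \<ominus> (\<ominus> h) \<otimes> P x = \<ominus> (P (h \<otimes> x) \<ominus> h \<otimes> P x)" using hc by algebra
          then show "?l x = ?r x" using True hc P0[of "h \<otimes> x"] by (simp add: commutator_with_def l_minus)
        qed (simp_all add: commutator_with_def)
        then show ?case using below_neg[OF K a_inv.IH] by metis
      next
        case (eng_add h1 h2)
        have hc: "h1 \<in> carrier R" "h2 \<in> carrier R" using eng_add gen by auto
        have "commutator_with R P (h1 \<oplus> h2) = (\<lambda>x\<in>carrier R. commutator_with R P h1 x \<oplus> commutator_with R P h2 x)" (is "?l = ?r")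
        proof (rule extensionalityI[of _ "carrier R"])
          fix x assume True: "x \<in> carrier R"
          have c: "P (h1 \<otimes> x) \<in> carrier R" "P (h2 \<otimes> x) \<in> carrier R" "P x \<in> carrier R" using D(1) True hc by auto
          then have "P (h1 \<otimes> x) \<oplus> P (h2 \<otimes> x) \<ominus> (h1 \<oplus> h2) \<otimes> P x =
             (P (h1 \<otimes> x) \<ominus> h1 \<otimes> P x) \<oplus> (P (h2 \<otimes> x) \<ominus> h2 \<otimes> P x)" using hc by algebra
          then show "?l x = ?r x" using True hc D(2) by (simp add: commutator_with_def l_distr)
        qed (simp_all add: commutator_with_def)
        then show ?case using below_add[OF K eng_add.IH] by metis
      next
        case (eng_mult h1 h2)
        have hc: "h1 \<in> carrier R" "h2 \<in> carrier R" using eng_mult gen by auto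
        have "commutator_with R P (h1 \<otimes> h2) =
          (\<lambda>x\<in>carrier R. (\<lambda>x\<in>carrier R. commutator_with R P h1 (h2 \<otimes> x)) x \<oplus> (\<lambda>x\<in>carrier R. h1 \<otimes> commutator_with R P h2 x) x)"
          (is "?l = ?r")
        proof (rule extensionalityI[of _ "carrier R"])
          fix x assume True: "x \<in> carrier R"
          have c: "P (h1 \<otimes> (h2 \<otimes> x)) \<in> carrier R" "P (h2 \<otimes> x) \<in> carrier R" "P x \<in> carrier R" using D(1) True hc by auto
          then have "P (h1 \<otimes> (h2 \<otimes> x)) \<ominus> (h1 \<otimes> h2) \<otimes> P x =
             (P (h1 \<otimes> (h2 \<otimes> x)) \<ominus> h1 \<otimes> P (h2 \<otimes> x)) \<oplus> h1 \<otimes> (P (h2 \<otimes> x) \<ominus> h2 \<otimes> P x)" using hc by algebra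
          then show "?l x = ?r x" using True hc by (simp add: commutator_with_def m_assoc)
        qed (simp_all add: commutator_with_def)
        then show ?case
          using below_add[OF K below_rmult[OF K eng_mult.IH(1) hc(2)] below_lmult[OF K eng_mult.IH(2) hc(1)]] by metis
      qed
      then show ?thesis using lin[OF P] gen by (intro below_SucI) simp_all
    qed
    {
      case 0
      show ?case
      proof (rule one_step[OF 0(1)])
        fix x assume x: "x \<in> X"
        then have "v x = 0" using 0(3) X(1) by simp
        then have "P y = \<zero>" if "y \<in> carrier R" for y using 0(2)[OF x that] by simp
        then have "commutator_with R P x = (\<lambda>y\<in>carrier R. \<zero>)"
          using commutator_zero[of P x] x X(2) by (auto simp: fun_eq_iff commutator_with_def)
        then show "commutator_with R P x \<in> diff_ops_below R K 0" by simp
      qed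
    next
      case (Suc N)
      show ?case
      proof (rule one_step[OF Suc.prems(1)])
        fix x assume x: "x \<in> X"
        have xc: "x \<in> carrier R" using x X by blast
        note D = frob_linear_opsD[OF Suc.prems(1)]
        have cl: "commutator_with R P x \<in> frob_linear_ops R p e" by (rule frob_linear_commutator[OF Suc.prems(1) xc])
        show "commutator_with R P x \<in> diff_ops_below R K (Suc N)"
        proof (cases "v x")
          case 0
          then have "P y = \<zero>" if "y \<in> carrier R" for y using Suc.prems(2)[OF x that] by simp
          then have "commutator_with R P x = (\<lambda>y\<in>carrier R. \<zero>)"
            using zero[OF cl] commutator_zero[of P x] xc by blast
          then show ?thesis using below_zero[OF K] by metis
        next
          case (Suc m)
          show ?thesis
          proof (rule Suc.IH[OF cl, of "v(x := m)"])
            show "ad_iter R (commutator_with R P x) x' ((v(x := m)) x') y = \<zero>"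
              if x': "x' \<in> X" and y: "y \<in> carrier R" for x' y
            proof (cases "x' = x")
              case True
              then show ?thesis using Suc.prems(2)[OF x y] Suc by (simp add: ad_iter_shift del: ad_iter.simps)
            next
              case False
              have x'c: "x' \<in> carrier R" using x' X by blast
              have Pc: "P \<in> carrier R \<rightarrow> carrier R" using D(1) by auto
              have "commutator_with R (ad_iter R P x' (v x')) x y = \<zero>"
                by (rule commutator_zero[OF _ xc y]) (rule Suc.prems(2)[OF x'])
              then show ?thesis
                unfolding ad_iter_commutator[OF Pc xc x'c] using False by simp
            qed
            have "sum v X = v x + sum v (X - {x})" using X(1) x by (simp add: sum.remove)
            moreover have "sum (v(x := m)) X = m + sum v (X - {x})"
              using X(1) x by (simp add: sum.remove)
            ultimately show "sum (v(x := m)) X \<le> N" using Suc.prems(3) Suc by simp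
          qed
        qed
      qed
    }
  qed
  have "P \<in> diff_ops_below R K (Suc (sum (\<lambda>_. p ^ e) X))"
  proof (rule main[OF P, of "\<lambda>_. p ^ e"])
    fix x y assume x: "x \<in> X" and y: "y \<in> carrier R"
    have xc: "x \<in> carrier R" using x X by blast
    note D = frob_linear_opsD[OF P]
    have Pc: "P \<in> carrier R \<rightarrow> carrier R" using D(1) by auto
    have c: "ad_iter R P x (p ^ e) y \<in> carrier R" by (rule ad_iter_closed[OF Pc xc y])
    have "x [^] (p ^ e) \<otimes> P y = x [^] (p ^ e) \<otimes> P y \<oplus> ad_iter R P x (p ^ e) y"
      using frob_commutator[OF Pc xc y, of e] D(3)[OF xc y] by simp
    then show "ad_iter R P x (p ^ e) y = \<zero>"
      using c xc D(1)[OF y] by (simp add: add.l_cancel_one')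
  qed simp
  then show ?thesis by auto
qed

theorem diff_ops_carrier:
  assumes K: "K \<subseteq> carrier R" and X: "finite X" "X \<subseteq> carrier R" and gen: "generate_ring R (K \<union> X) = carrier R"
    and root: "\<And>c e. c \<in> K ==> \<exists>d\<in>carrier R. d [^] (p ^ e) = c"
  shows "carrier (diff_ops R K) = (\<Union>e. frob_linear_ops R p e)"
proof
  show "carrier (diff_ops R K) \<subseteq> (\<Union>e. frob_linear_ops R p e)"
  proof
    fix P assume "P \<in> carrier (diff_ops R K)"
    then obtain n where "P \<in> diff_ops_upto R K n" by (auto simp: diff_ops_def)
    moreover have "n < p ^ n" by (rule power_gt_expt) (use p_gt_1 in simp)
    ultimately show "P \<in> (\<Union>e. frob_linear_ops R p e)" using diff_ops_upto_frob_linear[OF K] by blast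
  qed
  show "(\<Union>e. frob_linear_ops R p e) \<subseteq> carrier (diff_ops R K)"
    using frob_linear_diff_ops[OF K X gen root] by (auto simp: diff_ops_def)
qed

lemma frob_linear_mono:
  assumes "P \<in> frob_linear_ops R p e" "e \<le> e'"
  shows "P \<in> frob_linear_ops R p e'"
proof -
  note D = frob_linear_opsD[OF assms(1)]
  have "P (a [^] (p ^ e') \<otimes> x) = a [^] (p ^ e') \<otimes> P x" if "a \<in> carrier R" "x \<in> carrier R" for a x
  proof -
    have "a [^] (p ^ e') = (a [^] (p ^ (e' - e))) [^] (p ^ e)"
      using that assms(2) by (simp add: nat_pow_pow power_add[symmetric])
    then show ?thesis using D(3)[of "a [^] (p ^ (e' - e))" x] that by simp
  qed
  then show ?thesis using D by (auto simp: frob_linear_ops_def)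
qed

lemma frob_linear_compose:
  assumes "P \<in> frob_linear_ops R p e" "Q \<in> frob_linear_ops R p e"
  shows "compose (carrier R) P Q \<in> frob_linear_ops R p e"
  using frob_linear_opsD[OF assms(1)] frob_linear_opsD[OF assms(2)]
  by (auto simp: frob_linear_ops_def compose_def)

lemma frob_linear_add:
  assumes "P \<in> frob_linear_ops R p e" "Q \<in> frob_linear_ops R p e"
  shows "(\<lambda>x\<in>carrier R. P x \<oplus> Q x) \<in> frob_linear_ops R p e"
  using frob_linear_opsD[OF assms(1)] frob_linear_opsD[OF assms(2)]
  by (auto simp: frob_linear_ops_def r_distr a_ac)

lemma frob_linear_scalar_pow:
  assumes "P \<in> frob_linear_ops R p e" "b \<in> carrier R"
  shows "(\<lambda>x\<in>carrier R. b \<otimes> P x) \<in> frob_linear_ops R p e"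
  using frob_linear_opsD[OF assms(1)] assms(2)
  by (auto simp: frob_linear_ops_def r_distr m_lcomm)

lemma frob_linear_mult: "b \<in> carrier R ==> (\<lambda>x\<in>carrier R. b \<otimes> x) \<in> frob_linear_ops R p e"
  by (auto simp: frob_linear_ops_def r_distr m_lcomm)

lemma frob_linear_zero_val: "P \<in> frob_linear_ops R p e ==> P \<zero> = \<zero>"
  using frob_linear_opsD(1)[of P R p e \<zero>] frob_linear_opsD(2)[of P R p e \<zero> \<zero>] by (simp add: add.l_cancel_one)

lemma diff_ops_ring:
  assumes car: "carrier (diff_ops R K) = (\<Union>e. frob_linear_ops R p e)"
  shows "ring (diff_ops R K)"
proof -
  have common: "\<exists>e. P \<in> frob_linear_ops R p e \<and> Q \<in> frob_linear_ops R p e"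
    if PQ: "P \<in> carrier (diff_ops R K)" "Q \<in> carrier (diff_ops R K)" for P Q
  proof -
    obtain e e' where "P \<in> frob_linear_ops R p e" "Q \<in> frob_linear_ops R p e'" using PQ unfolding car by blast
    then show ?thesis using frob_linear_mono[of P e "max e e'"] frob_linear_mono[of Q e' "max e e'"] by auto
  qed
  have D: "P x \<in> carrier R" "P \<in> extensional (carrier R)" "y \<in> carrier R ==> P (x \<oplus> y) = P x \<oplus> P y"
    if "P \<in> carrier (diff_ops R K)" "x \<in> carrier R" for P x y
  proof -
    obtain e where e: "P \<in> frob_linear_ops R p e" using \<open>P \<in> carrier (diff_ops R K)\<close> unfolding car by blast
    show "P x \<in> carrier R" "P \<in> extensional (carrier R)" "y \<in> carrier R ==> P (x \<oplus> y) = P x \<oplus> P y"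
      using frob_linear_opsD(1,2,4)[OF e] that(2) by (auto simp: PiE_def)
  qed
  have ext: "P = Q" if "P \<in> carrier (diff_ops R K)" "Q \<in> extensional (carrier R)" "\<And>x. x \<in> carrier R ==> P x = Q x" for P Q
    using that D(2)[OF that(1) zero_closed] by (intro extensionalityI)
  have sel: "\<one>\<^bsub>diff_ops R K\<^esub> = (\<lambda>x \<in> carrier R. x)" "\<zero>\<^bsub>diff_ops R K\<^esub> = (\<lambda>x \<in> carrier R. \<zero>)"
    "P \<otimes>\<^bsub>diff_ops R K\<^esub> Q = compose (carrier R) P Q" "P \<oplus>\<^bsub>diff_ops R K\<^esub> Q = (\<lambda>x \<in> carrier R. P x \<oplus> Q x)" for P Q
    by (simp_all add: diff_ops_def)
  have mem: "P \<in> carrier (diff_ops R K)" if "P \<in> frob_linear_ops R p e" for P e using that unfolding car by blast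
  have add: "(\<lambda>x \<in> carrier R. P x \<oplus> Q x) \<in> carrier (diff_ops R K)" "compose (carrier R) P Q \<in> carrier (diff_ops R K)"
    if "P \<in> carrier (diff_ops R K)" "Q \<in> carrier (diff_ops R K)" for P Q
    using common[OF that] mem frob_linear_add frob_linear_compose by blast+
  have zero: "(\<lambda>x \<in> carrier R. \<zero>) \<in> carrier (diff_ops R K)"
    by (rule mem[of _ 0]) (auto simp: frob_linear_ops_def)
  have one: "(\<lambda>x \<in> carrier R. x) \<in> carrier (diff_ops R K)"
    by (rule mem[of _ 0]) (auto simp: frob_linear_ops_def)
  show ?thesis
  proof (intro ringI abelian_groupI monoidI, unfold sel)
    fix P Q T assume P: "P \<in> carrier (diff_ops R K)"
    show "compose (carrier R) (\<lambda>x \<in> carrier R. x) P = P" "compose (carrier R) P (\<lambda>x \<in> carrier R. x) = P"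
      "(\<lambda>x\<in>carrier R. (\<lambda>x\<in>carrier R. \<zero>) x \<oplus> P x) = P"
      by (rule ext[OF P, symmetric]; use D(1)[OF P] in \<open>auto simp: compose_def\<close>)+
    show "\<exists>Q\<in>carrier (diff_ops R K). (\<lambda>x\<in>carrier R. Q x \<oplus> P x) = (\<lambda>x\<in>carrier R. \<zero>)"
    proof
      obtain e where e: "P \<in> frob_linear_ops R p e" using P unfolding car by blast
      show "(\<lambda>x\<in>carrier R. \<ominus> \<one> \<otimes> P x) \<in> carrier (diff_ops R K)"
        by (rule mem[OF frob_linear_scalar_pow[OF e]]) simp
      show "(\<lambda>x\<in>carrier R. (\<lambda>x\<in>carrier R. \<ominus> \<one> \<otimes> P x) x \<oplus> P x) = (\<lambda>x\<in>carrier R. \<zero>)"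
        using D(1)[OF P] by (auto simp: fun_eq_iff l_minus l_neg)
    qed
    assume Q: "Q \<in> carrier (diff_ops R K)"
    show "(\<lambda>x\<in>carrier R. P x \<oplus> Q x) = (\<lambda>x\<in>carrier R. Q x \<oplus> P x)"
      using D(1)[OF P] D(1)[OF Q] by (auto simp: fun_eq_iff a_comm)
    assume T: "T \<in> carrier (diff_ops R K)"
    show "compose (carrier R) (compose (carrier R) P Q) T = compose (carrier R) P (compose (carrier R) Q T)"
      using D(1)[OF T] by (auto simp: fun_eq_iff compose_def)
    show "(\<lambda>x\<in>carrier R. (\<lambda>x\<in>carrier R. P x \<oplus> Q x) x \<oplus> T x) = (\<lambda>x\<in>carrier R. P x \<oplus> (\<lambda>x\<in>carrier R. Q x \<oplus> T x) x)"
      using D(1)[OF P] D(1)[OF Q] D(1)[OF T] by (auto simp: fun_eq_iff a_assoc)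
    show "compose (carrier R) (\<lambda>x\<in>carrier R. P x \<oplus> Q x) T = (\<lambda>x\<in>carrier R. compose (carrier R) P T x \<oplus> compose (carrier R) Q T x)"
      using D(1)[OF T] by (auto simp: fun_eq_iff compose_def)
    show "compose (carrier R) T (\<lambda>x\<in>carrier R. P x \<oplus> Q x) = (\<lambda>x\<in>carrier R. compose (carrier R) T P x \<oplus> compose (carrier R) T Q x)"
      using D(1)[OF P] D(1)[OF Q] D(3)[OF T] by (auto simp: fun_eq_iff compose_def)
  qed (use zero one add in auto)
qed

end

section \<open>Localization and quotient groups\<close>

text \<open>For regular \<open>g\<close>, fractions are compared by cross multiplication (\<open>L_eq\<close>).\<close>

locale char_p_localization = cring_char +
  fixes g
  assumes g: "g \<in> carrier R" and regular: "\<And>x. x \<in> carrier R ==> g \<otimes> x = \<zero> ==> x = \<zero>"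
begin

abbreviation "lf \<equiv> loc_frac R g"
abbreviation "RL \<equiv> localization R g"

lemma g_pow [simp]: "g [^] (n::nat) \<in> carrier R" using g by simp

lemma pow_cancel:
  assumes "a \<in> carrier R" "b \<in> carrier R" "g [^] (l::nat) \<otimes> a = g [^] l \<otimes> b"
  shows "a = b"
proof -
  have zero: "x = \<zero>" if "x \<in> carrier R" "g [^] (l::nat) \<otimes> x = \<zero>" for x l
    using that
  proof (induction l arbitrary: x)
    case (Suc l)
    have "g [^] l \<otimes> (g \<otimes> x) = \<zero>" using Suc.prems g by (simp add: m_assoc)
    then have "g \<otimes> x = \<zero>" using Suc.IH[of "g \<otimes> x"] Suc.prems g by simp
    then show ?case using regular Suc.prems by blast
  qed simp
  have "g [^] l \<otimes> (a \<ominus> b) = g [^] l \<otimes> a \<ominus> g [^] l \<otimes> b" using assms(1,2) by (simp add: r_distr_diff)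
  also have "\<dots> = \<zero>" unfolding assms(3) using assms(1,2) by (simp add: minus_eq r_neg)
  finally have "a \<ominus> b = \<zero>" using zero[of "a \<ominus> b" l] assms(1,2) by simp
  then show ?thesis using assms(1,2) by simp
qed

lemma pow_cancel_iff:
  "a \<in> carrier R ==> b \<in> carrier R ==> g [^] (l::nat) \<otimes> a = g [^] l \<otimes> b \<longleftrightarrow> a = b"
  using pow_cancel[of a b l] by auto

lemma L_mem: "a \<in> carrier R ==> (b, m) \<in> lf a n \<longleftrightarrow> b \<in> carrier R \<and> g [^] m \<otimes> a = g [^] n \<otimes> b"
  unfolding loc_frac_def by (auto simp: pow_cancel_iff)

lemma L_eq:
  assumes "a \<in> carrier R" "b \<in> carrier R"
  shows "lf a n = lf b m \<longleftrightarrow> g [^] m \<otimes> a = g [^] n \<otimes> b"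
proof
  assume "lf a n = lf b m"
  moreover have "(b, m) \<in> lf b m" using L_mem assms by simp
  ultimately have "(b, m) \<in> lf a n" by simp
  then show "g [^] m \<otimes> a = g [^] n \<otimes> b" using L_mem[OF assms(1)] by simp
next
  assume e: "g [^] m \<otimes> a = g [^] n \<otimes> b"
  have "g [^] l \<otimes> a = g [^] n \<otimes> c \<longleftrightarrow> g [^] l \<otimes> b = g [^] m \<otimes> c" if c: "c \<in> carrier R" for c and l :: nat
  proof -
    have "g [^] l \<otimes> a = g [^] n \<otimes> c \<longleftrightarrow> g [^] m \<otimes> (g [^] l \<otimes> a) = g [^] m \<otimes> (g [^] n \<otimes> c)"
      using assms c by (simp add: pow_cancel_iff)
    also have "g [^] m \<otimes> (g [^] l \<otimes> a) = g [^] l \<otimes> (g [^] m \<otimes> a)" using assms by (simp add: m_lcomm)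
    also have "\<dots> = g [^] n \<otimes> (g [^] l \<otimes> b)" unfolding e using assms by (simp add: m_lcomm)
    also have "g [^] m \<otimes> (g [^] n \<otimes> c) = g [^] n \<otimes> (g [^] m \<otimes> c)" using c by (simp add: m_lcomm)
    also have "g [^] n \<otimes> (g [^] l \<otimes> b) = g [^] n \<otimes> (g [^] m \<otimes> c) \<longleftrightarrow> g [^] l \<otimes> b = g [^] m \<otimes> c"
      using assms c by (simp add: pow_cancel_iff)
    finally show ?thesis .
  qed
  then show "lf a n = lf b m"
    by (auto simp: set_eq_iff L_mem[OF assms(1)] L_mem[OF assms(2)])
qed

lemma L_expand: "a \<in> carrier R ==> lf (g [^] j \<otimes> a) (n + j) = lf a n"
  by (subst L_eq) (auto simp: nat_pow_mult[symmetric] m_assoc g)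

lemma RL_carrier: "X \<in> carrier RL \<longleftrightarrow> (\<exists>a n. a \<in> carrier R \<and> X = lf a n)"
  by (auto simp: localization_def)

lemma L_closed [simp]: "a \<in> carrier R ==> lf a n \<in> carrier RL"
  by (auto simp: RL_carrier)

lemma L_self: "a \<in> carrier R ==> (a, n) \<in> lf a n" by (simp add: L_mem)

lemma UN_const2:
  assumes "(a0, n0) \<in> X" "(b0, m0) \<in> Y"
    and "\<And>a n b m. (a, n) \<in> X ==> (b, m) \<in> Y ==> F a n b m = c"
  shows "(\<Union>(a, n)\<in>X. \<Union>(b, m)\<in>Y. F a n b m) = c"
proof -
  have mem: "x \<in> (\<Union>(a, n)\<in>X. \<Union>(b, m)\<in>Y. F a n b m) \<longleftrightarrow>
      (\<exists>a n b m. (a, n) \<in> X \<and> (b, m) \<in> Y \<and> x \<in> F a n b m)" for x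
    by (simp add: Bex_def split_paired_Ex)
  have "F a0 n0 b0 m0 = c" by (rule assms(3)[OF assms(1,2)])
  moreover have "x \<in> c" if "(a, n) \<in> X" "(b, m) \<in> Y" "x \<in> F a n b m" for a n b m x
    using that(3) assms(3)[OF that(1,2)] by simp
  ultimately show ?thesis unfolding set_eq_iff mem using assms(1,2) by metis
qed

lemma L_mult:
  assumes a: "a \<in> carrier R" and b: "b \<in> carrier R"
  shows "lf a n \<otimes>\<^bsub>RL\<^esub> lf b m = lf (a \<otimes> b) (n + m)"
proof -
  have "lf (a' \<otimes> b') (n' + m') = lf (a \<otimes> b) (n + m)" if 1: "(a', n') \<in> lf a n" and 2: "(b', m') \<in> lf b m" for a' b' n' m'
  proof -
    have c: "a' \<in> carrier R" "b' \<in> carrier R" and e: "g [^] n' \<otimes> a = g [^] n \<otimes> a'" "g [^] m' \<otimes> b = g [^] m \<otimes> b'"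
      using 1 2 L_mem a b by auto
    have "g [^] (n + m) \<otimes> (a' \<otimes> b') = (g [^] n \<otimes> a') \<otimes> (g [^] m \<otimes> b')"
      using c by (simp add: nat_pow_mult[OF g, symmetric] m_ac)
    also have "\<dots> = g [^] (n' + m') \<otimes> (a \<otimes> b)"
      unfolding e[symmetric] using a b by (simp add: nat_pow_mult[OF g, symmetric] m_ac)
    finally show ?thesis using a b c by (subst L_eq) auto
  qed
  then show ?thesis
    unfolding localization_def monoid.simps by (rule UN_const2[OF L_self[OF a] L_self[OF b]])
qed

lemma L_add:
  assumes a: "a \<in> carrier R" and b: "b \<in> carrier R"
  shows "lf a n \<oplus>\<^bsub>RL\<^esub> lf b n = lf (a \<oplus> b) n"
proof -
  have "lf (g [^] m' \<otimes> a' \<oplus> g [^] n' \<otimes> b') (n' + m') = lf (a \<oplus> b) n"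
    if 1: "(a', n') \<in> lf a n" and 2: "(b', m') \<in> lf b n" for a' b' n' m'
  proof -
    have c: "a' \<in> carrier R" "b' \<in> carrier R" and e: "g [^] n' \<otimes> a = g [^] n \<otimes> a'" "g [^] m' \<otimes> b = g [^] n \<otimes> b'"
      using 1 2 L_mem a b by auto
    have "g [^] n \<otimes> (g [^] m' \<otimes> a' \<oplus> g [^] n' \<otimes> b') = g [^] m' \<otimes> (g [^] n \<otimes> a') \<oplus> g [^] n' \<otimes> (g [^] n \<otimes> b')"
      using c by (simp add: r_distr m_lcomm)
    also have "\<dots> = g [^] (n' + m') \<otimes> (a \<oplus> b)"
      unfolding e[symmetric] using a b by (simp add: nat_pow_mult[OF g, symmetric] r_distr m_ac)
    finally show ?thesis using a b c by (subst L_eq) auto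
  qed
  then show ?thesis
    unfolding localization_def ring.simps by (rule UN_const2[OF L_self[OF a] L_self[OF b]])
qed

lemma RL_one: "\<one>\<^bsub>RL\<^esub> = lf \<one> 0" and RL_zero: "\<zero>\<^bsub>RL\<^esub> = lf \<zero> 0"
  by (simp_all add: localization_def)

lemma L_zero: "lf \<zero> n = lf \<zero> 0" by (subst L_eq) auto

lemma common2:
  assumes "X \<in> carrier RL" "Y \<in> carrier RL"
  obtains a b n where "a \<in> carrier R" "b \<in> carrier R" "X = lf a n" "Y = lf b n"
proof -
  obtain a n b m where X: "a \<in> carrier R" "X = lf a n" and Y: "b \<in> carrier R" "Y = lf b m"
    using assms unfolding RL_carrier by blast
  have "X = lf (g [^] m \<otimes> a) (n + m)" "Y = lf (g [^] n \<otimes> b) (n + m)"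
    using X Y L_expand[of a m n] L_expand[of b n m] by (simp_all add: add.commute)
  then show ?thesis using that[of "g [^] m \<otimes> a" "g [^] n \<otimes> b" "n + m"] X Y by simp
qed

lemma common3:
  assumes "X \<in> carrier RL" "Y \<in> carrier RL" "Z \<in> carrier RL"
  obtains a b c n where "a \<in> carrier R" "b \<in> carrier R" "c \<in> carrier R" "X = lf a n" "Y = lf b n" "Z = lf c n"
proof -
  obtain a b n where X: "a \<in> carrier R" "b \<in> carrier R" "X = lf a n" "Y = lf b n" using common2[OF assms(1,2)] .
  obtain c m where Z: "c \<in> carrier R" "Z = lf c m" using assms(3) unfolding RL_carrier by blast
  have "X = lf (g [^] m \<otimes> a) (n + m)" "Y = lf (g [^] m \<otimes> b) (n + m)" "Z = lf (g [^] n \<otimes> c) (n + m)"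
    using X Z L_expand[of a m n] L_expand[of b m n] L_expand[of c n m] by (simp_all add: add.commute)
  then show ?thesis using that[of "g [^] m \<otimes> a" "g [^] m \<otimes> b" "g [^] n \<otimes> c" "n + m"] X Z by simp
qed

lemma RL_cring: "cring RL"
proof (rule cringI)
  show "abelian_group RL"
  proof (rule abelian_groupI)
    fix X Y assume XY: "X \<in> carrier RL" "Y \<in> carrier RL"
    then obtain a b n where X: "a \<in> carrier R" "b \<in> carrier R" "X = lf a n" "Y = lf b n" by (rule common2)
    then show "X \<oplus>\<^bsub>RL\<^esub> Y \<in> carrier RL" "X \<oplus>\<^bsub>RL\<^esub> Y = Y \<oplus>\<^bsub>RL\<^esub> X" by (simp_all add: L_add a_comm)
    fix Z assume "Z \<in> carrier RL"
    with XY obtain a b c n where "a \<in> carrier R" "b \<in> carrier R" "c \<in> carrier R" "X = lf a n" "Y = lf b n" "Z = lf c n"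
      by (rule common3)
    then show "X \<oplus>\<^bsub>RL\<^esub> Y \<oplus>\<^bsub>RL\<^esub> Z = X \<oplus>\<^bsub>RL\<^esub> (Y \<oplus>\<^bsub>RL\<^esub> Z)" by (simp add: L_add a_assoc)
  next
    fix X assume "X \<in> carrier RL"
    then obtain a n where X: "a \<in> carrier R" "X = lf a n" unfolding RL_carrier by blast
    show "\<zero>\<^bsub>RL\<^esub> \<oplus>\<^bsub>RL\<^esub> X = X"
      unfolding RL_zero L_zero[of n, symmetric] X(2) using X(1) by (simp add: L_add)
    show "\<exists>Y\<in>carrier RL. Y \<oplus>\<^bsub>RL\<^esub> X = \<zero>\<^bsub>RL\<^esub>"
      using X L_zero[of n] by (intro bexI[of _ "lf (\<ominus> a) n"]) (simp_all add: RL_zero L_add l_neg)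
  qed (simp add: RL_zero)
  show "comm_monoid RL"
  proof (rule comm_monoidI)
    fix X Y Z assume XY: "X \<in> carrier RL" "Y \<in> carrier RL"
    obtain a b n m where X: "a \<in> carrier R" "b \<in> carrier R" "X = lf a n" "Y = lf b m"
      using XY unfolding RL_carrier by blast
    then show "X \<otimes>\<^bsub>RL\<^esub> Y \<in> carrier RL" "X \<otimes>\<^bsub>RL\<^esub> Y = Y \<otimes>\<^bsub>RL\<^esub> X" by (simp_all add: L_mult m_comm add.commute)
    assume "Z \<in> carrier RL"
    then obtain c k where "c \<in> carrier R" "Z = lf c k" unfolding RL_carrier by blast
    with X show "X \<otimes>\<^bsub>RL\<^esub> Y \<otimes>\<^bsub>RL\<^esub> Z = X \<otimes>\<^bsub>RL\<^esub> (Y \<otimes>\<^bsub>RL\<^esub> Z)" by (simp add: L_mult m_assoc add.assoc)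
  next
    fix X assume "X \<in> carrier RL"
    then obtain a n where X: "a \<in> carrier R" "X = lf a n" unfolding RL_carrier by blast
    then show "\<one>\<^bsub>RL\<^esub> \<otimes>\<^bsub>RL\<^esub> X = X" by (simp add: RL_one L_mult)
  qed (simp add: RL_one)
  fix X Y Z assume "X \<in> carrier RL" "Y \<in> carrier RL" "Z \<in> carrier RL"
  then obtain a b c n where "a \<in> carrier R" "b \<in> carrier R" "c \<in> carrier R" "X = lf a n" "Y = lf b n" "Z = lf c n"
    by (rule common3)
  then show "(X \<oplus>\<^bsub>RL\<^esub> Y) \<otimes>\<^bsub>RL\<^esub> Z = X \<otimes>\<^bsub>RL\<^esub> Z \<oplus>\<^bsub>RL\<^esub> Y \<otimes>\<^bsub>RL\<^esub> Z"
    by (simp add: L_add L_mult l_distr)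
qed

lemma L_hom: "(\<lambda>a. lf a 0) \<in> ring_hom R RL"
  by (rule ring_hom_memI) (auto simp: L_mult L_add RL_one)

sublocale RL: cring_char RL p by (rule cring_char_hom[OF RL_cring L_hom])

lemma L_pow: "a \<in> carrier R ==> lf a n [^]\<^bsub>RL\<^esub> (m::nat) = lf (a [^] m) (n * m)"
  by (induction m) (auto simp: RL_one L_mult add.commute)

lemma L_neg: "a \<in> carrier R ==> \<ominus>\<^bsub>RL\<^esub> lf a n = lf (\<ominus> a) n"
  using RL.minus_equality[of "lf (\<ominus> a) n" "lf a n"] by (simp add: L_add l_neg L_zero[of n] RL_zero)

lemma RL_generated:
  assumes X: "X \<subseteq> carrier R" and K: "K \<subseteq> carrier R" and gen: "generate_ring R (K \<union> X) = carrier R"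
  shows "generate_ring RL (loc_image R g K \<union> insert (lf \<one> 1) (loc_image R g X)) = carrier RL"
proof
  let ?G = "generate_ring RL (loc_image R g K \<union> insert (lf \<one> 1) (loc_image R g X))"
  have sub: "loc_image R g K \<union> insert (lf \<one> 1) (loc_image R g X) \<subseteq> carrier RL"
    using X K by (auto simp: loc_image_def)
  show "?G \<subseteq> carrier RL" by (rule RL.generate_ring_incl[OF sub])
  have 0: "lf a 0 \<in> ?G" if "a \<in> generate_ring R (K \<union> X)" for a
    by (rule ring_hom_generate_ring[OF RL_cring L_hom _ _ that]) (use X K in \<open>auto simp: loc_image_def\<close>)
  have 1: "lf \<one> n \<in> ?G" for n
  proof (induction n)
    case 0
    then show ?case using generate_ring.one[of RL] by (simp add: RL_one)
  next
    case (Suc n)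
    have "lf \<one> n \<otimes>\<^bsub>RL\<^esub> lf \<one> 1 \<in> ?G" by (intro generate_ring.eng_mult Suc generate_ring.incl) simp
    then show ?case by (simp add: L_mult)
  qed
  show "carrier RL \<subseteq> ?G"
  proof
    fix Y assume "Y \<in> carrier RL"
    then obtain a n where Y: "a \<in> carrier R" "Y = lf a n" unfolding RL_carrier by blast
    have "lf a 0 \<otimes>\<^bsub>RL\<^esub> lf \<one> n \<in> ?G" using 0[of a] 1[of n] gen Y by (intro generate_ring.eng_mult) auto
    then show "Y \<in> ?G" using Y by (simp add: L_mult)
  qed
qed

text \<open>\<open>P (a/g\<^sup>n) = P (g\<^bsup>(q-1) n\<^esup> a) / g\<^bsup>q n\<^esup>\<close>, by linearity over \<open>q\<close>-th powers.\<close>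

lemma loc_extend_exists:
  assumes P: "P \<in> frob_linear_ops R p e"
  shows "\<exists>Q \<in> frob_linear_ops RL p e. \<forall>a\<in>carrier R. Q (lf a 0) = lf (P a) 0"
proof -
  note D = frob_linear_opsD[OF P]
  define q where "q = p ^ e"
  have q: "q > 0" by (simp add: q_def)
  have qn: "(q - 1) * n + n = q * n" for n using q by (cases q) auto
  have Pq: "P (g [^] (q * n) \<otimes> a) = g [^] (q * n) \<otimes> P a" if "a \<in> carrier R" for a n
    using D(3)[of "g [^] n" a] that g by (simp add: nat_pow_pow q_def mult.commute)
  define Q0 where "Q0 = (\<lambda>a n. lf (P (g [^] ((q - 1) * n) \<otimes> a)) (q * n))"
  have wd: "Q0 a n = Q0 b m" if ab: "a \<in> carrier R" "b \<in> carrier R" and e: "lf a n = lf b m" for a b n m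
  proof -
    have e: "g [^] m \<otimes> a = g [^] n \<otimes> b" using e ab by (simp add: L_eq)
    have "g [^] (q * m) \<otimes> P (g [^] ((q - 1) * n) \<otimes> a) = P (g [^] (q * m) \<otimes> (g [^] ((q - 1) * n) \<otimes> a))"
      using Pq[of "g [^] ((q - 1) * n) \<otimes> a" m] ab by simp
    also have "g [^] (q * m) \<otimes> (g [^] ((q - 1) * n) \<otimes> a) = (g [^] ((q - 1) * m) \<otimes> g [^] ((q - 1) * n)) \<otimes> (g [^] m \<otimes> a)"
      unfolding qn[symmetric, of m] using ab by (simp add: nat_pow_mult[OF g, symmetric] m_ac)
    also have "\<dots> = g [^] (q * n) \<otimes> (g [^] ((q - 1) * m) \<otimes> b)"
      unfolding e qn[symmetric, of n] using ab by (simp add: nat_pow_mult[OF g, symmetric] m_ac)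
    also have "P \<dots> = g [^] (q * n) \<otimes> P (g [^] ((q - 1) * m) \<otimes> b)"
      using Pq[of "g [^] ((q - 1) * m) \<otimes> b" n] ab by simp
    finally show ?thesis unfolding Q0_def using ab D(1) by (subst L_eq) auto
  qed
  define rep where "rep = (\<lambda>X. SOME (a, n). a \<in> carrier R \<and> X = lf a n)"
  define Q where "Q = (\<lambda>X\<in>carrier RL. case rep X of (a, n) => Q0 a n)"
  have Q: "Q (lf a n) = Q0 a n" if a: "a \<in> carrier R" for a n
  proof -
    obtain b m where bm: "rep (lf a n) = (b, m)" by fastforce
    have "\<exists>x. (case x of (b, m) => b \<in> carrier R \<and> lf a n = lf b m)" using a by auto
    from someI_ex[OF this] have "b \<in> carrier R \<and> lf a n = lf b m"
      using bm unfolding rep_def by auto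
    then have "Q0 a n = Q0 b m" using wd[of a b n m] a by blast
    moreover have "Q (lf a n) = Q0 b m" using a by (simp add: Q_def bm)
    ultimately show ?thesis by simp
  qed
  have "Q \<in> frob_linear_ops RL p e"
    unfolding frob_linear_ops_def
  proof (intro CollectI conjI ballI)
    show "Q \<in> carrier RL \<rightarrow>\<^sub>E carrier RL"
    proof (rule PiE_I)
      fix X assume "X \<in> carrier RL"
      then obtain a n where X: "a \<in> carrier R" "X = lf a n" unfolding RL_carrier by blast
      show "Q X \<in> carrier RL" unfolding X(2) Q[OF X(1)] Q0_def using X(1) D(1) by (intro L_closed) simp
    qed (simp add: Q_def)
    fix X Y assume XY: "X \<in> carrier RL" "Y \<in> carrier RL"
    then obtain a b n where X: "a \<in> carrier R" "b \<in> carrier R" "X = lf a n" "Y = lf b n" by (rule common2)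
    then show "Q (X \<oplus>\<^bsub>RL\<^esub> Y) = Q X \<oplus>\<^bsub>RL\<^esub> Q Y"
      using D(1,2) by (simp add: L_add Q Q0_def r_distr)
    obtain c m where c: "c \<in> carrier R" "X = lf c m" using XY unfolding RL_carrier by blast
    have xq: "X [^]\<^bsub>RL\<^esub> (p ^ e) = lf (c [^] q) (m * q)" using c by (simp add: L_pow q_def)
    have cq: "c [^] q \<in> carrier R" using c by simp
    have "P (g [^] ((q - 1) * (m * q + n)) \<otimes> (c [^] q \<otimes> b)) =
        c [^] q \<otimes> (g [^] (q * ((q - 1) * m)) \<otimes> P (g [^] ((q - 1) * n) \<otimes> b))"
    proof -
      have "g [^] ((q - 1) * (m * q + n)) \<otimes> (c [^] q \<otimes> b) = c [^] q \<otimes> (g [^] (q * ((q - 1) * m)) \<otimes> (g [^] ((q - 1) * n) \<otimes> b))"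
      proof -
        have ee: "(q - 1) * (m * q + n) = q * ((q - 1) * m) + (q - 1) * n" by (simp only: distrib_left mult.commute mult.left_commute)
        show ?thesis unfolding ee using cq X by (simp only: nat_pow_mult[OF g, symmetric] m_ac nat_pow_closed g m_closed)
      qed
      then show ?thesis
        using D(3)[OF c(1), of "g [^] (q * ((q - 1) * m)) \<otimes> (g [^] ((q - 1) * n) \<otimes> b)"] X
          Pq[of "g [^] ((q - 1) * n) \<otimes> b" "(q - 1) * m"] by (simp add: q_def)
    qed
    then have Pe: "Q0 (c [^] q \<otimes> b) (m * q + n) =
        lf (c [^] q \<otimes> (g [^] (q * ((q - 1) * m)) \<otimes> P (g [^] ((q - 1) * n) \<otimes> b))) (q * (m * q + n))"
      by (simp add: Q0_def)
    have "Q (X [^]\<^bsub>RL\<^esub> (p ^ e) \<otimes>\<^bsub>RL\<^esub> Y) = Q0 (c [^] q \<otimes> b) (m * q + n)"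
      unfolding xq X(4) using cq X by (simp add: L_mult Q)
    also have "\<dots> = lf (c [^] q \<otimes> P (g [^] ((q - 1) * n) \<otimes> b)) (m * q + q * n)"
    proof -
      have e: "q * (m * q + n) = (m * q + q * n) + q * ((q - 1) * m)"
      proof -
        obtain r where "q = Suc r" using q gr0_implies_Suc by blast
        then show ?thesis by (simp add: algebra_simps)
      qed
      have Pc: "P (g [^] ((q - 1) * n) \<otimes> b) \<in> carrier R" using D(1) X by simp
      have "c [^] q \<otimes> (g [^] (q * ((q - 1) * m)) \<otimes> P (g [^] ((q - 1) * n) \<otimes> b)) =
        g [^] (q * ((q - 1) * m)) \<otimes> (c [^] q \<otimes> P (g [^] ((q - 1) * n) \<otimes> b))" using cq Pc by (simp add: m_lcomm)
      moreover have "lf (g [^] (q * ((q - 1) * m)) \<otimes> (c [^] q \<otimes> P (g [^] ((q - 1) * n) \<otimes> b)))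
          ((m * q + q * n) + q * ((q - 1) * m)) = lf (c [^] q \<otimes> P (g [^] ((q - 1) * n) \<otimes> b)) (m * q + q * n)"
        using cq Pc by (intro L_expand m_closed)
      ultimately show ?thesis unfolding Pe e by (simp only:)
    qed
    also have "\<dots> = X [^]\<^bsub>RL\<^esub> (p ^ e) \<otimes>\<^bsub>RL\<^esub> Q Y"
      unfolding xq X(4) using cq X D(1) by (simp add: L_mult Q Q0_def)
    finally show "Q (X [^]\<^bsub>RL\<^esub> (p ^ e) \<otimes>\<^bsub>RL\<^esub> Y) = X [^]\<^bsub>RL\<^esub> (p ^ e) \<otimes>\<^bsub>RL\<^esub> Q Y" .
  qed
  moreover have "Q (lf a 0) = lf (P a) 0" if "a \<in> carrier R" for a using that by (simp add: Q Q0_def)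
  ultimately show ?thesis by blast
qed

lemma loc_extend_value:
  assumes Q: "Q \<in> frob_linear_ops RL p e" and QP: "\<And>a. a \<in> carrier R ==> Q (lf a 0) = lf (P a) 0"
    and P: "P \<in> carrier R \<rightarrow> carrier R" and a: "a \<in> carrier R"
  shows "Q (lf a n) = lf (P (g [^] (n * p ^ e - n) \<otimes> a)) (n * p ^ e)"
proof -
  note D = frob_linear_opsD[OF Q]
  define q where "q = p ^ e"
  have q: "q \<ge> 1" by (simp add: q_def Suc_leI)
  have nq: "n + (n * q - n) = n * q" using q by simp
  have Pc: "P (g [^] (n * q - n) \<otimes> a) \<in> carrier R" using P a by auto
  have gl: "lf (g [^] n) 0 [^]\<^bsub>RL\<^esub> (p ^ e) = lf (g [^] (n * q)) 0" by (simp add: L_pow nat_pow_pow g q_def)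
  have "lf (g [^] (n * q)) 0 \<otimes>\<^bsub>RL\<^esub> Q (lf a n) = Q (lf (g [^] (n * q)) 0 \<otimes>\<^bsub>RL\<^esub> lf a n)"
    using D(3)[of "lf (g [^] n) 0" "lf a n"] a by (simp add: gl)
  also have "lf (g [^] (n * q)) 0 \<otimes>\<^bsub>RL\<^esub> lf a n = lf (g [^] n \<otimes> (g [^] (n * q - n) \<otimes> a)) (0 + n)"
    using a nat_pow_mult[OF g, of n "n * q - n"] by (simp add: L_mult m_assoc[symmetric] nq)
  also have "\<dots> = lf (g [^] (n * q - n) \<otimes> a) 0" using a by (intro L_expand) simp
  also have "Q \<dots> = lf (P (g [^] (n * q - n) \<otimes> a)) 0" using a by (intro QP) simp
  finally have 1: "lf (g [^] (n * q)) 0 \<otimes>\<^bsub>RL\<^esub> Q (lf a n) = lf (P (g [^] (n * q - n) \<otimes> a)) 0" .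
  have Qc: "Q (lf a n) \<in> carrier RL" using D(1) a by simp
  have u: "lf \<one> (n * q) \<otimes>\<^bsub>RL\<^esub> lf (g [^] (n * q)) 0 = \<one>\<^bsub>RL\<^esub>"
    unfolding RL_one by (simp add: L_mult) (subst L_eq; simp)
  have "Q (lf a n) = lf \<one> (n * q) \<otimes>\<^bsub>RL\<^esub> (lf (g [^] (n * q)) 0 \<otimes>\<^bsub>RL\<^esub> Q (lf a n))"
    using Qc u by (simp add: RL.m_assoc[symmetric])
  also have "\<dots> = lf (P (g [^] (n * q - n) \<otimes> a)) (n * q)" unfolding 1 using Pc by (simp add: L_mult)
  finally show ?thesis by (simp add: q_def)
qed

text \<open>Uniqueness holds because two extensions lie in a common \<open>D\<^sub>E\<close>, where \<open>loc_extend_value\<close> determines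
  them. On fractions with denominator \<open>g\<^bsup>p^e\<^esup>\<close> the extension acts on the numerator alone.\<close>

lemma loc_extend_frob:
  assumes car: "carrier (diff_ops RL (loc_image R g K)) = (\<Union>e. frob_linear_ops RL p e)"
    and P: "P \<in> frob_linear_ops R p e"
  shows "loc_extend R K g P \<in> frob_linear_ops RL p e"
    and "a \<in> carrier R ==> loc_extend R K g P (lf a (p ^ e)) = lf (P a) (p ^ e)"
proof -
  note D = frob_linear_opsD[OF P]
  have Pc: "P \<in> carrier R \<rightarrow> carrier R" using D(1) by auto
  obtain Q where Q: "Q \<in> frob_linear_ops RL p e" "\<And>a. a \<in> carrier R ==> Q (lf a 0) = lf (P a) 0"
    using loc_extend_exists[OF P] by blast
  have eq: "loc_extend R K g P = Q"
    unfolding loc_extend_def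
  proof (rule the_equality)
    show "Q \<in> carrier (diff_ops RL (loc_image R g K)) \<and> (\<forall>a\<in>carrier R. Q (lf a 0) = lf (P a) 0)"
      using Q unfolding car by blast
    fix Q' assume Q': "Q' \<in> carrier (diff_ops RL (loc_image R g K)) \<and> (\<forall>a\<in>carrier R. Q' (lf a 0) = lf (P a) 0)"
    then obtain e' where e': "Q' \<in> frob_linear_ops RL p e'" unfolding car by blast
    define E where "E = max e e'"
    have E: "Q \<in> frob_linear_ops RL p E" "Q' \<in> frob_linear_ops RL p E"
      using RL.frob_linear_mono[OF Q(1), of E] RL.frob_linear_mono[OF e', of E] by (auto simp: E_def)
    show "Q' = Q"
    proof (rule extensionalityI[of _ "carrier RL"])
      show "Q' \<in> extensional (carrier RL)" "Q \<in> extensional (carrier RL)"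
        using frob_linear_opsD(4)[OF E(1)] frob_linear_opsD(4)[OF E(2)] by (auto simp: PiE_def)
      fix X assume "X \<in> carrier RL"
      then obtain a n where X: "a \<in> carrier R" "X = lf a n" unfolding RL_carrier by blast
      have "Q' X = lf (P (g [^] (n * p ^ E - n) \<otimes> a)) (n * p ^ E)"
        unfolding X(2) by (rule loc_extend_value[OF E(2) _ Pc X(1)]) (use Q' in blast)
      moreover have "Q X = lf (P (g [^] (n * p ^ E - n) \<otimes> a)) (n * p ^ E)"
        unfolding X(2) by (rule loc_extend_value[OF E(1) _ Pc X(1)]) (rule Q(2))
      ultimately show "Q' X = Q X" by simp
    qed
  qed
  show "loc_extend R K g P \<in> frob_linear_ops RL p e" unfolding eq by (rule Q(1))
  show "loc_extend R K g P (lf a (p ^ e)) = lf (P a) (p ^ e)" if a: "a \<in> carrier R" for a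
  proof -
    define q where "q = p ^ e"
    have q: "q \<ge> 1" by (simp add: q_def Suc_leI)
    have "Q (lf a q) = lf (P (g [^] (q * p ^ e - q) \<otimes> a)) (q * p ^ e)"
      by (rule loc_extend_value[OF Q(1) _ Pc a]) (rule Q(2))
    also have "g [^] (q * p ^ e - q) = (g [^] (q - 1)) [^] (p ^ e)"
      using q g by (simp add: nat_pow_pow q_def algebra_simps)
    also have "P ((g [^] (q - 1)) [^] (p ^ e) \<otimes> a) = (g [^] (q - 1)) [^] (p ^ e) \<otimes> P a"
      using a by (intro D(3)) simp_all
    also have "(g [^] (q - 1)) [^] (p ^ e) = g [^] (q * q - q)"
      using q g by (simp add: nat_pow_pow q_def algebra_simps)
    also have "q * p ^ e = q + (q * q - q)" using q by (simp add: q_def)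
    also have "lf (g [^] (q * q - q) \<otimes> P a) (q + (q * q - q)) = lf (P a) q"
      using D(1)[OF a] by (rule L_expand)
    finally show ?thesis unfolding eq q_def .
  qed
qed

end

lemma quot_abelian_group:
  fixes G (structure)
  assumes G: "abelian_group G" and H: "additive_subgroup H G"
  shows "abelian_group (G Quot H)"
    and "\<And>x y. x \<in> carrier G ==> y \<in> carrier G ==> H +> x = H +> y \<longleftrightarrow> x \<ominus> y \<in> H"
    and "\<And>x y. x \<in> carrier G ==> y \<in> carrier G ==> (H +> x) \<oplus>\<^bsub>G Quot H\<^esub> (H +> y) = H +> (x \<oplus> y)"
    and "carrier (G Quot H) = (\<lambda>x. H +> x) ` carrier G"
    and "\<zero>\<^bsub>G Quot H\<^esub> = H +> \<zero>"
    and "\<And>x. x \<in> carrier G ==> \<ominus>\<^bsub>G Quot H\<^esub> (H +> x) = H +> (\<ominus> x)"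
proof -
  interpret G: abelian_group G by (rule G)
  interpret H: abelian_subgroup H G by (rule abelian_subgroupI3[OF H G])
  show eq: "H +> x = H +> y \<longleftrightarrow> x \<ominus> y \<in> H" if "x \<in> carrier G" "y \<in> carrier G" for x y
  proof -
    have "H +> x = H +> y \<longleftrightarrow> x \<in> H +> y"
      using H.a_rcos_self[OF that(1)] H.a_repr_independence'[of x y] that by auto
    also have "\<dots> \<longleftrightarrow> x \<ominus> y \<in> H" using H.a_rcos_module[OF that(2,1)] by (simp add: a_minus_def)
    finally show ?thesis .
  qed
  show add: "(H +> x) \<oplus>\<^bsub>G Quot H\<^esub> (H +> y) = H +> (x \<oplus> y)" if "x \<in> carrier G" "y \<in> carrier G" for x y
    using H.a_rcos_sum[OF that] by (simp add: FactRing_def)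
  show car: "carrier (G Quot H) = (\<lambda>x. H +> x) ` carrier G"
    by (auto simp: FactRing_def A_RCOSETS_def')
  show zero: "\<zero>\<^bsub>G Quot H\<^esub> = H +> \<zero>"
    using G.a_coset_add_zero[OF H.a_subset] by (simp add: FactRing_def)
  show gr: "abelian_group (G Quot H)"
  proof (rule abelian_groupI)
    fix x assume "x \<in> carrier (G Quot H)"
    then obtain u where u: "u \<in> carrier G" "x = H +> u" by (auto simp: car)
    show "\<exists>y\<in>carrier (G Quot H). y \<oplus>\<^bsub>G Quot H\<^esub> x = \<zero>\<^bsub>G Quot H\<^esub>"
    proof
      show "(H +> (\<ominus> u)) \<oplus>\<^bsub>G Quot H\<^esub> x = \<zero>\<^bsub>G Quot H\<^esub>" unfolding u(2) zero using u by (simp add: add G.l_neg)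
    qed (use u in \<open>auto simp: car\<close>)
  qed (auto simp: car zero add G.a_ac)
  show "\<ominus>\<^bsub>G Quot H\<^esub> (H +> x) = H +> (\<ominus> x)" if x: "x \<in> carrier G" for x
  proof -
    interpret Q: abelian_group "G Quot H" by (rule gr)
    show ?thesis
      by (rule Q.minus_equality) (use x in \<open>auto simp: car zero add G.l_neg\<close>)
  qed
qed

lemma quot_action_coset:
  fixes G (structure)
  assumes G: "abelian_group G" and H: "additive_subgroup H G"
    and Q: "\<And>x. x \<in> carrier G ==> Q x \<in> carrier G" "\<And>x y. x \<in> carrier G ==> y \<in> carrier G ==> Q (x \<oplus> y) = Q x \<oplus> Q y"
    and QH: "\<And>h. h \<in> H ==> Q h \<in> H" and x: "x \<in> carrier G"
  shows "quot_action G H Q (H +> x) = H +> Q x"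
proof -
  interpret G: abelian_group G by (rule G)
  interpret H: abelian_subgroup H G by (rule abelian_subgroupI3[OF H G])
  have Hc: "h \<in> carrier G" if "h \<in> H" for h using that H.a_subset by blast
  show ?thesis
  proof
    show "quot_action G H Q (H +> x) \<subseteq> H +> Q x"
    proof
      fix z assume "z \<in> quot_action G H Q (H +> x)"
      then obtain h h' where h: "h \<in> H" "h' \<in> H" "z = h \<oplus> Q (h' \<oplus> x)"
        by (auto simp: quot_action_def set_add_def' a_r_coset_def')
      then have "z = (h \<oplus> Q h') \<oplus> Q x" using Q x Hc by (simp add: G.a_assoc)
      moreover have "h \<oplus> Q h' \<in> H" using h QH by simp
      ultimately show "z \<in> H +> Q x" by (auto simp: a_r_coset_def')
    qed
    show "H +> Q x \<subseteq> quot_action G H Q (H +> x)"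
    proof
      fix z assume "z \<in> H +> Q x"
      then obtain h where h: "h \<in> H" "z = h \<oplus> Q x" by (auto simp: a_r_coset_def')
      then show "z \<in> quot_action G H Q (H +> x)"
        using H.a_rcos_self[OF x] by (auto simp: quot_action_def set_add_def')
    qed
  qed
qed

lemma (in UP_cring) poly_generated:
  assumes KX: "K \<subseteq> carrier R" "X \<subseteq> carrier R" and gen: "generate_ring R (K \<union> X) = carrier R"
  shows "generate_ring P ((\<lambda>c. monom P c 0) ` K \<union> insert (monom P \<one> 1) ((\<lambda>c. monom P c 0) ` X)) = carrier P"
proof
  let ?G = "generate_ring P ((\<lambda>c. monom P c 0) ` K \<union> insert (monom P \<one> 1) ((\<lambda>c. monom P c 0) ` X))"
  show "?G \<subseteq> carrier P" using KX by (intro P.generate_ring_incl) auto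
  have const: "monom P c 0 \<in> ?G" if "c \<in> generate_ring R (K \<union> X)" for c
    by (rule R.ring_hom_generate_ring[OF UP_cring const_ring_hom _ _ that]) (use KX in auto)
  have var: "monom P \<one> k \<in> ?G" for k
  proof (induction k)
    case 0
    then show ?case using generate_ring.one[of P] by (simp add: monom_one)
  next
    case (Suc k)
    have "monom P \<one> k \<otimes>\<^bsub>P\<^esub> monom P \<one> 1 \<in> ?G" by (intro generate_ring.eng_mult Suc generate_ring.incl) simp
    then show ?case using monom_mult[of \<one> \<one> k 1] by simp
  qed
  show "carrier P \<subseteq> ?G"
  proof
    fix u assume "u \<in> carrier P"
    then show "u \<in> ?G"
    proof (induction rule: UP_add_induct)
      case (add u v)
      then show ?case by (intro generate_ring.eng_add)
    next
      case (monom c k)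
      have "monom P c 0 \<otimes>\<^bsub>P\<^esub> monom P \<one> k \<in> ?G" using const[of c] var[of k] gen monom by (intro generate_ring.eng_mult) auto
      then show ?case using monom_mult[of c \<one> 0 k] monom by simp
    qed
  qed
qed

section \<open>The algebra \<open>A\<^sub>k\<close> and its maximal ideals\<close>

context cring_char begin

lemma choose_add_pow:
  "[(N + p ^ e choose M)] \<cdot> \<one> = [(N choose M)] \<cdot> \<one> \<oplus> (if p ^ e \<le> M then [(N choose (M - p ^ e))] \<cdot> \<one> else \<zero>)"
proof -
  define B where "B = (\<lambda>(m::nat) (n::nat) j. if j \<le> M then [(N + m choose (M - j))] \<cdot> \<one> else \<zero>)"
  have "B (p ^ e) 0 0 = B 0 (0 + p ^ e) 0 \<oplus> B 0 0 (0 + p ^ e)"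
  proof (rule frobenius_recursion)
    fix m n j
    show "B m n j \<in> carrier R" by (simp add: B_def)
    show "B (Suc m) n j = B m (Suc n) j \<oplus> B m n (Suc j)"
    proof (cases "Suc j \<le> M")
      case True
      then obtain i where i: "M - j = Suc i" "M - Suc j = i" by (metis Suc_diff_Suc Suc_le_eq)
      then show ?thesis using True by (simp add: B_def add.nat_pow_mult add.commute)
    next
      case False
      then show ?thesis by (cases "j = M") (auto simp: B_def)
    qed
  qed
  then show ?thesis by (simp add: B_def)
qed

lemma choose_periodic: "M < p ^ e ==> [(N + p ^ e choose M)] \<cdot> \<one> = [(N choose M)] \<cdot> \<one>"
  by (simp add: choose_add_pow)

text \<open>Lucas' theorem for the binomials \<open>(l choose p\<^sup>e)\<close>.\<close>

lemma choose_pow_div: "[(l choose (p ^ e))] \<cdot> \<one> = [(l div p ^ e)] \<cdot> \<one>"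
proof (induction l rule: less_induct)
  case (less l)
  show ?case
  proof (cases "l < p ^ e")
    case False
    then have l: "l = (l - p ^ e) + p ^ e" by simp
    have "[(l choose (p ^ e))] \<cdot> \<one> = [((l - p ^ e) choose (p ^ e))] \<cdot> \<one> \<oplus> \<one>"
      by (subst l, subst choose_add_pow) simp
    also have "[((l - p ^ e) choose (p ^ e))] \<cdot> \<one> = [((l - p ^ e) div p ^ e)] \<cdot> \<one>"
      using False less_le_trans[of 0 "p ^ e" l] by (intro less.IH diff_less) (simp_all add: not_less)
    also have "[((l - p ^ e) div p ^ e)] \<cdot> \<one> \<oplus> \<one> = [((l - p ^ e) div p ^ e + 1)] \<cdot> \<one>" by simp
    also have "(l - p ^ e) div p ^ e + 1 = l div p ^ e" using False prime_gt_0_nat[OF p_prime] by (simp add: le_div_geq)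
    finally show ?thesis .
  qed (simp add: binomial_eq_0)
qed

lemma add_pow_mod: "[(n mod p)] \<cdot> \<one> = [(n::nat)] \<cdot> \<one>"
proof -
  have "[n] \<cdot> \<one> = [(p * (n div p) + n mod p)] \<cdot> \<one>" by simp
  also have "\<dots> = [(p * (n div p))] \<cdot> \<one> \<oplus> [(n mod p)] \<cdot> \<one>" by (rule add.nat_pow_mult[symmetric]) simp
  also have "[(p * (n div p))] \<cdot> \<one> = \<zero>" by (rule add_pow_char) auto
  finally show ?thesis by simp
qed

lemma add_pow_one_zero:
  assumes nt: "\<one> \<noteq> \<zero>" and z: "[(n::nat)] \<cdot> \<one> = \<zero>"
  shows "p dvd n"
proof (rule ccontr)
  assume "\<not> p dvd n"
  then have cop: "coprime n p" using prime_imp_coprime[OF p_prime] by (simp add: coprime_commute)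
  have "n \<noteq> 0" using \<open>\<not> p dvd n\<close> by (metis dvd_0_right)
  then obtain x y where "n * x = p * y + gcd n p" using bezout_nat by blast
  then have e: "n * x = p * y + 1" using cop by simp
  have "[(n * x)] \<cdot> \<one> = [x] \<cdot> ([n] \<cdot> \<one>)" by (simp add: add.nat_pow_pow mult.commute)
  then have "[(n * x)] \<cdot> \<one> = \<zero>" by (simp add: z)
  moreover have "[(p * y + 1)] \<cdot> \<one> = [(p * y)] \<cdot> \<one> \<oplus> \<one>" by simp
  moreover have "[(p * y)] \<cdot> \<one> = \<zero>" by (rule add_pow_char) auto
  ultimately show False using nt e by simp
qed

lemma add_pow_one_inj:
  assumes nt: "\<one> \<noteq> \<zero>" and e: "[(m::nat)] \<cdot> \<one> = [(n::nat)] \<cdot> \<one>"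
  shows "m mod p = n mod p"
proof -
  have *: "m mod p = n mod p" if "m \<le> n" and e: "[m] \<cdot> \<one> = [n] \<cdot> \<one>" for m n :: nat
  proof -
    have "[m] \<cdot> \<one> \<oplus> [(n - m)] \<cdot> \<one> = [n] \<cdot> \<one>" using that(1) by (simp add: add.nat_pow_mult)
    then have "[(n - m)] \<cdot> \<one> = \<zero>" using e add.l_cancel_one[of "[n] \<cdot> \<one>" "[(n - m)] \<cdot> \<one>"] by simp
    then have "p dvd n - m" by (rule add_pow_one_zero[OF nt])
    then show ?thesis using that(1) mod_eq_dvd_iff_nat[of m n p] by simp
  qed
  show ?thesis using *[of m n] *[of n m] e by (metis nat_le_linear)
qed

end

lemma digits_determine:
  fixes p m m' :: nat
  assumes "\<And>i. i < e ==> m div p ^ i mod p = m' div p ^ i mod p"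
  shows "m mod p ^ e = m' mod p ^ e"
  using assms
proof (induction e)
  case (Suc e)
  have "m mod (p ^ e * p) = m' mod (p ^ e * p)"
    unfolding mod_mult2_eq using Suc.IH Suc.prems by simp
  then show ?case by (simp add: mult.commute)
qed simp

locale binomial_algebra = cring_char k p + field k for k (structure) and p
begin

abbreviation "NF \<equiv> nat_fun_ring k"
abbreviation "A \<equiv> A_alg k"

lemma NF_sel: "carrier NF = UNIV \<rightarrow> carrier k" "a \<otimes>\<^bsub>NF\<^esub> b = (\<lambda>l. a l \<otimes> b l)" "\<one>\<^bsub>NF\<^esub> = (\<lambda>l. \<one>)"
  "\<zero>\<^bsub>NF\<^esub> = (\<lambda>l. \<zero>)" "a \<oplus>\<^bsub>NF\<^esub> b = (\<lambda>l. a l \<oplus> b l)"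
  by (simp_all add: nat_fun_ring_def)

lemma NF_cring: "cring NF"
proof (intro cringI abelian_groupI comm_monoidI)
  show "\<exists>y\<in>carrier NF. y \<oplus>\<^bsub>NF\<^esub> x = \<zero>\<^bsub>NF\<^esub>" if "x \<in> carrier NF" for x
    using that by (intro bexI[of _ "\<lambda>l. \<ominus> x l"]) (auto simp: NF_sel l_neg Pi_def)
qed (auto simp: NF_sel Pi_def a_ac m_ac l_distr r_distr fun_eq_iff)

sublocale NF: cring NF by (rule NF_cring)

lemma NF_neg: "a \<in> carrier NF ==> \<ominus>\<^bsub>NF\<^esub> a = (\<lambda>l. \<ominus> a l)"
  by (rule NF.minus_equality) (auto simp: NF_sel l_neg Pi_def)

definition periodic :: "(nat => 'a) => nat => bool" where
  "periodic a e \<longleftrightarrow> (\<forall>l. a (l + p ^ e) = a l)"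

text \<open>The functions whose period is a power of \<open>p\<close>. This is \<open>A\<^sub>k\<close> (\<open>A_carrier\<close>): binomial coefficients are
  periodic, and indicator functions of residue classes are products of interpolation factors in single digits.\<close>

definition Per :: "(nat => 'a) set" where
  "Per = {a \<in> carrier NF. \<exists>e. periodic a e}"

lemma periodic_mult: "periodic a e ==> a (l + p ^ e * m) = a l"
proof (induction m)
  case (Suc m)
  have "a (l + p ^ e * Suc m) = a ((l + p ^ e * m) + p ^ e)" by (simp add: ac_simps)
  also have "\<dots> = a (l + p ^ e * m)" using Suc.prems by (simp only: periodic_def)
  finally show ?case using Suc by simp
qed simp

lemma periodic_mod: "periodic a e ==> a (l mod p ^ e) = a l"
  using periodic_mult[of a e "l mod p ^ e" "l div p ^ e"] by simp

lemma periodic_mono: "periodic a e ==> e \<le> e' ==> periodic a e'"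
proof -
  assume a: "periodic a e" "e \<le> e'"
  have "p ^ e' = p ^ e * p ^ (e' - e)" using a(2) by (simp add: power_add[symmetric])
  then show ?thesis using periodic_mult[OF a(1)] by (simp add: periodic_def)
qed

lemma periodic_common:
  assumes "a \<in> Per" "b \<in> Per"
  obtains e where "periodic a e" "periodic b e"
proof -
  obtain e e' where "periodic a e" "periodic b e'" using assms by (auto simp: Per_def)
  then show ?thesis using that[of "max e e'"] periodic_mono by auto
qed

lemma Per_subring: "subring Per NF"
proof (rule NF.subringI)
  show "Per \<subseteq> carrier NF" by (auto simp: Per_def)
  show "\<one>\<^bsub>NF\<^esub> \<in> Per" by (auto simp: Per_def periodic_def NF_sel)
  show "\<ominus>\<^bsub>NF\<^esub> h \<in> Per" if "h \<in> Per" for h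
  proof -
    obtain e where h: "h \<in> carrier NF" "periodic h e" using \<open>h \<in> Per\<close> unfolding Per_def by blast
    then have "periodic (\<ominus>\<^bsub>NF\<^esub> h) e" by (simp add: periodic_def NF_neg)
    then show ?thesis using h(1) unfolding Per_def by blast
  qed
  fix a b assume ab: "a \<in> Per" "b \<in> Per"
  then obtain e where "periodic a e" "periodic b e" by (rule periodic_common)
  then have "periodic (a \<otimes>\<^bsub>NF\<^esub> b) e" "periodic (a \<oplus>\<^bsub>NF\<^esub> b) e" by (simp_all add: periodic_def NF_sel)
  then show "a \<otimes>\<^bsub>NF\<^esub> b \<in> Per" "a \<oplus>\<^bsub>NF\<^esub> b \<in> Per"
    using ab unfolding Per_def by blast+
qed

definition gens :: "(nat => 'a) set" where
  "gens = const_fun ` carrier k \<union> range (\<lambda>e. binom_fun k (p ^ e))"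

lemma gens_carrier: "gens \<subseteq> carrier NF"
  by (auto simp: gens_def NF_sel const_fun_def binom_fun_def)

abbreviation "B \<equiv> generate_ring NF gens"

lemma B_subring: "subring B NF" by (rule NF.generate_ring_is_subring[OF gens_carrier])

lemma binom_digit: "binom_fun k (p ^ e) l = [(l div p ^ e mod p)] \<cdot> \<one>"
  by (simp add: binom_fun_def choose_pow_div add_pow_mod)

definition ind :: "nat => nat => nat => 'a" where
  "ind e m = (\<lambda>l. if l mod p ^ e = m then \<one> else \<zero>)"

lemma ind_periodic: "periodic (ind e m) e" by (simp add: periodic_def ind_def)

lemma separating_digit:
  assumes "m mod p ^ e \<noteq> m' mod p ^ e"
  obtains i w where "i < e" "w \<in> carrier k" "w \<otimes> ([(m div p ^ i mod p)] \<cdot> \<one> \<ominus> [(m' div p ^ i mod p)] \<cdot> \<one>) = \<one>"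
proof -
  obtain i where i: "i < e" "m div p ^ i mod p \<noteq> m' div p ^ i mod p" using digits_determine assms by blast
  define d where "d = [(m div p ^ i mod p)] \<cdot> \<one> \<ominus> [(m' div p ^ i mod p)] \<cdot> \<one>"
  have "d \<noteq> \<zero>" unfolding d_def using i(2) add_pow_one_inj[OF one_not_zero] by (metis add.nat_pow_closed mod_mod_trivial one_closed r_right_minus_eq)
  then have "d \<in> Units k" using field_Units by (auto simp: d_def)
  then have "inv d \<in> carrier k" "inv d \<otimes> d = \<one>" by simp_all
  then show ?thesis using that i(1) unfolding d_def by blast
qed

lemma digit_period:
  assumes "i < e" "l mod p ^ e = m mod p ^ e"
  shows "l div p ^ i mod p = m div p ^ i mod p"
proof -
  have "p ^ e = p ^ (i + 1 + (e - i - 1))" using assms(1) by simp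
  then have pe: "p ^ e = p ^ i * p * p ^ (e - i - 1)" by (simp only: power_add power_one_right)
  have d: "p ^ i * p dvd p ^ e" unfolding pe by (rule dvd_triv_left)
  have "l mod (p ^ i * p) = m mod (p ^ i * p)"
    using arg_cong[OF assms(2), of "\<lambda>x. x mod (p ^ i * p)"] by (simp only: mod_mod_cancel[OF d])
  then have "(l mod (p ^ i * p)) div p ^ i = (m mod (p ^ i * p)) div p ^ i" by simp
  then show ?thesis using p_gt_0 by (simp add: mod_mult2_eq)
qed

lemma separate:
  assumes "m < p ^ e" "m' < p ^ e" "m \<noteq> m'"
  shows "\<exists>s\<in>B. periodic s e \<and> s m = \<one> \<and> s m' = \<zero>"
proof -
  obtain i w where i: "i < e" and w: "w \<in> carrier k" "w \<otimes> ([(m div p ^ i mod p)] \<cdot> \<one> \<ominus> [(m' div p ^ i mod p)] \<cdot> \<one>) = \<one>"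
    using separating_digit[of m e m'] assms by auto
  define v where "v = [(m' div p ^ i mod p)] \<cdot> \<one>"
  have v: "v \<in> carrier k" by (simp add: v_def)
  define s where "s = const_fun w \<otimes>\<^bsub>NF\<^esub> (binom_fun k (p ^ i) \<oplus>\<^bsub>NF\<^esub> \<ominus>\<^bsub>NF\<^esub> const_fun v)"
  have vc: "const_fun v \<in> carrier NF" using v by (auto simp: NF_sel const_fun_def)
  have s: "s l = w \<otimes> ([(l div p ^ i mod p)] \<cdot> \<one> \<ominus> v)" for l
    unfolding s_def NF_neg[OF vc] by (simp add: NF_sel const_fun_def binom_digit minus_eq)
  have sub: "subring B NF" by (rule B_subring)
  have "s \<in> B"
    unfolding s_def using v w
    by (intro generate_ring.eng_mult generate_ring.eng_add generate_ring.a_inv generate_ring.incl) (auto simp: gens_def)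
  moreover have "periodic s e"
  proof -
    have "(l + p ^ e) div p ^ i mod p = l div p ^ i mod p" for l by (rule digit_period[OF i]) simp
    then show ?thesis by (simp add: periodic_def s)
  qed
  moreover have "s m = \<one>" using w by (simp add: s v_def)
  moreover have "s m' = \<zero>" using w v by (simp add: s v_def[symmetric] minus_eq r_neg)
  ultimately show ?thesis by blast
qed

lemma ind_B:
  assumes m: "m < p ^ e"
  shows "ind e m \<in> B"
proof -
  have "\<exists>s\<in>B. periodic s e \<and> s m = \<one> \<and> (\<forall>m'\<in>D. s m' = \<zero>)" if "finite D" "D \<subseteq> {..<p ^ e} - {m}" for D
    using that
  proof (induction D)
    case empty
    show ?case by (intro bexI[of _ "\<one>\<^bsub>NF\<^esub>"] generate_ring.one) (auto simp: NF_sel periodic_def)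
  next
    case (insert m' D)
    then obtain s where s: "s \<in> B" "periodic s e" "s m = \<one>" "\<forall>m'\<in>D. s m' = \<zero>" by auto
    obtain t where t: "t \<in> B" "periodic t e" "t m = \<one>" "t m' = \<zero>"
      using separate[OF m, of m'] insert.prems by auto
    have c: "s l \<in> carrier k" "t l \<in> carrier k" for l
      using s(1) t(1) NF.generate_ring_incl[OF gens_carrier] by (auto simp: NF_sel)
    have st: "s \<otimes>\<^bsub>NF\<^esub> t \<in> B" using s t by (intro generate_ring.eng_mult)
    have "periodic (s \<otimes>\<^bsub>NF\<^esub> t) e" "(s \<otimes>\<^bsub>NF\<^esub> t) m = \<one>" "\<forall>m''\<in>insert m' D. (s \<otimes>\<^bsub>NF\<^esub> t) m'' = \<zero>"
      using s t c by (auto simp: NF_sel periodic_def)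
    then show ?case using st by blast
  qed
  from this[of "{..<p ^ e} - {m}"] obtain s where s: "s \<in> B" "periodic s e" "s m = \<one>"
    "\<forall>m'\<in>{..<p ^ e} - {m}. s m' = \<zero>" by auto
  have "s = ind e m"
  proof
    fix l
    have "s l = s (l mod p ^ e)" by (rule periodic_mod[OF s(2), symmetric])
    then show "s l = ind e m l" using s(3,4) by (auto simp: ind_def)
  qed
  then show ?thesis using s(1) by simp
qed

lemma periodic_decomp:
  assumes a: "a \<in> carrier NF" "periodic a e" and S: "subring S NF" "const_fun ` carrier k \<subseteq> S"
    and I: "ideal I (NF\<lparr>carrier := S\<rparr>)" and ind: "\<And>m. m < p ^ e ==> a m \<noteq> \<zero> ==> ind e m \<in> I"
  shows "a \<in> I"
proof -
  interpret I: ideal I "NF\<lparr>carrier := S\<rparr>" by (rule I)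
  have "(\<lambda>l. if l mod p ^ e < N then a l else \<zero>) \<in> I" if "N \<le> p ^ e" for N
    using that
  proof (induction N)
    case 0
    then show ?case using additive_subgroup.zero_closed[OF ideal.axioms(1)[OF I]] by (simp add: NF_sel)
  next
    case (Suc N)
    have aN: "a N \<in> carrier k" using a by (auto simp: NF_sel)
    have "(\<lambda>l. if l mod p ^ e = N then a N else \<zero>) \<in> I"
    proof (cases "a N = \<zero>")
      case True
      then have "(\<lambda>l. if l mod p ^ e = N then a N else \<zero>) = (\<lambda>l. \<zero>)" by auto
      then show ?thesis using additive_subgroup.zero_closed[OF ideal.axioms(1)[OF I]] by (simp add: NF_sel)
    next
      case False
      then have "ind e N \<in> I" using Suc.prems by (intro ind) auto
      then have "const_fun (a N) \<otimes>\<^bsub>NF\<^esub> ind e N \<in> I"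
        using I.I_l_closed[of "ind e N" "const_fun (a N)"] S(2) aN by auto
      also have "const_fun (a N) \<otimes>\<^bsub>NF\<^esub> ind e N = (\<lambda>l. if l mod p ^ e = N then a N else \<zero>)"
        using aN by (auto simp: NF_sel const_fun_def ind_def)
      finally show ?thesis .
    qed
    then have "(\<lambda>l. if l mod p ^ e < N then a l else \<zero>) \<oplus>\<^bsub>NF\<^esub> (\<lambda>l. if l mod p ^ e = N then a N else \<zero>) \<in> I"
      using additive_subgroup.a_closed[OF ideal.axioms(1)[OF I], of _ "\<lambda>l. if l mod p ^ e = N then a N else \<zero>"] Suc by simp
    also have "(\<lambda>l. if l mod p ^ e < N then a l else \<zero>) \<oplus>\<^bsub>NF\<^esub> (\<lambda>l. if l mod p ^ e = N then a N else \<zero>) =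
      (\<lambda>l. if l mod p ^ e < Suc N then a l else \<zero>)"
    proof
      fix l
      have "a l \<in> carrier k" using a by (auto simp: NF_sel)
      then show "((\<lambda>l. if l mod p ^ e < N then a l else \<zero>) \<oplus>\<^bsub>NF\<^esub> (\<lambda>l. if l mod p ^ e = N then a N else \<zero>)) l =
          (if l mod p ^ e < Suc N then a l else \<zero>)"
        using periodic_mod[OF a(2), of l] aN by (auto simp: NF_sel less_Suc_eq)
    qed
    finally show ?case .
  qed
  from this[of "p ^ e"] show ?thesis by simp
qed

lemma Per_B: "Per \<subseteq> B"
proof
  fix a assume "a \<in> Per"
  then obtain e where a: "a \<in> carrier NF" "periodic a e" by (auto simp: Per_def)
  have "cring (NF\<lparr>carrier := B\<rparr>)"
    using NF.subcring_iff[of B] NF.subcringI'[OF B_subring] NF.generate_ring_incl[OF gens_carrier] by simp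
  then interpret C: cring "NF\<lparr>carrier := B\<rparr>" .
  have "const_fun ` carrier k \<subseteq> B" by (auto simp: gens_def intro: generate_ring.incl)
  then show "a \<in> B"
    using periodic_decomp[OF a B_subring _ C.oneideal] ind_B by simp
qed

lemma A_carrier: "carrier A = Per" and B_eq: "B = Per"
proof -
  have 1: "B \<subseteq> carrier A"
    unfolding A_alg_def by (simp, rule NF.mono_generate_ring) (auto simp: gens_def NF_sel const_fun_def binom_fun_def)
  have "const_fun ` carrier k \<union> range (binom_fun k) \<subseteq> Per"
  proof -
    have "binom_fun k n \<in> Per" for n
    proof -
      have "n < p ^ n" by (rule power_gt_expt) (use p_gt_1 in simp)
      then have "periodic (binom_fun k n) n" by (simp add: periodic_def binom_fun_def choose_periodic)
      then show ?thesis by (auto simp: Per_def NF_sel binom_fun_def)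
    qed
    moreover have "const_fun c \<in> Per" if "c \<in> carrier k" for c
      using that by (auto simp: Per_def NF_sel const_fun_def periodic_def)
    ultimately show ?thesis by blast
  qed
  then have 2: "carrier A \<subseteq> Per"
    unfolding A_alg_def
    by (simp, intro NF.generate_ring_min_subring1 Per_subring) (auto simp: NF_sel const_fun_def binom_fun_def)
  show "carrier A = Per" "B = Per" using 1 2 Per_B by auto
qed

lemma A_eq: "A = NF\<lparr>carrier := Per\<rparr>"
  using A_carrier by (simp add: A_alg_def)

lemma A_cring: "cring A"
  unfolding A_eq using NF.subcring_iff[of Per] NF.subcringI'[OF Per_subring] subringE(1)[OF Per_subring] by simp

sublocale A: cring A by (rule A_cring)

lemma A_sel: "a \<otimes>\<^bsub>A\<^esub> b = (\<lambda>l. a l \<otimes> b l)" "\<one>\<^bsub>A\<^esub> = (\<lambda>l. \<one>)" "\<zero>\<^bsub>A\<^esub> = (\<lambda>l. \<zero>)" "a \<oplus>\<^bsub>A\<^esub> b = (\<lambda>l. a l \<oplus> b l)"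
  by (simp_all add: A_eq NF_sel)

lemma A_closed: "a \<in> carrier A ==> a l \<in> carrier k"
  by (auto simp: A_carrier Per_def NF_sel)

lemma A_neg: "a \<in> carrier A ==> \<ominus>\<^bsub>A\<^esub> a = (\<lambda>l. \<ominus> a l)"
proof (rule A.minus_equality)
  assume a: "a \<in> carrier A"
  show "(\<lambda>l. \<ominus> a l) \<oplus>\<^bsub>A\<^esub> a = \<zero>\<^bsub>A\<^esub>" using A_closed[OF a] by (simp add: A_sel l_neg)
  obtain e where "a \<in> carrier NF" "periodic a e" using a unfolding A_carrier Per_def by blast
  then have "periodic (\<lambda>l. \<ominus> a l) e" "(\<lambda>l. \<ominus> a l) \<in> carrier NF" by (auto simp: periodic_def NF_sel Pi_def)
  then show "(\<lambda>l. \<ominus> a l) \<in> carrier A" unfolding A_carrier Per_def by blast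
qed

lemma const_A: "c \<in> carrier k ==> const_fun c \<in> carrier A"
  using B_eq by (auto simp: A_carrier gens_def B_eq[symmetric] intro: generate_ring.incl)

lemma binom_A: "binom_fun k (p ^ e) \<in> carrier A"
  by (auto simp: A_carrier gens_def B_eq[symmetric] intro: generate_ring.incl)

lemma ind_A: "m < p ^ e ==> ind e m \<in> carrier A"
  using ind_B by (simp add: A_carrier B_eq)

lemma A_induct [consumes 1, case_names const binom neg add mult]:
  assumes a: "a \<in> carrier A"
    and "\<And>c. c \<in> carrier k ==> Q (const_fun c)" "\<And>e. Q (binom_fun k (p ^ e))"
    and "\<And>a. a \<in> carrier A ==> Q a ==> Q (\<ominus>\<^bsub>A\<^esub> a)"
    and "\<And>a b. a \<in> carrier A ==> b \<in> carrier A ==> Q a ==> Q b ==> Q (a \<oplus>\<^bsub>A\<^esub> b)"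
    and "\<And>a b. a \<in> carrier A ==> b \<in> carrier A ==> Q a ==> Q b ==> Q (a \<otimes>\<^bsub>A\<^esub> b)"
  shows "Q a"
proof -
  have BA: "x \<in> carrier A" if "x \<in> B" for x using that by (simp add: A_carrier B_eq)
  have "a \<in> B" using a by (simp add: A_carrier B_eq)
  then show ?thesis
  proof induction
    case one
    have "\<one>\<^bsub>NF\<^esub> = const_fun \<one>" by (simp add: NF_sel const_fun_def)
    then show ?case using assms(2) by simp
  next
    case (incl h)
    then show ?case using assms(2,3) by (auto simp: gens_def)
  next
    case (a_inv h)
    have "h \<in> carrier NF" using a_inv(1) NF.generate_ring_incl[OF gens_carrier] by blast
    then have "\<ominus>\<^bsub>NF\<^esub> h = \<ominus>\<^bsub>A\<^esub> h" using NF_neg A_neg[OF BA[OF a_inv(1)]] by simp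
    then show ?case using assms(4) a_inv BA by simp
  next
    case (eng_add a b)
    then show ?case using assms(5)[of a b] BA by (simp add: A_sel NF_sel)
  next
    case (eng_mult a b)
    then show ?case using assms(6)[of a b] BA by (simp add: A_sel NF_sel)
  qed
qed

lemma A_add_pow: "[(n::nat)] \<cdot>\<^bsub>A\<^esub> \<one>\<^bsub>A\<^esub> = const_fun ([n] \<cdot> \<one>)"
  by (induction n) (simp_all add: A_sel const_fun_def)

lemma root_digit:
  assumes z: "z \<in> padic_ints p"
  shows "padic_digit p z e \<ge> 0" and "e < e' ==> nat (padic_digit p z e) = nat (z e') div p ^ e mod p"
proof -
  have z0: "z n \<ge> 0" for n using z by (simp add: padic_ints_def)
  show "padic_digit p z e \<ge> 0" using z0 by (simp add: padic_digit_def pos_imp_zdiv_nonneg_iff)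
  assume e: "e < e'"
  have "nat (z e') mod p ^ Suc e = nat (z (Suc e))" using e by (intro padic_nat_mod[OF z]) simp
  then have "nat (z (Suc e)) div p ^ e = (nat (z e') mod (p ^ e * p)) div p ^ e" by (simp add: mult.commute)
  also have "\<dots> = nat (z e') div p ^ e mod p" using p_gt_0 by (simp add: mod_mult2_eq)
  finally show "nat (padic_digit p z e) = nat (z e') div p ^ e mod p"
    using z0[of "Suc e"] by (simp add: padic_digit_def nat_div_distrib nat_power_eq)
qed

lemma root_generator:
  assumes z: "z \<in> padic_ints p"
  shows "binom_fun k (p ^ e) \<ominus>\<^bsub>A\<^esub> [padic_digit p z e] \<cdot>\<^bsub>A\<^esub> \<one>\<^bsub>A\<^esub> =
    (\<lambda>l. [(l div p ^ e mod p)] \<cdot> \<one> \<ominus> [(nat (padic_digit p z e))] \<cdot> \<one>)"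
proof -
  have "[padic_digit p z e] \<cdot>\<^bsub>A\<^esub> \<one>\<^bsub>A\<^esub> = const_fun ([(nat (padic_digit p z e))] \<cdot> \<one>)"
    using root_digit(1)[OF z, of e] by (simp add: add_pow_int_ge A_add_pow)
  then show ?thesis
    by (simp add: A.minus_eq A_neg[OF const_A] A_sel) (simp add: const_fun_def binom_digit minus_eq)
qed

text \<open>The ideal \<open>\<mm>\<^sub>z\<close> consists of the functions vanishing at \<open>z\<close>, extended continuously to \<open>\<int>\<^sub>p\<close>. A
  residue class missing \<open>z\<close> differs from \<open>z\<close> in some digit, so its indicator is a multiple of a generator.\<close>

lemma root_ideal_eq:
  assumes z: "z \<in> padic_ints p"
  shows "root_ideal k p z = {a \<in> carrier A. \<exists>e0. \<forall>e\<ge>e0. a (nat (z e)) = \<zero>}" (is "_ = ?V")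
proof
  let ?g = "\<lambda>e. binom_fun k (p ^ e) \<ominus>\<^bsub>A\<^esub> [padic_digit p z e] \<cdot>\<^bsub>A\<^esub> \<one>\<^bsub>A\<^esub>"
  have gA: "?g e \<in> carrier A" for e
    using root_digit(1)[OF z, of e] binom_A[of e] by (simp add: add_pow_int_ge)
  then have gens: "{?g e | e. True} \<subseteq> carrier A" by blast
  have V: "ideal ?V A"
  proof (rule A.ideal_of_closed)
    show "?V \<subseteq> carrier A" "?V \<noteq> {}" using A.zero_closed by (auto simp: A_sel)
    show "a \<oplus>\<^bsub>A\<^esub> b \<in> ?V" if ab: "a \<in> ?V" "b \<in> ?V" for a b
    proof -
      obtain e e' where "\<forall>n\<ge>e. a (nat (z n)) = \<zero>" "\<forall>n\<ge>e'. b (nat (z n)) = \<zero>" using ab by auto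
      then have "\<forall>n\<ge>max e e'. (a \<oplus>\<^bsub>A\<^esub> b) (nat (z n)) = \<zero>" by (simp add: A_sel)
      then show ?thesis using ab by blast
    qed
    show "x \<otimes>\<^bsub>A\<^esub> a \<in> ?V" if ax: "x \<in> carrier A" "a \<in> ?V" for a x
    proof -
      obtain e where "\<forall>n\<ge>e. a (nat (z n)) = \<zero>" using ax by auto
      then have "\<forall>n\<ge>e. (x \<otimes>\<^bsub>A\<^esub> a) (nat (z n)) = \<zero>" using A_closed[OF ax(1)] by (simp add: A_sel)
      then show ?thesis using ax by blast
    qed
  qed
  have "{?g e | e. True} \<subseteq> ?V"
  proof clarify
    fix e
    have "?g e (nat (z n)) = \<zero>" if "n \<ge> Suc e" for n
      using root_digit(2)[OF z, of e n] that by (simp add: root_generator[OF z] minus_eq r_neg)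
    then show "?g e \<in> carrier A \<and> (\<exists>e0. \<forall>n\<ge>e0. ?g e (nat (z n)) = \<zero>)" using gA by blast
  qed
  then show "root_ideal k p z \<subseteq> ?V" unfolding root_ideal_def by (rule A.genideal_minimal[OF V])
  show "?V \<subseteq> root_ideal k p z"
  proof
    fix a assume a: "a \<in> ?V"
    then obtain e where e: "periodic a e" by (auto simp: A_carrier Per_def)
    obtain e0 where e0: "\<And>n. n \<ge> e0 ==> a (nat (z n)) = \<zero>" using a by auto
    have I: "ideal (root_ideal k p z) A" unfolding root_ideal_def by (rule A.genideal_ideal[OF gens])
    show "a \<in> root_ideal k p z"
    proof (rule periodic_decomp[OF _ e Per_subring _ I[unfolded A_eq]])
      show "a \<in> carrier NF" using a by (auto simp: A_carrier Per_def)
      show "const_fun ` carrier k \<subseteq> Per" using const_A by (auto simp: A_carrier)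
      fix m assume m: "m < p ^ e" "a m \<noteq> \<zero>"
      have "m \<noteq> nat (z e)"
      proof
        assume "m = nat (z e)"
        define n where "n = max e0 e"
        have "nat (z n) mod p ^ e = m" unfolding \<open>m = nat (z e)\<close> by (rule padic_nat_mod[OF z]) (simp add: n_def)
        then have "a m = a (nat (z n))" using periodic_mod[OF e, of "nat (z n)"] by simp
        then show False using m(2) e0[of n] by (simp add: n_def)
      qed
      moreover have "nat (z e) < p ^ e" using z by (simp add: padic_ints_def nat_less_iff)
      ultimately obtain i w where i: "i < e" and w: "w \<in> carrier k"
        "w \<otimes> ([(m div p ^ i mod p)] \<cdot> \<one> \<ominus> [(nat (z e) div p ^ i mod p)] \<cdot> \<one>) = \<one>"
        using separating_digit[of m e "nat (z e)"] m(1) by auto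
      have gI: "?g i \<in> root_ideal k p z" unfolding root_ideal_def using A.genideal_self[OF gens] by blast
      have "(const_fun w \<otimes>\<^bsub>A\<^esub> ind e m) \<otimes>\<^bsub>A\<^esub> ?g i \<in> root_ideal k p z"
        using ideal.I_l_closed[OF I gI] w(1) const_A ind_A[OF m(1)] by simp
      also have "(const_fun w \<otimes>\<^bsub>A\<^esub> ind e m) \<otimes>\<^bsub>A\<^esub> ?g i = ind e m"
      proof
        fix l
        show "((const_fun w \<otimes>\<^bsub>A\<^esub> ind e m) \<otimes>\<^bsub>A\<^esub> ?g i) l = ind e m l"
        proof (cases "l mod p ^ e = m")
          case True
          have "l div p ^ i mod p = m div p ^ i mod p" by (rule digit_period[OF i]) (use True m(1) in simp)
          then have "?g i l = [(m div p ^ i mod p)] \<cdot> \<one> \<ominus> [(nat (z e) div p ^ i mod p)] \<cdot> \<one>"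
            using root_digit(2)[OF z i] by (simp add: root_generator[OF z])
          then show ?thesis using True w by (simp add: A_sel const_fun_def ind_def)
        next
          case False
          then show ?thesis using w A_closed[OF gA[of i], of l] by (simp add: A_sel const_fun_def ind_def)
        qed
      qed
      finally show "ind e m \<in> root_ideal k p z" .
    qed
  qed
qed

text \<open>If a member of \<open>I\<close> does not vanish at \<open>z\<close>, a multiple of it is the indicator of a residue class
  around \<open>z\<close>.\<close>

lemma roots_of_ideal:
  assumes I: "I \<subseteq> carrier A" and mult: "\<And>a b. a \<in> I ==> b \<in> carrier A ==> b \<otimes>\<^bsub>A\<^esub> a \<in> I"
  shows "roots_of k p I = {z \<in> padic_ints p. \<forall>e. ind e (nat (z e)) \<notin> I}"
proof -
  have "I \<subseteq> root_ideal k p z \<longleftrightarrow> (\<forall>e. ind e (nat (z e)) \<notin> I)" if z: "z \<in> padic_ints p" for z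
  proof
    note zmod = padic_nat_mod[OF z]
    have zlt: "nat (z e) < p ^ e" for e using z by (simp add: padic_ints_def nat_less_iff)
    show "\<forall>e. ind e (nat (z e)) \<notin> I" if sub: "I \<subseteq> root_ideal k p z"
    proof (intro allI notI)
      fix e assume "ind e (nat (z e)) \<in> I"
      then obtain e0 where "\<And>n. n \<ge> e0 ==> ind e (nat (z e)) (nat (z n)) = \<zero>"
        using sub unfolding root_ideal_eq[OF z] by blast
      from this[of "max e0 e"] show False using zmod[of e "max e0 e"] by (simp add: ind_def)
    qed
    show "I \<subseteq> root_ideal k p z" if ni: "\<forall>e. ind e (nat (z e)) \<notin> I"
    proof
      fix a assume a: "a \<in> I"
      then have aA: "a \<in> carrier A" using I by blast
      then obtain e where e: "periodic a e" by (auto simp: A_carrier Per_def)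
      have "a (nat (z e)) = \<zero>"
      proof (rule ccontr)
        assume nz: "a (nat (z e)) \<noteq> \<zero>"
        have ac: "a (nat (z e)) \<in> carrier k" by (rule A_closed[OF aA])
        then have w: "inv (a (nat (z e))) \<in> carrier k" "inv (a (nat (z e))) \<otimes> a (nat (z e)) = \<one>"
          using nz field_Units by auto
        have "(const_fun (inv (a (nat (z e)))) \<otimes>\<^bsub>A\<^esub> ind e (nat (z e))) \<otimes>\<^bsub>A\<^esub> a \<in> I"
          using w(1) const_A ind_A[OF zlt] by (intro mult a) simp
        also have "(const_fun (inv (a (nat (z e)))) \<otimes>\<^bsub>A\<^esub> ind e (nat (z e))) \<otimes>\<^bsub>A\<^esub> a = ind e (nat (z e))"
        proof
          fix l
          show "((const_fun (inv (a (nat (z e)))) \<otimes>\<^bsub>A\<^esub> ind e (nat (z e))) \<otimes>\<^bsub>A\<^esub> a) l = ind e (nat (z e)) l"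
            using periodic_mod[OF e, of l] w A_closed[OF aA, of l] by (auto simp: A_sel const_fun_def ind_def)
        qed
        finally show False using ni by blast
      qed
      then have "a (nat (z n)) = \<zero>" if "n \<ge> e" for n
        using periodic_mod[OF e, of "nat (z n)"] zmod[OF that] by simp
      then show "a \<in> root_ideal k p z" unfolding root_ideal_eq[OF z] using aA by blast
    qed
  qed
  then show ?thesis unfolding roots_of_def by blast
qed

end

section \<open>Operators acting on coefficients\<close>

locale cring_char_poly = cring_char
begin

abbreviation "S \<equiv> UP R"

sublocale S: UP_cring R "UP R" by (simp_all add: UP_cring_def is_cring)

lemma UP_cring_char: "cring_char S p"
  by (rule cring_char_hom[OF S.UP_cring S.const_ring_hom])

declare S.coeff_mult [simp del]

lemma coeff_monom_mult_if:
  assumes c: "c \<in> carrier R" and u: "u \<in> carrier S"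
  shows "coeff S (monom S c d \<otimes>\<^bsub>S\<^esub> u) n = (if d \<le> n then c \<otimes> coeff S u (n - d) else \<zero>)"
proof (cases "d \<le> n")
  case True
  then show ?thesis using S.coeff_monom_mult[OF c u, of d "n - d"] by simp
next
  case False
  have "coeff S (monom S c d \<otimes>\<^bsub>S\<^esub> u) n = \<zero>"
    unfolding S.coeff_mult[OF S.monom_closed[OF c] u]
    by (rule add.finprod_one_eqI) (use False c u in auto)
  then show ?thesis using False by simp
qed

text \<open>Sequences \<open>\<Phi>\<close> in \<open>D\<^sub>e\<close> of period \<open>p\<^sup>e\<close>; through \<open>coeff_op\<close>, acting by \<open>\<Phi> n\<close> on the coefficient of \<open>t\<^sup>n\<close>,
  they turn out to be the operators in \<open>D\<^sub>R[\<nu>\<^sub>e; e \<in> \<nat>]\<close>.\<close>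

definition euler_coeffs :: "nat => (nat => 'a => 'a) set" where
  "euler_coeffs e = {\<Phi>. (\<forall>n. \<Phi> n \<in> frob_linear_ops R p e) \<and> (\<forall>n. \<Phi> (n + p ^ e) = \<Phi> n)}"

definition coeff_op :: "(nat => 'a => 'a) => (nat => 'a) => nat => 'a" where
  "coeff_op \<Phi> = (\<lambda>u\<in>carrier S. \<lambda>n. \<Phi> n (coeff S u n))"

definition scalar_coeffs :: "(nat => 'a) => nat => 'a => 'a" where
  "scalar_coeffs s = (\<lambda>n. \<lambda>x\<in>carrier R. s n \<otimes> x)"

definition mult_coeffs :: "(nat => 'a => 'a) => (nat => 'a => 'a) => nat => 'a => 'a" where
  "mult_coeffs \<Phi> \<Psi> = (\<lambda>n. compose (carrier R) (\<Phi> n) (\<Psi> n))"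

definition add_coeffs :: "(nat => 'a => 'a) => (nat => 'a => 'a) => nat => 'a => 'a" where
  "add_coeffs \<Phi> \<Psi> = (\<lambda>n. \<lambda>x\<in>carrier R. \<Phi> n x \<oplus> \<Psi> n x)"

lemma euler_coeffs_op: "\<Phi> \<in> euler_coeffs e ==> \<Phi> n \<in> frob_linear_ops R p e"
  by (simp add: euler_coeffs_def)

lemma euler_coeffs_closed [simp]: "\<Phi> \<in> euler_coeffs e ==> x \<in> carrier R ==> \<Phi> n x \<in> carrier R"
  using frob_linear_opsD(1)[OF euler_coeffs_op] by blast

lemma euler_coeffs_zero [simp]: "\<Phi> \<in> euler_coeffs e ==> \<Phi> n \<zero> = \<zero>"
  using frob_linear_zero_val[OF euler_coeffs_op] by blast

lemma euler_coeffs_period: "\<Phi> \<in> euler_coeffs e ==> \<Phi> (n + p ^ e * m) = \<Phi> n"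
proof (induction m)
  case (Suc m)
  have "\<Phi> (n + p ^ e * Suc m) = \<Phi> ((n + p ^ e * m) + p ^ e)" by (simp add: ac_simps)
  also have "\<dots> = \<Phi> (n + p ^ e * m)" using Suc.prems unfolding euler_coeffs_def by blast
  finally show ?case using Suc by simp
qed simp

lemma euler_coeffs_mono:
  assumes "\<Phi> \<in> euler_coeffs e" "e \<le> e'"
  shows "\<Phi> \<in> euler_coeffs e'"
proof -
  have "p ^ e' = p ^ e * p ^ (e' - e)" using assms(2) by (simp add: power_add[symmetric])
  then have "\<Phi> (n + p ^ e') = \<Phi> n" for n using euler_coeffs_period[OF assms(1)] by simp
  moreover have "\<Phi> n \<in> frob_linear_ops R p e'" for n
    by (rule frob_linear_mono[OF euler_coeffs_op[OF assms(1)] assms(2)])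
  ultimately show ?thesis by (simp add: euler_coeffs_def)
qed

lemma euler_coeffs_common:
  assumes "\<Phi> \<in> euler_coeffs e" "\<Psi> \<in> euler_coeffs e'"
  shows "\<Phi> \<in> euler_coeffs (max e e')" "\<Psi> \<in> euler_coeffs (max e e')"
  using assms euler_coeffs_mono by (meson max.cobounded1 max.cobounded2)+

lemma mult_coeffs_euler: "\<Phi> \<in> euler_coeffs e ==> \<Psi> \<in> euler_coeffs e ==> mult_coeffs \<Phi> \<Psi> \<in> euler_coeffs e"
  by (simp add: euler_coeffs_def mult_coeffs_def frob_linear_compose)

lemma add_coeffs_euler: "\<Phi> \<in> euler_coeffs e ==> \<Psi> \<in> euler_coeffs e ==> add_coeffs \<Phi> \<Psi> \<in> euler_coeffs e"
  by (simp add: euler_coeffs_def add_coeffs_def frob_linear_add)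

lemma scalar_coeffs_euler:
  "(\<And>n. s n \<in> carrier R) ==> (\<And>n. s (n + p ^ e) = s n) ==> scalar_coeffs s \<in> euler_coeffs e"
  by (simp add: euler_coeffs_def scalar_coeffs_def frob_linear_mult)

lemma shift_euler: "\<Phi> \<in> euler_coeffs e ==> (\<lambda>n. \<Phi> (n + j)) \<in> euler_coeffs e"
proof -
  assume \<Phi>: "\<Phi> \<in> euler_coeffs e"
  have "\<Phi> ((n + j) + p ^ e * 1) = \<Phi> (n + j)" for n by (rule euler_coeffs_period[OF \<Phi>])
  moreover have "(n + p ^ e) + j = (n + j) + p ^ e * 1" for n by simp
  ultimately have "\<Phi> ((n + p ^ e) + j) = \<Phi> (n + j)" for n by (simp only:)
  then show ?thesis using \<Phi> by (simp add: euler_coeffs_def)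
qed

context
  fixes \<Phi> e assumes \<Phi>: "\<Phi> \<in> euler_coeffs e"
begin

lemma coeff_op_closed [simp]: "u \<in> carrier S ==> coeff_op \<Phi> u \<in> carrier S"
  and coeff_coeff_op [simp]: "u \<in> carrier S ==> coeff S (coeff_op \<Phi> u) n = \<Phi> n (coeff S u n)"
proof -
  assume u: "u \<in> carrier S"
  have "(\<lambda>n. \<Phi> n (coeff S u n)) \<in> up R"
  proof (rule mem_upI)
    show "\<Phi> n (coeff S u n) \<in> carrier R" for n using \<Phi> u by simp
    have "bound \<zero> (deg R u) (\<lambda>n. \<Phi> n (coeff S u n))"
      using \<Phi> u S.deg_aboveD[OF _ u] by (intro bound.intro) simp
    then show "\<exists>n. bound \<zero> n (\<lambda>n. \<Phi> n (coeff S u n))" by blast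
  qed
  then show "coeff_op \<Phi> u \<in> carrier S" "coeff S (coeff_op \<Phi> u) n = \<Phi> n (coeff S u n)"
    using u by (simp_all add: coeff_op_def UP_def)
qed

text \<open>Multiplying by \<open>(c t\<^sup>k)\<^sup>q\<close> shifts coefficients by a multiple of the period.\<close>

lemma coeff_op_frob_linear: "coeff_op \<Phi> \<in> frob_linear_ops S p e"
proof -
  interpret SC: cring_char S p by (rule UP_cring_char)
  note D = frob_linear_opsD[OF euler_coeffs_op[OF \<Phi>]]
  have add: "coeff_op \<Phi> (u \<oplus>\<^bsub>S\<^esub> v) = coeff_op \<Phi> u \<oplus>\<^bsub>S\<^esub> coeff_op \<Phi> v"
    if "u \<in> carrier S" "v \<in> carrier S" for u v
    using that D(2) by (intro S.up_eqI) simp_all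
  have "coeff_op \<Phi> (a [^]\<^bsub>S\<^esub> (p ^ e) \<otimes>\<^bsub>S\<^esub> u) = a [^]\<^bsub>S\<^esub> (p ^ e) \<otimes>\<^bsub>S\<^esub> coeff_op \<Phi> u"
    if a: "a \<in> carrier S" and u: "u \<in> carrier S" for a u
    using a
  proof (induction rule: S.UP_add_induct)
    case (add a b)
    have c: "a [^]\<^bsub>S\<^esub> (p ^ e) \<in> carrier S" "b [^]\<^bsub>S\<^esub> (p ^ e) \<in> carrier S" using add by simp_all
    show ?case
      unfolding SC.frob_add[OF add(1,2)] S.P.l_distr[OF c u] S.P.l_distr[OF c coeff_op_closed[OF u]]
      using c u add by (simp add: \<open>\<And>u v. u \<in> carrier S ==> v \<in> carrier S ==> coeff_op \<Phi> (u \<oplus>\<^bsub>S\<^esub> v) = coeff_op \<Phi> u \<oplus>\<^bsub>S\<^esub> coeff_op \<Phi> v\<close>)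
  next
    case (monom c k)
    have per: "\<Phi> n = \<Phi> (n - k * p ^ e)" if "k * p ^ e \<le> n" for n
      using euler_coeffs_period[OF \<Phi>, of "n - k * p ^ e" k] that by (simp add: mult.commute)
    show ?case
      unfolding S.monom_pow[OF monom]
    proof (rule S.up_eqI)
      fix n
      show "coeff S (coeff_op \<Phi> (monom S (c [^] p ^ e) (k * p ^ e) \<otimes>\<^bsub>S\<^esub> u)) n =
         coeff S (monom S (c [^] p ^ e) (k * p ^ e) \<otimes>\<^bsub>S\<^esub> coeff_op \<Phi> u) n"
      proof (cases "k * p ^ e \<le> n")
        case True
        then show ?thesis using monom u D(3)[OF monom, of "coeff S u (n - k * p ^ e)" n] per[OF True]
          by (simp add: coeff_monom_mult_if)
      next
        case False
        then show ?thesis using monom u \<Phi> by (simp add: coeff_monom_mult_if)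
      qed
    qed (use monom u in simp_all)
  qed
  moreover have "coeff_op \<Phi> \<in> carrier S \<rightarrow>\<^sub>E carrier S"
    by (rule PiE_I) (simp, simp add: coeff_op_def)
  ultimately show ?thesis using add unfolding frob_linear_ops_def by blast
qed

end

lemma coeff_op_cong:
  assumes "\<And>n x. x \<in> carrier R ==> \<Phi> n x = \<Psi> n x"
  shows "coeff_op \<Phi> = coeff_op \<Psi>"
  using assms by (auto simp: coeff_op_def fun_eq_iff)

lemma coeff_op_mult:
  assumes "\<Phi> \<in> euler_coeffs e" "\<Psi> \<in> euler_coeffs e'"
  shows "compose (carrier S) (coeff_op \<Phi>) (coeff_op \<Psi>) = coeff_op (mult_coeffs \<Phi> \<Psi>)"
proof -
  have "coeff_op \<Phi> (coeff_op \<Psi> u) = coeff_op (mult_coeffs \<Phi> \<Psi>) u" if u: "u \<in> carrier S" for u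
    using coeff_op_closed[OF assms(2) u] coeff_coeff_op[OF assms(2) u] u
    by (subst (1 3) coeff_op_def) (simp add: mult_coeffs_def compose_def)
  then show ?thesis by (auto simp: compose_def fun_eq_iff) (simp add: coeff_op_def)
qed

lemma coeff_op_add:
  assumes "\<Phi> \<in> euler_coeffs e" "\<Psi> \<in> euler_coeffs e"
  shows "(\<lambda>u\<in>carrier S. coeff_op \<Phi> u \<oplus>\<^bsub>S\<^esub> coeff_op \<Psi> u) = coeff_op (add_coeffs \<Phi> \<Psi>)"
proof (rule extensionalityI[of _ "carrier S"])
  fix u assume u: "u \<in> carrier S"
  show "(\<lambda>u\<in>carrier S. coeff_op \<Phi> u \<oplus>\<^bsub>S\<^esub> coeff_op \<Psi> u) u = coeff_op (add_coeffs \<Phi> \<Psi>) u"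
    using u coeff_op_closed[OF assms(1) u] coeff_op_closed[OF assms(2) u]
      coeff_op_closed[OF add_coeffs_euler[OF assms] u]
      coeff_coeff_op[OF assms(1) u] coeff_coeff_op[OF assms(2) u] coeff_coeff_op[OF add_coeffs_euler[OF assms] u]
    by (intro S.up_eqI) (simp_all add: add_coeffs_def)
qed (auto simp: coeff_op_def)

text \<open>Commuting an operator past \<open>t\<close> shifts the sequence cyclically by one, here by \<open>p\<^sup>e - 1\<close> the other way
  round.\<close>

lemma coeff_op_shift:
  assumes \<Phi>: "\<Phi> \<in> euler_coeffs e" and u: "u \<in> carrier S"
  shows "monom S \<one> 1 \<otimes>\<^bsub>S\<^esub> coeff_op \<Phi> u = coeff_op (\<lambda>n. \<Phi> (n + (p ^ e - 1))) (monom S \<one> 1 \<otimes>\<^bsub>S\<^esub> u)"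
proof (rule S.up_eqI)
  note \<Psi> = shift_euler[OF \<Phi>, of "p ^ e - 1"]
  have tu: "monom S \<one> 1 \<otimes>\<^bsub>S\<^esub> u \<in> carrier S" using u by simp
  show "monom S \<one> 1 \<otimes>\<^bsub>S\<^esub> coeff_op \<Phi> u \<in> carrier S" using coeff_op_closed[OF \<Phi> u] by simp
  show "coeff_op (\<lambda>n. \<Phi> (n + (p ^ e - 1))) (monom S \<one> 1 \<otimes>\<^bsub>S\<^esub> u) \<in> carrier S"
    by (rule coeff_op_closed[OF \<Psi> tu])
  fix n
  have "\<Phi> (n + (p ^ e - 1)) = \<Phi> (n - 1)" if "1 \<le> n"
  proof -
    have "n + (p ^ e - 1) = n - 1 + p ^ e * 1" using that by (simp add: Suc_leI)
    then show ?thesis using euler_coeffs_period[OF \<Phi>, of "n - 1" 1] by simp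
  qed
  then show "coeff S (monom S \<one> 1 \<otimes>\<^bsub>S\<^esub> coeff_op \<Phi> u) n = coeff S (coeff_op (\<lambda>n. \<Phi> (n + (p ^ e - 1))) (monom S \<one> 1 \<otimes>\<^bsub>S\<^esub> u)) n"
    unfolding coeff_coeff_op[OF \<Psi> tu] using u \<Phi> coeff_op_closed[OF \<Phi> u] coeff_coeff_op[OF \<Phi> u]
    by (simp add: coeff_monom_mult_if)
qed

text \<open>\<open>\<nu>\<^sub>e t\<^sup>n = (n + p\<^sup>e choose p\<^sup>e) t\<^sup>n\<close>, and this binomial is \<open>n div p\<^sup>e + 1\<close> modulo \<open>p\<close>.\<close>

lemma euler_op_eq:
  "euler_op R p e = coeff_op (scalar_coeffs (\<lambda>n. [(n div p ^ e + 1)] \<cdot> \<one>))"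
proof (rule extensionalityI[of _ "carrier S"])
  fix u assume u: "u \<in> carrier S"
  have "poly_var R [^]\<^bsub>S\<^esub> (p ^ e) = monom S \<one> (p ^ e)"
    unfolding poly_var_def by (subst S.monom_pow) simp_all
  then have v: "mult_operator S (poly_var R [^]\<^bsub>S\<^esub> (p ^ e)) u = monom S \<one> (p ^ e) \<otimes>\<^bsub>S\<^esub> u" using u by (simp add: mult_operator_def)
  have "euler_op R p e u j = [((j + p ^ e) choose p ^ e)] \<cdot> coeff S u j" for j
    using u S.coeff_monom_mult[of \<one> u "p ^ e" j] by (simp add: euler_op_def compose_def v divided_ddt_def)
  also have "\<dots> j = ([((j + p ^ e) choose p ^ e)] \<cdot> \<one>) \<otimes> coeff S u j" for j
    using u by (subst add_pow_ldistr) auto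
  also have "\<dots> j = coeff_op (scalar_coeffs (\<lambda>n. [(n div p ^ e + 1)] \<cdot> \<one>)) u j" for j
    unfolding choose_pow_div using u by (simp add: coeff_op_def scalar_coeffs_def)
  finally show "euler_op R p e u = coeff_op (scalar_coeffs (\<lambda>n. [(n div p ^ e + 1)] \<cdot> \<one>)) u" by (rule ext)
qed (auto simp: euler_op_def coeff_op_def)

lemma add_pow_cong: "[(n + p * m)] \<cdot> \<one> = [(n::nat)] \<cdot> \<one>"
  using add_pow_mod[of "n + p * m"] add_pow_mod[of n] by simp

lemma euler_op_coeffs: "scalar_coeffs (\<lambda>n. [(n div p ^ e + 1)] \<cdot> \<one>) \<in> euler_coeffs (Suc e)"
proof (rule scalar_coeffs_euler)
  fix n
  have "(n + p ^ Suc e) div p ^ e = n div p ^ e + p" by (simp add: mult.commute)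
  then show "[((n + p ^ Suc e) div p ^ e + 1)] \<cdot> \<one> = [(n div p ^ e + 1)] \<cdot> \<one>"
    using add_pow_cong[of "n div p ^ e + 1" 1] by (simp only: mult_1_right add.commute add.left_commute)
qed simp

lemma extend_to_poly_eq: "extend_to_poly R Q = coeff_op (\<lambda>_. Q)"
  by (simp add: extend_to_poly_def coeff_op_def)

lemma extend_coeffs: "Q \<in> frob_linear_ops R p e ==> (\<lambda>_. Q) \<in> euler_coeffs e"
  by (simp add: euler_coeffs_def)

end

section \<open>The ring generated by the Euler operators\<close>

text \<open>\<open>(n + 1) (q - 1)\<close> is a natural number congruent to \<open>-1 - n\<close>.\<close>

lemma neg_mod:
  fixes n q :: nat
  assumes q: "q > 0"
  shows "((n + 1) * (q - 1)) mod q = q - 1 - n mod q"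
proof -
  obtain s where s: "q = Suc s" using q gr0_implies_Suc by blast
  define a r where "a = n div q" and "r = n mod q"
  have n: "n = Suc s * a + r" and r: "r \<le> s" using q by (simp_all add: a_def r_def s[symmetric]) (simp add: s less_Suc_eq_le[symmetric])
  have "(n + 1) * s = Suc s * (s * a + r) + (s - r)"
  proof -
    obtain d where "s = r + d" using r le_Suc_ex by blast
    then show ?thesis unfolding n by (simp add: algebra_simps)
  qed
  then have "((n + 1) * s) mod Suc s = s - r" by (simp only: mod_mult_self4) simp
  then show ?thesis by (simp add: s r_def)
qed

lemma pow_minus_one: "e \<le> e' ==> (p::nat) > 0 ==> p ^ e' - 1 = (p ^ e - 1) + p ^ e * (p ^ (e' - e) - 1)"
proof -
  assume a: "e \<le> e'" "p > 0"
  have "p ^ e' = p ^ e * p ^ (e' - e)" using a(1) by (simp add: power_add[symmetric])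
  moreover have "p ^ e \<ge> 1" "p ^ (e' - e) \<ge> 1" using a by (simp_all add: Suc_leI)
  ultimately show ?thesis by (simp add: diff_mult_distrib2)
qed

locale finite_type_perfect = cring_char_poly R p + kk: binomial_algebra k p for R (structure) and p and k :: "('k, 'z) ring_scheme" +
  fixes \<iota> X
  assumes hom: "\<iota> \<in> ring_hom k R" and perfect: "\<And>c. c \<in> carrier k ==> \<exists>d\<in>carrier k. d [^]\<^bsub>k\<^esub> p = c"
    and X: "finite X" "X \<subseteq> carrier R" and gen: "generate_ring R (\<iota> ` carrier k \<union> X) = carrier R"
begin

abbreviation "K \<equiv> \<iota> ` carrier k"
abbreviation "KS \<equiv> poly_scalars R K"
abbreviation "D \<equiv> poly_diff_ops R K"
abbreviation "A \<equiv> A_alg k"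

sublocale io: ring_hom_cring k R \<iota> by (intro ring_hom_cringI kk.is_cring is_cring hom)

lemma K_closed: "K \<subseteq> carrier R" by auto

lemma K_root: "c \<in> K ==> \<exists>d\<in>K. d [^] (p ^ e) = c"
proof (induction e)
  case 0
  then show ?case using K_closed by (intro bexI[of _ c]) auto
next
  case (Suc e)
  then obtain d where d: "d \<in> carrier k" "\<iota> d [^] (p ^ e) = c" by auto
  obtain d' where d': "d' \<in> carrier k" "d' [^]\<^bsub>k\<^esub> p = d" using perfect[OF d(1)] by blast
  have pow: "\<iota> d' [^] (n::nat) = \<iota> (d' [^]\<^bsub>k\<^esub> n)" for n using d'(1) by (induction n) simp_all
  have "\<iota> d' [^] (p ^ Suc e) = (\<iota> d' [^] p) [^] (p ^ e)" using d' by (simp add: nat_pow_pow)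
  also have "\<iota> d' [^] p = \<iota> d" using d'(2) pow by simp
  finally show ?case using d d' by (intro bexI[of _ "\<iota> d'"]) auto
qed

lemma R_diff_ops: "carrier (diff_ops R K) = (\<Union>e. frob_linear_ops R p e)"
  by (rule diff_ops_carrier[OF K_closed X gen]) (use K_root K_closed in blast)

lemma KS_closed: "KS \<subseteq> carrier S" by (auto simp: poly_scalars_def)

lemma S_gen: "generate_ring S (KS \<union> insert (monom S \<one> 1) ((\<lambda>c. monom S c 0) ` X)) = carrier S"
  unfolding poly_scalars_def by (rule S.poly_generated[OF K_closed X(2) gen])

lemma KS_root: "c \<in> KS ==> \<exists>d\<in>KS. d [^]\<^bsub>S\<^esub> (p ^ e) = c"
proof -
  assume "c \<in> KS"
  then obtain b where b: "b \<in> K" "c = monom S b 0" by (auto simp: poly_scalars_def)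
  obtain d where d: "d \<in> K" "d [^] (p ^ e) = b" using K_root[OF b(1)] by blast
  have "monom S d 0 [^]\<^bsub>S\<^esub> (p ^ e) = c" using d K_closed b by (subst S.monom_pow) auto
  then show ?thesis using d(1) by (auto simp: poly_scalars_def)
qed

lemma S_diff_ops: "carrier D = (\<Union>e. frob_linear_ops S p e)"
  unfolding poly_diff_ops_def
  by (rule cring_char.diff_ops_carrier[OF UP_cring_char KS_closed _ _ S_gen]) (use X in simp, use X in auto, use KS_root KS_closed in blast)

lemma D_ring: "ring D"
  using cring_char.diff_ops_ring[OF UP_cring_char] S_diff_ops unfolding poly_diff_ops_def by blast

lemma D_sel: "\<one>\<^bsub>D\<^esub> = (\<lambda>x \<in> carrier S. x)" "\<zero>\<^bsub>D\<^esub> = (\<lambda>x \<in> carrier S. \<zero>\<^bsub>S\<^esub>)"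
    "P \<otimes>\<^bsub>D\<^esub> Q = compose (carrier S) P Q" "P \<oplus>\<^bsub>D\<^esub> Q = (\<lambda>x \<in> carrier S. P x \<oplus>\<^bsub>S\<^esub> Q x)"
  by (simp_all add: poly_diff_ops_def diff_ops_def)

definition neg_coeffs :: "(nat => 'a => 'a) => nat => 'a => 'a" where
  "neg_coeffs \<Phi> = mult_coeffs (scalar_coeffs (\<lambda>_. \<ominus> \<one>)) \<Phi>"

lemma neg_coeffs_euler: "\<Phi> \<in> euler_coeffs e ==> neg_coeffs \<Phi> \<in> euler_coeffs e"
  unfolding neg_coeffs_def by (intro mult_coeffs_euler scalar_coeffs_euler) auto

lemma neg_coeffs_apply: "\<Phi> \<in> euler_coeffs e ==> x \<in> carrier R ==> neg_coeffs \<Phi> n x = \<ominus> \<Phi> n x"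
  by (simp add: neg_coeffs_def mult_coeffs_def scalar_coeffs_def compose_def l_minus)

lemma D_closed: "\<Phi> \<in> euler_coeffs e ==> coeff_op \<Phi> \<in> carrier D"
  using coeff_op_frob_linear S_diff_ops by blast

lemma D_mult: "\<Phi> \<in> euler_coeffs e ==> \<Psi> \<in> euler_coeffs e' ==> coeff_op \<Phi> \<otimes>\<^bsub>D\<^esub> coeff_op \<Psi> = coeff_op (mult_coeffs \<Phi> \<Psi>)"
  unfolding D_sel by (rule coeff_op_mult)

lemma D_add: "\<Phi> \<in> euler_coeffs e ==> \<Psi> \<in> euler_coeffs e ==> coeff_op \<Phi> \<oplus>\<^bsub>D\<^esub> coeff_op \<Psi> = coeff_op (add_coeffs \<Phi> \<Psi>)"
  unfolding D_sel by (rule coeff_op_add)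

lemma D_neg:
  assumes \<Phi>: "\<Phi> \<in> euler_coeffs e"
  shows "\<ominus>\<^bsub>D\<^esub> coeff_op \<Phi> = coeff_op (neg_coeffs \<Phi>)"
proof -
  interpret D: ring D by (rule D_ring)
  have "coeff_op (neg_coeffs \<Phi>) \<oplus>\<^bsub>D\<^esub> coeff_op \<Phi> = coeff_op (add_coeffs (neg_coeffs \<Phi>) \<Phi>)"
    by (rule D_add[OF neg_coeffs_euler[OF \<Phi>] \<Phi>])
  also have "\<dots> = coeff_op (\<lambda>n. \<lambda>x\<in>carrier R. \<zero>)"
    by (rule coeff_op_cong) (use \<Phi> in \<open>simp add: add_coeffs_def neg_coeffs_apply[OF \<Phi>] l_neg\<close>)
  also have "\<dots> = \<zero>\<^bsub>D\<^esub>"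
    by (auto simp: D_sel coeff_op_def fun_eq_iff UP_def)
  finally show ?thesis by (rule D.minus_equality[OF _ D_closed[OF \<Phi>] D_closed[OF neg_coeffs_euler[OF \<Phi>]]])
qed

lemma euler_ring_le: "P \<in> euler_ring R K p ==> \<exists>e. \<exists>\<Phi>\<in>euler_coeffs e. P = coeff_op \<Phi>"
  unfolding euler_ring_def
proof (induction rule: generate_ring.induct)
  case one
  have "(\<lambda>_. \<lambda>x\<in>carrier R. x) \<in> euler_coeffs 0" by (auto simp: euler_coeffs_def frob_linear_ops_def)
  moreover have "\<one>\<^bsub>D\<^esub> = coeff_op (\<lambda>_. \<lambda>x\<in>carrier R. x)"
    by (auto simp: D_sel coeff_op_def fun_eq_iff UP_def)
  ultimately show ?case by blast
next
  case (incl P)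
  then show ?case
  proof
    assume "P \<in> extend_to_poly R ` carrier (diff_ops R K)"
    then obtain e Q where "Q \<in> frob_linear_ops R p e" "P = extend_to_poly R Q" unfolding R_diff_ops by blast
    then show ?thesis using extend_coeffs extend_to_poly_eq by blast
  next
    assume "P \<in> range (euler_op R p)"
    then show ?thesis using euler_op_coeffs euler_op_eq by blast
  qed
next
  case (a_inv P)
  then obtain e \<Phi> where \<Phi>: "\<Phi> \<in> euler_coeffs e" "P = coeff_op \<Phi>" by blast
  then show ?case using D_neg[OF \<Phi>(1)] neg_coeffs_euler[OF \<Phi>(1)] by blast
next
  case (eng_add P Q)
  then obtain e e' \<Phi> \<Psi> where *: "\<Phi> \<in> euler_coeffs e" "P = coeff_op \<Phi>" "\<Psi> \<in> euler_coeffs e'" "Q = coeff_op \<Psi>" by blast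
  note c = euler_coeffs_common[OF *(1,3)]
  show ?case using D_add[OF c] add_coeffs_euler[OF c] *(2,4) by blast
next
  case (eng_mult P Q)
  then obtain e e' \<Phi> \<Psi> where *: "\<Phi> \<in> euler_coeffs e" "P = coeff_op \<Phi>" "\<Psi> \<in> euler_coeffs e'" "Q = coeff_op \<Psi>" by blast
  note c = euler_coeffs_common[OF *(1,3)]
  show ?case using D_mult[OF c] mult_coeffs_euler[OF c] *(2,4) by blast
qed

text \<open>The value of \<open>a \<in> A\<^sub>k\<close> at the \<open>p\<close>-adic integer \<open>-1 - n\<close>, by periodicity. Since \<open>-\<nu>\<^sub>e\<close> multiplies \<open>t\<^sup>n\<close> by
  \<open>(-1 - n choose p\<^sup>e)\<close>, letting \<open>(s choose p\<^sup>e)\<close> act as \<open>-\<nu>\<^sub>e\<close> means letting \<open>a\<close> act on \<open>t\<^sup>n\<close> through this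
  value.\<close>

definition neg_eval :: "(nat => 'k) => nat => 'k" where
  "neg_eval a n = a ((n + 1) * (p ^ (SOME e. kk.periodic a e) - 1))"

definition eval_coeffs :: "(nat => 'k) => nat => 'a => 'a" where
  "eval_coeffs a = scalar_coeffs (\<lambda>n. \<iota> (neg_eval a n))"

lemma neg_eval_eq:
  assumes e: "kk.periodic a e"
  shows "neg_eval a n = a ((n + 1) * (p ^ e - 1))"
proof -
  have *: "a ((n + 1) * (p ^ d' - 1)) = a ((n + 1) * (p ^ d - 1))" if d: "kk.periodic a d" "d \<le> d'" for d d'
  proof -
    have "(n + 1) * (p ^ d' - 1) = (n + 1) * (p ^ d - 1) + p ^ d * ((n + 1) * (p ^ (d' - d) - 1))"
      unfolding pow_minus_one[OF d(2) p_gt_0] by (simp only: distrib_left mult.left_commute)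
    then show ?thesis using kk.periodic_mult[OF d(1)] by (simp only:)
  qed
  define d where "d = (SOME e. kk.periodic a e)"
  have d: "kk.periodic a d" unfolding d_def using e by (rule someI)
  have "neg_eval a n = a ((n + 1) * (p ^ d - 1))" by (simp add: neg_eval_def d_def)
  also have "\<dots> = a ((n + 1) * (p ^ max d e - 1))" using *[OF d, of "max d e"] by simp
  also have "\<dots> = a ((n + 1) * (p ^ e - 1))" using *[OF e, of "max d e"] by simp
  finally show ?thesis .
qed

lemma A_periodic: "a \<in> carrier A ==> \<exists>e. kk.periodic a e"
  by (auto simp: kk.A_carrier kk.Per_def)

lemma neg_eval_closed [simp]: "a \<in> carrier A ==> neg_eval a n \<in> carrier k"
  by (simp add: neg_eval_def kk.A_closed)

lemma neg_eval_hom: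
  assumes "a \<in> carrier A" "b \<in> carrier A"
  shows "neg_eval (a \<oplus>\<^bsub>A\<^esub> b) n = neg_eval a n \<oplus>\<^bsub>k\<^esub> neg_eval b n"
    and "neg_eval (a \<otimes>\<^bsub>A\<^esub> b) n = neg_eval a n \<otimes>\<^bsub>k\<^esub> neg_eval b n"
proof -
  obtain e where e: "kk.periodic a e" "kk.periodic b e"
    using assms kk.periodic_common unfolding kk.A_carrier by blast
  then have "kk.periodic (a \<oplus>\<^bsub>A\<^esub> b) e" "kk.periodic (a \<otimes>\<^bsub>A\<^esub> b) e" by (simp_all add: kk.periodic_def kk.A_sel)
  then show "neg_eval (a \<oplus>\<^bsub>A\<^esub> b) n = neg_eval a n \<oplus>\<^bsub>k\<^esub> neg_eval b n"
    "neg_eval (a \<otimes>\<^bsub>A\<^esub> b) n = neg_eval a n \<otimes>\<^bsub>k\<^esub> neg_eval b n"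
    by (simp_all add: neg_eval_eq[OF e(1)] neg_eval_eq[OF e(2)] neg_eval_eq kk.A_sel)
qed

lemma neg_eval_neg:
  assumes a: "a \<in> carrier A"
  shows "neg_eval (\<ominus>\<^bsub>A\<^esub> a) n = \<ominus>\<^bsub>k\<^esub> neg_eval a n"
proof -
  obtain e where e: "kk.periodic a e" using A_periodic[OF a] by blast
  then have "kk.periodic (\<ominus>\<^bsub>A\<^esub> a) e" by (simp add: kk.periodic_def kk.A_neg[OF a])
  then show ?thesis by (simp add: neg_eval_eq[OF e] neg_eval_eq kk.A_neg[OF a])
qed

lemma neg_eval_const: "neg_eval (const_fun c) n = c"
  by (simp add: neg_eval_def const_fun_def)

lemma neg_eval_ind: "m < p ^ e ==> neg_eval (kk.ind e m) n = (if n mod p ^ e = p ^ e - 1 - m then \<one>\<^bsub>k\<^esub> else \<zero>\<^bsub>k\<^esub>)"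
proof -
  assume m: "m < p ^ e"
  have q: "p ^ e > 0" by simp
  have "n mod p ^ e < p ^ e" by simp
  then have "p ^ e - 1 - n mod p ^ e = m \<longleftrightarrow> n mod p ^ e = p ^ e - 1 - m" using m by linarith
  then show ?thesis
    unfolding neg_eval_eq[OF kk.ind_periodic[of e m]] by (simp only: kk.ind_def neg_mod[OF q])
qed

lemma iota_add_pow: "\<iota> ([(n::nat)] \<cdot>\<^bsub>k\<^esub> \<one>\<^bsub>k\<^esub>) = [n] \<cdot> \<one>"
  using io.hom_add_pow[of "\<one>\<^bsub>k\<^esub>" n] by simp

text \<open>Digit by digit, \<open>-1 - n\<close> is complementary to \<open>n\<close>: \<open>(-1 - n) div p\<^sup>e = -1 - n div p\<^sup>e\<close>.\<close>

lemma neg_eval_binom: "\<iota> (neg_eval (binom_fun k (p ^ e)) n) = \<ominus> ([(n div p ^ e + 1)] \<cdot> \<one>)"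
proof -
  define q where "q = p ^ e"
  have q: "q > 0" by (simp add: q_def)
  define a r where "a = n div q" and "r = n mod q"
  have n: "n = q * a + r" and r: "r < q" using q by (simp_all add: a_def r_def)
  define l where "l = (n + 1) * (p ^ Suc e - 1)"
  have per: "kk.periodic (binom_fun k (p ^ e)) (Suc e)"
    using kk.choose_periodic[of "p ^ e" "Suc e"] p_gt_1 by (simp add: kk.periodic_def binom_fun_def)
  have "a + 1 \<le> 1 * (n + 1)" by (simp add: a_def)
  also have "\<dots> \<le> p * (n + 1)" using p_gt_1 by (intro mult_le_mono) auto
  finally have le: "a + 1 \<le> p * (n + 1)" .
  have "l + (n + 1) = q * (p * (n + 1))"
  proof -
    have "(n + 1) * (Q - 1) + (n + 1) = (n + 1) * Q" if "Q > 0" for Q :: nat using that by (cases Q) auto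
    from this[of "p ^ Suc e"] show ?thesis by (simp add: l_def q_def algebra_simps)
  qed
  then have "l + (q * a + r + 1) = q * (p * (n + 1) - (a + 1)) + q * (a + 1)"
    unfolding n[symmetric] distrib_left[symmetric] using le by simp
  then have "l = q * (p * (n + 1) - (a + 1)) + (q - 1 - r)" using r by (simp add: algebra_simps) 
  then have "l div q = p * (n + 1) - (a + 1)" using q by simp
  then have ld: "l div q + (a + 1) = 0 + p * (n + 1)" using le by simp
  have "neg_eval (binom_fun k (p ^ e)) n = [(l div q)] \<cdot>\<^bsub>k\<^esub> \<one>\<^bsub>k\<^esub>"
    unfolding neg_eval_eq[OF per] by (simp add: binom_fun_def kk.choose_pow_div l_def q_def)
  then have 1: "\<iota> (neg_eval (binom_fun k (p ^ e)) n) = [(l div q)] \<cdot> \<one>" by (simp add: iota_add_pow)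
  have "[(l div q)] \<cdot> \<one> \<oplus> [(a + 1)] \<cdot> \<one> = [(l div q + (a + 1))] \<cdot> \<one>" by (rule add.nat_pow_mult) simp
  also have "\<dots> = \<zero>" unfolding ld using add_pow_cong[of 0 "n + 1"] by simp
  finally have "[(l div q)] \<cdot> \<one> = \<ominus> ([(a + 1)] \<cdot> \<one>)" by (intro minus_equality[symmetric]) simp_all
  then show ?thesis unfolding 1 by (simp only: a_def q_def)
qed

lemma eval_coeffs_euler: "a \<in> carrier A ==> kk.periodic a e ==> eval_coeffs a \<in> euler_coeffs e"
  unfolding eval_coeffs_def
proof (rule scalar_coeffs_euler)
  assume a: "a \<in> carrier A" "kk.periodic a e"
  show "\<iota> (neg_eval a n) \<in> carrier R" for n using a by simp
  have "(n + p ^ e + 1) * (p ^ e - 1) = (n + 1) * (p ^ e - 1) + p ^ e * (p ^ e - 1)" for n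
  proof -
    have "n + p ^ e + 1 = (n + 1) + p ^ e" by simp
    then show ?thesis by (simp only: distrib_right)
  qed
  then show "\<iota> (neg_eval a (n + p ^ e)) = \<iota> (neg_eval a n)" for n
    unfolding neg_eval_eq[OF a(2)] by (simp only: kk.periodic_mult[OF a(2)])
qed

lemma eval_coeffs_apply: "x \<in> carrier R ==> eval_coeffs a n x = \<iota> (neg_eval a n) \<otimes> x"
  by (simp add: eval_coeffs_def scalar_coeffs_def)

lemma eval_coeffs_ex: "a \<in> carrier A ==> \<exists>e. eval_coeffs a \<in> euler_coeffs e"
  using A_periodic eval_coeffs_euler by blast

lemma eval_coeffs_binom: "coeff_op (eval_coeffs (binom_fun k (p ^ e))) = \<ominus>\<^bsub>D\<^esub> euler_op R p e"
proof -
  have "\<ominus>\<^bsub>D\<^esub> euler_op R p e = coeff_op (neg_coeffs (scalar_coeffs (\<lambda>n. [(n div p ^ e + 1)] \<cdot> \<one>)))"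
    unfolding euler_op_eq by (rule D_neg[OF euler_op_coeffs])
  also have "\<dots> = coeff_op (eval_coeffs (binom_fun k (p ^ e)))"
  proof (rule coeff_op_cong)
    fix n x assume x: "x \<in> carrier R"
    show "neg_coeffs (scalar_coeffs (\<lambda>n. [(n div p ^ e + 1)] \<cdot> \<one>)) n x = eval_coeffs (binom_fun k (p ^ e)) n x"
      unfolding neg_coeffs_apply[OF euler_op_coeffs x] eval_coeffs_apply[OF x] neg_eval_binom
      using x by (simp add: scalar_coeffs_def l_minus del: add.nat_pow_Suc)
  qed
  finally show ?thesis by simp
qed

lemma eval_in_euler_ring: "a \<in> carrier A ==> coeff_op (eval_coeffs a) \<in> euler_ring R K p"
proof (induction rule: kk.A_induct)
  case (const c)
  have "(\<lambda>x\<in>carrier R. \<iota> c \<otimes> x) \<in> carrier (diff_ops R K)"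
    unfolding R_diff_ops using frob_linear_mult[of "\<iota> c" 0] const by auto
  then have "extend_to_poly R (\<lambda>x\<in>carrier R. \<iota> c \<otimes> x) \<in> euler_ring R K p"
    unfolding euler_ring_def by (intro generate_ring.incl) blast
  also have "extend_to_poly R (\<lambda>x\<in>carrier R. \<iota> c \<otimes> x) = coeff_op (eval_coeffs (const_fun c))"
    unfolding extend_to_poly_eq by (rule coeff_op_cong) (simp add: eval_coeffs_apply neg_eval_const)
  finally show ?case .
next
  case (binom e)
  show ?case unfolding eval_coeffs_binom euler_ring_def by (intro generate_ring.a_inv generate_ring.incl) blast
next
  case (neg a)
  obtain e where e: "eval_coeffs a \<in> euler_coeffs e" using eval_coeffs_ex[OF neg(1)] by blast
  have "coeff_op (neg_coeffs (eval_coeffs a)) = coeff_op (eval_coeffs (\<ominus>\<^bsub>A\<^esub> a))"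
    by (rule coeff_op_cong) (use neg(1) in \<open>simp add: neg_coeffs_apply[OF e] eval_coeffs_apply neg_eval_neg l_minus\<close>)
  then show ?case using generate_ring.a_inv[OF neg(2)[unfolded euler_ring_def]] D_neg[OF e] by (simp add: euler_ring_def)
next
  case (add a b)
  obtain e e' where "eval_coeffs a \<in> euler_coeffs e" "eval_coeffs b \<in> euler_coeffs e'" using eval_coeffs_ex add by blast
  note c = euler_coeffs_common[OF this]
  have "coeff_op (add_coeffs (eval_coeffs a) (eval_coeffs b)) = coeff_op (eval_coeffs (a \<oplus>\<^bsub>A\<^esub> b))"
    by (rule coeff_op_cong) (use add(1,2) in \<open>simp add: add_coeffs_def eval_coeffs_apply neg_eval_hom l_distr\<close>)
  then show ?case
    using generate_ring.eng_add[OF add(3)[unfolded euler_ring_def] add(4)[unfolded euler_ring_def]] D_add[OF c]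
    by (simp add: euler_ring_def)
next
  case (mult a b)
  obtain e e' where c: "eval_coeffs a \<in> euler_coeffs e" "eval_coeffs b \<in> euler_coeffs e'" using eval_coeffs_ex mult by blast
  have "coeff_op (mult_coeffs (eval_coeffs a) (eval_coeffs b)) = coeff_op (eval_coeffs (a \<otimes>\<^bsub>A\<^esub> b))"
    by (rule coeff_op_cong) (use mult(1,2) in \<open>simp add: mult_coeffs_def compose_def eval_coeffs_apply neg_eval_hom m_assoc\<close>)
  then show ?case
    using generate_ring.eng_mult[OF mult(3)[unfolded euler_ring_def] mult(4)[unfolded euler_ring_def]] D_mult[OF c]
    by (simp add: euler_ring_def)
qed

text \<open>Indicator functions of residue classes give the projections onto the \<open>t\<^sup>n\<close> with \<open>n \<equiv> N\<close>, so that
  \<open>\<Phi>\<close> is a finite sum of projections composed with elements of \<open>D\<^sub>R\<close>.\<close>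

lemma euler_ring_ge:
  assumes \<Phi>: "\<Phi> \<in> euler_coeffs e"
  shows "coeff_op \<Phi> \<in> euler_ring R K p"
proof -
  define q where "q = p ^ e"
  have q: "q > 0" by (simp add: q_def)
  define z where "z = (\<lambda>x\<in>carrier R. \<zero>)"
  have z: "z \<in> frob_linear_ops R p e" by (auto simp: z_def frob_linear_ops_def)
  \<comment> \<open>\<open>\<Phi>\<close> cut down to the residues below \<open>N\<close>, for induction on \<open>N\<close>\<close>
  define \<Theta> where "\<Theta> = (\<lambda>N n. if n mod q < N then \<Phi> n else z)"
  have \<Theta>: "\<Theta> N \<in> euler_coeffs e" for N
    using euler_coeffs_op[OF \<Phi>] euler_coeffs_period[OF \<Phi>, of _ 1] z by (simp add: euler_coeffs_def \<Theta>_def q_def)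
  have "coeff_op (\<Theta> N) \<in> euler_ring R K p" if "N \<le> q" for N
    using that
  proof (induction N)
    case 0
    have "z \<in> carrier (diff_ops R K)" unfolding R_diff_ops using z by blast
    then have "extend_to_poly R z \<in> euler_ring R K p" unfolding euler_ring_def by (intro generate_ring.incl) blast
    then show ?case by (simp add: \<Theta>_def extend_to_poly_eq)
  next
    case (Suc N)
    have m: "q - 1 - N < p ^ e" using q by (simp add: q_def)
    have ev: "eval_coeffs (kk.ind e (q - 1 - N)) \<in> euler_coeffs e"
      by (rule eval_coeffs_euler[OF kk.ind_A[OF m] kk.ind_periodic])
    have "\<Phi> N \<in> carrier (diff_ops R K)" unfolding R_diff_ops using euler_coeffs_op[OF \<Phi>] by blast
    then have ext: "coeff_op (\<lambda>_. \<Phi> N) \<in> euler_ring R K p"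
      unfolding euler_ring_def extend_to_poly_eq[symmetric] by (intro generate_ring.incl) blast
    have cN: "(\<lambda>_. \<Phi> N) \<in> euler_coeffs e" by (rule extend_coeffs[OF euler_coeffs_op[OF \<Phi>]])
    have ec: "mult_coeffs (eval_coeffs (kk.ind e (q - 1 - N))) (\<lambda>_. \<Phi> N) \<in> euler_coeffs e"
      by (rule mult_coeffs_euler[OF ev cN])
    have e1: "coeff_op (mult_coeffs (eval_coeffs (kk.ind e (q - 1 - N))) (\<lambda>_. \<Phi> N)) \<in> euler_ring R K p"
      using generate_ring.eng_mult[OF eval_in_euler_ring[OF kk.ind_A[OF m], unfolded euler_ring_def] ext[unfolded euler_ring_def]]
        D_mult[OF ev cN] by (simp add: euler_ring_def)
    have "coeff_op (\<Theta> (Suc N)) = coeff_op (add_coeffs (\<Theta> N) (mult_coeffs (eval_coeffs (kk.ind e (q - 1 - N))) (\<lambda>_. \<Phi> N)))"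
    proof (rule coeff_op_cong)
      fix n x assume x: "x \<in> carrier R"
      have "q - 1 - (q - 1 - N) = N" using Suc.prems by simp
      then have "neg_eval (kk.ind e (q - 1 - N)) n = (if n mod q = N then \<one>\<^bsub>k\<^esub> else \<zero>\<^bsub>k\<^esub>)"
        using neg_eval_ind[OF m, of n] by (simp add: q_def)
      moreover have "\<Phi> n = \<Phi> N" if "n mod q = N"
        using euler_coeffs_period[OF \<Phi>, of "n mod q" "n div q"] that by (simp add: q_def)
      ultimately show "\<Theta> (Suc N) n x = add_coeffs (\<Theta> N) (mult_coeffs (eval_coeffs (kk.ind e (q - 1 - N))) (\<lambda>_. \<Phi> N)) n x"
        using x \<Phi> by (auto simp: \<Theta>_def add_coeffs_def mult_coeffs_def compose_def eval_coeffs_apply z_def)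
    qed
    also have "\<dots> = coeff_op (\<Theta> N) \<oplus>\<^bsub>D\<^esub> coeff_op (mult_coeffs (eval_coeffs (kk.ind e (q - 1 - N))) (\<lambda>_. \<Phi> N))"
      by (rule D_add[OF \<Theta> ec, symmetric])
    also have "\<dots> \<in> euler_ring R K p"
      using Suc e1 unfolding euler_ring_def by (intro generate_ring.eng_add) auto
    finally show ?case .
  qed
  from this[of q] have "coeff_op (\<Theta> q) \<in> euler_ring R K p" by simp
  moreover have "\<Theta> q = \<Phi>" using q by (simp add: \<Theta>_def)
  ultimately show ?thesis by simp
qed

lemma euler_ring_eq: "euler_ring R K p = (\<Union>e. coeff_op ` euler_coeffs e)"
  using euler_ring_le euler_ring_ge by blast

end

section \<open>The modules \<open>B\<^sub>f\<close> and \<open>M\<^sub>f\<close>\<close>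

text \<open>Multiples of \<open>y - t\<^sup>q\<close> have degree at least \<open>q\<close>; coefficientwise, since \<open>y\<close> may be a zero divisor.
  For \<open>q = 1\<close> it shows that \<open>f - t\<close> is regular, and in general it recovers elements of \<open>B\<^sub>f\<close> from numerators
  of degree less than \<open>q\<close>.\<close>

lemma (in UP_cring) binomial_multiple_degree:
  assumes y: "y \<in> carrier R" and q: "q > 0" and w: "w \<in> carrier P"
    and deg: "\<And>n. n \<ge> q ==> coeff P ((monom P y 0 \<ominus>\<^bsub>P\<^esub> monom P \<one> q) \<otimes>\<^bsub>P\<^esub> w) n = \<zero>"
  shows "w = \<zero>\<^bsub>P\<^esub>"
proof -
  have step: "coeff P w k = y \<otimes> coeff P w (k + q)" for k
  proof -
    have "(monom P y 0 \<ominus>\<^bsub>P\<^esub> monom P \<one> q) \<otimes>\<^bsub>P\<^esub> w = y \<odot>\<^bsub>P\<^esub> w \<oplus>\<^bsub>P\<^esub> \<ominus>\<^bsub>P\<^esub> (monom P \<one> q \<otimes>\<^bsub>P\<^esub> w)"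
      using y w by (simp add: P.minus_eq P.l_distr P.l_minus monom_mult_is_smult)
    moreover have "coeff P (monom P \<one> q \<otimes>\<^bsub>P\<^esub> w) (k + q) = \<one> \<otimes> coeff P w k" using w by (intro coeff_monom_mult) auto
    ultimately have "y \<otimes> coeff P w (k + q) \<ominus> coeff P w k = \<zero>"
      using deg[of "k + q"] y w by (simp add: R.minus_eq del: coeff_mult)
    then show ?thesis using y w by simp
  qed
  have pow: "coeff P w k = y [^] j \<otimes> coeff P w (k + q * j)" for k j
  proof (induction j)
    case (Suc j)
    have "coeff P w (k + q * j) = y \<otimes> coeff P w (k + q * j + q)" by (rule step)
    then have "y [^] j \<otimes> coeff P w (k + q * j) = y [^] j \<otimes> (y \<otimes> coeff P w (k + q * j + q))" by (simp only:)
    moreover have "k + q * Suc j = k + q * j + q" by simp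
    ultimately show ?case unfolding Suc using y w by (simp add: R.m_assoc ac_simps)
  qed (use w in simp)
  have "coeff P w k = \<zero>" for k
  proof -
    have "q * Suc (deg R w) \<ge> 1 * Suc (deg R w)" using q by (intro mult_le_mono) auto
    then have z: "coeff P w (k + q * Suc (deg R w)) = \<zero>" using w by (intro deg_aboveD) simp_all
    show ?thesis unfolding pow[of k "Suc (deg R w)"] z using y by simp
  qed
  then show ?thesis using w by (intro up_eqI) auto
qed

locale b_function_setting = finite_type_perfect +
  fixes f assumes f: "f \<in> carrier R"
begin

abbreviation "g \<equiv> f_minus_t R f"

lemma g_eq: "g = monom S f 0 \<ominus>\<^bsub>S\<^esub> monom S \<one> 1"
  by (simp add: f_minus_t_def poly_var_def)

lemma g_closed [simp]: "g \<in> carrier S" using f by (simp add: g_eq)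

sublocale L: char_p_localization "UP R" p g
proof (intro char_p_localization.intro char_p_localization_axioms.intro UP_cring_char g_closed)
  fix u assume u: "u \<in> carrier S" "g \<otimes>\<^bsub>S\<^esub> u = \<zero>\<^bsub>S\<^esub>"
  then show "u = \<zero>\<^bsub>S\<^esub>" using S.binomial_multiple_degree[OF f, of 1 u] by (simp add: g_eq)
qed

lemma L_diff_ops: "carrier (diff_ops L.RL (loc_image S g KS)) = (\<Union>e. frob_linear_ops L.RL p e)"
proof (rule L.RL.diff_ops_carrier[OF _ _ _ L.RL_generated[OF _ KS_closed S_gen]])
  show "loc_image S g KS \<subseteq> carrier L.RL" using KS_closed by (auto simp: loc_image_def)
  show "\<exists>d\<in>carrier L.RL. d [^]\<^bsub>L.RL\<^esub> (p ^ e) = c" if c: "c \<in> loc_image S g KS" for c e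
  proof -
    obtain b where b: "b \<in> KS" "c = L.lf b 0" using c by (auto simp: loc_image_def)
    obtain d where d: "d \<in> KS" "d [^]\<^bsub>S\<^esub> (p ^ e) = b" using KS_root[OF b(1)] by blast
    have dc: "d \<in> carrier S" using d(1) KS_closed by blast
    then show ?thesis using b d L.L_pow[OF dc, of 0 "p ^ e"] by (intro bexI[of _ "L.lf d 0"]) auto
  qed
qed (use X in \<open>auto simp: loc_image_def\<close>)

abbreviation "Bf \<equiv> B_mod R f"

text \<open>The class of \<open>u/(f - t)\<^bsup>p^e\<^esup>\<close> in \<open>B\<^sub>f\<close>. Operators of level \<open>e\<close> act on \<open>u\<close> alone, and
  \<open>\<delta>\<^sub>f\<close> has the numerator \<open>(f - t)\<^bsup>p^e - 1\<^esup>\<close> for every \<open>e\<close>.\<close>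

definition bclass :: "(nat => 'a) => nat => ((nat => 'a) \<times> nat) set set" where
  "bclass u e = B_poly R f +>\<^bsub>L.RL\<^esub> L.lf u (p ^ e)"

lemma B_poly_mem: "x \<in> B_poly R f \<longleftrightarrow> (\<exists>w\<in>carrier S. x = L.lf w 0)"
  by (auto simp: B_poly_def loc_image_def)

lemma B_poly_subgroup: "additive_subgroup (B_poly R f) L.RL"
proof (rule additive_subgroup.intro, rule L.RL.add.subgroupI)
  show "B_poly R f \<noteq> {}" using S.P.zero_closed by (auto simp: B_poly_def loc_image_def)
qed (auto simp: B_poly_mem L.L_neg L.L_add)

lemmas B_quot = quot_abelian_group[OF L.RL.abelian_group_axioms B_poly_subgroup, folded B_loc_def, folded B_mod_def, unfolded B_loc_def]

lemma Bf_group: "abelian_group Bf" by (rule B_quot(1))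

lemma bclass_eq_iff:
  assumes u: "u \<in> carrier S" and v: "v \<in> carrier S"
  shows "bclass u e = bclass v e \<longleftrightarrow> (\<exists>w\<in>carrier S. u \<ominus>\<^bsub>S\<^esub> v = g [^]\<^bsub>S\<^esub> (p ^ e) \<otimes>\<^bsub>S\<^esub> w)"
proof -
  have "L.lf u (p ^ e) \<ominus>\<^bsub>L.RL\<^esub> L.lf v (p ^ e) = L.lf (u \<ominus>\<^bsub>S\<^esub> v) (p ^ e)"
    using u v by (simp add: a_minus_def L.L_neg L.L_add)
  then show ?thesis
    unfolding bclass_def using u v B_quot(2)[of "L.lf u (p ^ e)" "L.lf v (p ^ e)"]
    by (simp add: B_poly_mem L.L_eq S.P.minus_closed)
qed

lemma bclass_closed: "u \<in> carrier S ==> bclass u e \<in> carrier Bf"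
  unfolding B_quot(4) bclass_def by simp

lemma bclass_add: "u \<in> carrier S ==> v \<in> carrier S ==> bclass u e \<oplus>\<^bsub>Bf\<^esub> bclass v e = bclass (u \<oplus>\<^bsub>S\<^esub> v) e"
  unfolding bclass_def by (simp add: B_quot(3) L.L_add)

lemma bclass_zero: "bclass \<zero>\<^bsub>S\<^esub> e = \<zero>\<^bsub>Bf\<^esub>"
  unfolding bclass_def B_quot(5) L.RL_zero L.L_zero[of "p ^ e"] ..

lemma bclass_ex:
  assumes x: "x \<in> carrier Bf"
  shows "\<exists>e\<ge>e0. \<exists>u\<in>carrier S. x = bclass u e"
proof -
  obtain u n where u: "u \<in> carrier S" "x = B_poly R f +>\<^bsub>L.RL\<^esub> L.lf u n"
    using x unfolding B_quot(4) L.RL_carrier image_iff by (metis L.RL_carrier)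
  define e where "e = max n e0"
  have "n < p ^ n" by (rule power_gt_expt) (use p_gt_1 in simp)
  also have "p ^ n \<le> p ^ e" using p_gt_1 by (intro power_increasing) (auto simp: e_def)
  finally have "n + (p ^ e - n) = p ^ e" by simp
  then have "x = bclass (g [^]\<^bsub>S\<^esub> (p ^ e - n) \<otimes>\<^bsub>S\<^esub> u) e"
    unfolding u(2) bclass_def using L.L_expand[OF u(1), of "p ^ e - n" n] by simp
  then show ?thesis using u(1) by (intro exI[of _ e] conjI bexI[of _ "g [^]\<^bsub>S\<^esub> (p ^ e - n) \<otimes>\<^bsub>S\<^esub> u"]) (simp_all add: e_def)
qed

lemma B_action_bclass:
  assumes P: "P \<in> frob_linear_ops S p e" and u: "u \<in> carrier S"
  shows "B_action R K f P (bclass u e) = bclass (P u) e"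
proof -
  define Q where "Q = loc_extend S KS g P"
  note Qv = L.loc_extend_frob[OF L_diff_ops P, folded Q_def]
  note QD = frob_linear_opsD[OF Qv(1)] and PD = frob_linear_opsD[OF P]
  have Q0: "Q (L.lf w 0) = L.lf (P w) 0" if w: "w \<in> carrier S" for w
  proof -
    have "L.lf w 0 = L.lf (g [^]\<^bsub>S\<^esub> (p ^ e) \<otimes>\<^bsub>S\<^esub> w) (p ^ e)" using L.L_expand[OF w, of "p ^ e" 0] by simp
    then have "Q (L.lf w 0) = L.lf (P (g [^]\<^bsub>S\<^esub> (p ^ e) \<otimes>\<^bsub>S\<^esub> w)) (p ^ e)" using Qv(2)[of "g [^]\<^bsub>S\<^esub> (p ^ e) \<otimes>\<^bsub>S\<^esub> w"] w by simp
    also have "\<dots> = L.lf (P w) 0" using PD(3)[OF g_closed w] L.L_expand[OF PD(1)[OF w], of "p ^ e" 0] by simp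
    finally show ?thesis .
  qed
  have "quot_action L.RL (B_poly R f) Q (B_poly R f +>\<^bsub>L.RL\<^esub> L.lf u (p ^ e)) = B_poly R f +>\<^bsub>L.RL\<^esub> Q (L.lf u (p ^ e))"
  proof (rule quot_action_coset[OF L.RL.abelian_group_axioms B_poly_subgroup QD(1,2)])
    show "Q h \<in> B_poly R f" if "h \<in> B_poly R f" for h using that Q0 PD(1) unfolding B_poly_mem by blast
  qed (use u in simp_all)
  then show ?thesis unfolding B_action_def B_loc_def Q_def[symmetric] bclass_def Qv(2)[OF u] .
qed

lemma B_action_additive:
  assumes P: "P \<in> frob_linear_ops S p e" and x: "x \<in> carrier Bf" and y: "y \<in> carrier Bf"
  shows "B_action R K f P x \<in> carrier Bf"
    and "B_action R K f P (x \<oplus>\<^bsub>Bf\<^esub> y) = B_action R K f P x \<oplus>\<^bsub>Bf\<^esub> B_action R K f P y"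
proof -
  obtain e1 u where u: "e1 \<ge> e" "u \<in> carrier S" "x = bclass u e1" using bclass_ex[OF x] by blast
  obtain e2 v where v: "e2 \<ge> e1" "v \<in> carrier S" "y = bclass v e2" using bclass_ex[OF y] by blast
  have "p ^ e1 + (p ^ e2 - p ^ e1) = p ^ e2" using v(1) p_gt_1 by (simp add: power_increasing)
  then have u': "x = bclass (g [^]\<^bsub>S\<^esub> (p ^ e2 - p ^ e1) \<otimes>\<^bsub>S\<^esub> u) e2"
    unfolding u(3) bclass_def using L.L_expand[OF u(2), of "p ^ e2 - p ^ e1" "p ^ e1"] by simp
  have P': "P \<in> frob_linear_ops S p e2" using cring_char.frob_linear_mono[OF UP_cring_char P] u(1) v(1) by simp
  note PD = frob_linear_opsD[OF P']
  have w: "g [^]\<^bsub>S\<^esub> (p ^ e2 - p ^ e1) \<otimes>\<^bsub>S\<^esub> u \<in> carrier S" using u(2) by simp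
  show "B_action R K f P x \<in> carrier Bf"
    unfolding u' B_action_bclass[OF P' w] by (rule bclass_closed[OF PD(1)[OF w]])
  show "B_action R K f P (x \<oplus>\<^bsub>Bf\<^esub> y) = B_action R K f P x \<oplus>\<^bsub>Bf\<^esub> B_action R K f P y"
    unfolding u' v(3) bclass_add[OF w v(2)] B_action_bclass[OF P' w] B_action_bclass[OF P' v(2)]
      B_action_bclass[OF P' S.P.a_closed[OF w v(2)]] PD(2)[OF w v(2)]
    by (rule bclass_add[OF PD(1)[OF w] PD(1)[OF v(2)], symmetric])
qed

lemma delta_eq: "delta_f R f = bclass (g [^]\<^bsub>S\<^esub> (p ^ e - 1)) e"
proof -
  have "1 + (p ^ e - 1) = p ^ e" using p_gt_0 by (simp add: Suc_leI)
  then show ?thesis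
    unfolding delta_f_def bclass_def B_loc_def using L.L_expand[OF S.P.one_closed, of "p ^ e - 1" 1] by simp
qed

definition act :: "(nat => 'a => 'a) => ((nat => 'a) \<times> nat) set set" where
  "act \<Phi> = B_action R K f (coeff_op \<Phi>) (delta_f R f)"

abbreviation "gp e \<equiv> g [^]\<^bsub>S\<^esub> (p ^ e - 1)"

lemma act_eq: "\<Phi> \<in> euler_coeffs e ==> act \<Phi> = bclass (coeff_op \<Phi> (gp e)) e"
  unfolding act_def delta_eq[of e] by (rule B_action_bclass[OF coeff_op_frob_linear]) simp_all

lemma act_closed: "\<Phi> \<in> euler_coeffs e ==> act \<Phi> \<in> carrier Bf"
  by (simp add: act_eq bclass_closed)

lemma act_cong: "(\<And>n x. x \<in> carrier R ==> \<Phi> n x = \<Psi> n x) ==> act \<Phi> = act \<Psi>"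
  unfolding act_def using coeff_op_cong[of \<Phi> \<Psi>] by simp

lemma coeff_op_mult_apply:
  assumes "\<Phi> \<in> euler_coeffs e" "\<Psi> \<in> euler_coeffs e'" "u \<in> carrier S"
  shows "coeff_op (mult_coeffs \<Phi> \<Psi>) u = coeff_op \<Phi> (coeff_op \<Psi> u)"
  using fun_cong[OF coeff_op_mult[OF assms(1,2)], of u] assms(3) by (simp add: compose_def)

lemma act_mult:
  assumes "\<Phi> \<in> euler_coeffs e" "\<Psi> \<in> euler_coeffs e'"
  shows "B_action R K f (coeff_op \<Phi>) (act \<Psi>) = act (mult_coeffs \<Phi> \<Psi>)"
proof -
  note c = euler_coeffs_common[OF assms]
  have w: "coeff_op \<Psi> (gp (max e e')) \<in> carrier S" by (rule coeff_op_closed[OF c(2)]) simp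
  show ?thesis
    unfolding act_eq[OF c(2)] act_eq[OF mult_coeffs_euler[OF c]] B_action_bclass[OF coeff_op_frob_linear[OF c(1)] w]
    by (subst coeff_op_mult_apply[OF c]) simp_all
qed

lemma act_add:
  assumes "\<Phi> \<in> euler_coeffs e" "\<Psi> \<in> euler_coeffs e"
  shows "act \<Phi> \<oplus>\<^bsub>Bf\<^esub> act \<Psi> = act (add_coeffs \<Phi> \<Psi>)"
proof -
  have "coeff_op (add_coeffs \<Phi> \<Psi>) (gp e) = coeff_op \<Phi> (gp e) \<oplus>\<^bsub>S\<^esub> coeff_op \<Psi> (gp e)"
    using fun_cong[OF coeff_op_add[OF assms], of "gp e"] by simp
  then show ?thesis
    unfolding act_eq[OF assms(1)] act_eq[OF assms(2)] act_eq[OF add_coeffs_euler[OF assms]]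
    using assms by (simp add: bclass_add)
qed

lemma act_zero: "(\<And>n x. x \<in> carrier R ==> \<Phi> n x = \<zero>) ==> \<Phi> \<in> euler_coeffs e ==> act \<Phi> = \<zero>\<^bsub>Bf\<^esub>"
proof -
  assume z: "\<And>n x. x \<in> carrier R ==> \<Phi> n x = \<zero>" and \<Phi>: "\<Phi> \<in> euler_coeffs e"
  have "coeff_op \<Phi> (gp e) = \<zero>\<^bsub>S\<^esub>"
    using coeff_coeff_op[OF \<Phi>] coeff_op_closed[OF \<Phi>] z by (intro S.up_eqI) simp_all
  then show ?thesis unfolding act_eq[OF \<Phi>] by (simp only: bclass_zero)
qed

lemma act_neg:
  assumes \<Phi>: "\<Phi> \<in> euler_coeffs e"
  shows "\<ominus>\<^bsub>Bf\<^esub> act \<Phi> = act (neg_coeffs \<Phi>)"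
proof (rule abelian_group.minus_equality[OF Bf_group])
  show "act (neg_coeffs \<Phi>) \<oplus>\<^bsub>Bf\<^esub> act \<Phi> = \<zero>\<^bsub>Bf\<^esub>"
    unfolding act_add[OF neg_coeffs_euler[OF \<Phi>] \<Phi>]
    by (rule act_zero[OF _ add_coeffs_euler[OF neg_coeffs_euler[OF \<Phi>] \<Phi>]])
      (use \<Phi> in \<open>simp add: add_coeffs_def neg_coeffs_apply[OF \<Phi>] l_neg\<close>)
qed (use \<Phi> neg_coeffs_euler act_closed in blast)+

abbreviation "Fm \<equiv> scalar_coeffs (\<lambda>_. f)"

lemma Fm_euler: "Fm \<in> euler_coeffs e" using f by (intro scalar_coeffs_euler) auto

text \<open>Modulo \<open>(f - t)\<^sup>q\<close>, \<open>t (f - t)\<^bsup>q-1\<^esup>\<close> is \<open>f (f - t)\<^bsup>q-1\<^esup>\<close>; the operators respect this congruence as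
  \<open>(f - t)\<^sup>q\<close> is a \<open>q\<close>-th power. So \<open>t\<close> acts as the operator \<open>f\<close>, after the shift of \<open>\<Phi>\<close>.\<close>

lemma act_t:
  assumes \<Phi>: "\<Phi> \<in> euler_coeffs e"
  shows "B_action R K f (mult_operator S (poly_var R)) (act \<Phi>) = act (mult_coeffs (\<lambda>n. \<Phi> (n + (p ^ e - 1))) Fm)"
proof -
  let ?\<Psi> = "\<lambda>n. \<Phi> (n + (p ^ e - 1))"
  have \<Psi>: "?\<Psi> \<in> euler_coeffs e" by (rule shift_euler[OF \<Phi>])
  have q: "p ^ e > 0" by simp
  have T: "mult_operator S (poly_var R) \<in> frob_linear_ops S p e"
    unfolding mult_operator_def by (rule cring_char.frob_linear_mult[OF UP_cring_char]) (simp add: poly_var_def)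
  have t: "monom S \<one> 1 \<in> carrier S" by simp
  have gpc: "gp e \<in> carrier S" by simp
  have c: "coeff_op \<Phi> (gp e) \<in> carrier S" by (rule coeff_op_closed[OF \<Phi> gpc])
  have gq: "g [^]\<^bsub>S\<^esub> (p ^ e) = gp e \<otimes>\<^bsub>S\<^esub> g"
    using q by (metis S.P.nat_pow_Suc Suc_diff_1)
  have tg: "monom S \<one> 1 \<otimes>\<^bsub>S\<^esub> gp e = monom S f 0 \<otimes>\<^bsub>S\<^esub> gp e \<ominus>\<^bsub>S\<^esub> g [^]\<^bsub>S\<^esub> (p ^ e)"
  proof -
    define h where "h = gp e"
    have h: "h \<in> carrier S" by (simp add: h_def)
    have "monom S f 0 \<otimes>\<^bsub>S\<^esub> h \<ominus>\<^bsub>S\<^esub> h \<otimes>\<^bsub>S\<^esub> (monom S f 0 \<ominus>\<^bsub>S\<^esub> monom S \<one> 1) = monom S \<one> 1 \<otimes>\<^bsub>S\<^esub> h"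
      using h t S.monom_closed[OF f, of 0] by (simp only: S.P.r_distr_diff S.P.m_comm[of h]) (simp add: S.P.minus_eq S.P.minus_add S.P.a_assoc[symmetric] S.P.r_neg)
    then show ?thesis unfolding gq h_def[symmetric] g_eq[symmetric] by simp
  qed
  have fc: "coeff_op Fm (gp e) = monom S f 0 \<otimes>\<^bsub>S\<^esub> gp e"
    using f coeff_op_closed[OF Fm_euler gpc] coeff_coeff_op[OF Fm_euler gpc]
    by (intro S.up_eqI) (simp_all add: S.monom_mult_is_smult scalar_coeffs_def)
  have D: "coeff_op ?\<Psi> \<in> frob_linear_ops S p e" by (rule coeff_op_frob_linear[OF \<Psi>])
  note DD = frob_linear_opsD[OF D]
  let ?a = "coeff_op ?\<Psi> (monom S f 0 \<otimes>\<^bsub>S\<^esub> gp e)" and ?w = "coeff_op ?\<Psi> (\<ominus>\<^bsub>S\<^esub> \<one>\<^bsub>S\<^esub>)"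
  have ac: "?a \<in> carrier S" "?w \<in> carrier S" using DD(1) f by simp_all
  have "monom S \<one> 1 \<otimes>\<^bsub>S\<^esub> coeff_op \<Phi> (gp e) = coeff_op ?\<Psi> (monom S \<one> 1 \<otimes>\<^bsub>S\<^esub> gp e)"
    by (rule coeff_op_shift[OF \<Phi> gpc])
  also have "monom S \<one> 1 \<otimes>\<^bsub>S\<^esub> gp e = monom S f 0 \<otimes>\<^bsub>S\<^esub> gp e \<oplus>\<^bsub>S\<^esub> g [^]\<^bsub>S\<^esub> (p ^ e) \<otimes>\<^bsub>S\<^esub> (\<ominus>\<^bsub>S\<^esub> \<one>\<^bsub>S\<^esub>)"
    unfolding tg by (simp add: S.P.minus_eq S.P.r_minus)
  also have "coeff_op ?\<Psi> \<dots> = ?a \<oplus>\<^bsub>S\<^esub> g [^]\<^bsub>S\<^esub> (p ^ e) \<otimes>\<^bsub>S\<^esub> ?w"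
    using DD(2)[of "monom S f 0 \<otimes>\<^bsub>S\<^esub> gp e" "g [^]\<^bsub>S\<^esub> (p ^ e) \<otimes>\<^bsub>S\<^esub> (\<ominus>\<^bsub>S\<^esub> \<one>\<^bsub>S\<^esub>)"]
      DD(3)[OF g_closed, of "\<ominus>\<^bsub>S\<^esub> \<one>\<^bsub>S\<^esub>"] f by simp
  finally have e1: "monom S \<one> 1 \<otimes>\<^bsub>S\<^esub> coeff_op \<Phi> (gp e) = ?a \<oplus>\<^bsub>S\<^esub> g [^]\<^bsub>S\<^esub> (p ^ e) \<otimes>\<^bsub>S\<^esub> ?w" .
  have "bclass (monom S \<one> 1 \<otimes>\<^bsub>S\<^esub> coeff_op \<Phi> (gp e)) e = bclass ?a e"
    unfolding e1
  proof (subst bclass_eq_iff)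
    show "\<exists>w\<in>carrier S. ?a \<oplus>\<^bsub>S\<^esub> g [^]\<^bsub>S\<^esub> (p ^ e) \<otimes>\<^bsub>S\<^esub> ?w \<ominus>\<^bsub>S\<^esub> ?a = g [^]\<^bsub>S\<^esub> (p ^ e) \<otimes>\<^bsub>S\<^esub> w"
    proof
      have "a \<oplus>\<^bsub>S\<^esub> b \<ominus>\<^bsub>S\<^esub> a = b" if "a \<in> carrier S" "b \<in> carrier S" for a b
        unfolding S.P.a_comm[OF that] using that by (simp add: S.P.minus_eq S.P.a_assoc S.P.r_neg)
      then show "?a \<oplus>\<^bsub>S\<^esub> g [^]\<^bsub>S\<^esub> (p ^ e) \<otimes>\<^bsub>S\<^esub> ?w \<ominus>\<^bsub>S\<^esub> ?a = g [^]\<^bsub>S\<^esub> (p ^ e) \<otimes>\<^bsub>S\<^esub> ?w" using ac by simp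
    qed (rule ac(2))
  qed (use ac in simp_all)
  then show ?thesis
    unfolding act_eq[OF \<Phi>] act_eq[OF mult_coeffs_euler[OF \<Psi> Fm_euler]] B_action_bclass[OF T c]
      coeff_op_mult_apply[OF \<Psi> Fm_euler gpc] fc
    using c by (simp add: mult_operator_def poly_var_def)
qed

lemma M_eq: "M_mod R K p f = {act \<Phi> | \<Phi> e. \<Phi> \<in> euler_coeffs e}"
  unfolding M_mod_def euler_ring_eq by (auto simp: act_def)

text \<open>The shift in \<open>act_t\<close> is a bijection on sequences of period \<open>p\<^sup>e\<close>.\<close>

lemma tM_eq: "tM_mod R K p f = {act (mult_coeffs \<Phi> Fm) | \<Phi> e. \<Phi> \<in> euler_coeffs e}"
proof
  show "tM_mod R K p f \<subseteq> {act (mult_coeffs \<Phi> Fm) | \<Phi> e. \<Phi> \<in> euler_coeffs e}"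
    unfolding tM_mod_def M_eq using act_t shift_euler by blast
  show "{act (mult_coeffs \<Phi> Fm) | \<Phi> e. \<Phi> \<in> euler_coeffs e} \<subseteq> tM_mod R K p f"
  proof clarify
    fix \<Phi> e assume \<Phi>: "\<Phi> \<in> euler_coeffs e"
    have "n + (p ^ e - 1) + 1 = n + p ^ e * 1" for n by (simp add: Suc_leI)
    then have "\<Phi> (n + (p ^ e - 1) + 1) = \<Phi> n" for n using euler_coeffs_period[OF \<Phi>] by (simp only:)
    then have "act (mult_coeffs \<Phi> Fm) = B_action R K f (mult_operator S (poly_var R)) (act (\<lambda>n. \<Phi> (n + 1)))"
      using act_t[OF shift_euler[OF \<Phi>, of 1]] by simp
    then show "act (mult_coeffs \<Phi> Fm) \<in> tM_mod R K p f"
      unfolding tM_mod_def M_eq using shift_euler[OF \<Phi>, of 1] by blast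
  qed
qed

end

section \<open>The module \<open>N\<^sub>f\<close> and the b-function\<close>

lemma complement_mod:
  fixes q r m :: nat
  assumes m: "m < q * r"
  shows "(q * r - 1 - m) mod q = q - 1 - m mod q"
proof -
  have q: "q > 0" using m by (cases q) auto
  define a b where "a = m div q" and "b = m mod q"
  have ab: "m = q * a + b" "b < q" using q by (simp_all add: a_def b_def)
  have "a < r" using m q by (simp add: a_def less_mult_imp_div_less mult.commute)
  then obtain d where d: "r = a + 1 + d" by (metis Suc_eq_plus1 add_Suc_right add.commute less_natE)
  have "q * r - 1 - m = q * d + (q - 1 - b)" using ab(2) unfolding ab(1) d by (simp add: algebra_simps)
  then show ?thesis using q by (simp add: b_def)
qed

context b_function_setting
begin

abbreviation "MM \<equiv> M_mod R K p f"
abbreviation "tM \<equiv> tM_mod R K p f"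
abbreviation "N \<equiv> N_mod R K p f"
abbreviation "BM \<equiv> Bf\<lparr>carrier := MM\<rparr>"

lemma act_M: "\<Phi> \<in> euler_coeffs e ==> act \<Phi> \<in> MM" unfolding M_eq by blast

lemma act_tM: "\<Phi> \<in> euler_coeffs e ==> act (mult_coeffs \<Phi> Fm) \<in> tM" unfolding tM_eq by blast

lemma zero_act: "\<zero>\<^bsub>Bf\<^esub> = act (mult_coeffs (scalar_coeffs (\<lambda>_. \<zero>)) Fm)"
proof (rule act_zero[symmetric])
  show "mult_coeffs (scalar_coeffs (\<lambda>_. \<zero>)) Fm \<in> euler_coeffs 0"
    by (intro mult_coeffs_euler Fm_euler scalar_coeffs_euler) auto
qed (use f in \<open>simp add: mult_coeffs_def scalar_coeffs_def compose_def\<close>)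

lemma zero_euler: "scalar_coeffs (\<lambda>_. \<zero>) \<in> euler_coeffs e" by (intro scalar_coeffs_euler) auto

lemma M_subset: "MM \<subseteq> carrier Bf" using act_closed unfolding M_eq by blast

lemma tM_subset: "tM \<subseteq> MM" using act_M[OF mult_coeffs_euler[OF _ Fm_euler]] unfolding tM_eq by blast

lemma M_add: "x \<in> MM ==> y \<in> MM ==> x \<oplus>\<^bsub>Bf\<^esub> y \<in> MM"
proof -
  assume "x \<in> MM" "y \<in> MM"
  then obtain \<Phi> e \<Psi> e' where *: "\<Phi> \<in> euler_coeffs e" "x = act \<Phi>" "\<Psi> \<in> euler_coeffs e'" "y = act \<Psi>" unfolding M_eq by blast
  note c = euler_coeffs_common[OF *(1,3)]
  show ?thesis unfolding *(2,4) act_add[OF c] by (rule act_M[OF add_coeffs_euler[OF c]])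
qed

lemma tM_add: "x \<in> tM ==> y \<in> tM ==> x \<oplus>\<^bsub>Bf\<^esub> y \<in> tM"
proof -
  assume "x \<in> tM" "y \<in> tM"
  then obtain \<Phi> e \<Psi> e' where *: "\<Phi> \<in> euler_coeffs e" "x = act (mult_coeffs \<Phi> Fm)"
    "\<Psi> \<in> euler_coeffs e'" "y = act (mult_coeffs \<Psi> Fm)" unfolding tM_eq by blast
  note c = euler_coeffs_common[OF *(1,3)]
  have "x \<oplus>\<^bsub>Bf\<^esub> y = act (add_coeffs (mult_coeffs \<Phi> Fm) (mult_coeffs \<Psi> Fm))"
    unfolding *(2,4) by (rule act_add[OF mult_coeffs_euler[OF c(1) Fm_euler] mult_coeffs_euler[OF c(2) Fm_euler]])
  also have "\<dots> = act (mult_coeffs (add_coeffs \<Phi> \<Psi>) Fm)"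
    using f by (intro act_cong) (simp add: add_coeffs_def mult_coeffs_def scalar_coeffs_def compose_def)
  also have "\<dots> \<in> tM" by (rule act_tM[OF add_coeffs_euler[OF c]])
  finally show ?thesis .
qed

lemma act_neg_left: "\<Phi> \<in> euler_coeffs e ==> act (neg_coeffs \<Phi>) \<oplus>\<^bsub>Bf\<^esub> act \<Phi> = \<zero>\<^bsub>Bf\<^esub>"
  using act_neg abelian_group.l_neg[OF Bf_group act_closed] by metis

lemma BM_group: "abelian_group BM"
proof -
  interpret Bf: abelian_group Bf by (rule Bf_group)
  have c: "x \<in> carrier Bf" if "x \<in> MM" for x using that M_subset by blast
  show ?thesis
  proof (rule abelian_groupI)
    show "\<zero>\<^bsub>BM\<^esub> \<in> carrier BM" using act_tM[OF zero_euler] tM_subset by (auto simp: zero_act)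
    show "\<exists>y\<in>carrier BM. y \<oplus>\<^bsub>BM\<^esub> x = \<zero>\<^bsub>BM\<^esub>" if "x \<in> carrier BM" for x
    proof -
      obtain \<Phi> e where \<Phi>: "\<Phi> \<in> euler_coeffs e" "x = act \<Phi>" using \<open>x \<in> carrier BM\<close> unfolding M_eq by auto
      then show ?thesis using act_neg_left[OF \<Phi>(1)] act_M[OF neg_coeffs_euler[OF \<Phi>(1)]] by (intro bexI[of _ "act (neg_coeffs \<Phi>)"]) auto
    qed
  qed (auto simp: M_add c Bf.a_ac)
qed

lemma tM_neg:
  assumes "x \<in> tM"
  shows "\<exists>y\<in>tM. y \<oplus>\<^bsub>Bf\<^esub> x = \<zero>\<^bsub>Bf\<^esub>"
proof -
  obtain \<Phi> e where \<Phi>: "\<Phi> \<in> euler_coeffs e" "x = act (mult_coeffs \<Phi> Fm)" using assms unfolding tM_eq by blast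
  have "act (neg_coeffs (mult_coeffs \<Phi> Fm)) = act (mult_coeffs (neg_coeffs \<Phi>) Fm)"
    using f \<Phi>(1) by (intro act_cong) (simp add: neg_coeffs_def mult_coeffs_def scalar_coeffs_def compose_def)
  then show ?thesis
    using act_neg_left[OF mult_coeffs_euler[OF \<Phi>(1) Fm_euler]] act_tM[OF neg_coeffs_euler[OF \<Phi>(1)]] \<Phi>(2) by metis
qed

lemma tM_subgroup: "additive_subgroup tM Bf" "additive_subgroup tM BM"
proof -
  have *: "additive_subgroup tM G" if G: "abelian_group G" "add G = add Bf" "zero G = zero Bf" "tM \<subseteq> carrier G" for G :: "((nat => 'a) \<times> nat) set set ring"
  proof -
    interpret G: abelian_group G by (rule G)
    show ?thesis
    proof (rule additive_subgroup.intro, rule G.add.subgroupI)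
      show "tM \<noteq> {}" using act_tM[OF zero_euler] by blast
      show "\<ominus>\<^bsub>G\<^esub> x \<in> tM" if x: "x \<in> tM" for x
      proof -
        obtain y where y: "y \<in> tM" "y \<oplus>\<^bsub>G\<^esub> x = \<zero>\<^bsub>G\<^esub>" using tM_neg[OF x] G by auto
        then have "\<ominus>\<^bsub>G\<^esub> x = y" using x G(4) by (intro G.minus_equality) auto
        then show ?thesis using y by simp
      qed
    qed (use G tM_add in auto)
  qed
  show "additive_subgroup tM Bf" using tM_subset M_subset by (intro *[OF Bf_group]) auto
  show "additive_subgroup tM BM" using tM_subset by (intro *[OF BM_group]) auto
qed

lemmas N_quot = quot_abelian_group[OF BM_group tM_subgroup(2), folded N_mod_def]

definition cls :: "(nat => 'a => 'a) => ((nat => 'a) \<times> nat) set set set" where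
  "cls \<Phi> = tM +>\<^bsub>Bf\<^esub> act \<Phi>"

lemma coset_BM: "tM +>\<^bsub>BM\<^esub> x = tM +>\<^bsub>Bf\<^esub> x" by (simp add: a_r_coset_def')

lemma N_carrier: "x \<in> carrier N \<longleftrightarrow> (\<exists>e. \<exists>\<Phi>\<in>euler_coeffs e. x = cls \<Phi>)"
  unfolding N_quot(4) cls_def coset_BM using M_eq by auto

lemma cls_N: "\<Phi> \<in> euler_coeffs e ==> cls \<Phi> \<in> carrier N" using N_carrier by blast

lemma cls_cong: "(\<And>n x. x \<in> carrier R ==> \<Phi> n x = \<Psi> n x) ==> cls \<Phi> = cls \<Psi>"
  unfolding cls_def using act_cong[of \<Phi> \<Psi>] by simp

lemma cls_zero: "\<Phi> \<in> euler_coeffs e ==> cls \<Phi> = \<zero>\<^bsub>N\<^esub> \<longleftrightarrow> act \<Phi> \<in> tM"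
proof -
  assume \<Phi>: "\<Phi> \<in> euler_coeffs e"
  interpret BM: abelian_group BM by (rule BM_group)
  have "act \<Phi> \<ominus>\<^bsub>BM\<^esub> \<zero>\<^bsub>BM\<^esub> = act \<Phi>"
    unfolding BM.minus_eq BM.minus_equality[OF BM.r_zero[OF BM.zero_closed] BM.zero_closed BM.zero_closed]
    by (rule BM.r_zero) (use act_M[OF \<Phi>] in simp)
  then show ?thesis
    using N_quot(2)[of "act \<Phi>" "\<zero>\<^bsub>BM\<^esub>"] act_M[OF \<Phi>] BM.zero_closed unfolding N_quot(5) coset_BM cls_def by simp
qed

lemma cls_add: "\<Phi> \<in> euler_coeffs e ==> \<Psi> \<in> euler_coeffs e ==> cls \<Phi> \<oplus>\<^bsub>N\<^esub> cls \<Psi> = cls (add_coeffs \<Phi> \<Psi>)"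
  using N_quot(3)[of "act \<Phi>" "act \<Psi>"] act_M by (simp add: cls_def coset_BM act_add)

lemma cls_neg: "\<Phi> \<in> euler_coeffs e ==> \<ominus>\<^bsub>N\<^esub> cls \<Phi> = cls (neg_coeffs \<Phi>)"
proof (rule abelian_group.minus_equality[OF N_quot(1)])
  assume \<Phi>: "\<Phi> \<in> euler_coeffs e"
  note n = neg_coeffs_euler[OF \<Phi>]
  have "act (add_coeffs (neg_coeffs \<Phi>) \<Phi>) = \<zero>\<^bsub>Bf\<^esub>" unfolding act_add[OF n \<Phi>, symmetric] by (rule act_neg_left[OF \<Phi>])
  also have "\<dots> \<in> tM" unfolding zero_act by (rule act_tM[OF zero_euler])
  finally show "cls (neg_coeffs \<Phi>) \<oplus>\<^bsub>N\<^esub> cls \<Phi> = \<zero>\<^bsub>N\<^esub>"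
    unfolding cls_add[OF n \<Phi>] cls_zero[OF add_coeffs_euler[OF n \<Phi>]] .
qed (use cls_N neg_coeffs_euler in blast)+

lemma mult_coeffs_assoc_apply:
  "\<Psi> \<in> euler_coeffs e ==> x \<in> carrier R ==> mult_coeffs \<Theta> (mult_coeffs \<Phi> \<Psi>) n x = mult_coeffs (mult_coeffs \<Theta> \<Phi>) \<Psi> n x"
  by (simp add: mult_coeffs_def compose_def)

lemma tM_stable:
  assumes \<Psi>: "\<Psi> \<in> euler_coeffs e" and x: "x \<in> tM"
  shows "B_action R K f (coeff_op \<Psi>) x \<in> tM"
proof -
  obtain \<Phi> e' where \<Phi>: "\<Phi> \<in> euler_coeffs e'" "x = act (mult_coeffs \<Phi> Fm)" using x unfolding tM_eq by blast
  have "B_action R K f (coeff_op \<Psi>) x = act (mult_coeffs \<Psi> (mult_coeffs \<Phi> Fm))"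
    unfolding \<Phi>(2) by (rule act_mult[OF \<Psi> mult_coeffs_euler[OF \<Phi>(1) Fm_euler]])
  also have "\<dots> = act (mult_coeffs (mult_coeffs \<Psi> \<Phi>) Fm)"
    by (rule act_cong) (rule mult_coeffs_assoc_apply[OF Fm_euler])
  also have "\<dots> \<in> tM" by (rule act_tM[OF mult_coeffs_euler[OF euler_coeffs_common[OF \<Psi> \<Phi>(1)]]])
  finally show ?thesis .
qed

lemma N_action_cls:
  assumes \<Psi>: "\<Psi> \<in> euler_coeffs e" and \<Phi>: "\<Phi> \<in> euler_coeffs e'"
  shows "N_action R K p f (coeff_op \<Psi>) (cls \<Phi>) = cls (mult_coeffs \<Psi> \<Phi>)"
  unfolding N_action_def cls_def act_mult[OF \<Psi> \<Phi>, symmetric]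
  by (rule quot_action_coset[OF Bf_group tM_subgroup(1)])
    (use B_action_additive[OF coeff_op_frob_linear[OF \<Psi>]] tM_stable[OF \<Psi>] act_closed[OF \<Phi>] in auto)

definition
  "smul = (\<lambda>a\<in>carrier A. \<lambda>x\<in>carrier N. N_action R K p f (coeff_op (eval_coeffs a)) x)"

lemma smul_cls:
  assumes a: "a \<in> carrier A" and \<Phi>: "\<Phi> \<in> euler_coeffs e"
  shows "smul a (cls \<Phi>) = cls (mult_coeffs (eval_coeffs a) \<Phi>)"
proof -
  obtain e' where "eval_coeffs a \<in> euler_coeffs e'" using eval_coeffs_ex[OF a] by blast
  then show ?thesis using a cls_N[OF \<Phi>] N_action_cls[OF _ \<Phi>] by (simp add: smul_def)
qed

lemma eval_cls:
  assumes a: "a \<in> carrier A" and \<Phi>: "\<Phi> \<in> euler_coeffs e"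
  obtains e' where "mult_coeffs (eval_coeffs a) \<Phi> \<in> euler_coeffs e'"
  using eval_coeffs_ex[OF a] mult_coeffs_euler[OF euler_coeffs_common[OF _ \<Phi>]] by blast

lemma eval_apply: "\<Phi> \<in> euler_coeffs e ==> x \<in> carrier R ==> mult_coeffs (eval_coeffs a) \<Phi> n x = \<iota> (neg_eval a n) \<otimes> \<Phi> n x"
  by (simp add: mult_coeffs_def compose_def eval_coeffs_apply)

lemma with_smult_sel [simp]: "carrier (with_smult N' sm) = carrier N'" "smult (with_smult N' sm) = sm"
  "add (with_smult N' sm) = add N'" "zero (with_smult N' sm) = zero N'" "a_inv (with_smult N' sm) = a_inv N'"
  by (simp_all add: with_smult_def a_inv_def m_inv_def fun_eq_iff)

lemma smul_module: "module A (with_smult N smul)"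
proof (rule moduleI, unfold with_smult_sel)
  show "cring A" by (rule kk.A_cring)
  show "abelian_group (with_smult N smul)"
  proof -
    interpret N: abelian_group N by (rule N_quot(1))
    show ?thesis
    proof (rule abelian_groupI, unfold with_smult_sel)
      show "\<exists>y\<in>carrier N. y \<oplus>\<^bsub>N\<^esub> x = \<zero>\<^bsub>N\<^esub>" if "x \<in> carrier N" for x
        using N.l_neg[OF that] N.a_inv_closed[OF that] by blast
    qed (simp_all add: N.a_ac)
  qed
  fix a x assume a: "a \<in> carrier A" and "x \<in> carrier N"
  then obtain \<Phi> e where \<Phi>: "\<Phi> \<in> euler_coeffs e" and x: "x = cls \<Phi>" unfolding N_carrier by blast
  obtain e1 where e1: "mult_coeffs (eval_coeffs a) \<Phi> \<in> euler_coeffs e1" using eval_cls[OF a \<Phi>] .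
  show "smul a x \<in> carrier N" unfolding x smul_cls[OF a \<Phi>] by (rule cls_N[OF e1])
  {
    fix b assume b: "b \<in> carrier A"
    obtain e2 where e2: "mult_coeffs (eval_coeffs b) \<Phi> \<in> euler_coeffs e2" using eval_cls[OF b \<Phi>] .
    have ab: "a \<oplus>\<^bsub>A\<^esub> b \<in> carrier A" "a \<otimes>\<^bsub>A\<^esub> b \<in> carrier A"
      using a b by (rule kk.A.a_closed kk.A.m_closed)+
    show "smul (a \<oplus>\<^bsub>A\<^esub> b) x = smul a x \<oplus>\<^bsub>N\<^esub> smul b x"
      unfolding x smul_cls[OF a \<Phi>] smul_cls[OF b \<Phi>] smul_cls[OF ab(1) \<Phi>] cls_add[OF euler_coeffs_common[OF e1 e2]]
      by (rule cls_cong) (use a b \<Phi> in \<open>simp add: eval_apply[OF \<Phi>] add_coeffs_def neg_eval_hom l_distr\<close>)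
    show "smul (a \<otimes>\<^bsub>A\<^esub> b) x = smul a (smul b x)"
      unfolding x smul_cls[OF b \<Phi>] smul_cls[OF ab(2) \<Phi>] smul_cls[OF a e2]
      by (rule cls_cong) (use a b \<Phi> in \<open>simp add: eval_apply[OF \<Phi>] eval_apply[OF e2] neg_eval_hom m_assoc\<close>)
  next
    fix y assume "y \<in> carrier N"
    then obtain \<Psi> e' where \<Psi>: "\<Psi> \<in> euler_coeffs e'" and y: "y = cls \<Psi>" unfolding N_carrier by blast
    note c = euler_coeffs_common[OF \<Phi> \<Psi>]
    obtain e2 where e2: "mult_coeffs (eval_coeffs a) \<Psi> \<in> euler_coeffs e2" using eval_cls[OF a \<Psi>] .
    show "smul a (x \<oplus>\<^bsub>N\<^esub> y) = smul a x \<oplus>\<^bsub>N\<^esub> smul a y"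
      unfolding x y cls_add[OF c] smul_cls[OF a \<Phi>] smul_cls[OF a \<Psi>] smul_cls[OF a add_coeffs_euler[OF c]]
        cls_add[OF euler_coeffs_common[OF e1 e2]]
    proof (rule cls_cong)
      fix n x assume x: "x \<in> carrier R"
      show "mult_coeffs (eval_coeffs a) (add_coeffs \<Phi> \<Psi>) n x =
          add_coeffs (mult_coeffs (eval_coeffs a) \<Phi>) (mult_coeffs (eval_coeffs a) \<Psi>) n x"
        unfolding eval_apply[OF add_coeffs_euler[OF c] x]
        using a x \<Phi> \<Psi> by (simp add: add_coeffs_def eval_apply[OF \<Phi>] eval_apply[OF \<Psi>] r_distr)
    qed
  }
next
  fix x assume "x \<in> carrier N"
  then obtain \<Phi> e where \<Phi>: "\<Phi> \<in> euler_coeffs e" and x: "x = cls \<Phi>" unfolding N_carrier by blast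
  have o: "\<one>\<^bsub>A\<^esub> \<in> carrier A" by (rule kk.A.one_closed)
  have "neg_eval \<one>\<^bsub>A\<^esub> n = \<one>\<^bsub>k\<^esub>" for n by (simp add: neg_eval_def kk.A_sel)
  then show "smul \<one>\<^bsub>A\<^esub> x = x"
    unfolding x smul_cls[OF o \<Phi>] using \<Phi> by (intro cls_cong) (simp add: eval_apply[OF \<Phi>])
qed

lemma const_eval:
  assumes c: "c \<in> carrier k"
  shows "mult_operator S (monom S (\<iota> c) 0) = coeff_op (eval_coeffs (const_fun c))"
proof (rule extensionalityI[of _ "carrier S"])
  obtain e where e: "eval_coeffs (const_fun c) \<in> euler_coeffs e" using eval_coeffs_ex[OF kk.const_A[OF c]] by blast
  fix u assume u: "u \<in> carrier S"
  show "mult_operator S (monom S (\<iota> c) 0) u = coeff_op (eval_coeffs (const_fun c)) u"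
    using u c coeff_op_closed[OF e u] coeff_coeff_op[OF e u]
    by (intro S.up_eqI) (simp_all add: mult_operator_def S.monom_mult_is_smult eval_coeffs_apply neg_eval_const)
qed (simp_all add: mult_operator_def coeff_op_def)

lemma euler_cls:
  assumes \<Phi>: "\<Phi> \<in> euler_coeffs e'"
  shows "\<ominus>\<^bsub>N\<^esub> N_action R K p f (euler_op R p e) (cls \<Phi>) = smul (binom_fun k (p ^ e)) (cls \<Phi>)"
proof -
  let ?E = "scalar_coeffs (\<lambda>n. [(n div p ^ e + 1)] \<cdot> \<one>)"
  have E: "mult_coeffs ?E \<Phi> \<in> euler_coeffs (max (Suc e) e')"
    by (rule mult_coeffs_euler[OF euler_coeffs_common[OF euler_op_coeffs \<Phi>]])
  show ?thesis
    unfolding euler_op_eq N_action_cls[OF euler_op_coeffs \<Phi>] cls_neg[OF E] smul_cls[OF kk.binom_A \<Phi>]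
  proof (rule cls_cong)
    fix n x assume x: "x \<in> carrier R"
    show "neg_coeffs (mult_coeffs ?E \<Phi>) n x = mult_coeffs (eval_coeffs (binom_fun k (p ^ e))) \<Phi> n x"
      unfolding neg_coeffs_apply[OF E x] eval_apply[OF \<Phi> x] neg_eval_binom
      using x \<Phi> by (simp add: mult_coeffs_def scalar_coeffs_def compose_def l_minus del: add.nat_pow_Suc)
  qed
qed

lemma smul_unique:
  assumes sm: "sm \<in> carrier A \<rightarrow>\<^sub>E (carrier N \<rightarrow>\<^sub>E carrier N)" and mod: "module A (with_smult N sm)"
    and const: "\<forall>c\<in>carrier k. \<forall>x\<in>carrier N. sm (const_fun c) x = smul (const_fun c) x"
    and binom: "\<forall>e. \<forall>x\<in>carrier N. sm (binom_fun k (p ^ e)) x = smul (binom_fun k (p ^ e)) x"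
  shows "sm = smul"
proof (rule extensionalityI[of _ "carrier A"])
  interpret m: module A "with_smult N sm" by (rule mod)
  interpret s: module A "with_smult N smul" by (rule smul_module)
  fix a assume a: "a \<in> carrier A"
  have cl: "sm a x \<in> carrier N" "smul a x \<in> carrier N" if "a \<in> carrier A" "x \<in> carrier N" for a x
    using m.smult_closed s.smult_closed that by simp_all
  have eq: "sm a x = smul a x" if x: "x \<in> carrier N" for x
    using a x
  proof (induction arbitrary: x rule: kk.A_induct)
    case (neg a)
    then show ?case using m.smult_l_minus[of a x] s.smult_l_minus[of a x] by simp
  next
    case (add a b)
    then show ?case using m.smult_l_distr[of a b x] s.smult_l_distr[of a b x] by simp
  next
    case (mult a b)
    then show ?case using m.smult_assoc1[of a b x] s.smult_assoc1[of a b x] cl[of b x] by simp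
  qed (use const binom in auto)
  show "sm a = smul a"
    by (rule extensionalityI[of _ "carrier N"]) (use sm a eq in \<open>auto simp: PiE_def Pi_def smul_def\<close>)
qed (use sm in \<open>auto simp: PiE_def smul_def\<close>)

abbreviation "bf \<equiv> b_function k R \<iota> p f"

lemma N_gamma_eq: "N_gamma k R \<iota> p f = with_smult N smul"
proof -
  have const: "smul (const_fun c) x = N_action R K p f (mult_operator S (monom S (\<iota> c) 0)) x"
    if "c \<in> carrier k" "x \<in> carrier N" for c x
    using that kk.const_A[OF that(1)] by (simp add: smul_def const_eval)
  have binom: "smul (binom_fun k (p ^ e)) x = \<ominus>\<^bsub>N\<^esub> N_action R K p f (euler_op R p e) x" if "x \<in> carrier N" for e x
    using that euler_cls unfolding N_carrier by auto
  have ext: "smul \<in> carrier A \<rightarrow>\<^sub>E (carrier N \<rightarrow>\<^sub>E carrier N)"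
    using module.smult_closed[OF smul_module] by (auto simp: smul_def PiE_def Pi_def extensional_def)
  show ?thesis
    unfolding N_gamma_def Let_def
  proof (rule arg_cong[of _ _ "with_smult N"], rule the_equality)
    fix sm
    assume sm: "sm \<in> carrier A \<rightarrow>\<^sub>E (carrier N \<rightarrow>\<^sub>E carrier N) \<and> module A (with_smult N sm) \<and>
      (\<forall>c\<in>carrier k. \<forall>x\<in>carrier N. sm (const_fun c) x = N_action R K p f (mult_operator S (monom S (\<iota> c) 0)) x) \<and>
      (\<forall>e. \<forall>x\<in>carrier N. sm (binom_fun k (p ^ e)) x = \<ominus>\<^bsub>N\<^esub> N_action R K p f (euler_op R p e) x)"
    show "sm = smul"
    proof (rule smul_unique)
      show "sm \<in> carrier A \<rightarrow>\<^sub>E (carrier N \<rightarrow>\<^sub>E carrier N)" "module A (with_smult N sm)" using sm by blast+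
      show "\<forall>c\<in>carrier k. \<forall>x\<in>carrier N. sm (const_fun c) x = smul (const_fun c) x" using sm const by metis
      show "\<forall>e. \<forall>x\<in>carrier N. sm (binom_fun k (p ^ e)) x = smul (binom_fun k (p ^ e)) x" using sm binom by metis
    qed
  qed (intro conjI ballI allI ext smul_module const binom)
qed

lemma bf_iff: "a \<in> bf \<longleftrightarrow> a \<in> carrier A \<and> (\<forall>e. \<forall>\<Phi>\<in>euler_coeffs e. act (mult_coeffs (eval_coeffs a) \<Phi>) \<in> tM)"
proof -
  have "smul a x = \<zero>\<^bsub>N\<^esub> \<longleftrightarrow> act (mult_coeffs (eval_coeffs a) \<Phi>) \<in> tM"
    if a: "a \<in> carrier A" and \<Phi>: "\<Phi> \<in> euler_coeffs e" and x: "x = cls \<Phi>" for \<Phi> e x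
  proof -
    obtain e' where "mult_coeffs (eval_coeffs a) \<Phi> \<in> euler_coeffs e'" using eval_cls[OF a \<Phi>] .
    then show ?thesis unfolding x smul_cls[OF a \<Phi>] by (rule cls_zero)
  qed
  then show ?thesis
    unfolding b_function_def annihilator_def N_gamma_eq mem_Collect_eq with_smult_sel using N_carrier by metis
qed

lemma bf_mult:
  assumes a: "a \<in> bf" and b: "b \<in> carrier A"
  shows "b \<otimes>\<^bsub>A\<^esub> a \<in> bf"
  unfolding bf_iff
proof (intro conjI allI ballI)
  have aA: "a \<in> carrier A" using a bf_iff by blast
  show "b \<otimes>\<^bsub>A\<^esub> a \<in> carrier A" by (rule kk.A.m_closed[OF b aA])
  fix e \<Phi> assume \<Phi>: "\<Phi> \<in> euler_coeffs e"
  obtain e1 where e1: "mult_coeffs (eval_coeffs a) \<Phi> \<in> euler_coeffs e1" using eval_cls[OF aA \<Phi>] .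
  obtain e2 where e2: "eval_coeffs b \<in> euler_coeffs e2" using eval_coeffs_ex[OF b] by blast
  have "act (mult_coeffs (eval_coeffs (b \<otimes>\<^bsub>A\<^esub> a)) \<Phi>) = act (mult_coeffs (eval_coeffs b) (mult_coeffs (eval_coeffs a) \<Phi>))"
    by (rule act_cong) (use aA b \<Phi> in \<open>simp add: eval_apply[OF \<Phi>] eval_apply[OF e1] neg_eval_hom m_assoc\<close>)
  also have "\<dots> = B_action R K f (coeff_op (eval_coeffs b)) (act (mult_coeffs (eval_coeffs a) \<Phi>))"
    by (rule act_mult[OF e2 e1, symmetric])
  also have "\<dots> \<in> tM" using tM_stable[OF e2] a \<Phi> unfolding bf_iff by blast
  finally show "act (mult_coeffs (eval_coeffs (b \<otimes>\<^bsub>A\<^esub> a)) \<Phi>) \<in> tM" .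
qed

lemma g_frob: "g [^]\<^bsub>S\<^esub> (p ^ e) = monom S (f [^] (p ^ e)) 0 \<ominus>\<^bsub>S\<^esub> monom S \<one> (p ^ e)"
proof -
  have "g [^]\<^bsub>S\<^esub> (p ^ e) = monom S f 0 [^]\<^bsub>S\<^esub> (p ^ e) \<ominus>\<^bsub>S\<^esub> monom S \<one> 1 [^]\<^bsub>S\<^esub> (p ^ e)"
    unfolding g_eq by (rule cring_char.frob_diff[OF UP_cring_char]) (use f in simp_all)
  also have "monom S f 0 [^]\<^bsub>S\<^esub> (p ^ e) = monom S (f [^] (p ^ e)) 0" using f by (subst S.monom_pow) simp_all
  also have "monom S \<one> 1 [^]\<^bsub>S\<^esub> (p ^ e) = monom S \<one> (p ^ e)" by (subst S.monom_pow) simp_all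
  finally show ?thesis .
qed

lemma coeff_g_mult: "u \<in> carrier S ==> coeff S (g \<otimes>\<^bsub>S\<^esub> u) n = f \<otimes> coeff S u n \<ominus> (if 1 \<le> n then coeff S u (n - 1) else \<zero>)"
proof -
  assume u: "u \<in> carrier S"
  have "g \<otimes>\<^bsub>S\<^esub> u = monom S f 0 \<otimes>\<^bsub>S\<^esub> u \<oplus>\<^bsub>S\<^esub> \<ominus>\<^bsub>S\<^esub> (monom S \<one> 1 \<otimes>\<^bsub>S\<^esub> u)"
    using u f by (simp add: g_eq S.P.minus_eq S.P.l_distr S.P.l_minus)
  then show ?thesis using u f by (simp add: coeff_monom_mult_if minus_eq)
qed

text \<open>\<open>(f - t)\<^bsup>q-1\<^esup> = \<Sum>\<^bsub>j<q\<^esub> f\<^bsup>q-1-j\<^esup> t\<^sup>j\<close>: multiply by \<open>f - t\<close>, telescope, and compare with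
  \<open>(f - t)\<^sup>q = f\<^sup>q - t\<^sup>q\<close>.\<close>

lemma coeff_gp: "coeff S (gp e) j = (if j < p ^ e then f [^] (p ^ e - 1 - j) else \<zero>)"
proof -
  define q where "q = p ^ e"
  have q: "q \<ge> 1" by (simp add: q_def Suc_leI)
  define h where "h = (\<lambda>j. if j < q then f [^] (q - 1 - j) else \<zero>)"
  have hR: "h j \<in> carrier R" for j using f by (simp add: h_def)
  have "bound \<zero> q h" by (rule bound.intro) (simp add: h_def)
  then have "h \<in> up R" using hR by (intro mem_upI) auto
  then have h: "h \<in> carrier S" "coeff S h n = h n" for n by (simp_all add: UP_def)
  have "g \<otimes>\<^bsub>S\<^esub> h = g [^]\<^bsub>S\<^esub> q"
  proof (rule S.up_eqI)
    fix n
    have rhs: "coeff S (g [^]\<^bsub>S\<^esub> q) n = (if n = 0 then f [^] q else \<zero>) \<ominus> (if n = q then \<one> else \<zero>)"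
      unfolding q_def g_frob using f by (simp add: S.P.minus_eq minus_eq)
    show "coeff S (g \<otimes>\<^bsub>S\<^esub> h) n = coeff S (g [^]\<^bsub>S\<^esub> q) n"
    proof (cases "n = 0")
      case True
      have "f \<otimes> f [^] (q - 1) = f [^] q"
        using q f m_comm[of f "f [^] (q - 1)"] nat_pow_Suc[of f "q - 1"] by simp
      then show ?thesis unfolding coeff_g_mult[OF h(1)] rhs h(2) using True q f by (simp add: h_def)
    next
      case False
      show ?thesis
      proof (cases "n < q")
        case True
        then have "q - 1 - (n - 1) = Suc (q - 1 - n)" "n - 1 < q" using False by simp_all
        then have "h (n - 1) = f [^] Suc (q - 1 - n)" by (simp only: h_def if_True)
        moreover have "h n = f [^] (q - 1 - n)" using True by (simp only: h_def if_True)
        ultimately have "f \<otimes> h n = h (n - 1)" using f m_comm[of f "f [^] (q - 1 - n)"] by simp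
        then show ?thesis unfolding coeff_g_mult[OF h(1)] rhs h(2) using True False hR[of "n - 1"] by (simp add: minus_eq r_neg)
      next
        case False
        then show ?thesis unfolding coeff_g_mult[OF h(1)] rhs h(2) using f q by (cases "n = q") (auto simp: h_def)
      qed
    qed
  qed (use h in simp_all)
  moreover have "g \<otimes>\<^bsub>S\<^esub> gp e = g [^]\<^bsub>S\<^esub> q"
  proof -
    have "g [^]\<^bsub>S\<^esub> Suc (q - 1) = gp e \<otimes>\<^bsub>S\<^esub> g" unfolding q_def by (rule S.P.nat_pow_Suc)
    moreover have "Suc (q - 1) = q" using q by simp
    moreover have "g \<otimes>\<^bsub>S\<^esub> gp e = gp e \<otimes>\<^bsub>S\<^esub> g" by (rule S.P.m_comm) simp_all
    ultimately show ?thesis by (simp only:)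
  qed
  ultimately have "g [^]\<^bsub>S\<^esub> (1::nat) \<otimes>\<^bsub>S\<^esub> h = g [^]\<^bsub>S\<^esub> (1::nat) \<otimes>\<^bsub>S\<^esub> gp e" using h by simp
  then have "h = gp e" by (intro L.pow_cancel[of h "gp e" 1]) (use h in simp_all)
  then have "coeff S (gp e) j = h j" using h(2)[of j] by (simp only:)
  then show ?thesis by (simp only: h_def q_def)
qed

text \<open>The \<open>m\<close> with \<open>f\<^sup>m \<notin> D\<^sub>e f\<^bsup>m+1\<^esup>\<close>, for which the summand of \<open>N\<^sub>f\<close> with index \<open>m\<close> at level \<open>e\<close> is nonzero.\<close>

definition essential :: "nat => nat set" where
  "essential e = {m. m < p ^ e \<and> \<not> (\<exists>P\<in>frob_linear_ops R p e. P (f [^] (m + 1)) = f [^] m)}"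

text \<open>The indicator selects the coefficients of \<open>t\<^sup>j\<close> with \<open>p\<^sup>d - 1 - j \<equiv> m\<close>, whose powers of \<open>f\<close> are
  \<open>f\<^bsup>m + q l\<^esup>\<close>. An operator \<open>Q \<in> D\<^sub>e\<close> with \<open>Q f\<^bsup>m+1\<^esup> = f\<^sup>m\<close> works for all of them, so \<open>\<Phi>\<close> may be replaced by
  \<open>\<Phi>\<close> after \<open>Q\<close> after \<open>f\<close>.\<close>

lemma bf_ind:
  assumes m: "m < p ^ e" "m \<notin> essential e"
  shows "kk.ind e m \<in> bf"
  unfolding bf_iff
proof (intro conjI allI ballI)
  show iA: "kk.ind e m \<in> carrier A" by (rule kk.ind_A[OF m(1)])
  obtain Q where Q: "Q \<in> frob_linear_ops R p e" "Q (f [^] (m + 1)) = f [^] m" using m by (auto simp: essential_def)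
  fix e1 \<Phi> assume \<Phi>1: "\<Phi> \<in> euler_coeffs e1"
  define d where "d = max e e1"
  have \<Phi>: "\<Phi> \<in> euler_coeffs d" and Qc: "(\<lambda>_. Q) \<in> euler_coeffs d" and ev: "eval_coeffs (kk.ind e m) \<in> euler_coeffs d"
    using euler_coeffs_mono[OF \<Phi>1] euler_coeffs_mono[OF extend_coeffs[OF Q(1)]]
      euler_coeffs_mono[OF eval_coeffs_euler[OF iA kk.ind_periodic]] by (simp_all add: d_def)
  note e\<Phi> = mult_coeffs_euler[OF ev \<Phi>]
  define \<Theta> where "\<Theta> = mult_coeffs (mult_coeffs (eval_coeffs (kk.ind e m)) \<Phi>) (\<lambda>_. Q)"
  have \<Theta>: "\<Theta> \<in> euler_coeffs d" unfolding \<Theta>_def by (rule mult_coeffs_euler[OF e\<Phi> Qc])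
  note \<Theta>F = mult_coeffs_euler[OF \<Theta> Fm_euler]
  have pd: "p ^ d = p ^ e * p ^ (d - e)" by (simp add: d_def power_add[symmetric])
  have gpc: "gp d \<in> carrier S" by simp
  have "coeff_op (mult_coeffs (eval_coeffs (kk.ind e m)) \<Phi>) (gp d) = coeff_op (mult_coeffs \<Theta> Fm) (gp d)"
  proof (rule S.up_eqI)
    fix j
    let ?c = "coeff S (gp d) j"
    have c: "?c \<in> carrier R" by simp
    have "\<iota> (neg_eval (kk.ind e m) j) \<otimes> \<Phi> j ?c = \<iota> (neg_eval (kk.ind e m) j) \<otimes> \<Phi> j (Q (f \<otimes> ?c))"
    proof (cases "j < p ^ d \<and> j mod p ^ e = p ^ e - 1 - m")
      case True
      have "(p ^ d - 1 - j) mod p ^ e = m"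
        using complement_mod[of j "p ^ e" "p ^ (d - e)"] True m(1) unfolding pd[symmetric] by simp
      then obtain l where l: "p ^ d - 1 - j = l * p ^ e + m" by (metis div_mult_mod_eq)
      have c': "?c = (f [^] l) [^] (p ^ e) \<otimes> f [^] m"
        unfolding coeff_gp[of d j] l using True f by (simp add: nat_pow_mult nat_pow_pow)
      have "f \<otimes> ?c = (f [^] l) [^] (p ^ e) \<otimes> f [^] (m + 1)"
        unfolding c' using f by (simp add: m_ac)
      then have "Q (f \<otimes> ?c) = (f [^] l) [^] (p ^ e) \<otimes> f [^] m"
        using frob_linear_opsD(3)[OF Q(1), of "f [^] l" "f [^] (m + 1)"] f Q(2) by simp
      then show ?thesis unfolding c' by simp
    next
      case False
      then consider "\<not> j < p ^ d" | "j mod p ^ e \<noteq> p ^ e - 1 - m" by blast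
      then show ?thesis
      proof cases
        case 1
        then have "?c = \<zero>" by (simp add: coeff_gp del: One_nat_def)
        then show ?thesis using f frob_linear_zero_val[OF Q(1)] by simp
      next
        case 2
        then have "neg_eval (kk.ind e m) j = \<zero>\<^bsub>k\<^esub>" using neg_eval_ind[OF m(1), of j] by simp
        then show ?thesis using c f \<Phi> frob_linear_opsD(1)[OF Q(1)] by simp
      qed
    qed
    then show "coeff S (coeff_op (mult_coeffs (eval_coeffs (kk.ind e m)) \<Phi>) (gp d)) j = coeff S (coeff_op (mult_coeffs \<Theta> Fm) (gp d)) j"
      unfolding coeff_coeff_op[OF e\<Phi> gpc] coeff_coeff_op[OF \<Theta>F gpc] eval_apply[OF \<Phi> c]
      using c f frob_linear_opsD(1)[OF Q(1), of "f \<otimes> ?c"] \<Phi>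
      by (simp add: \<Theta>_def mult_coeffs_def compose_def scalar_coeffs_def eval_coeffs_apply)
  qed (use coeff_op_closed[OF e\<Phi> gpc] coeff_op_closed[OF \<Theta>F gpc] in simp_all)
  then have "act (mult_coeffs (eval_coeffs (kk.ind e m)) \<Phi>) = act (mult_coeffs \<Theta> Fm)"
    unfolding act_eq[OF e\<Phi>] act_eq[OF \<Theta>F] by simp
  then show "act (mult_coeffs (eval_coeffs (kk.ind e m)) \<Phi>) \<in> tM" using act_tM[OF \<Theta>] by simp
qed

text \<open>Apply the indicator to \<open>\<delta>\<^sub>f\<close> itself and compare coefficients at a level where the resulting element of
  \<open>tM\<^sub>f\<close> is defined; numerators of degree less than \<open>p\<^sup>d\<close> are unique.\<close>

lemma ind_bf:
  assumes m: "m < p ^ e" and ind: "kk.ind e m \<in> bf"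
  shows "\<exists>d\<ge>e. \<forall>m'<p ^ d. m' mod p ^ e = m --> m' \<notin> essential d"
proof -
  define I where "I = scalar_coeffs (\<lambda>_. \<one>)"
  have I: "I \<in> euler_coeffs n" for n unfolding I_def by (intro scalar_coeffs_euler) auto
  have ev: "eval_coeffs (kk.ind e m) \<in> euler_coeffs e" by (rule eval_coeffs_euler[OF kk.ind_A[OF m] kk.ind_periodic])
  define E where "E = mult_coeffs (eval_coeffs (kk.ind e m)) I"
  have "act E \<in> tM" using ind I[of 0] unfolding bf_iff E_def by blast
  then obtain \<Psi> e1 where \<Psi>1: "\<Psi> \<in> euler_coeffs e1" and eq: "act E = act (mult_coeffs \<Psi> Fm)" unfolding tM_eq by blast
  define d where "d = max e e1"
  have E: "E \<in> euler_coeffs d" and \<Psi>: "\<Psi> \<in> euler_coeffs d"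
    using mult_coeffs_euler[OF euler_coeffs_mono[OF ev] I] euler_coeffs_mono[OF \<Psi>1] by (simp_all add: E_def d_def)
  note \<Psi>F = mult_coeffs_euler[OF \<Psi> Fm_euler]
  have gpc: "gp d \<in> carrier S" by simp
  let ?u = "coeff_op E (gp d)" and ?v = "coeff_op (mult_coeffs \<Psi> Fm) (gp d)"
  have uv: "?u \<in> carrier S" "?v \<in> carrier S" using coeff_op_closed[OF E gpc] coeff_op_closed[OF \<Psi>F gpc] by blast+
  obtain w where w: "w \<in> carrier S" "?u \<ominus>\<^bsub>S\<^esub> ?v = g [^]\<^bsub>S\<^esub> (p ^ d) \<otimes>\<^bsub>S\<^esub> w"
    using eq unfolding act_eq[OF E] act_eq[OF \<Psi>F] bclass_eq_iff[OF uv] by blast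
  have "w = \<zero>\<^bsub>S\<^esub>"
  proof (rule S.binomial_multiple_degree[OF _ _ w(1)])
    fix n assume n: "p ^ d \<le> n"
    have "coeff S (?u \<ominus>\<^bsub>S\<^esub> ?v) n = coeff S ?u n \<ominus> coeff S ?v n" using uv by (simp add: S.P.minus_eq minus_eq)
    also have "\<dots> = \<zero>"
      unfolding coeff_coeff_op[OF E gpc] coeff_coeff_op[OF \<Psi>F gpc] using n E \<Psi>F by (simp add: coeff_gp minus_eq del: One_nat_def)
    finally show "coeff S ((monom S (f [^] p ^ d) 0 \<ominus>\<^bsub>S\<^esub> monom S \<one> (p ^ d)) \<otimes>\<^bsub>S\<^esub> w) n = \<zero>"
      unfolding w(2) g_frob .
  qed (use f in simp_all)
  then have "?u = ?v" using w(2) uv by (simp add: S.P.r_right_minus_eq)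
  have "m' \<notin> essential d" if m': "m' < p ^ d" "m' mod p ^ e = m" for m'
  proof -
    define j where "j = p ^ d - 1 - m'"
    have j: "j < p ^ d" "p ^ d - 1 - j = m'" using m'(1) by (auto simp: j_def)
    have pd: "p ^ d = p ^ e * p ^ (d - e)" by (simp add: d_def power_add[symmetric])
    have "j mod p ^ e = p ^ e - 1 - m"
      using complement_mod[of m' "p ^ e" "p ^ (d - e)"] m' unfolding pd[symmetric] j_def by simp
    then have "neg_eval (kk.ind e m) j = \<one>\<^bsub>k\<^esub>" using neg_eval_ind[OF m, of j] by simp
    moreover have cj: "coeff S (gp d) j = f [^] m'" using j by (simp add: coeff_gp del: One_nat_def)
    ultimately have "coeff S ?u j = f [^] m'" "coeff S ?v j = \<Psi> j (f [^] (m' + 1))"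
      unfolding coeff_coeff_op[OF E gpc] coeff_coeff_op[OF \<Psi>F gpc] using f m_comm[of f "f [^] m'"]
      by (simp_all add: E_def I_def mult_coeffs_def compose_def scalar_coeffs_def eval_coeffs_apply)
    then have "\<Psi> j (f [^] (m' + 1)) = f [^] m'" using \<open>?u = ?v\<close> by simp
    then show ?thesis using euler_coeffs_op[OF \<Psi>, of j] by (auto simp: essential_def)
  qed
  moreover have "d \<ge> e" by (simp add: d_def)
  ultimately show ?thesis by blast
qed

theorem roots_of_b_function: "roots_of k p bf = {z \<in> padic_ints p. \<forall>e. nat (z e) \<in> essential e}"
proof -
  have "(\<forall>e. kk.ind e (nat (z e)) \<notin> bf) \<longleftrightarrow> (\<forall>e. nat (z e) \<in> essential e)" if z: "z \<in> padic_ints p" for z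
  proof -
    have zlt: "nat (z e) < p ^ e" for e using z by (simp add: padic_ints_def nat_less_iff)
    note zmod = padic_nat_mod[OF z]
    show ?thesis
    proof (intro iffI allI)
      show "nat (z e) \<in> essential e" if "\<forall>e. kk.ind e (nat (z e)) \<notin> bf" for e
        using bf_ind[OF zlt] that by blast
      show "kk.ind e (nat (z e)) \<notin> bf" if ess: "\<forall>e. nat (z e) \<in> essential e" for e
      proof
        assume "kk.ind e (nat (z e)) \<in> bf"
        then obtain d where "d \<ge> e" "\<forall>m'<p ^ d. m' mod p ^ e = nat (z e) --> m' \<notin> essential d" using ind_bf[OF zlt] by blast
        then show False using zlt[of d] zmod ess by blast
      qed
    qed
  qed
  moreover have "roots_of k p bf = {z \<in> padic_ints p. \<forall>e. kk.ind e (nat (z e)) \<notin> bf}"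
    by (rule kk.roots_of_ideal) (use bf_iff bf_mult in blast)+
  ultimately show ?thesis by blast
qed

end

section \<open>Roots of the b-function\<close>

lemma (in frobenius_basis_algebra) jump_chain_cartier_ideals:
  assumes f: "f \<in> carrier R" and nzd: "nonzerodivisor R f"
  shows "jump_chain p (\<lambda>e m. C e (f [^] m))"
proof
  show "Factorial_Ring.prime p" by (rule p_prime)
  show "C e (f [^] m') \<subseteq> C e (f [^] m)" if "m \<le> m'" for m m' e :: nat by (rule C_antimono[OF f that])
  show "C (e + a) (f [^] (m * p ^ a)) = C e (f [^] m)" for e a m :: nat
    using C_pow[of "f [^] m" e a] f by (simp add: nat_pow_pow)
  show "finite {C e (f [^] m) | e (m::nat). m \<le> p ^ e}" by (rule finite_cartier_ideals[OF f])
  show "\<exists>a. C e (f [^] m) \<subseteq> C (e + a) (f [^] (m * p ^ a + 1))" for e m :: nat by (rule C_right_continuous[OF f nzd])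
  show "C (e + a) (f [^] (m + p ^ e * l)) \<subseteq> C (e + a) (f [^] (m + p ^ e * l + 1))"
    if sub: "C e (f [^] m) \<subseteq> C e (f [^] (m + 1))" for e a m l :: nat
  proof -
    obtain P where P: "P \<in> frob_linear_ops R p e" "P (f [^] (m + 1)) = f [^] m"
      using sub linear_op_iff[of "f [^] (m + 1)" "f [^] m" e] f by auto
    have pow: "f [^] (m' + p ^ e * l) = (f [^] l) [^] (p ^ e) \<otimes> f [^] m'" for m' :: nat
      using f by (simp add: nat_pow_pow nat_pow_mult add.commute mult.commute)
    have "m + p ^ e * l + 1 = (m + 1) + p ^ e * l" by simp
    then have "f [^] (m + p ^ e * l + 1) = (f [^] l) [^] (p ^ e) \<otimes> f [^] (m + 1)" by (simp only: pow)
    moreover have "P ((f [^] l) [^] (p ^ e) \<otimes> f [^] (m + 1)) = (f [^] l) [^] (p ^ e) \<otimes> f [^] m"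
      using frob_linear_opsD(3)[OF P(1), of "f [^] l" "f [^] (m + 1)"] f P(2) by simp
    ultimately have "P (f [^] (m + p ^ e * l + 1)) = f [^] (m + p ^ e * l)" by (simp only: pow)
    moreover have "P \<in> frob_linear_ops R p (e + a)" by (rule frob_linear_mono[OF P(1)]) simp
    ultimately show ?thesis
      using linear_op_iff[of "f [^] (m + p ^ e * l + 1)" "f [^] (m + p ^ e * l)" "e + a"] f by blast
  qed
qed

theorem theorem2p4p1:
  fixes k :: "'k ring" and R :: "'a ring" and \<iota> :: "'k \<Rightarrow> 'a"
    and p :: nat and f :: 'a
  assumes "perfect_field_of_char k p"
    and "smooth_algebra k R \<iota>"
    and "f \<in> carrier R"
    and "f \<notin> \<iota> ` carrier k"
    and "nonzerodivisor R f"
  shows "roots_of k p (b_function k R \<iota> p f) =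
    {padic_of_rat p (- r) | r. F_jumping_exponent R p f (real_of_rat r) \<and>
                               0 < r \<and> r \<le> 1 \<and> r \<in> rat_local p}"
proof -
  note k = perfect_field_cring_char[OF assms(1)]
  have R: "cring R" and hom: "\<iota> \<in> ring_hom k R" using assms(2) by (auto simp: smooth_algebra_def)
  obtain X where X: "finite X" "X \<subseteq> carrier R" "generate_ring R (\<iota> ` carrier k \<union> X) = carrier R"
    using assms(2) by (auto simp: smooth_algebra_def finite_type_algebra_def)
  have perfect: "\<exists>d\<in>carrier k. d [^]\<^bsub>k\<^esub> p = c" if "c \<in> carrier k" for c
    using assms(1) that by (simp add: perfect_field_of_char_def)
  interpret k: cring_char k p by (rule k(1))
  interpret kf: field k by (rule k(2))
  interpret R: cring_char R p by (rule k.cring_char_hom[OF R hom])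
  interpret io: ring_hom_cring k R \<iota> by (intro ring_hom_cringI k.is_cring R hom)
  interpret bf: b_function_setting R p k \<iota> X f
    by unfold_locales (use perfect X hom assms(3) in auto)
  have nontriv: "\<zero>\<^bsub>R\<^esub> \<noteq> \<one>\<^bsub>R\<^esub>"
  proof
    assume "\<zero>\<^bsub>R\<^esub> = \<one>\<^bsub>R\<^esub>"
    then have "f = \<iota> \<zero>\<^bsub>k\<^esub>" using R.one_zeroD assms(3) by (metis io.hom_zero singletonD)
    then show False using assms(4) by blast
  qed
  obtain n x \<sigma> where basis: "frobenius_dual_basis R p n x \<sigma>"
    using smooth_frobenius_dual_basis[OF assms(1,2) nontriv] .
  have K: "subring (\<iota> ` carrier k) R"
    by (rule ring_hom_ring.img_is_subring[OF ring_hom_ringI2[OF k.ring_axioms R.ring_axioms hom] k.carrier_is_subring])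
  have K_inv: "\<exists>d\<in>\<iota> ` carrier k. d \<otimes>\<^bsub>R\<^esub> c = \<one>\<^bsub>R\<^esub>" if c: "c \<in> \<iota> ` carrier k" "c \<noteq> \<zero>\<^bsub>R\<^esub>" for c
  proof -
    obtain a where a: "a \<in> carrier k" "c = \<iota> a" using c by blast
    then have "a \<noteq> \<zero>\<^bsub>k\<^esub>" using c by auto
    then have "a \<in> Units k" using a kf.field_Units by auto
    then have "inv\<^bsub>k\<^esub> a \<in> carrier k" "inv\<^bsub>k\<^esub> a \<otimes>\<^bsub>k\<^esub> a = \<one>\<^bsub>k\<^esub>" by simp_all
    then show ?thesis using a io.hom_mult[of "inv\<^bsub>k\<^esub> a" a] by (intro bexI[of _ "\<iota> (inv\<^bsub>k\<^esub> a)"]) auto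
  qed
  interpret fb: frobenius_basis_algebra R p n x \<sigma> "\<iota> ` carrier k" X
  proof (intro frobenius_basis_algebra.intro frobenius_basis.intro frobenius_basis_axioms.intro
      frobenius_basis_algebra_axioms.intro R.cring_char_axioms)
    show "\<exists>d\<in>\<iota> ` carrier k. d \<otimes>\<^bsub>R\<^esub> c = \<one>\<^bsub>R\<^esub>" if "c \<in> \<iota> ` carrier k" "c \<noteq> \<zero>\<^bsub>R\<^esub>" for c
      by (rule K_inv[OF that])
    show "\<exists>d\<in>\<iota> ` carrier k. d [^]\<^bsub>R\<^esub> p = c" if "c \<in> \<iota> ` carrier k" for c
      using bf.K_root[OF that, of 1] unfolding power_one_right .
  qed (fact basis K X)+
  interpret jc: jump_chain p "\<lambda>e m. fb.C e (f [^]\<^bsub>R\<^esub> m)"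
    by (rule fb.jump_chain_cartier_ideals[OF assms(3,5)])
  have T: "jc.T r = test_ideal R p f r" for r
    unfolding jc.T_def test_ideal_def fb.frob_root_PIdl[OF R.nat_pow_closed[OF assms(3)]] ..
  have jump: "jc.jump r \<longleftrightarrow> F_jumping_exponent R p f r" for r
    unfolding jc.jump_def F_jumping_exponent_def T ..
  have S: "bf.essential e = jc.S e" for e
  proof -
    have "(\<exists>P\<in>frob_linear_ops R p e. P (f [^]\<^bsub>R\<^esub> (m + 1)) = f [^]\<^bsub>R\<^esub> m) \<longleftrightarrow>
        fb.C e (f [^]\<^bsub>R\<^esub> m) = fb.C e (f [^]\<^bsub>R\<^esub> (m + 1))" for m :: nat
      unfolding fb.linear_op_iff[OF R.nat_pow_closed[OF assms(3)] R.nat_pow_closed[OF assms(3)]]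
      by (rule iffI, erule subset_antisym, rule fb.C_antimono[OF assms(3) le_add1], erule equalityD1)
    then show ?thesis unfolding bf.essential_def jc.S_def by (simp only:)
  qed
  show ?thesis
    unfolding bf.roots_of_b_function S
  proof (intro equalityI subsetI)
    fix z assume "z \<in> {z \<in> padic_ints p. \<forall>e. nat (z e) \<in> jc.S e}"
    then show "z \<in> {padic_of_rat p (- r) | r. F_jumping_exponent R p f (real_of_rat r) \<and> 0 < r \<and> r \<le> 1 \<and> r \<in> rat_local p}"
      using jc.padic_root_imp_jump[of z] unfolding jump by blast
  next
    fix z assume "z \<in> {padic_of_rat p (- r) | r. F_jumping_exponent R p f (real_of_rat r) \<and> 0 < r \<and> r \<le> 1 \<and> r \<in> rat_local p}"
    then show "z \<in> {z \<in> padic_ints p. \<forall>e. nat (z e) \<in> jc.S e}"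
      using jc.jump_imp_padic_root unfolding jump by blast
  qed
qed

end
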